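(* Let $N\ge 2$, let $b^-<b^+$ be real constants, let $\Omega=\{x\in\mathbb{R}^N : b^-<x_N<b^+\}$, and let $1<p<\infty$. There exists a unique linear operator $$\operatorname{Tr}:\dot{W}^{1,p}(\Omega)\to L^p_{\mathrm{loc}}(\partial\Omega)$$ satisfying the following. (1) $\operatorname{Tr}(u)=u$ on $\partial\Omega$ for all $u\in\dot{W}^{1,p}(\Omega)\cap C^0(\overline{\Omega})$. (2) There exists a constant $c=c(N,p)>0$ such that for all $u\in\dot{W}^{1,p}(\Omega)$ $$\int_{\mathbb{R}^{N-1}}|\operatorname{Tr}(u)(x',b^+)-\operatorname{Tr}(u)(x',b^-)|^p\,dx'\le (b^+-b^-)^{p-1}\int_\Omega|\partial_N u(x)|^p\,dx,$$ $$|\operatorname{Tr}(u)(\cdot,b^\pm)|^p_{\tilde{W}^{1-1/p,p}_{(b^+-b^-)}(\mathbb{R}^{N-1})}\le c\int_\Omega|\nabla u(x)|^p\,dx .$$ (3) The integration by parts formula $$\int_\Omega u\,\partial_i\psi\,dx=-\int_\Omega\psi\,\partial_i u\,dx+\int_{\partial\Omega}\psi\operatorname{Tr}(u)\,\nu_i\,d\mathcal{H}^{N-1}$$ holds for all $u\in\dot{W}^{1,p}(\Omega)$, all $\psi\in C^1_c(\mathbb{R}^N)$, and all $i=1,\dots,N$.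
   Context: Points are written $x=(x',x_N)\in\mathbb{R}^{N-1}\times\mathbb{R}$. For an open set $\Omega\subseteq\mathbb{R}^N$, $\dot{W}^{1,p}(\Omega)$ is the space of real-valued $u\in L^1_{\mathrm{loc}}(\Omega)$ whose first-order weak derivatives all belong to $L^p(\Omega)$. $\nu$ is the outward unit normal to $\partial\Omega$ and $\mathcal{H}^{N-1}$ is the $(N-1)$-dimensional Hausdorff measure. $B'(x',r)$ is the open ball in $\mathbb{R}^{N-1}$. For a constant $a>0$ and $f\in L^1_{\mathrm{loc}}(\mathbb{R}^{N-1})$, $$|f|_{\tilde{W}^{1-1/p,p}_{(a)}(\mathbb{R}^{N-1})}:=\left(\int_{\mathbb{R}^{N-1}}\int_{B'(0,a)}\frac{|f(x'+h')-f(x')|^p}{|h'|^{p+N-2}}\,dh'\,dx'\right)^{1/p}.$$ *)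

theory Defs
  imports "HOL-Analysis.Analysis"
begin

text \<open>
  Points of $\mathbb{R}^N = \mathbb{R}^{N-1} \times \mathbb{R}$ are pairs \<open>(x', x\<^sub>N)\<close> of type
  \<open>(real^'n) \<times> real\<close>, so that $N = \mathrm{CARD}('n) + 1 \ge 2$. The coordinate directions
  $1,\dots,N$ are the elements of \<open>Basis\<close>, the last one being \<open>(0, 1)\<close>.

  Elements of Lebesgue and Sobolev spaces are represented by Borel functions on the whole type whose
  values outside the domain are irrelevant. Every a.e. class contains a Borel function. Equality
  in these spaces is equality almost everywhere and is always written out as such.
\<close>

section \<open>Lebesgue spaces\<close>

definition Lp_on :: "'a measure \<Rightarrow> 'a set \<Rightarrow> real \<Rightarrow> ('a \<Rightarrow> real) set" where
  "Lp_on M S p =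
     {f. set_borel_measurable M S f \<and> (\<integral>\<^sup>+x\<in>S. ennreal (\<bar>f x\<bar> powr p) \<partial>M) < \<infinity>}"

definition Lp_loc :: "'a::topological_space measure \<Rightarrow> 'a set \<Rightarrow> real \<Rightarrow> ('a \<Rightarrow> real) set" where
  "Lp_loc M S p =
     {f. set_borel_measurable M S f \<and>
         (\<forall>K. compact K \<and> K \<subseteq> S \<longrightarrow> (\<integral>\<^sup>+x\<in>K. ennreal (\<bar>f x\<bar> powr p) \<partial>M) < \<infinity>)}"


section \<open>Classical and weak derivatives\<close>

definition partial_deriv :: "'a::euclidean_space \<Rightarrow> ('a \<Rightarrow> real) \<Rightarrow> 'a \<Rightarrow> real" where
  "partial_deriv b f x = frechet_derivative f (at x) b"

fun C_k :: "nat \<Rightarrow> ('a::euclidean_space \<Rightarrow> real) \<Rightarrow> bool" where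
  "C_k 0 f \<longleftrightarrow> continuous_on UNIV f"
| "C_k (Suc k) f \<longleftrightarrow>
     (\<forall>x. f differentiable at x) \<and> (\<forall>b\<in>Basis. C_k k (partial_deriv b f))"

definition fun_support :: "('a::topological_space \<Rightarrow> real) \<Rightarrow> 'a set" where
  "fun_support f = closure {x. f x \<noteq> 0}"

definition C1_c :: "('a::euclidean_space \<Rightarrow> real) set" where
  "C1_c = {\<psi>. C_k 1 \<psi> \<and> compact (fun_support \<psi>)}"

definition test_functions :: "'a::euclidean_space set \<Rightarrow> ('a \<Rightarrow> real) set" where
  "test_functions \<Omega> =
     {\<phi>. (\<forall>k. C_k k \<phi>) \<and> compact (fun_support \<phi>) \<and> fun_support \<phi> \<subseteq> \<Omega>}"

definition is_weak_partial ::
  "'a::euclidean_space set \<Rightarrow> 'a \<Rightarrow> ('a \<Rightarrow> real) \<Rightarrow> ('a \<Rightarrow> real) \<Rightarrow> bool" where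
  "is_weak_partial \<Omega> b u v \<longleftrightarrow>
     u \<in> Lp_loc lborel \<Omega> 1 \<and> v \<in> Lp_loc lborel \<Omega> 1 \<and>
     (\<forall>\<phi>\<in>test_functions \<Omega>.
        (LINT x:\<Omega>|lborel. u x * partial_deriv b \<phi> x) = - (LINT x:\<Omega>|lborel. v x * \<phi> x))"

text \<open>Weak derivatives are unique up to null sets; we fix one representative.\<close>

definition weak_partial ::
  "'a::euclidean_space set \<Rightarrow> 'a \<Rightarrow> ('a \<Rightarrow> real) \<Rightarrow> 'a \<Rightarrow> real" where
  "weak_partial \<Omega> b u = (SOME v. is_weak_partial \<Omega> b u v)"

definition weak_grad ::
  "'a::euclidean_space set \<Rightarrow> ('a \<Rightarrow> real) \<Rightarrow> 'a \<Rightarrow> 'a" where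
  "weak_grad \<Omega> u x = (\<Sum>b\<in>Basis. weak_partial \<Omega> b u x *\<^sub>R b)"

definition hom_sobolev :: "'a::euclidean_space set \<Rightarrow> real \<Rightarrow> ('a \<Rightarrow> real) set" where
  "hom_sobolev \<Omega> p =
     {u \<in> Lp_loc lborel \<Omega> 1. \<forall>b\<in>Basis. \<exists>v. is_weak_partial \<Omega> b u v \<and> v \<in> Lp_on lborel \<Omega> p}"


section \<open>The fractional seminorm\<close>

text \<open>Powers of extended nonnegative numbers, for exponents \<open>a > 0\<close>.\<close>

definition epowr :: "ennreal \<Rightarrow> real \<Rightarrow> ennreal" where
  "epowr t a = (if t = \<infinity> then \<infinity> else ennreal (enn2real t powr a))"

text \<open>The type \<open>'a\<close> plays the role of $\mathbb{R}^{N-1}$, so $N = \mathrm{DIM}('a) + 1$.\<close>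

definition frac_seminorm :: "real \<Rightarrow> real \<Rightarrow> ('a::euclidean_space \<Rightarrow> real) \<Rightarrow> ennreal" where
  "frac_seminorm p a f =
     epowr (\<integral>\<^sup>+x. (\<integral>\<^sup>+h\<in>ball 0 a.
              ennreal (\<bar>f (x + h) - f x\<bar> powr p / norm h powr (p + real (DIM('a) + 1) - 2))
            \<partial>lborel) \<partial>lborel) (1 / p)"


section \<open>Hausdorff measure\<close>

text \<open>
  For \<open>s > 0\<close>, with the normalisation for which $\mathcal{H}^n$ is Lebesgue measure on
  $\mathbb{R}^n$. Boundedness is required because \<open>diameter\<close> is not meaningful for unbounded sets.
\<close>

definition hausdorff_pre :: "real \<Rightarrow> real \<Rightarrow> 'a::metric_space set \<Rightarrow> ennreal" where
  "hausdorff_pre s \<delta> E =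
     (INF C\<in>{C :: nat \<Rightarrow> 'a set. E \<subseteq> (\<Union>i. C i) \<and> (\<forall>i. bounded (C i) \<and> diameter (C i) \<le> \<delta>)}.
        \<Sum>i. ennreal (unit_ball_vol s * (diameter (C i) / 2) powr s))"

definition hausdorff_outer :: "real \<Rightarrow> 'a::metric_space set \<Rightarrow> ennreal" where
  "hausdorff_outer s E = (SUP \<delta>\<in>{0<..}. hausdorff_pre s \<delta> E)"

text \<open>The outer measure is countably additive on the Borel sets, being a metric outer measure.\<close>

definition hausdorff_measure :: "real \<Rightarrow> 'a::metric_space measure" where
  "hausdorff_measure s = measure_of UNIV (sets borel) (hausdorff_outer s)"


section \<open>Outward unit normal\<close>

text \<open>
  At a boundary point near which \<open>\<Omega>\<close> is the sublevel set \<open>{\<phi> < 0}\<close> of a \<open>C\<^sup>1\<close> function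
  with nonvanishing gradient \<open>g\<close>, the outward unit normal is the normalised gradient.
\<close>

definition is_outward_normal :: "'a::euclidean_space set \<Rightarrow> 'a \<Rightarrow> 'a \<Rightarrow> bool" where
  "is_outward_normal \<Omega> x n \<longleftrightarrow>
     x \<in> frontier \<Omega> \<and>
     (\<exists>U (\<phi> :: 'a \<Rightarrow> real) g. open U \<and> x \<in> U \<and>
        (\<forall>y\<in>U. (\<phi> has_derivative (\<lambda>h. g y \<bullet> h)) (at y)) \<and> continuous_on U g \<and>
        \<Omega> \<inter> U = {y\<in>U. \<phi> y < 0} \<and> g x \<noteq> 0 \<and> n = g x /\<^sub>R norm (g x))"

definition outward_normal :: "'a::euclidean_space set \<Rightarrow> 'a \<Rightarrow> 'a" where
  "outward_normal \<Omega> x = (THE n. is_outward_normal \<Omega> x n)"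


section \<open>Trace operators on a strip\<close>

definition strip :: "real \<Rightarrow> real \<Rightarrow> ('a::euclidean_space \<times> real) set" where
  "strip bm bp = {x. bm < snd x \<and> snd x < bp}"

abbreviation surface_measure :: "('a::euclidean_space \<times> real) measure" where
  "surface_measure \<equiv> hausdorff_measure (real DIM('a \<times> real) - 1)"

definition bdry_eq ::
  "('a::euclidean_space \<times> real) set \<Rightarrow> ('a \<times> real \<Rightarrow> real) \<Rightarrow> ('a \<times> real \<Rightarrow> real) \<Rightarrow> bool" where
  "bdry_eq \<Omega> f g \<longleftrightarrow> (AE x in surface_measure. x \<in> frontier \<Omega> \<longrightarrow> f x = g x)"

text \<open>
  A linear operator from the homogeneous Sobolev space to \<open>L\<^sup>p\<^sub>l\<^sub>o\<^sub>c(\<partial>\<Omega>)\<close>. The second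
  conjunct says that it acts on a.e. classes.
\<close>

definition linear_trace ::
  "real \<Rightarrow> ('a::euclidean_space \<times> real) set \<Rightarrow> (('a \<times> real \<Rightarrow> real) \<Rightarrow> 'a \<times> real \<Rightarrow> real) \<Rightarrow> bool" where
  "linear_trace p \<Omega> Tr \<longleftrightarrow>
     (\<forall>u\<in>hom_sobolev \<Omega> p. Tr u \<in> Lp_loc surface_measure (frontier \<Omega>) p) \<and>
     (\<forall>u\<in>hom_sobolev \<Omega> p. \<forall>v\<in>hom_sobolev \<Omega> p.
        (AE x in lborel. x \<in> \<Omega> \<longrightarrow> u x = v x) \<longrightarrow> bdry_eq \<Omega> (Tr u) (Tr v)) \<and>
     (\<forall>u\<in>hom_sobolev \<Omega> p. \<forall>v\<in>hom_sobolev \<Omega> p. \<forall>\<alpha> \<beta>.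
        bdry_eq \<Omega> (Tr (\<lambda>x. \<alpha> * u x + \<beta> * v x)) (\<lambda>x. \<alpha> * Tr u x + \<beta> * Tr v x))"

definition extends_restriction ::
  "real \<Rightarrow> ('a::euclidean_space \<times> real) set \<Rightarrow> (('a \<times> real \<Rightarrow> real) \<Rightarrow> 'a \<times> real \<Rightarrow> real) \<Rightarrow> bool" where
  "extends_restriction p \<Omega> Tr \<longleftrightarrow>
     (\<forall>u\<in>hom_sobolev \<Omega> p. continuous_on (closure \<Omega>) u \<longrightarrow> bdry_eq \<Omega> (Tr u) u)"

definition trace_bounds ::
  "real \<Rightarrow> real \<Rightarrow> real \<Rightarrow> real \<Rightarrow> (('a::euclidean_space \<times> real \<Rightarrow> real) \<Rightarrow> 'a \<times> real \<Rightarrow> real) \<Rightarrow> bool" where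
  "trace_bounds p bm bp c Tr \<longleftrightarrow>
     (\<forall>u\<in>hom_sobolev (strip bm bp) p.
        (\<integral>\<^sup>+x. ennreal (\<bar>Tr u (x, bp) - Tr u (x, bm)\<bar> powr p) \<partial>lborel)
          \<le> ennreal ((bp - bm) powr (p - 1)) *
            (\<integral>\<^sup>+x\<in>strip bm bp. ennreal (\<bar>weak_partial (strip bm bp) (0, 1) u x\<bar> powr p) \<partial>lborel) \<and>
        (\<forall>b\<in>{bm, bp}.
           epowr (frac_seminorm p (bp - bm) (\<lambda>x. Tr u (x, b))) p
             \<le> ennreal c * (\<integral>\<^sup>+x\<in>strip bm bp. ennreal (norm (weak_grad (strip bm bp) u x) powr p) \<partial>lborel)))"

text \<open>
  Integrability is part of the formula, since the Bochner integral of a non-integrable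
  function is 0 by convention.
\<close>

definition integration_by_parts ::
  "real \<Rightarrow> ('a::euclidean_space \<times> real) set \<Rightarrow> (('a \<times> real \<Rightarrow> real) \<Rightarrow> 'a \<times> real \<Rightarrow> real) \<Rightarrow> bool" where
  "integration_by_parts p \<Omega> Tr \<longleftrightarrow>
     (\<forall>u\<in>hom_sobolev \<Omega> p. \<forall>\<psi>\<in>C1_c. \<forall>i\<in>Basis.
        set_integrable lborel \<Omega> (\<lambda>x. u x * partial_deriv i \<psi> x) \<and>
        set_integrable lborel \<Omega> (\<lambda>x. \<psi> x * weak_partial \<Omega> i u x) \<and>
        set_integrable surface_measure (frontier \<Omega>)
          (\<lambda>x. \<psi> x * Tr u x * (outward_normal \<Omega> x \<bullet> i)) \<and>
        (LINT x:\<Omega>|lborel. u x * partial_deriv i \<psi> x) =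
          - (LINT x:\<Omega>|lborel. \<psi> x * weak_partial \<Omega> i u x)
          + (LINT x:frontier \<Omega>|surface_measure. \<psi> x * Tr u x * (outward_normal \<Omega> x \<bullet> i)))"

end

theory Submission
  imports Defs "HOL-Computational_Algebra.Polynomial"
begin

text \<open>
  For a.e. \<open>x'\<close> the function \<open>u(x', t) - \<integral>\<^sub>b\<^sub>-\<^sup>t \<partial>\<^sub>N u(x', s) ds\<close> is a.e. equal to a constant; this constant is
  the lower boundary value \<open>T\<^sup>-(x')\<close>, and \<open>T\<^sup>+(x') = T\<^sup>-(x') + \<integral> \<partial>\<^sub>N u(x', s) ds\<close> is the upper one. The bound on
  the jump is Jensen's inequality. For the fractional seminorm, \<open>T\<^sup>\<plusminus>(x' + h')\<close> is compared with \<open>T\<^sup>\<plusminus>(x')\<close>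
  through \<open>u\<close> at a distance \<open>\<rho>\<close> from the boundary, averaged over \<open>\<bar>h'\<bar>/2 < \<rho> < \<bar>h'\<bar>\<close>: the two vertical differences
  are controlled by Hardy's inequality and the horizontal one by the horizontal derivatives of \<open>u\<close>.
  Uniqueness follows from integration by parts in the vertical direction alone. That the surface measure on
  a hyperplane is Lebesgue measure rests on the isodiametric inequality (via Steiner symmetrisation)
  and on Vitali's covering theorem.
\<close>

section \<open>Hausdorff measure on the Borel sets\<close>

text \<open>The constant must not depend on the width of the strip. No rescaling is necessary: the
  seminorm only involves translations shorter than \<open>bp - bm\<close>, so every height \<rho> <
  |h| is available inside the strip. Averaging over heights, instead of taking \<rho> = |h|, allows
  the horizontal estimate to be proved for a fixed translation on layers of positive thickness,
  where the a.e. defined \<open>u\<close> makes sense. The weak derivative is never approached by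
  mollification. It is first turned into the a.e. identity that u(x + \<tau> e) - u(x) is the
  integral of the derivative over the segment; the boundary values and both integration by parts
  formulas, whose test functions do not vanish on the boundary, start from these increments. The
  Hausdorff measure is built from covers by arbitrary sets, not by balls. Hence its lower bound
  needs the fact that balls have the largest volume for a given diameter, and its upper bound needs
  covers by balls with almost no waste.\<close>

lemma hausdorff_pre_le:
  assumes "E \<subseteq> (\<Union>i. C i)" "\<And>i. bounded (C i)" "\<And>i. diameter (C i) \<le> \<delta>"
  shows "hausdorff_pre s \<delta> E \<le> (\<Sum>i. ennreal (unit_ball_vol s * (diameter (C i) / 2) powr s))"
  unfolding hausdorff_pre_def by (rule INF_lower) (use assms in auto)

lemma hausdorff_pre_mono: "E \<subseteq> F \<Longrightarrow> hausdorff_pre s \<delta> E \<le> hausdorff_pre s \<delta> F"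
  unfolding hausdorff_pre_def by (rule INF_superset_mono) auto

lemma hausdorff_pre_antimono: "\<delta> \<le> \<epsilon> \<Longrightarrow> hausdorff_pre s \<epsilon> E \<le> hausdorff_pre s \<delta> E"
  unfolding hausdorff_pre_def by (rule INF_superset_mono) (auto intro: order_trans)

lemma hausdorff_pre_empty: "0 \<le> \<delta> \<Longrightarrow> hausdorff_pre s \<delta> {} = 0"
  using hausdorff_pre_le[of "{}" "\<lambda>_. {}" \<delta> s] by (simp add: diameter_def)

lemma hausdorff_outer_empty [simp]: "hausdorff_outer s {} = 0"
  by (auto simp: hausdorff_outer_def hausdorff_pre_empty)

lemma hausdorff_outer_mono: "E \<subseteq> F \<Longrightarrow> hausdorff_outer s E \<le> hausdorff_outer s F"
  unfolding hausdorff_outer_def by (rule SUP_mono') (auto intro: hausdorff_pre_mono)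

lemma hausdorff_pre_le_outer: "0 < \<delta> \<Longrightarrow> hausdorff_pre s \<delta> E \<le> hausdorff_outer s E"
  unfolding hausdorff_outer_def by (rule SUP_upper) auto

lemma hausdorff_pre_cover:
  assumes "hausdorff_pre s \<delta> E < t"
  shows "\<exists>C :: nat \<Rightarrow> 'a::metric_space set. E \<subseteq> (\<Union>i. C i) \<and> (\<forall>i. bounded (C i) \<and> diameter (C i) \<le> \<delta>) \<and>
    (\<Sum>i. ennreal (unit_ball_vol s * (diameter (C i) / 2) powr s)) < t"
  using assms unfolding hausdorff_pre_def INF_less_iff by auto

lemma hausdorff_pre_countably_subadditive:
  "hausdorff_pre s \<delta> (\<Union>i. A i) \<le> (\<Sum>i. hausdorff_pre s \<delta> (A i :: 'a::metric_space set))"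
proof (rule ennreal_le_epsilon)
  fix e :: real
  assume fin: "(\<Sum>i. hausdorff_pre s \<delta> (A i)) < top" and e: "0 < e"
  \<comment> \<open>The error is split geometrically; the shares add up to \<open>e\<close>.\<close>
  define d where "d i = e * (1/2) ^ Suc i" for i
  have d: "d i > 0" for i using e by (simp add: d_def)
  have "hausdorff_pre s \<delta> (A i) < top" for i
    using fin by (metis ennreal_suminf_lessD)
  then have "hausdorff_pre s \<delta> (A i) < hausdorff_pre s \<delta> (A i) + ennreal (d i)" for i
    using d[of i] by (auto simp: less_top[symmetric])
  then have "\<exists>C. A i \<subseteq> (\<Union>j. C j) \<and> (\<forall>j. bounded (C j) \<and> diameter (C j) \<le> \<delta>) \<and>
     (\<Sum>j. ennreal (unit_ball_vol s * (diameter (C j) / 2) powr s)) < hausdorff_pre s \<delta> (A i) + ennreal (d i)" for i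
    by (rule hausdorff_pre_cover)
  then obtain C where C: "\<And>i. A i \<subseteq> (\<Union>j. C i j)" "\<And>i j. bounded (C i j)" "\<And>i j. diameter (C i j) \<le> \<delta>"
    "\<And>i. (\<Sum>j. ennreal (unit_ball_vol s * (diameter (C i j) / 2) powr s)) < hausdorff_pre s \<delta> (A i) + ennreal (d i)"
    by metis
  let ?f = "\<lambda>(i,j). ennreal (unit_ball_vol s * (diameter (C i j) / 2) powr s)"
  \<comment> \<open>A bijection between \<open>nat\<close> and pairs of naturals merges the covers
    of all \<open>A i\<close> into one sequence.\<close>
  let ?D = "\<lambda>n. case prod_decode n of (i,j) \<Rightarrow> C i j"
  have "hausdorff_pre s \<delta> (\<Union>i. A i) \<le> (\<Sum>n. ennreal (unit_ball_vol s * (diameter (?D n) / 2) powr s))"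
  proof (rule hausdorff_pre_le)
    show "(\<Union>i. A i) \<subseteq> (\<Union>n. ?D n)"
    proof
      fix x assume "x \<in> (\<Union>i. A i)"
      then obtain i j where "x \<in> C i j" using C(1) by blast
      then have "x \<in> ?D (prod_encode (i,j))" by simp
      then show "x \<in> (\<Union>n. ?D n)" by (rule UN_I[OF UNIV_I])
    qed
  qed (auto simp: C split: prod.split)
  also have "\<dots> = (\<Sum>n. ?f (prod_decode n))"
    by (auto intro!: suminf_cong split: prod.split)
  also have "\<dots> = (\<Sum>i. \<Sum>j. ?f (i,j))"
    by (rule suminf_ennreal_2dimen) simp
  also have "\<dots> \<le> (\<Sum>i. hausdorff_pre s \<delta> (A i) + ennreal (d i))"
    using C(4) by (intro suminf_le) (auto intro: less_imp_le)
  also have "\<dots> = (\<Sum>i. hausdorff_pre s \<delta> (A i)) + (\<Sum>i. ennreal (d i))"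
    by (simp add: suminf_add)
  also have "(\<Sum>i. ennreal (d i)) = ennreal e"
    using sums_mult[OF power_half_series, of e] d
    by (intro suminf_ennreal_eq) (auto simp: d_def intro: less_imp_le)
  finally show "hausdorff_pre s \<delta> (\<Union>i. A i) \<le> (\<Sum>i. hausdorff_pre s \<delta> (A i)) + ennreal e" .
qed

lemma hausdorff_outer_countably_subadditive:
  "hausdorff_outer s (\<Union>i. A i) \<le> (\<Sum>i. hausdorff_outer s (A i :: 'a::metric_space set))"
  unfolding hausdorff_outer_def[of s "\<Union>i. A i"]
proof (rule SUP_least)
  fix \<delta> :: real assume "\<delta> \<in> {0<..}"
  then show "hausdorff_pre s \<delta> (\<Union>i. A i) \<le> (\<Sum>i. hausdorff_outer s (A i))"
    by (intro order_trans[OF hausdorff_pre_countably_subadditive] suminf_le hausdorff_pre_le_outer) auto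
qed

lemma hausdorff_outer_space: "outer_measure_space UNIV (hausdorff_outer s)"
  unfolding outer_measure_space_def positive_def increasing_def countably_subadditive_def
  using hausdorff_outer_countably_subadditive by (auto intro: hausdorff_outer_mono)

lemma hausdorff_outer_subadditive:
  "hausdorff_outer s (A \<union> B) \<le> hausdorff_outer s A + hausdorff_outer s B"
proof -
  have "hausdorff_outer s (\<Union>i::nat. if i = 0 then A else if i = 1 then B else {}) \<le>
     (\<Sum>i::nat. hausdorff_outer s (if i = 0 then A else if i = 1 then B else {}))"
    by (rule hausdorff_outer_countably_subadditive)
  also have "\<dots> = (\<Sum>i\<in>{0,1::nat}. hausdorff_outer s (if i = 0 then A else if i = 1 then B else {}))"
    by (rule suminf_finite) auto
  also have "(\<Union>i::nat. if i = 0 then A else if i = 1 then B else {}) = A \<union> B"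
    by (auto split: if_splits)
  finally show ?thesis by simp
qed

text \<open>At scales below \<open>d\<close> no set of a cover can meet both \<open>A\<close> and
  \<open>B\<close>, so every fine cover of the union falls apart into one of \<open>A\<close> and
  one of \<open>B\<close>. This is the metric property on which Caratheodory's criterion
  rests.\<close>

lemma hausdorff_outer_separated:
  fixes A B :: "'a::metric_space set"
  assumes d: "0 < d" and sep: "\<And>x y. x \<in> A \<Longrightarrow> y \<in> B \<Longrightarrow> d \<le> dist x y"
  shows "hausdorff_outer s A + hausdorff_outer s B \<le> hausdorff_outer s (A \<union> B)"
proof -
  have *: "hausdorff_pre s \<delta> A + hausdorff_pre s \<delta> B \<le> hausdorff_pre s \<delta> (A \<union> B)"
    if \<delta>: "0 < \<delta>" "\<delta> < d" for \<delta>
  proof (rule ccontr)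
    assume "\<not> ?thesis"
    then have "hausdorff_pre s \<delta> (A \<union> B) < hausdorff_pre s \<delta> A + hausdorff_pre s \<delta> B" by simp
    then obtain C where C: "A \<union> B \<subseteq> (\<Union>i. C i)" "\<And>i. bounded (C i)" "\<And>i. diameter (C i) \<le> \<delta>"
      and less: "(\<Sum>i. ennreal (unit_ball_vol s * (diameter (C i) / 2) powr s)) < hausdorff_pre s \<delta> A + hausdorff_pre s \<delta> B"
      using hausdorff_pre_cover by metis
    \<comment> \<open>Discarded sets become empty and cost nothing: the diameter of the empty set is
      0 and \<open>0 powr s = 0\<close>.\<close>
    define CA where "CA i = (if C i \<inter> A = {} then {} else C i)" for i
    define CB where "CB i = (if C i \<inter> B = {} then {} else C i)" for i
    have dis: "C i \<inter> A = {} \<or> C i \<inter> B = {}" for i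
    proof (rule ccontr)
      assume "\<not> ?thesis"
      then obtain x y where xy: "x \<in> C i" "x \<in> A" "y \<in> C i" "y \<in> B" by auto
      then have "dist x y \<le> diameter (C i)" using C(2) by (intro diameter_bounded_bound)
      then show False using C(3)[of i] \<delta>(2) sep[OF xy(2,4)] by linarith
    qed
    have "hausdorff_pre s \<delta> A \<le> (\<Sum>i. ennreal (unit_ball_vol s * (diameter (CA i) / 2) powr s))"
      using C \<delta> by (intro hausdorff_pre_le) (auto simp: CA_def, blast)
    moreover have "hausdorff_pre s \<delta> B \<le> (\<Sum>i. ennreal (unit_ball_vol s * (diameter (CB i) / 2) powr s))"
      using C \<delta> by (intro hausdorff_pre_le) (auto simp: CB_def, blast)
    moreover have "(\<Sum>i. ennreal (unit_ball_vol s * (diameter (CA i) / 2) powr s)) +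
       (\<Sum>i. ennreal (unit_ball_vol s * (diameter (CB i) / 2) powr s)) \<le>
       (\<Sum>i. ennreal (unit_ball_vol s * (diameter (C i) / 2) powr s))"
    proof -
      have "ennreal (unit_ball_vol s * (diameter (CA i) / 2) powr s) + ennreal (unit_ball_vol s * (diameter (CB i) / 2) powr s)
        \<le> ennreal (unit_ball_vol s * (diameter (C i) / 2) powr s)" for i
        using dis[of i] by (auto simp: CA_def CB_def)
      then show ?thesis by (subst suminf_add) (auto intro!: suminf_le)
    qed
    ultimately show False using less by (meson add_mono leD order_trans)
  qed
  \<comment> \<open>The pre-measures grow as the scale shrinks, so two scales can be replaced by
    their minimum and the suprema add up.\<close>
  have "hausdorff_outer s A + hausdorff_outer s B =
     (SUP \<delta>\<in>{0<..}. hausdorff_pre s \<delta> A + hausdorff_pre s \<delta> B)"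
    unfolding hausdorff_outer_def
  proof (rule SUP_add_directed_ennreal[symmetric])
    fix i j :: real assume "i \<in> {0<..}" "j \<in> {0<..}"
    then show "\<exists>k\<in>{0<..}. hausdorff_pre s i A + hausdorff_pre s j B \<le> hausdorff_pre s k A + hausdorff_pre s k B"
      by (intro bexI[of _ "min i j"] add_mono hausdorff_pre_antimono) auto
  qed
  also have "\<dots> \<le> hausdorff_outer s (A \<union> B)"
  proof (rule SUP_least)
    fix \<delta> :: real assume \<delta>: "\<delta> \<in> {0<..}"
    let ?m = "min \<delta> (d/2)"
    have "hausdorff_pre s \<delta> A + hausdorff_pre s \<delta> B \<le> hausdorff_pre s ?m A + hausdorff_pre s ?m B"
      by (intro add_mono hausdorff_pre_antimono) auto
    also have "\<dots> \<le> hausdorff_pre s ?m (A \<union> B)" using \<delta> d by (intro *) auto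
    also have "\<dots> \<le> hausdorff_outer s (A \<union> B)" using \<delta> d by (intro hausdorff_pre_le_outer) auto
    finally show "hausdorff_pre s \<delta> A + hausdorff_pre s \<delta> B \<le> hausdorff_outer s (A \<union> B)" .
  qed
  finally show ?thesis .
qed

text \<open>Caratheodory's criterion: the shells \<open>R k\<close> around a closed set are pairwise separated
  among those of equal parity, so their measures are summable.\<close>

lemma hausdorff_outer_closed:
  fixes F X :: "'a::metric_space set"
  assumes F: "closed F" 
  shows "hausdorff_outer s (X \<inter> F) + hausdorff_outer s (X - F) \<le> hausdorff_outer s X"
proof (cases "F = {} \<or> hausdorff_outer s X = \<infinity>")
  case True then show ?thesis by auto
next
  case False
  then have ne: "F \<noteq> {}" and fin: "hausdorff_outer s X \<noteq> \<infinity>" by auto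
  let ?H = "hausdorff_outer s"
  let ?e = "\<lambda>k::nat. 1 / (real k + 1)"
  \<comment> \<open>\<open>Y k\<close> is separated from \<open>F\<close>, and the shells from index
    \<open>k\<close> on fill what is left of \<open>X - F\<close>.\<close>
  define Y where "Y k = {x\<in>X. ?e k \<le> infdist x F}" for k
  define R where "R k = {x\<in>X. ?e (Suc k) \<le> infdist x F \<and> infdist x F < ?e k}" for k
  have e_mono: "j \<le> k \<Longrightarrow> ?e k \<le> ?e j" for j k by (simp add: field_simps)
  have sumR: "(\<Sum>i<n. ?H (R (2 * i + c))) \<le> ?H X" for n c
  proof -
    have "(\<Sum>i<n. ?H (R (2 * i + c))) \<le> ?H (\<Union>i<n. R (2 * i + c))"
    proof (induction n)
      case (Suc n)
      let ?d = "?e (2 * n + c) - (?e (2 * n + c) + ?e (Suc (2 * n + c)))/ 2"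
      have "(\<Sum>i<Suc n. ?H (R (2 * i + c))) \<le> ?H (\<Union>i<n. R (2 * i + c)) + ?H (R (2 * n + c))"
        using Suc by (simp add: add_right_mono)
      also have "\<dots> \<le> ?H ((\<Union>i<n. R (2 * i + c)) \<union> R (2 * n + c))"
      proof (cases n)
        case (Suc m)
        let ?j = "2 * m + c"
        let ?d = "?e (Suc ?j) - ?e (Suc (Suc ?j))"
        show ?thesis
        proof (rule hausdorff_outer_separated)
          have "real ?j + 2 < real ?j + 3" "0 < real ?j + 2" by auto
          then show "0 < ?d" by (simp add: frac_less2 add.commute add.left_commute)
          fix x y assume x: "x \<in> (\<Union>i<n. R (2 * i + c))" and y: "y \<in> R (2 * n + c)"
          then obtain i where i: "i < n" "x \<in> R (2 * i + c)" by auto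
          have "?e (Suc ?j) \<le> ?e (Suc (2 * i + c))" using i Suc by (intro e_mono) auto
          also have "\<dots> \<le> infdist x F" using i by (auto simp: R_def)
          also have "\<dots> \<le> infdist y F + dist x y" by (rule infdist_triangle)
          also have "infdist y F < ?e (2 * n + c)" using y by (auto simp: R_def)
          finally show "?d \<le> dist x y" using Suc by simp
        qed
      qed auto
      also have "(\<Union>i<n. R (2 * i + c)) \<union> R (2 * n + c) = (\<Union>i<Suc n. R (2 * i + c))"
        by (auto simp: lessThan_Suc)
      finally show ?case .
    qed auto
    also have "\<dots> \<le> ?H X" by (rule hausdorff_outer_mono) (auto simp: R_def)
    finally show ?thesis .
  qed
  have sum_split: "(\<Sum>i<2*n. ?H (R i)) = (\<Sum>i<n. ?H (R (2 * i + 0))) + (\<Sum>i<n. ?H (R (2 * i + 1)))" for n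
    by (induction n) (auto simp: algebra_simps)
  have sumR2: "(\<Sum>i<n. ?H (R i)) \<le> 2 * ?H X" for n
  proof -
    have "(\<Sum>i<n. ?H (R i)) \<le> (\<Sum>i<2*n. ?H (R i))" by (rule sum_mono2) auto
    also have "\<dots> \<le> ?H X + ?H X" unfolding sum_split by (intro add_mono sumR)
    finally show ?thesis by (simp add: mult_2)
  qed
  have summ: "(\<Sum>i. ?H (R i)) \<le> 2 * ?H X"
    unfolding suminf_eq_SUP by (rule SUP_least) (rule sumR2)
  \<comment> \<open>Summability makes the tails vanish, so \<open>Y k\<close> exhausts
    \<open>X - F\<close> in outer measure.\<close>
  have tail: "(\<lambda>k. \<Sum>i. ?H (R (i + k))) \<longlonglongrightarrow> 0"
  proof -
    have fin2: "(\<Sum>i. ?H (R i)) \<noteq> \<infinity>"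
    proof
      assume "(\<Sum>i. ?H (R i)) = \<infinity>"
      then have "2 * ?H X = top" using summ by (simp add: top_unique)
      then show False using fin by (simp add: ennreal_mult_eq_top_iff)
    qed
    have "(\<lambda>k. (\<Sum>i. ?H (R i)) - (\<Sum>i<k. ?H (R i))) \<longlonglongrightarrow> (\<Sum>i. ?H (R i)) - (\<Sum>i. ?H (R i))"
      using fin2 by (intro tendsto_diff_ennreal tendsto_const summable_LIMSEQ) auto
    moreover have "(\<Sum>i. ?H (R i)) - (\<Sum>i<k. ?H (R i)) = (\<Sum>i. ?H (R (i + k)))" for k
    proof -
      have "(\<Sum>i. ?H (R i)) = (\<Sum>i. ?H (R (i + k))) + (\<Sum>i<k. ?H (R i))"
        by (rule suminf_offset) auto
      moreover have "(\<Sum>i<k. ?H (R i)) \<noteq> \<infinity>"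
        using fin2 by (metis calculation ennreal_add_eq_top infinity_ennreal_def)
      ultimately show ?thesis by (metis ennreal_add_diff_cancel_right infinity_ennreal_def)
    qed
    ultimately show ?thesis using fin2 by simp
  qed
  have XF: "?H (X - F) \<le> ?H (Y k) + (\<Sum>i. ?H (R (i + k)))" for k
  proof -
    have "X - F \<subseteq> Y k \<union> (\<Union>i. R (i + k))"
    proof
      fix x assume x: "x \<in> X - F"
      then have pos: "infdist x F > 0" using F ne
        by (metis DiffD2 in_closed_iff_infdist_zero infdist_nonneg less_eq_real_def)
      show "x \<in> Y k \<union> (\<Union>i. R (i + k))"
      proof (cases "?e k \<le> infdist x F")
        case True then show ?thesis using x by (auto simp: Y_def)
      next
        case False
        \<comment> \<open>Being at positive distance from the closed set, \<open>x\<close> has a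
          first index m with 1/(m+1) \<le> \<open>infdist x F\<close>. It lies in the shell of index
          m - 1, and m > k because \<open>x\<close> is not in \<open>Y k\<close>.\<close>
        define P where "P m \<longleftrightarrow> ?e m \<le> infdist x F" for m
        have "\<exists>m. P m" using pos unfolding P_def
          by (metis Suc_eq_plus1 nat_approx_posE inverse_eq_divide less_imp_le of_nat_Suc add.commute)
        then have "P (LEAST m. P m)" by (rule LeastI_ex)
        moreover define m where "m = (LEAST m. P m)"
        ultimately have m: "P m" "\<And>j. j < m \<Longrightarrow> \<not> P j" using not_less_Least by auto
        have "m > k" using False m(1) e_mono[of m k] unfolding P_def
          by (meson not_le order_trans)
        then obtain i where i: "m = Suc (i + k)" using less_iff_Suc_add by (metis add.commute)
        then have "x \<in> R (i + k)" using m(1) m(2)[of "i+k"] x by (auto simp: R_def P_def)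
        then show ?thesis by auto
      qed
    qed
    then have "?H (X - F) \<le> ?H (Y k \<union> (\<Union>i. R (i + k)))" by (rule hausdorff_outer_mono)
    also have "\<dots> \<le> ?H (Y k) + (\<Sum>i. ?H (R (i + k)))"
      by (intro order_trans[OF hausdorff_outer_subadditive] add_left_mono hausdorff_outer_countably_subadditive)
    finally show ?thesis .
  qed
  have "?H (X \<inter> F) + ?H (X - F) \<le> ?H X + (\<Sum>i. ?H (R (i + k)))" for k
  proof -
    have "?H (X \<inter> F) + ?H (Y k) \<le> ?H (X \<inter> F \<union> Y k)"
    proof (rule hausdorff_outer_separated)
      show "0 < ?e k" by simp
      fix x y assume "x \<in> X \<inter> F" "y \<in> Y k"
      then show "?e k \<le> dist x y" unfolding Y_def
        by (metis (mono_tags, lifting) IntD2 dist_commute infdist_le mem_Collect_eq order_trans)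
    qed
    also have "\<dots> \<le> ?H X" by (rule hausdorff_outer_mono) (auto simp: Y_def)
    finally have *: "?H (X \<inter> F) + ?H (Y k) \<le> ?H X" .
    have "?H (X \<inter> F) + ?H (X - F) \<le> ?H (X \<inter> F) + (?H (Y k) + (\<Sum>i. ?H (R (i + k))))"
      by (intro add_left_mono XF)
    also have "\<dots> \<le> ?H X + (\<Sum>i. ?H (R (i + k)))"
      using * by (simp add: add.assoc[symmetric] add_right_mono)
    finally show ?thesis .
  qed
  moreover have "(\<lambda>k. ?H X + (\<Sum>i. ?H (R (i + k)))) \<longlonglongrightarrow> ?H X + 0"
    by (intro tendsto_add tendsto_const tail)
  ultimately show ?thesis by (intro LIMSEQ_le_const[of _ "?H X"]) auto
qed

text \<open>Caratheodory: the outer measure is a measure on the sigma-algebra of those sets that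
  split every set additively. This sigma-algebra contains the closed sets and therefore the Borel
  sets.\<close>

lemma measure_space_hausdorff:
  "measure_space UNIV (sets borel) (hausdorff_outer s :: 'a::metric_space set \<Rightarrow> ennreal)"
proof -
  let ?L = "lambda_system UNIV UNIV (hausdorff_outer s :: 'a set \<Rightarrow> ennreal)"
  have ms: "measure_space UNIV ?L (hausdorff_outer s)"
    using sigma_algebra.caratheodory_lemma[OF sigma_algebra_Pow[of UNIV, simplified] hausdorff_outer_space, of s]
    by simp
  then have sa: "sigma_algebra UNIV ?L" by (simp add: measure_space_def)
  have cl: "F \<in> ?L" if "closed F" for F
  proof -
    have "hausdorff_outer s (F \<inter> X) + hausdorff_outer s ((UNIV - F) \<inter> X) = hausdorff_outer s X" for X
    proof (rule antisym)
      show "hausdorff_outer s (F \<inter> X) + hausdorff_outer s ((UNIV - F) \<inter> X) \<le> hausdorff_outer s X"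
        using hausdorff_outer_closed[OF that, of s X] by (simp add: Int_commute Diff_eq)
      have "hausdorff_outer s X = hausdorff_outer s (F \<inter> X \<union> (UNIV - F) \<inter> X)"
        by (rule arg_cong[where f="hausdorff_outer s"]) auto
      then show "hausdorff_outer s X \<le> hausdorff_outer s (F \<inter> X) + hausdorff_outer s ((UNIV - F) \<inter> X)"
        using hausdorff_outer_subadditive by metis
    qed
    then show ?thesis by (auto simp: lambda_system_def)
  qed
  have "sets (borel :: 'a measure) \<subseteq> ?L"
    unfolding borel_eq_closed
    by (simp add: sigma_algebra.sigma_sets_subset[OF sa] cl subset_eq)
      (metis (no_types, lifting) cl mem_Collect_eq sa sigma_algebra.sigma_sets_subset subsetD subsetI)
  moreover have "sigma_algebra UNIV (sets (borel :: 'a measure))"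
    by (metis sets.sigma_algebra_axioms space_borel)
  ultimately show ?thesis using ms measure_down by blast
qed

lemma sets_hausdorff_measure [simp, measurable_cong]: "sets (hausdorff_measure s) = sets borel"
  unfolding hausdorff_measure_def by (metis sets.sigma_sets_eq sets_measure_of_conv space_borel top_greatest Pow_UNIV)

lemma space_hausdorff_measure [simp]: "space (hausdorff_measure s) = UNIV"
  unfolding hausdorff_measure_def by (simp add: space_measure_of_conv)

text \<open>\<open>measure_of\<close> yields the zero measure unless it is given a genuine measure,
  so countable additivity has to be established before the value can be read off.\<close>

lemma emeasure_hausdorff_measure:
  "E \<in> sets borel \<Longrightarrow> emeasure (hausdorff_measure s) E = hausdorff_outer s E"
  unfolding hausdorff_measure_def
  using measure_space_hausdorff[of s]
  by (intro emeasure_measure_of_sigma) (auto simp: measure_space_def)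

section \<open>The isodiametric inequality\<close>

text \<open>Fubini with one coordinate direction split off. The remaining coordinates are kept as a
  function on \<open>Basis - {e}\<close>, since the hyperplane orthogonal to \<open>e\<close> is not
  a type of its own.\<close>

lemma nn_integral_lborel_direction:
  fixes f :: "'a::euclidean_space \<Rightarrow> ennreal"
  assumes [measurable]: "f \<in> borel_measurable borel" and e: "e \<in> Basis"
  shows "(\<integral>\<^sup>+x. f x \<partial>lborel) =
    (\<integral>\<^sup>+y. (\<integral>\<^sup>+t. f ((\<Sum>b\<in>Basis-{e}. y b *\<^sub>R b) + t *\<^sub>R e) \<partial>lborel) \<partial>(\<Pi>\<^sub>M b\<in>Basis-{e}. lborel))"
proof -
  interpret product_sigma_finite "\<lambda>_::'a. lborel :: real measure" ..
  let ?g = "\<lambda>y::'a \<Rightarrow> real. f (\<Sum>b\<in>Basis. y b *\<^sub>R b)"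
  have "(\<integral>\<^sup>+x. f x \<partial>lborel) = (\<integral>\<^sup>+y. ?g y \<partial>(\<Pi>\<^sub>M b\<in>Basis. lborel))"
    by (subst lborel_eq, subst nn_integral_distr) auto
  also have "\<dots> = (\<integral>\<^sup>+y. ?g y \<partial>(\<Pi>\<^sub>M b\<in>insert e (Basis-{e}). lborel))"
    using e by (simp add: insert_absorb)
  also have "(\<integral>\<^sup>+y. ?g y \<partial>(\<Pi>\<^sub>M b\<in>insert e (Basis-{e}). lborel)) =
    (\<integral>\<^sup>+y. (\<integral>\<^sup>+t. ?g (y(e:=t)) \<partial>lborel) \<partial>(\<Pi>\<^sub>M b\<in>Basis-{e}. lborel))"
  proof (rule product_nn_integral_insert)
    show "?g \<in> borel_measurable (\<Pi>\<^sub>M b\<in>insert e (Basis-{e}). lborel)"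
      using e by (simp add: insert_absorb)
  qed auto
  also have "\<dots> = (\<integral>\<^sup>+y. (\<integral>\<^sup>+t. f ((\<Sum>b\<in>Basis-{e}. y b *\<^sub>R b) + t *\<^sub>R e) \<partial>lborel) \<partial>(\<Pi>\<^sub>M b\<in>Basis-{e}. lborel))"
  proof -
    have "(\<Sum>b\<in>Basis. (y(e:=t)) b *\<^sub>R b) = (\<Sum>b\<in>Basis-{e}. y b *\<^sub>R b) + t *\<^sub>R e" for y :: "'a \<Rightarrow> real" and t
      using e by (subst sum.remove[of _ e]) (auto intro!: sum.cong simp: add.commute)
    then show ?thesis by simp
  qed
  finally show ?thesis .
qed

text \<open>Parametrised by the \<open>e\<close>-coordinate itself rather than by the distance from
  \<open>x\<close>, so that for a unit vector \<open>e\<close> all points of a line parallel to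
  \<open>e\<close> have the same slice.\<close>

definition line_slice :: "'a::euclidean_space \<Rightarrow> 'a set \<Rightarrow> 'a \<Rightarrow> real set" where
  "line_slice e A x = {t. x + (t - x \<bullet> e) *\<^sub>R e \<in> A}"

text \<open>On each line parallel to \<open>e\<close> the slice is replaced by the centred open
  interval of the same length; the strict inequality leaves lines with a null slice empty.\<close>

definition steiner :: "'a::euclidean_space \<Rightarrow> 'a set \<Rightarrow> 'a set" where
  "steiner e A = {x. ennreal (2 * \<bar>x \<bullet> e\<bar>) < emeasure lborel (line_slice e A x)}"

definition reflect :: "'a::euclidean_space \<Rightarrow> 'a \<Rightarrow> 'a" where
  "reflect b x = x - (2 * (x \<bullet> b)) *\<^sub>R b"

lemma steiner_measurable [measurable]:
  assumes [measurable]: "A \<in> sets borel"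
  shows "steiner e A \<in> sets borel"
proof -
  have "(\<lambda>x. emeasure lborel (line_slice e A x)) \<in> borel_measurable borel"
  proof -
    let ?Q = "{z :: 'a \<times> real. fst z + (snd z - fst z \<bullet> e) *\<^sub>R e \<in> A}"
    have "?Q = (\<lambda>z. fst z + (snd z - fst z \<bullet> e) *\<^sub>R e) -` A \<inter> space (borel \<Otimes>\<^sub>M lborel)"
      by (auto simp: space_pair_measure)
    also have "\<dots> \<in> sets (borel \<Otimes>\<^sub>M lborel)"
      by measurable
    finally have "(\<lambda>x. emeasure lborel (Pair x -` ?Q)) \<in> borel_measurable borel"
      by (rule lborel.measurable_emeasure_Pair)
    moreover have "Pair x -` ?Q = line_slice e A x" for x
      by (auto simp: line_slice_def)
    ultimately show ?thesis by (simp only:)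
  qed
  then show ?thesis unfolding steiner_def by measurable
qed

lemma emeasure_centered_interval: "emeasure lborel {t::real. ennreal (2 * \<bar>t\<bar>) < m} = m"
proof (cases m)
  case (real r)
  then have "{t::real. ennreal (2 * \<bar>t\<bar>) < m} = {-r/2<..<r/2}"
    by (auto simp: ennreal_less_iff abs_less_iff)
  then show ?thesis using real by simp
next
  case top
  then show ?thesis by simp
qed

text \<open>Cavalieri's principle: on every line parallel to \<open>e\<close> both sets have the
  same length.\<close>

lemma emeasure_steiner:
  fixes A :: "'a::euclidean_space set"
  assumes [measurable]: "A \<in> sets borel" and e: "e \<in> Basis"
  shows "emeasure lborel (steiner e A) = emeasure lborel A"
proof -
  define h where "h y = (\<Sum>b\<in>Basis-{e}. y b *\<^sub>R b)" for y :: "'a \<Rightarrow> real"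
  have h: "h y \<bullet> e = 0" for y
    using e by (auto simp: h_def inner_sum_left inner_Basis intro!: sum.neutral)
  have ee: "e \<bullet> e = 1" using e by (simp add: inner_Basis)
  have sl: "line_slice e A (h y + t *\<^sub>R e) = {s. h y + s *\<^sub>R e \<in> A}" for y t
    by (auto simp: line_slice_def inner_add_left h ee algebra_simps)
  have *: "emeasure lborel B = (\<integral>\<^sup>+y. emeasure lborel {t. h y + t *\<^sub>R e \<in> B} \<partial>(\<Pi>\<^sub>M b\<in>Basis-{e}. lborel))"
    if [measurable]: "B \<in> sets borel" for B
  proof -
    have "emeasure lborel B = (\<integral>\<^sup>+x. indicator B x \<partial>lborel)" by simp
    also have "\<dots> = (\<integral>\<^sup>+y. (\<integral>\<^sup>+t. indicator B (h y + t *\<^sub>R e) \<partial>lborel) \<partial>(\<Pi>\<^sub>M b\<in>Basis-{e}. lborel))"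
      unfolding h_def by (rule nn_integral_lborel_direction) (use e in auto)
    also have "\<dots> = (\<integral>\<^sup>+y. emeasure lborel {t. h y + t *\<^sub>R e \<in> B} \<partial>(\<Pi>\<^sub>M b\<in>Basis-{e}. lborel))"
    proof (rule nn_integral_cong)
      fix y
      have "(\<integral>\<^sup>+t. indicator B (h y + t *\<^sub>R e) \<partial>lborel) = (\<integral>\<^sup>+t. indicator {t. h y + t *\<^sub>R e \<in> B} t \<partial>lborel)"
        by (rule nn_integral_cong) (auto simp: indicator_def)
      also have "\<dots> = emeasure lborel {t. h y + t *\<^sub>R e \<in> B}"
        by (rule nn_integral_indicator) measurable
      finally show "(\<integral>\<^sup>+t. indicator B (h y + t *\<^sub>R e) \<partial>lborel) = emeasure lborel {t. h y + t *\<^sub>R e \<in> B}" .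
    qed
    finally show ?thesis .
  qed
  have "{t. h y + t *\<^sub>R e \<in> steiner e A} = {t. ennreal (2 * \<bar>t\<bar>) < emeasure lborel {s. h y + s *\<^sub>R e \<in> A}}" for y
    by (simp add: steiner_def sl inner_add_left h ee)
  then show ?thesis
    by (simp add: *[of "steiner e A"] *[of A] emeasure_centered_interval)
qed

text \<open>The one-dimensional core of symmetrisation. The lengths of the hulls add up to (Sup S -
  Inf T) + (Sup T - Inf S), and each bracket is at most \<open>d\<close>.\<close>

lemma emeasure_slices_le:
  fixes S T :: "real set"
  assumes ne: "S \<noteq> {}" "T \<noteq> {}" and d: "\<And>s t. s \<in> S \<Longrightarrow> t \<in> T \<Longrightarrow> \<bar>s - t\<bar> \<le> d"
  shows "emeasure lborel S + emeasure lborel T \<le> ennreal (2 * d)"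
proof -
  obtain s0 t0 where s0: "s0 \<in> S" and t0: "t0 \<in> T" using ne by auto
  have S: "s0 - 2*d \<le> s \<and> s \<le> s0 + 2*d" if "s \<in> S" for s
    using d[OF that t0] d[OF s0 t0] by linarith
  have T: "t0 - 2*d \<le> t \<and> t \<le> t0 + 2*d" if "t \<in> T" for t
    using d[OF s0 that] d[OF s0 t0] by linarith
  have bS: "bdd_above S" "bdd_below S" using S by (auto intro!: bdd_aboveI bdd_belowI)
  have bT: "bdd_above T" "bdd_below T" using T by (auto intro!: bdd_aboveI bdd_belowI)
  have SS: "S \<subseteq> {Inf S..Sup S}" using bS by (auto intro: cInf_lower cSup_upper)
  have TT: "T \<subseteq> {Inf T..Sup T}" using bT by (auto intro: cInf_lower cSup_upper)
  have "Sup S \<le> Inf T + d"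
  proof (rule cSup_least[OF ne(1)])
    fix s assume s: "s \<in> S"
    have "s - d \<le> Inf T" by (rule cInf_greatest[OF ne(2)]) (use d[OF s] in \<open>force simp: abs_le_iff\<close>)
    then show "s \<le> Inf T + d" by simp
  qed
  moreover have "Sup T \<le> Inf S + d"
  proof (rule cSup_least[OF ne(2)])
    fix t assume t: "t \<in> T"
    have "t - d \<le> Inf S" by (rule cInf_greatest[OF ne(1)]) (use d[OF _ t] in \<open>force simp: abs_le_iff\<close>)
    then show "t \<le> Inf S + d" by simp
  qed
  moreover have "Inf S \<le> Sup S" "Inf T \<le> Sup T" using SS TT s0 t0 by fastforce+
  ultimately have "ennreal (Sup S - Inf S) + ennreal (Sup T - Inf T) \<le> ennreal (2 * d)"
    by (subst ennreal_plus[symmetric]) (auto intro!: ennreal_leI simp del: ennreal_plus)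
  moreover have "emeasure lborel S \<le> ennreal (Sup S - Inf S)"
    using emeasure_mono[OF SS, of lborel] \<open>Inf S \<le> Sup S\<close> by simp
  moreover have "emeasure lborel T \<le> ennreal (Sup T - Inf T)"
    using emeasure_mono[OF TT, of lborel] \<open>Inf T \<le> Sup T\<close> by simp
  ultimately show ?thesis by (meson add_mono order_trans)
qed

text \<open>By Pythagoras a distance splits into the part \<open>z\<close> orthogonal to
  \<open>e\<close>, which symmetrisation leaves alone, and a difference of heights. Points of the
  two slices differ in height by at most sqrt(D^2 - |z|^2), so the slices have total length at most
  twice that, and the heights of the symmetrised points are at most half the lengths.\<close>

lemma steiner_dist_le:
  fixes A :: "'a::euclidean_space set"
  assumes D: "\<And>x y. x \<in> A \<Longrightarrow> y \<in> A \<Longrightarrow> dist x y \<le> D" and e: "e \<in> Basis"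
    and x: "x \<in> steiner e A" and y: "y \<in> steiner e A"
  shows "dist x y \<le> D"
proof -
  have ee: "e \<bullet> e = 1" using e by (simp add: inner_Basis)
  let ?s = "x \<bullet> e" and ?s' = "y \<bullet> e"
  define z where "z = (x - y) - (?s - ?s') *\<^sub>R e"
  have ze: "z \<bullet> e = 0" by (simp add: z_def inner_diff_left ee)
  have nrm: "norm (z + r *\<^sub>R e) ^ 2 = norm z ^ 2 + r^2" for r
    using ze ee by (simp only: power2_norm_eq_inner)
      (simp add: inner_add_left inner_add_right inner_commute power2_eq_square)
  let ?S = "line_slice e A x" and ?T = "line_slice e A y"
  have neS: "?S \<noteq> {}" using x by (auto simp: steiner_def)
  have neT: "?T \<noteq> {}" using y by (auto simp: steiner_def)
  have sq: "norm z ^ 2 + (t - t')^2 \<le> D^2" if t: "t \<in> ?S" and t': "t' \<in> ?T" for t t'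
  proof -
    have "(x + (t - ?s) *\<^sub>R e) - (y + (t' - ?s') *\<^sub>R e) = z + (t - t') *\<^sub>R e"
      by (simp add: z_def algebra_simps)
    moreover have "dist (x + (t - ?s) *\<^sub>R e) (y + (t' - ?s') *\<^sub>R e) \<le> D"
      using t t' by (intro D) (auto simp: line_slice_def)
    ultimately have "norm (z + (t - t') *\<^sub>R e) \<le> D" by (simp add: dist_norm)
    then have "norm (z + (t - t') *\<^sub>R e) ^ 2 \<le> D^2" by (intro power_mono) auto
    then show ?thesis by (simp add: nrm)
  qed
  have D0: "0 \<le> D" using neS D by (force simp: line_slice_def)
  obtain t t' where "t \<in> ?S" "t' \<in> ?T" using neS neT by auto
  from sq[OF this] have zD: "norm z ^ 2 \<le> D^2" by (smt (verit) zero_le_power2)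
  define d where "d = sqrt (D^2 - norm z ^ 2)"
  have d: "0 \<le> d" "d^2 = D^2 - norm z ^ 2" using zD by (auto simp: d_def)
  have "emeasure lborel ?S + emeasure lborel ?T \<le> ennreal (2 * d)"
  proof (rule emeasure_slices_le[OF neS neT])
    fix t t' assume "t \<in> ?S" "t' \<in> ?T"
    from sq[OF this] have "(t - t')^2 \<le> d^2" using d(2) by simp
    then show "\<bar>t - t'\<bar> \<le> d" using d(1) by (simp add: abs_le_square_iff[symmetric])
  qed
  moreover have "ennreal (2 * \<bar>?s\<bar>) + ennreal (2 * \<bar>?s'\<bar>) \<le> emeasure lborel ?S + emeasure lborel ?T"
    using x y by (intro add_mono) (auto simp: steiner_def)
  ultimately have "ennreal (2 * \<bar>?s\<bar>) + ennreal (2 * \<bar>?s'\<bar>) \<le> ennreal (2 * d)" by order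
  then have "ennreal (2 * \<bar>?s\<bar> + 2 * \<bar>?s'\<bar>) \<le> ennreal (2 * d)"
    by (subst ennreal_plus) (auto simp del: ennreal_plus)
  then have "2 * \<bar>?s\<bar> + 2 * \<bar>?s'\<bar> \<le> 2 * d"
    using d(1) by (subst (asm) ennreal_le_iff) auto
  then have "\<bar>?s - ?s'\<bar> \<le> d" by linarith
  then have "(?s - ?s')^2 \<le> d^2" using d(1) by (simp add: abs_le_square_iff[symmetric])
  then have "norm (z + (?s - ?s') *\<^sub>R e) ^ 2 \<le> D^2" using d(2) by (simp add: nrm)
  then have "norm (z + (?s - ?s') *\<^sub>R e) \<le> D" using D0 by (rule power2_le_imp_le)
  then show ?thesis by (simp add: z_def dist_norm)
qed

lemma reflect_steiner:
  assumes e: "e \<in> Basis" and x: "x \<in> steiner e A"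
  shows "reflect e x \<in> steiner e A"
proof -
  have "e \<bullet> e = 1" using e by (simp add: inner_Basis)
  then have "reflect e x \<bullet> e = - (x \<bullet> e)"
    by (simp add: reflect_def inner_diff_left)
  moreover have "reflect e x + (t + x \<bullet> e) *\<^sub>R e = x + (t - x \<bullet> e) *\<^sub>R e" for t
    by (simp add: reflect_def algebra_simps flip: scaleR_add_left)
  ultimately have "reflect e x \<bullet> e = - (x \<bullet> e)" "line_slice e A (reflect e x) = line_slice e A x"
    by (auto simp: line_slice_def)
  then show ?thesis using x by (simp add: steiner_def)
qed

lemma reflect_reflect: "b \<in> Basis \<Longrightarrow> reflect b (reflect b x) = x"
  by (simp add: reflect_def inner_diff_left inner_Basis algebra_simps)

text \<open>Reflection in \<open>b\<close> maps lines parallel to \<open>e\<close> to such lines and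
  keeps the height along \<open>e\<close>. Hence symmetries gained in earlier directions survive
  later symmetrisations.\<close>

lemma reflect_steiner_other:
  assumes e: "e \<in> Basis" "b \<in> Basis" "b \<noteq> e" and sym: "\<And>x. x \<in> A \<Longrightarrow> reflect b x \<in> A"
    and x: "x \<in> steiner e A"
  shows "reflect b x \<in> steiner e A"
proof -
  have be: "b \<bullet> e = 0" "e \<bullet> b = 0" using e by (auto simp: inner_Basis)
  have iff: "reflect b y \<in> A \<longleftrightarrow> y \<in> A" for y
    using sym reflect_reflect[OF e(2)] by metis
  have "reflect b x + (t - reflect b x \<bullet> e) *\<^sub>R e = reflect b (x + (t - x \<bullet> e) *\<^sub>R e)" for t
    by (simp add: reflect_def inner_diff_left inner_add_left be algebra_simps)
  then have "line_slice e A (reflect b x) = line_slice e A x"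
    by (simp add: line_slice_def iff)
  moreover have "reflect b x \<bullet> e = x \<bullet> e"
    by (simp add: reflect_def inner_diff_left be)
  ultimately show ?thesis using x by (simp add: steiner_def)
qed

text \<open>The induction carries volume, diameter and symmetries at once, since symmetrising in a
  new direction must not destroy what was gained in the old ones.\<close>

lemma steiner_all_directions:
  fixes A :: "'a::euclidean_space set"
  assumes A: "A \<in> sets borel" and D: "\<And>x y. x \<in> A \<Longrightarrow> y \<in> A \<Longrightarrow> dist x y \<le> D"
    and B: "finite B" "B \<subseteq> Basis"
  shows "\<exists>A' :: 'a set. A' \<in> sets borel \<and> emeasure lborel A' = emeasure lborel A \<and>
    (\<forall>x\<in>A'. \<forall>y\<in>A'. dist x y \<le> D) \<and> (\<forall>b\<in>B. \<forall>x\<in>A'. reflect b x \<in> A')"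
  using B
proof (induction B)
  case empty
  then show ?case using A D by (intro exI[of _ A]) auto
next
  case (insert e B)
  then obtain A' where A': "A' \<in> sets borel" "emeasure lborel A' = emeasure lborel A"
    "\<forall>x\<in>A'. \<forall>y\<in>A'. dist x y \<le> D" "\<forall>b\<in>B. \<forall>x\<in>A'. reflect b x \<in> A'" by auto
  have e: "e \<in> Basis" using insert by auto
  have "\<forall>b\<in>insert e B. \<forall>x\<in>steiner e A'. reflect b x \<in> steiner e A'"
    using A'(4) insert reflect_steiner[OF e] reflect_steiner_other[OF e]
    by (metis insert_iff subset_iff)
  moreover have "\<forall>x\<in>steiner e A'. \<forall>y\<in>steiner e A'. dist x y \<le> D"
    using steiner_dist_le[OF _ e, of A' D] A'(3) by blast
  ultimately show ?case
    using A'(1,2) emeasure_steiner[OF A'(1) e] steiner_measurable[OF A'(1), of e] by metis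
qed

text \<open>Symmetrising in every coordinate direction preserves the volume, does not increase the diameter and
  makes the set symmetric about the origin, hence contained in a ball of half the diameter.\<close>

lemma isodiametric:
  fixes A :: "'a::euclidean_space set"
  assumes A: "A \<in> sets borel" and D: "\<And>x y. x \<in> A \<Longrightarrow> y \<in> A \<Longrightarrow> dist x y \<le> D" "0 \<le> D"
  shows "emeasure lborel A \<le> ennreal (unit_ball_vol DIM('a) * (D / 2) ^ DIM('a))"
proof -
  obtain A' :: "'a set" where A': "A' \<in> sets borel" "emeasure lborel A' = emeasure lborel A"
    "\<forall>x\<in>A'. \<forall>y\<in>A'. dist x y \<le> D" "\<forall>b\<in>Basis. \<forall>x\<in>A'. reflect b x \<in> A'"
    using steiner_all_directions[OF A D(1) finite_Basis order_refl] by blast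
  \<comment> \<open>The reflections in all coordinate directions compose to the point reflection;
    they are applied one direction at a time.\<close>
  have neg: "x - 2 *\<^sub>R (\<Sum>b\<in>B. (x \<bullet> b) *\<^sub>R b) \<in> A'" if x: "x \<in> A'" and "finite B" "B \<subseteq> Basis" for x B
    using that(2,3)
  proof (induction B)
    case (insert e B)
    let ?y = "x - 2 *\<^sub>R (\<Sum>b\<in>B. (x \<bullet> b) *\<^sub>R b)"
    have "?y \<bullet> e = x \<bullet> e"
      using insert by (auto simp: inner_diff_left inner_sum_left inner_Basis subset_iff intro!: sum.neutral)
    then have "reflect e ?y = x - 2 *\<^sub>R (\<Sum>b\<in>insert e B. (x \<bullet> b) *\<^sub>R b)"
      using insert by (simp add: reflect_def algebra_simps)
    moreover have "reflect e ?y \<in> A'" using A'(4) insert by auto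
    ultimately show ?case by simp
  qed (use x in auto)
  have "A' \<subseteq> cball 0 (D / 2)"
  proof
    fix x assume x: "x \<in> A'"
    have "- x \<in> A'" using neg[OF x finite_Basis order_refl]
      by (simp add: euclidean_representation scaleR_2)
    then have "dist x (- x) \<le> D" using A'(3) x by auto
    moreover have "dist x (- x) = 2 * norm x" by (simp add: dist_norm scaleR_2[symmetric])
    ultimately show "x \<in> cball 0 (D / 2)" by simp
  qed
  then have "emeasure lborel A' \<le> emeasure lborel (cball (0::'a) (D / 2))"
    by (rule emeasure_mono) simp
  then show ?thesis using A'(2) D(2) by (simp add: emeasure_cball)
qed

text \<open>Covers in the Hausdorff measure consist of arbitrary sets; passing to the closure makes
  them Borel without changing the diameter.\<close>

lemma emeasure_closure_le_diameter:
  fixes S :: "'a::euclidean_space set"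
  assumes "bounded S"
  shows "emeasure lborel (closure S) \<le> ennreal (unit_ball_vol DIM('a) * (diameter S / 2) powr DIM('a))"
proof -
  have "emeasure lborel (closure S) \<le> ennreal (unit_ball_vol DIM('a) * (diameter (closure S) / 2) ^ DIM('a))"
    using assms diameter_bounded_bound[of "closure S"] diameter_ge_0[of "closure S"]
    by (intro isodiametric) auto
  also have "(diameter (closure S) / 2) ^ DIM('a) = (diameter S / 2) powr DIM('a)"
    using diameter_ge_0[OF assms] assms by (subst diameter_closure) (auto simp: powr_realpow')
  finally show ?thesis .
qed

section \<open>Hausdorff measure on hyperplanes\<close>

text \<open>The covering theorems deliver countable, possibly finite, families indexed by a set of
  balls. They are renumbered by \<open>nat\<close> and padded with empty sets, which contribute
  0.\<close>

lemma hausdorff_pre_le_countable: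
  fixes D :: "'i \<Rightarrow> 'a::metric_space set"
  assumes I: "countable I" and E: "E \<subseteq> (\<Union>i\<in>I. D i)" and D: "\<And>i. i \<in> I \<Longrightarrow> bounded (D i)"
    "\<And>i. i \<in> I \<Longrightarrow> diameter (D i) \<le> \<delta>" and \<delta>: "0 \<le> \<delta>"
  shows "hausdorff_pre s \<delta> E \<le> (\<integral>\<^sup>+i. ennreal (unit_ball_vol s * (diameter (D i) / 2) powr s) \<partial>count_space I)"
proof -
  define J where "J = to_nat_on I ` I"
  have bij: "bij_betw (to_nat_on I) I J" using I unfolding J_def
    by (simp add: bij_betw_def inj_on_to_nat_on)
  define C where "C n = (if n \<in> J then D (from_nat_into I n) else {})" for n
  have inv: "from_nat_into I (to_nat_on I i) = i" if "i \<in> I" for i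
    using I that by simp
  have fromJ: "n \<in> J \<Longrightarrow> from_nat_into I n \<in> I" for n using inv by (auto simp: J_def)
  have "hausdorff_pre s \<delta> E \<le> (\<Sum>n. ennreal (unit_ball_vol s * (diameter (C n) / 2) powr s))"
  proof (rule hausdorff_pre_le)
    show "E \<subseteq> (\<Union>n. C n)"
    proof
      fix x assume "x \<in> E"
      then obtain i where i: "i \<in> I" "x \<in> D i" using E by auto
      then have "x \<in> C (to_nat_on I i)" by (auto simp: C_def J_def inv)
      then show "x \<in> (\<Union>n. C n)" by (rule UN_I[OF UNIV_I])
    qed
  qed (use D \<delta> fromJ in \<open>auto simp: C_def\<close>)
  also have "\<dots> = (\<integral>\<^sup>+n. ennreal (unit_ball_vol s * (diameter (C n) / 2) powr s) \<partial>count_space UNIV)"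
    by (simp add: nn_integral_count_space_nat)
  also have "\<dots> = (\<integral>\<^sup>+n. ennreal (unit_ball_vol s * (diameter (C n) / 2) powr s) \<partial>count_space J)"
    by (rule nn_integral_count_space_eq) (auto simp: C_def)
  also have "\<dots> = (\<integral>\<^sup>+i. ennreal (unit_ball_vol s * (diameter (C (to_nat_on I i)) / 2) powr s) \<partial>count_space I)"
    by (rule nn_integral_bij_count_space[OF bij, symmetric])
  also have "\<dots> = (\<integral>\<^sup>+i. ennreal (unit_ball_vol s * (diameter (D i) / 2) powr s) \<partial>count_space I)"
    by (rule nn_integral_cong) (auto simp: C_def J_def inv)
  finally show ?thesis .
qed

lemma hausdorff_pre_subadditive:
  fixes A :: "'a::metric_space set"
  assumes "0 \<le> \<delta>"
  shows "hausdorff_pre s \<delta> (A \<union> B) \<le> hausdorff_pre s \<delta> A + hausdorff_pre s \<delta> B"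
proof -
  have "hausdorff_pre s \<delta> (\<Union>i::nat. if i = 0 then A else if i = 1 then B else {}) \<le>
     (\<Sum>i::nat. hausdorff_pre s \<delta> (if i = 0 then A else if i = 1 then B else {}))"
    by (rule hausdorff_pre_countably_subadditive)
  also have "\<dots> = (\<Sum>i\<in>{0,1::nat}. hausdorff_pre s \<delta> (if i = 0 then A else if i = 1 then B else {}))"
    by (rule suminf_finite) (auto simp: hausdorff_pre_empty assms)
  also have "(\<Union>i::nat. if i = 0 then A else if i = 1 then B else {}) = A \<union> B"
    by (auto split: if_splits)
  finally show ?thesis by simp
qed

text \<open>The isodiametric inequality applied to the slices of a cover.\<close>

lemma emeasure_slice_le_hausdorff_pre:
  fixes E :: "('a::euclidean_space \<times> real) set"
  shows "emeasure lborel {x. (x, b) \<in> E} \<le> hausdorff_pre DIM('a) \<delta> E"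
  unfolding hausdorff_pre_def
proof (rule INF_greatest, safe)
  fix C :: "nat \<Rightarrow> ('a \<times> real) set"
  assume E: "E \<subseteq> (\<Union>i. C i)" and C: "\<forall>i. bounded (C i) \<and> diameter (C i) \<le> \<delta>"
  have bdd: "bounded (fst ` C i)" for i using C bounded_fst by blast
  have diam: "diameter (fst ` C i) \<le> diameter (C i)" for i
  proof (rule diameter_le)
    show "fst ` C i \<noteq> {} \<or> 0 \<le> diameter (C i)" using C diameter_ge_0 by blast
    fix x y assume "x \<in> fst ` C i" "y \<in> fst ` C i"
    then obtain p q where "p \<in> C i" "q \<in> C i" "x = fst p" "y = fst q" by auto
    then show "norm (x - y) \<le> diameter (C i)"
      using dist_fst_le[of p q] diameter_bounded_bound[of "C i" p q] C by (simp add: dist_norm)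
  qed
  have "emeasure lborel {x. (x, b) \<in> E} \<le> emeasure lborel (\<Union>i. closure (fst ` C i))"
  proof (rule emeasure_mono)
    show "{x. (x, b) \<in> E} \<subseteq> (\<Union>i. closure (fst ` C i))"
    proof safe
      fix x assume "(x, b) \<in> E"
      then obtain i where "(x, b) \<in> C i" using E by auto
      then have "x \<in> closure (fst ` C i)" using closure_subset by force
      then show "x \<in> (\<Union>i. closure (fst ` C i))" by (rule UN_I[OF UNIV_I])
    qed
  qed auto
  also have "\<dots> \<le> (\<Sum>i. emeasure lborel (closure (fst ` C i)))"
    by (rule emeasure_subadditive_countably) auto
  also have "\<dots> \<le> (\<Sum>i. ennreal (unit_ball_vol DIM('a) * (diameter (C i) / 2) powr DIM('a)))"
  proof (intro suminf_le)
    fix i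
    have "emeasure lborel (closure (fst ` C i)) \<le> ennreal (unit_ball_vol DIM('a) * (diameter (fst ` C i) / 2) powr DIM('a))"
      by (rule emeasure_closure_le_diameter[OF bdd])
    also have "\<dots> \<le> ennreal (unit_ball_vol DIM('a) * (diameter (C i) / 2) powr DIM('a))"
      using diam[of i] diameter_ge_0[OF bdd[of i]]
      by (intro ennreal_leI mult_left_mono powr_mono2) auto
    finally show "emeasure lborel (closure (fst ` C i)) \<le> ennreal (unit_ball_vol DIM('a) * (diameter (C i) / 2) powr DIM('a))" .
  qed auto
  finally show "emeasure lborel {x. (x, b) \<in> E} \<le> (\<Sum>i. ennreal (unit_ball_vol DIM('a) * (diameter (C i) / 2) powr DIM('a)))" .
qed

text \<open>The normalisation of the Hausdorff terms is chosen so that a flat ball costs no more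
  than its Lebesgue volume.\<close>

lemma hausdorff_term_ball_le:
  fixes S :: "('a::euclidean_space \<times> real) set"
  assumes S: "S \<subseteq> cball a r \<times> {b}" and r: "0 \<le> r"
  shows "bounded S" "diameter S \<le> 2 * r"
    "ennreal (unit_ball_vol DIM('a) * (diameter S / 2) powr DIM('a)) \<le> emeasure lborel (cball a r)"
proof -
  show bd: "bounded S" using S bounded_subset[OF bounded_Times[OF bounded_cball, of "{b}"]] by auto
  show d: "diameter S \<le> 2 * r"
  proof (rule diameter_le)
    fix x y assume "x \<in> S" "y \<in> S"
    then have "x \<in> cball a r \<times> {b}" "y \<in> cball a r \<times> {b}" using S by auto
    then have "dist a (fst x) \<le> r" "dist a (fst y) \<le> r" "snd x = snd y" by (auto simp: mem_Times_iff)
    then show "norm (x - y) \<le> 2 * r"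
      using dist_triangle2[of "fst x" "fst y" a]
      by (simp add: norm_prod_def dist_norm[symmetric] dist_commute)
  qed (use r in auto)
  have "(diameter S / 2) powr DIM('a) \<le> r ^ DIM('a)"
  proof -
    have "(diameter S / 2) powr DIM('a) \<le> r powr DIM('a)"
      using d diameter_ge_0[OF bd] by (intro powr_mono2) auto
    then show ?thesis using r by (simp add: powr_realpow')
  qed
  then show "ennreal (unit_ball_vol DIM('a) * (diameter S / 2) powr DIM('a)) \<le> emeasure lborel (cball a r)"
    unfolding emeasure_cball[OF r] by (intro ennreal_leI mult_left_mono) auto
qed

text \<open>Enclose the null set in an open set of volume at most \<open>e\<close>. Disjoint balls
  inside it have fivefold enlargements that still cover, at the price of a factor 5^n. This disposes
  of the remainder that Vitali's covering theorem leaves uncovered.\<close>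

lemma hausdorff_pre_null_slice:
  fixes X :: "'a::euclidean_space set"
  assumes X: "X \<in> null_sets lborel" and \<delta>: "0 < \<delta>"
  shows "hausdorff_pre DIM('a) \<delta> (X \<times> {b::real}) = 0"
proof -
  have *: "hausdorff_pre DIM('a) \<delta> (X \<times> {b}) \<le> 0 + ennreal (5 ^ DIM('a) * e)" if e: "0 < e" for e
  proof -
    obtain U where U: "open U" "X \<subseteq> U" "emeasure lborel (U - X) < ennreal e"
      using outer_regular_lborel[of X e] null_setsD2[OF X] e by (metis sets_lborel)
    have "emeasure lborel ((U - X) \<union> X) = emeasure lborel (U - X)"
      by (rule emeasure_Un_null_set) (use U X in auto)
    moreover have "(U - X) \<union> X = U" using U by auto
    ultimately have Ue: "emeasure lborel U \<le> ennreal e" using U(3) by auto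
    \<comment> \<open>With radii up to \<delta> / 10 the fivefold balls have diameter at most
      \<delta>.\<close>
    have "\<exists>r. 0 < r \<and> r \<le> \<delta> / 10 \<and> cball x r \<subseteq> U" if x: "x \<in> X" for x
    proof -
      obtain r where "0 < r" and "cball x r \<subseteq> U" using U(1)[unfolded open_contains_cball, rule_format, of x] U(2) x by auto
      define t where "t = min r (\<delta> / 10)"
      have t: "0 < t" "t \<le> \<delta> / 10" "t \<le> r" using \<open>0 < r\<close> \<delta> by (auto simp: t_def)
      have "cball x t \<subseteq> U" using subset_cball[OF t(3), of x] \<open>cball x r \<subseteq> U\<close> by (rule subset_trans)
      then show ?thesis using t by (intro exI[of _ t] conjI)
    qed
    then obtain r where r: "\<And>x. x \<in> X \<Longrightarrow> 0 < r x \<and> r x \<le> \<delta> / 10 \<and> cball x (r x) \<subseteq> U" by metis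
    obtain C where C: "countable C" "C \<subseteq> X"
      and dis: "pairwise (\<lambda>i j. disjnt (cball i (r i)) (cball j (r j))) C"
      and cov: "X \<subseteq> (\<Union>i\<in>C. cball i (5 * r i))"
    proof (rule Vitali_covering_lemma_cballs[of X "\<lambda>x. x" r X "\<delta>/10"])
      show "X \<subseteq> (\<Union>i\<in>X. cball i (r i))" using r by (force intro: less_imp_le)
      show "\<And>i. i \<in> X \<Longrightarrow> 0 < r i \<and> r i \<le> \<delta> / 10" using r by blast
    qed (use that in auto)
    have "hausdorff_pre DIM('a) \<delta> (X \<times> {b}) \<le>
      (\<integral>\<^sup>+i. ennreal (unit_ball_vol DIM('a) * (diameter (cball i (5 * r i) \<times> {b}) / 2) powr DIM('a)) \<partial>count_space C)"
    proof (rule hausdorff_pre_le_countable[OF C(1)])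
      show "X \<times> {b} \<subseteq> (\<Union>i\<in>C. cball i (5 * r i) \<times> {b})" using cov by auto
      fix i assume "i \<in> C"
      then have i: "0 < r i" "r i \<le> \<delta> / 10" using r C by auto
      show "bounded (cball i (5 * r i) \<times> {b})" using i by (intro hausdorff_term_ball_le) auto
      have "diameter (cball i (5 * r i) \<times> {b}) \<le> 2 * (5 * r i)" using i by (intro hausdorff_term_ball_le) auto
      then show "diameter (cball i (5 * r i) \<times> {b}) \<le> \<delta>" using i by linarith
    qed (use \<delta> in auto)
    also have "\<dots> \<le> (\<integral>\<^sup>+i. ennreal (5 ^ DIM('a)) * emeasure lborel (cball i (r i)) \<partial>count_space C)"
    proof (rule nn_integral_mono)
      fix i assume "i \<in> space (count_space C)"
      then have i: "0 \<le> r i" using r C by (auto intro: less_imp_le)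
      have "ennreal (unit_ball_vol DIM('a) * (diameter (cball i (5 * r i) \<times> {b}) / 2) powr DIM('a))
        \<le> emeasure lborel (cball i (5 * r i))"
        using i by (intro hausdorff_term_ball_le) auto
      also have "\<dots> = ennreal (5 ^ DIM('a)) * emeasure lborel (cball i (r i))"
        using i by (simp add: emeasure_cball power_mult_distrib ennreal_mult[symmetric] mult_ac)
      finally show "ennreal (unit_ball_vol DIM('a) * (diameter (cball i (5 * r i) \<times> {b}) / 2) powr DIM('a))
        \<le> ennreal (5 ^ DIM('a)) * emeasure lborel (cball i (r i))" .
    qed
    also have "\<dots> = ennreal (5 ^ DIM('a)) * emeasure lborel (\<Union>i\<in>C. cball i (r i))"
      using C dis by (subst emeasure_UN_countable)
        (auto simp: nn_integral_cmult disjoint_family_on_def pairwise_def disjnt_def)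
    also have "\<dots> \<le> ennreal (5 ^ DIM('a)) * ennreal e"
      using r C U(1) by (intro mult_left_mono order_trans[OF emeasure_mono Ue]) auto
    finally show ?thesis using e by (simp add: ennreal_mult)
  qed
  have "hausdorff_pre DIM('a) \<delta> (X \<times> {b}) \<le> 0 + ennreal e" if "0 < e" for e
    using *[of "e / 5 ^ DIM('a)"] that by simp
  note small = this
  have "hausdorff_pre DIM('a) \<delta> (X \<times> {b}) \<le> 0"
  proof (rule ennreal_le_epsilon)
    fix e :: real assume "0 < e"
    then show "hausdorff_pre DIM('a) \<delta> (X \<times> {b}) \<le> 0 + ennreal e" by (rule small)
  qed
  then show ?thesis by simp
qed

text \<open>By Vitali, all but a null set of \<open>X\<close> is covered by disjoint small balls of almost the same total volume.\<close>

lemma hausdorff_outer_slice_le: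
  fixes X :: "'a::euclidean_space set"
  assumes X: "X \<in> sets borel"
  shows "hausdorff_outer DIM('a) (X \<times> {b::real}) \<le> emeasure lborel X"
  unfolding hausdorff_outer_def
proof (rule SUP_least, rule ennreal_le_epsilon)
  fix \<delta> e :: real assume \<delta>: "\<delta> \<in> {0<..}" and e: "0 < e"
  obtain U where U: "open U" "X \<subseteq> U" "emeasure lborel (U - X) < ennreal e"
    using outer_regular_lborel[of X e] X e by metis
  have "emeasure lborel U \<le> emeasure lborel X + emeasure lborel (U - X)"
    using U X by (subst plus_emeasure) (auto simp: Un_absorb1)
  then have Ue: "emeasure lborel U \<le> emeasure lborel X + ennreal e"
    using U(3) by (meson add_left_mono less_imp_le order_trans)
  \<comment> \<open>Balls inside \<open>U\<close> of diameter at most \<delta>, as the pre-measure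
    at scale \<delta> demands.\<close>
  let ?K = "{(a :: 'a, r). 0 < r \<and> r \<le> \<delta> / 2 \<and> ball a r \<subseteq> U}"
  have "\<exists>i. i \<in> ?K \<and> x \<in> ball (fst i) (snd i) \<and> snd i < d" if x: "x \<in> X" and d: "0 < d" for x d
  proof -
    obtain r where "0 < r" "ball x r \<subseteq> U" using U(1)[unfolded open_contains_ball, rule_format, of x] U(2) x by auto
    define t where "t = min r (min (\<delta>/2) (d/2))"
    have t: "0 < t" "t \<le> \<delta> / 2" "t < d" "t \<le> r" using \<open>0 < r\<close> \<delta> d by (auto simp: t_def)
    have "ball x t \<subseteq> U" using subset_ball[OF t(4), of x] \<open>ball x r \<subseteq> U\<close> by (rule subset_trans)
    then have "(x, t) \<in> ?K \<and> x \<in> ball (fst (x, t)) (snd (x, t)) \<and> snd (x, t) < d" using t by simp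
    then show ?thesis by (rule exI)
  qed
  note cov = this
  obtain C where C: "countable C" "C \<subseteq> ?K"
      and dis: "pairwise (\<lambda>i j. disjnt (ball (fst i) (snd i)) (ball (fst j) (snd j))) C"
      and neg: "negligible (X - (\<Union>i\<in>C. ball (fst i) (snd i)))"
    by (rule Vitali_covering_theorem_balls[where S=X and K="?K" and a=fst and r=snd, OF cov]) (assumption, assumption, rule that)
  let ?V = "\<Union>i\<in>C. ball (fst i) (snd i)"
  have V: "?V \<in> sets borel" using C by (intro borel_open open_UN) auto
  have "hausdorff_pre DIM('a) \<delta> (X \<times> {b}) \<le> hausdorff_pre DIM('a) \<delta> (?V \<times> {b} \<union> (X - ?V) \<times> {b})"
    by (intro hausdorff_pre_mono) auto
  also have "\<dots> \<le> hausdorff_pre DIM('a) \<delta> (?V \<times> {b}) + hausdorff_pre DIM('a) \<delta> ((X - ?V) \<times> {b})"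
    using \<delta> by (intro hausdorff_pre_subadditive) auto
  also have "hausdorff_pre DIM('a) \<delta> ((X - ?V) \<times> {b}) = 0"
  proof (rule hausdorff_pre_null_slice)
    show "X - ?V \<in> null_sets lborel"
      using neg X V by (simp add: negligible_iff_null_sets null_sets_completion_iff)
  qed (use \<delta> in auto)
  also have "hausdorff_pre DIM('a) \<delta> (?V \<times> {b}) \<le>
      (\<integral>\<^sup>+i. ennreal (unit_ball_vol DIM('a) * (diameter (ball (fst i) (snd i) \<times> {b}) / 2) powr DIM('a)) \<partial>count_space C)"
  proof (rule hausdorff_pre_le_countable[OF C(1)])
    fix i assume "i \<in> C"
    then have i: "0 < snd i" "snd i \<le> \<delta> / 2" using C by auto
    have sub: "ball (fst i) (snd i) \<times> {b} \<subseteq> cball (fst i) (snd i) \<times> {b}" by auto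
    show "bounded (ball (fst i) (snd i) \<times> {b})" using i by (intro hausdorff_term_ball_le[OF sub]) auto
    have "diameter (ball (fst i) (snd i) \<times> {b}) \<le> 2 * snd i" using i by (intro hausdorff_term_ball_le[OF sub]) auto
    then show "diameter (ball (fst i) (snd i) \<times> {b}) \<le> \<delta>" using i by linarith
  qed (use \<delta> in auto)
  also have "\<dots> \<le> (\<integral>\<^sup>+i. emeasure lborel (ball (fst i) (snd i)) \<partial>count_space C)"
  proof (rule nn_integral_mono)
    fix i assume "i \<in> space (count_space C)"
    then have i: "0 \<le> snd i" using C by auto
    have sub: "ball (fst i) (snd i) \<times> {b} \<subseteq> cball (fst i) (snd i) \<times> {b}" by auto
    show "ennreal (unit_ball_vol DIM('a) * (diameter (ball (fst i) (snd i) \<times> {b}) / 2) powr DIM('a))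
        \<le> emeasure lborel (ball (fst i) (snd i))"
      using hausdorff_term_ball_le(3)[OF sub i] i by (simp add: emeasure_ball emeasure_cball)
  qed
  also have "\<dots> = emeasure lborel ?V"
    using C dis by (subst emeasure_UN_countable)
      (auto simp: disjoint_family_on_def pairwise_def disjnt_def)
  also have "\<dots> \<le> emeasure lborel U"
  proof (rule emeasure_mono)
    show "?V \<subseteq> U"
    proof (rule UN_least)
      fix i assume "i \<in> C"
      then show "ball (fst i) (snd i) \<subseteq> U" using subsetD[OF C(2), of i] by (simp add: case_prod_beta)
    qed
    show "U \<in> sets lborel" using U(1) by simp
  qed
  also have "\<dots> \<le> emeasure lborel X + ennreal e" by (rule Ue)
  finally show "hausdorff_pre DIM('a) \<delta> (X \<times> {b}) \<le> emeasure lborel X + ennreal e" by simp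
qed

section \<open>Surface measure on a horizontal hyperplane is Lebesgue measure\<close>

lemma slice_measurable [measurable]:
  fixes E :: "('a::euclidean_space \<times> real) set"
  assumes [measurable]: "E \<in> sets borel" shows "{x. (x, b) \<in> E} \<in> sets borel"
proof -
  have "(\<lambda>x::'a. (x, b)) -` E \<inter> space borel \<in> sets borel"
    by (rule measurable_sets[OF _ assms]) (intro borel_measurable_continuous_onI continuous_intros)
  then show ?thesis by (simp add: vimage_def)
qed

abbreviation surf :: "('a::euclidean_space \<times> real) measure" where
  "surf \<equiv> hausdorff_measure (real DIM('a))"

lemma surface_measure_eq: "surface_measure = (surf :: ('a::euclidean_space \<times> real) measure)"
  by simp

text \<open>Closes the chain: Lebesgue measure \<le> pre-measure at scale 1 (isodiametric
  inequality) \<le> outer measure \<le> Lebesgue measure (Vitali).\<close>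

lemma emeasure_surf_slice:
  fixes E :: "('a::euclidean_space \<times> real) set"
  assumes E: "E \<in> sets borel"
  shows "emeasure surf (E \<inter> UNIV \<times> {b}) = emeasure lborel {x. (x, b) \<in> E}"
proof -
  define X where "X = {x. (x, b) \<in> E}"
  have X: "X \<in> sets borel" unfolding X_def using E by (rule slice_measurable)
  have eq: "E \<inter> UNIV \<times> {b} = X \<times> {b}" by (auto simp: X_def)
  have "(UNIV :: 'a set) \<times> {b} \<in> sets borel" by (intro borel_closed closed_Times) auto
  then have "X \<times> {b} \<in> sets borel" using E eq by (metis sets.Int)
  then have "emeasure surf (X \<times> {b}) = hausdorff_outer DIM('a) (X \<times> {b})"
    by (rule emeasure_hausdorff_measure)
  moreover have "hausdorff_outer DIM('a) (X \<times> {b}) \<le> emeasure lborel X"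
    by (rule hausdorff_outer_slice_le[OF X])
  moreover have "emeasure lborel X \<le> hausdorff_pre DIM('a) 1 (X \<times> {b})"
    using emeasure_slice_le_hausdorff_pre[of b "X \<times> {b}" 1] by simp
  moreover have "hausdorff_pre DIM('a) 1 (X \<times> {b}) \<le> hausdorff_outer DIM('a) (X \<times> {b})"
    by (rule hausdorff_pre_le_outer) simp
  ultimately show ?thesis unfolding eq X_def[symmetric] by (metis antisym order_trans)
qed

lemma hyperplane_borel [measurable]: "(UNIV :: 'a::euclidean_space set) \<times> {b::real} \<in> sets borel"
  by (intro borel_closed closed_Times) auto

lemma measurable_Pair_const [measurable]: "(\<lambda>x::'a::euclidean_space. (x, b::real)) \<in> borel_measurable borel"
  by (intro borel_measurable_continuous_onI continuous_intros)

text \<open>Restriction is expressed by a density and the embedding by \<open>distr\<close>, so that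
  integrability and integrals transfer by the general rules for these two.\<close>

lemma density_surf_hyperplane:
  "density surf (indicator (UNIV \<times> {b})) = distr lborel borel (\<lambda>x::'a::euclidean_space. (x, b))"
proof (rule measure_eqI)
  fix E assume "E \<in> sets (density surf (indicator ((UNIV :: 'a set) \<times> {b})))"
  then have E: "E \<in> sets borel" by simp
  have "emeasure (density surf (indicator ((UNIV :: 'a set) \<times> {b}))) E = emeasure surf (E \<inter> UNIV \<times> {b})"
    using E by (subst emeasure_density) (auto simp: indicator_inter_arith[symmetric] Int_commute mult.commute
      intro!: nn_integral_cong simp flip: nn_integral_indicator)
  also have "\<dots> = emeasure (distr lborel borel (\<lambda>x. (x, b))) E"
    using E by (subst emeasure_distr) (auto simp: emeasure_surf_slice vimage_def)
  finally show "emeasure (density surf (indicator (UNIV \<times> {b}))) E = emeasure (distr lborel borel (\<lambda>x::'a. (x, b))) E" .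
qed simp

text \<open>Null sets pass to slices in one direction; in the other, the slice N becomes the
  cylinder over N cut by the hyperplane.\<close>

lemma AE_surf_hyperplane:
  "(AE x in surf. x \<in> UNIV \<times> {b} \<longrightarrow> P x) \<longleftrightarrow> (AE x in lborel. P (x :: 'a::euclidean_space, b :: real))"
proof
  assume "AE x in surf. x \<in> (UNIV :: 'a set) \<times> {b} \<longrightarrow> P x"
  then obtain N where N: "{x. \<not> (x \<in> (UNIV :: 'a set) \<times> {b} \<longrightarrow> P x)} \<subseteq> N" "N \<in> sets borel" "emeasure surf N = 0"
    unfolding eventually_ae_filter by (auto simp: null_sets_def)
  have "emeasure lborel {x. (x, b) \<in> N} \<le> emeasure surf N"
    unfolding emeasure_surf_slice[OF N(2), symmetric] using N by (intro emeasure_mono) auto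
  then have "{x. (x, b) \<in> N} \<in> null_sets lborel" using N(2,3) by (auto intro!: null_setsI)
  then show "AE x in lborel. P (x, b)"
    by (rule AE_I') (use N(1) in auto)
next
  assume "AE x in lborel. P (x, b)"
  then obtain N where N: "{x. \<not> P (x, b)} \<subseteq> N" "N \<in> sets borel" "emeasure lborel N = 0"
    unfolding eventually_ae_filter by (auto simp: null_sets_def)
  have *: "N \<times> UNIV \<in> sets (borel :: ('a \<times> real) measure)"
    using pair_measureI[of N borel UNIV "borel :: real measure"] N(2) unfolding borel_prod by simp
  have "N \<times> UNIV \<inter> UNIV \<times> {b} \<in> null_sets surf"
    using emeasure_surf_slice[OF *, of b] N * by (intro null_setsI) auto
  then show "AE x in surf. x \<in> UNIV \<times> {b} \<longrightarrow> P x"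
    by (rule AE_I') (use N(1) in auto)
qed

lemma set_integral_surf_hyperplane:
  fixes f :: "'a::euclidean_space \<times> real \<Rightarrow> real"
  assumes f: "set_borel_measurable surf (UNIV \<times> {b}) f"
  shows "set_integrable surf (UNIV \<times> {b}) f \<longleftrightarrow> integrable lborel (\<lambda>x. f (x, b))" (is ?A)
    "(LINT x:UNIV \<times> {b}|surf. f x) = (LINT x|lborel. f (x, b))" (is ?B)
proof -
  let ?H = "UNIV \<times> {b} :: ('a \<times> real) set"
  \<comment> \<open>\<open>f\<close> is measurable only on the hyperplane; cut off there it becomes
    Borel on the whole space.\<close>
  let ?g = "\<lambda>x. indicator ?H x * f x"
  have g [measurable]: "?g \<in> borel_measurable borel"
    using f by (simp add: set_borel_measurable_def cong: measurable_cong_sets)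
  have D: "density surf (\<lambda>x. ennreal (indicator ?H x)) = distr lborel borel (\<lambda>x::'a. (x, b))"
    by (simp add: ennreal_indicator density_surf_hyperplane)
  have gg: "indicator ?H x *\<^sub>R f x = indicator ?H x *\<^sub>R ?g x" for x by (simp add: indicator_def)
  have "set_integrable surf ?H f \<longleftrightarrow> integrable surf (\<lambda>x. indicator ?H x *\<^sub>R ?g x)"
    unfolding set_integrable_def by (simp only: gg)
  also have "\<dots> \<longleftrightarrow> integrable (density surf (\<lambda>x. ennreal (indicator ?H x))) ?g"
    by (subst integrable_density) auto
  also have "\<dots> \<longleftrightarrow> integrable lborel (\<lambda>x. ?g (x, b))"
    unfolding D by (subst integrable_distr_eq) auto
  finally show ?A by simp
  have "(LINT x:?H|surf. f x) = (LINT x|surf. indicator ?H x *\<^sub>R ?g x)"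
    unfolding set_lebesgue_integral_def by (simp only: gg)
  also have "\<dots> = (LINT x|density surf (\<lambda>x. ennreal (indicator ?H x)). ?g x)"
    by (subst integral_density) auto
  also have "\<dots> = (LINT x|lborel. ?g (x, b))"
    unfolding D by (subst integral_distr) auto
  finally show ?B by simp
qed

lemma nn_integral_surf_hyperplane:
  fixes f :: "'a::euclidean_space \<times> real \<Rightarrow> ennreal"
  assumes [measurable]: "f \<in> borel_measurable borel"
  shows "(\<integral>\<^sup>+x\<in>UNIV \<times> {b}. f x \<partial>surf) = (\<integral>\<^sup>+x. f (x, b) \<partial>lborel)"
proof -
  have "(\<integral>\<^sup>+x\<in>UNIV \<times> {b}. f x \<partial>surf) = (\<integral>\<^sup>+x. f x \<partial>density surf (indicator (UNIV \<times> {b})))"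
  proof (subst nn_integral_density)
    have [measurable]: "UNIV \<times> {b} \<in> sets (surf :: ('a \<times> real) measure)"
      unfolding sets_hausdorff_measure by (rule hyperplane_borel)
    show "indicator (UNIV \<times> {b}) \<in> borel_measurable (surf :: ('a \<times> real) measure)" by (rule borel_measurable_indicator) fact
    show "f \<in> borel_measurable surf"
      using assms by (simp cong: measurable_cong_sets)
    show "(\<integral>\<^sup>+x\<in>UNIV \<times> {b}. f x \<partial>surf) = (\<integral>\<^sup>+x. indicator (UNIV \<times> {b}) x * f x \<partial>surf)"
      by (simp only: mult.commute)
  qed
  also have "\<dots> = (\<integral>\<^sup>+x. f (x, b) \<partial>lborel)"
    unfolding density_surf_hyperplane by (rule nn_integral_distr) (simp_all add: measurable_Pair_const assms)
  finally show ?thesis .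
qed

section \<open>Smooth bump functions\<close>

text \<open>The derivative is existentially quantified: a closure property then amounts to
  exhibiting a derivative of the right class.\<close>

fun Ck1 :: "nat \<Rightarrow> (real \<Rightarrow> real) \<Rightarrow> bool" where
  "Ck1 0 f \<longleftrightarrow> continuous_on UNIV f"
| "Ck1 (Suc k) f \<longleftrightarrow> (\<exists>f'. (\<forall>x. (f has_real_derivative f' x) (at x)) \<and> Ck1 k f')"

definition smooth1 :: "(real \<Rightarrow> real) \<Rightarrow> bool" where
  "smooth1 f \<longleftrightarrow> (\<forall>k. Ck1 k f)"

lemma has_real_derivative_imp_continuous_on_UNIV:
  assumes "\<And>x. (f has_real_derivative f' x) (at x)"
  shows "continuous_on UNIV f"
proof (rule continuous_at_imp_continuous_on, rule ballI)
  fix x show "isCont f x" by (rule DERIV_isCont) (rule assms)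
qed

lemma Ck1_SucE:
  assumes "Ck1 (Suc k) f"
  obtains f' where "\<forall>x. (f has_real_derivative f' x) (at x)" "Ck1 k f'"
  using assms by auto

lemma Ck1_SucI: "(\<And>x. (f has_real_derivative f' x) (at x)) \<Longrightarrow> Ck1 k f' \<Longrightarrow> Ck1 (Suc k) f"
  by auto

lemma Ck1_Suc_imp: "Ck1 (Suc k) f \<Longrightarrow> Ck1 k f"
proof (induction k arbitrary: f)
  case 0
  obtain f' where "\<forall>x. (f has_real_derivative f' x) (at x)" "Ck1 0 f'"
    by (rule Ck1_SucE[OF 0])
  then show ?case unfolding Ck1.simps by (intro has_real_derivative_imp_continuous_on_UNIV[of f f']) simp
next
  case (Suc k)
  obtain f' where f': "\<forall>x. (f has_real_derivative f' x) (at x)" "Ck1 (Suc k) f'"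
    by (rule Ck1_SucE[OF Suc.prems])
  show ?case by (rule Ck1_SucI[OF f'(1)[rule_format] Suc.IH[OF f'(2)]])
qed

lemma Ck1_const: "Ck1 k (\<lambda>_. c)"
proof (induction k arbitrary: c)
  case (Suc k)
  show ?case using Suc[of 0] by (auto intro!: exI[of _ "\<lambda>_. 0"])
qed auto

lemma Ck1_add: "Ck1 k f \<Longrightarrow> Ck1 k g \<Longrightarrow> Ck1 k (\<lambda>x. f x + g x)"
proof (induction k arbitrary: f g)
  case 0
  then show ?case by (auto intro: continuous_on_add)
next
  case (Suc k)
  then obtain f' g' where "\<forall>x. (f has_real_derivative f' x) (at x)" "Ck1 k f'"
    "\<forall>x. (g has_real_derivative g' x) (at x)" "Ck1 k g'" by auto
  then show ?case using Suc.IH[of f' g'] by (auto intro!: exI[of _ "\<lambda>x. f' x + g' x"] DERIV_add)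
qed

lemma Ck1_mult: "Ck1 k f \<Longrightarrow> Ck1 k g \<Longrightarrow> Ck1 k (\<lambda>x. f x * g x)"
proof (induction k arbitrary: f g)
  case 0
  then show ?case by (auto intro: continuous_on_mult)
next
  case (Suc k)
  then obtain f' g' where D: "\<forall>x. (f has_real_derivative f' x) (at x)" "Ck1 k f'"
    "\<forall>x. (g has_real_derivative g' x) (at x)" "Ck1 k g'" by auto
  have "Ck1 k (\<lambda>x. f' x * g x + g' x * f x)"
    using D Ck1_Suc_imp[OF Suc.prems(1)] Ck1_Suc_imp[OF Suc.prems(2)] by (intro Ck1_add Suc.IH)
  moreover have "((\<lambda>x. f x * g x) has_real_derivative f' x * g x + g' x * f x) (at x)" for x
    using D by (intro DERIV_mult) auto
  ultimately show ?case unfolding Ck1.simps by (intro exI[of _ "\<lambda>x. f' x * g x + g' x * f x"] conjI allI)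
qed

lemma Ck1_affine: "Ck1 k f \<Longrightarrow> Ck1 k (\<lambda>x. f (a * x + b))"
proof (induction k arbitrary: f)
  case 0
  then show ?case by (auto intro!: continuous_on_compose2[of UNIV f] continuous_intros)
next
  case (Suc k)
  then obtain f' where D: "\<forall>x. (f has_real_derivative f' x) (at x)" "Ck1 k f'" by auto
  have "((\<lambda>x. f (a * x + b)) has_real_derivative f' (a * x + b) * a) (at x)" for x
  proof (rule DERIV_chain2[of f _ "\<lambda>x. a * x + b"])
    show "(f has_real_derivative f' (a * x + b)) (at (a * x + b))" using D(1) by blast
    show "((\<lambda>x. a * x + b) has_real_derivative a) (at x)" by (auto intro!: derivative_eq_intros)
  qed
  moreover have "Ck1 k (\<lambda>x. f' (a * x + b) * a)"
    by (intro Ck1_mult Ck1_const Suc.IH D(2))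
  ultimately show ?case unfolding Ck1.simps by (intro exI[of _ "\<lambda>x. f' (a * x + b) * a"] conjI allI)
qed

lemma smooth1_const: "smooth1 (\<lambda>_. c)" by (simp add: smooth1_def Ck1_const)
lemma smooth1_add: "smooth1 f \<Longrightarrow> smooth1 g \<Longrightarrow> smooth1 (\<lambda>x. f x + g x)" by (simp add: smooth1_def Ck1_add)
lemma smooth1_mult: "smooth1 f \<Longrightarrow> smooth1 g \<Longrightarrow> smooth1 (\<lambda>x. f x * g x)" by (simp add: smooth1_def Ck1_mult)
lemma smooth1_affine: "smooth1 f \<Longrightarrow> smooth1 (\<lambda>x. f (a * x + b))" by (simp add: smooth1_def Ck1_affine)

lemma smooth1_diff: "smooth1 f \<Longrightarrow> smooth1 g \<Longrightarrow> smooth1 (\<lambda>x. f x - g x)"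
  using smooth1_add[of f "\<lambda>x. -1 * g x"] smooth1_mult[OF smooth1_const[of "-1"], of g] by simp

lemma smooth1_continuous: "smooth1 f \<Longrightarrow> continuous_on UNIV f"
  unfolding smooth1_def by (drule spec[of _ 0]) simp

lemma smooth1_has_antiderivative:
  assumes "smooth1 f"
  shows "\<exists>F. smooth1 F \<and> (\<forall>x. (F has_real_derivative f x) (at x))"
proof -
  have "\<exists>F. \<forall>x::real. -\<infinity> < ereal x \<longrightarrow> ereal x < \<infinity> \<longrightarrow> (F has_vector_derivative f x) (at x)"
    using smooth1_continuous[OF assms]
    by (intro einterval_antiderivative) (auto simp: continuous_on_eq_continuous_at)
  then obtain F where F: "\<forall>x. (F has_real_derivative f x) (at x)"
    by (auto simp: has_real_derivative_iff_has_vector_derivative)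
  have "Ck1 k F" for k
  proof (cases k)
    case 0
    show ?thesis unfolding 0 Ck1.simps by (rule has_real_derivative_imp_continuous_on_UNIV) (rule F[rule_format])
  next
    case (Suc j)
    have "Ck1 j f" using assms by (simp add: smooth1_def)
    then show ?thesis unfolding Suc by (rule Ck1_SucI[OF F[rule_format]])
  qed
  then show ?thesis using F by (auto simp: smooth1_def)
qed

lemma poly_exp_tendsto_0: "((\<lambda>y::real. poly p y * exp (- y)) \<longlongrightarrow> 0) at_top"
proof -
  have "((\<lambda>y::real. \<Sum>i\<le>degree p. coeff p i * (y ^ i / exp y)) \<longlongrightarrow> (\<Sum>i\<le>degree p. coeff p i * 0)) at_top"
    by (intro tendsto_sum tendsto_mult tendsto_const tendsto_power_div_exp_0)
  then show ?thesis by (simp add: poly_altdef exp_minus sum_distrib_right divide_inverse mult.assoc)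
qed

text \<open>As a family over all polynomials these functions are closed under differentiation, which
  makes smoothness, including flatness at 0, an induction on the order.\<close>

definition flat_exp :: "real poly \<Rightarrow> real \<Rightarrow> real" where
  "flat_exp p x = (if x > 0 then poly p (1 / x) * exp (- (1 / x)) else 0)"

text \<open>With y = 1/x the chain rule gives y^2 (p(y) - p'(y)) exp(-y), and
  \<open>[:0, 0, 1:]\<close> is y^2. At 0 the exponential decay beats the polynomial.\<close>

lemma flat_exp_deriv:
  "(flat_exp p has_real_derivative flat_exp ([:0, 0, 1:] * (p - pderiv p)) x) (at x)"
proof -
  consider "x > 0" | "x < 0" | "x = 0" by linarith
  then show ?thesis
  proof cases
    case 1
    have "((\<lambda>x. poly p (1 / x) * exp (- (1 / x))) has_real_derivative
      flat_exp ([:0, 0, 1:] * (p - pderiv p)) x) (at x)"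
      using 1 by (auto intro!: derivative_eq_intros DERIV_chain2[OF poly_DERIV]
        simp: flat_exp_def power2_eq_square field_simps)
    then show ?thesis
      by (rule has_field_derivative_transform_within_open[of _ _ _ "{0<..}"]) (use 1 in \<open>auto simp: flat_exp_def\<close>)
  next
    case 2
    have "((\<lambda>x. 0) has_real_derivative flat_exp ([:0, 0, 1:] * (p - pderiv p)) x) (at x)"
      using 2 by (simp add: flat_exp_def)
    then show ?thesis
      by (rule has_field_derivative_transform_within_open[of _ _ _ "{..<0}"]) (use 2 in \<open>auto simp: flat_exp_def\<close>)
  next
    case 3
    have "((\<lambda>h. flat_exp p h / h) \<longlongrightarrow> 0) (at 0)"
    proof (rule filterlim_split_at)
      have "\<forall>\<^sub>F h in at_left 0. 0 = flat_exp p h / h"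
        by (auto simp: flat_exp_def eventually_at_filter)
      then show "((\<lambda>h. flat_exp p h / h) \<longlongrightarrow> 0) (at_left 0)"
        by (rule Lim_transform_eventually[OF tendsto_const])
      \<comment> \<open>The factor 1/h of the difference quotient raises the degree of the
        polynomial by one.\<close>
      have "((\<lambda>h. poly (pCons 0 p) (inverse h) * exp (- inverse h)) \<longlongrightarrow> 0) (at_right 0)"
        by (rule filterlim_compose[OF poly_exp_tendsto_0 filterlim_inverse_at_top_right])
      moreover have "\<forall>\<^sub>F h in at_right 0. poly (pCons 0 p) (inverse h) * exp (- inverse h) = flat_exp p h / h"
        by (auto simp: flat_exp_def eventually_at_filter divide_inverse)
      ultimately show "((\<lambda>h. flat_exp p h / h) \<longlongrightarrow> 0) (at_right 0)"
        by (rule Lim_transform_eventually)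
    qed
    then show ?thesis using 3 by (simp add: has_field_derivative_iff flat_exp_def)
  qed
qed

lemma smooth1_flat_exp: "smooth1 (flat_exp p)"
proof -
  have "Ck1 k (flat_exp p)" for k
  proof (induction k arbitrary: p)
    case 0
    show ?case unfolding Ck1.simps
      by (rule has_real_derivative_imp_continuous_on_UNIV) (rule flat_exp_deriv)
  next
    case (Suc k)
    show ?case by (rule Ck1_SucI[OF flat_exp_deriv Suc.IH])
  qed
  then show ?thesis by (simp add: smooth1_def)
qed

text \<open>The normalised antiderivative of a smooth nonnegative function that is positive exactly
  on (0, 1), namely of a flat exponential times its mirror image.\<close>

lemma smooth_step_exists:
  "\<exists>S. smooth1 S \<and> (\<forall>x\<le>0. S x = 0) \<and> (\<forall>x\<ge>1. S x = 1) \<and> (\<forall>x. 0 \<le> S x \<and> S x \<le> 1)"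
proof -
  define \<rho> where "\<rho> x = flat_exp 1 x * flat_exp 1 (-1 * x + 1)" for x
  have "smooth1 \<rho>" unfolding \<rho>_def[abs_def]
    by (intro smooth1_mult smooth1_flat_exp smooth1_affine)
  from smooth1_has_antiderivative[OF this] obtain R where R: "smooth1 R" "\<And>x. (R has_real_derivative \<rho> x) (at x)"
    by auto
  have mono: "R x \<le> R y" if "x \<le> y" for x y
  proof (rule DERIV_nonneg_imp_nondecreasing[OF that, of R])
    fix z show "\<exists>y. (R has_real_derivative y) (at z) \<and> 0 \<le> y"
      by (intro exI[of _ "\<rho> z"] conjI R(2)) (simp add: \<rho>_def flat_exp_def)
  qed
  have lt: "R 0 < R 1"
  proof (rule DERIV_pos_imp_increasing_open[of 0 1 R])
    fix x :: real assume x: "0 < x" "x < 1"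
    have e: "0 < -1 * x + 1" using x by simp
    have "\<rho> x = exp (- (1 / x)) * exp (- (1 / (-1 * x + 1)))"
      unfolding \<rho>_def flat_exp_def if_P[OF x(1)] if_P[OF e] poly_1 mult_1_left ..
    then have "0 < \<rho> x" by (simp only: mult_pos_pos exp_gt_zero)
    with R(2) show "\<exists>y. (R has_real_derivative y) (at x) \<and> 0 < y"
      by (rule exI[of _ "\<rho> x", OF conjI])
  next
    show "continuous_on {0..1} R" by (rule continuous_on_subset[OF smooth1_continuous[OF R(1)]]) (rule subset_UNIV)
    show "(0::real) < 1" by (rule zero_less_one)
  qed
  have anti: "R y \<le> R x" if "x \<le> y" and 0: "\<And>z. x \<le> z \<Longrightarrow> z \<le> y \<Longrightarrow> \<rho> z = 0" for x y
  proof -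
    have "- R x \<le> - R y"
    proof (rule DERIV_nonneg_imp_nondecreasing[OF that(1), of "\<lambda>x. - R x"])
      fix z assume "x \<le> z" "z \<le> y"
      then show "\<exists>y. ((\<lambda>x. - R x) has_real_derivative y) (at z) \<and> 0 \<le> y"
        using DERIV_minus[OF R(2)[of z]] 0 by (intro exI[of _ "- \<rho> z"]) simp
    qed
    then show ?thesis by simp
  qed
  have R0: "R x = R 0" if "x \<le> 0" for x
    using anti[OF that] mono[OF that] by (simp add: \<rho>_def flat_exp_def)
  have R1: "R x = R 1" if "1 \<le> x" for x
    using anti[OF that] mono[OF that] by (simp add: \<rho>_def flat_exp_def)
  define S where "S x = (R x - R 0) * (1 / (R 1 - R 0))" for x
  have "smooth1 S" unfolding S_def[abs_def]
    by (intro smooth1_mult smooth1_diff smooth1_const R(1))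
  moreover have "R 0 \<le> R x" for x
    using R0[of x] mono[of 0 x] by (cases "x \<le> 0") auto
  then have "0 \<le> S x" for x unfolding S_def using lt by (intro mult_nonneg_nonneg) simp_all
  moreover have "R x \<le> R 1" for x
    using R1[of x] mono[of x 1] by (cases "x \<le> 1") auto
  then have "S x \<le> 1" for x unfolding S_def using lt by (simp add: pos_divide_le_eq)
  moreover have "S x = 0" if "x \<le> 0" for x using R0[OF that] by (simp add: S_def)
  moreover have "S x = 1" if "1 \<le> x" for x using R1[OF that] lt by (simp add: S_def)
  ultimately show ?thesis by (intro exI[of _ S] conjI allI impI)
qed

definition smooth_step :: "real \<Rightarrow> real" where
  "smooth_step = (SOME S. smooth1 S \<and> (\<forall>x\<le>0. S x = 0) \<and> (\<forall>x\<ge>1. S x = 1) \<and> (\<forall>x. 0 \<le> S x \<and> S x \<le> 1))"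

lemma smooth_step:
  "smooth1 smooth_step" "x \<le> 0 \<Longrightarrow> smooth_step x = 0" "1 \<le> x \<Longrightarrow> smooth_step x = 1"
  "0 \<le> smooth_step x" "smooth_step x \<le> 1"
  using someI_ex[OF smooth_step_exists] unfolding smooth_step_def[symmetric] by auto

text \<open>A rising edge on [l, l + 1/k] and a falling one on [r - 1/k, r]. The summand 1 / (r - l)
  ensures k (r - l) \<ge> 1 even for m = 0, so that the function vanishes outside (l, r); as m grows
  the edges steepen and the indicator of (l, r) is approached.\<close>

definition bump1 :: "real \<Rightarrow> real \<Rightarrow> nat \<Rightarrow> real \<Rightarrow> real" where
  "bump1 l r m x = (let k = m + 1 / (r - l) in smooth_step (k * (x - l)) - smooth_step (k * (x - r) + 1))"

lemma smooth1_bump1: "smooth1 (bump1 l r m)"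
proof -
  define k where "k = m + 1 / (r - l)"
  have "smooth1 (\<lambda>x. smooth_step (k * x + (- k * l)) - smooth_step (k * x + (1 - k * r)))"
    by (intro smooth1_diff smooth1_affine smooth_step)
  also have "(\<lambda>x. smooth_step (k * x + (- k * l)) - smooth_step (k * x + (1 - k * r))) = bump1 l r m"
    unfolding bump1_def Let_def k_def[symmetric] by (simp add: algebra_simps)
  finally show ?thesis .
qed

lemma bump1_abs_le: "\<bar>bump1 l r m x\<bar> \<le> 1"
  unfolding bump1_def Let_def using smooth_step(4,5) by (smt (verit))

lemma bump1_outside:
  assumes "l < r" "x \<notin> {l<..<r}"
  shows "bump1 l r m x = 0"
proof -
  define k where "k = m + 1 / (r - l)"
  have bump: "bump1 l r m x = smooth_step (k * (x - l)) - smooth_step (k * (x - r) + 1)"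
    by (simp add: bump1_def k_def Let_def)
  have k0: "0 < k" unfolding k_def using assms by (intro add_nonneg_pos) auto
  have "(1 / (r - l)) * (r - l) \<le> k * (r - l)"
    unfolding k_def using assms by (intro mult_right_mono) auto
  then have "1 \<le> k * (r - l)" using assms by simp
  then have k: "k * (x - r) + 1 \<le> k * (x - l)" by (simp add: algebra_simps)
  consider "x \<le> l" | "r \<le> x" using assms by fastforce
  then show ?thesis
  proof cases
    case 1
    have "k * (x - l) \<le> 0" using 1 k0 by (simp add: mult_nonneg_nonpos)
    then show ?thesis using k by (simp add: bump smooth_step)
  next
    case 2
    have "1 \<le> k * (x - r) + 1" using 2 k0 by simp
    then show ?thesis using k by (simp add: bump smooth_step)
  qed
qed

lemma bump1_tendsto:
  assumes "l < r"
  shows "(\<lambda>m. bump1 l r m x) \<longlonglongrightarrow> indicator {l<..<r} x"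
proof (cases "x \<in> {l<..<r}")
  case False
  then show ?thesis using bump1_outside[OF assms] by simp
next
  case True
  have "\<forall>\<^sub>F m in sequentially. bump1 l r m x = 1"
  proof -
    obtain M :: nat where M: "max (1 / (x - l)) (1 / (r - x)) \<le> M" by (metis real_arch_simple)
    have "bump1 l r m x = 1" if "M \<le> m" for m
    proof -
      define k where "k = m + 1 / (r - l)"
      have bump: "bump1 l r m x = smooth_step (k * (x - l)) - smooth_step (k * (x - r) + 1)"
        by (simp add: bump1_def k_def Let_def)
      have "real M \<le> k" using that assms by (simp add: k_def add_increasing2)
      then have k: "1 / (x - l) \<le> k" "1 / (r - x) \<le> k" using M by auto
      have "1 \<le> k * (x - l)" using k(1) True by (simp add: pos_divide_le_eq)
      moreover have "k * (x - r) + 1 \<le> 0" using k(2) True by (simp add: pos_divide_le_eq algebra_simps)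
      ultimately show ?thesis by (simp add: bump smooth_step)
    qed
    then show ?thesis by (auto simp: eventually_sequentially)
  qed
  then show ?thesis using True by (auto intro: tendsto_eventually)
qed

section \<open>Functions of class \<open>C_k\<close> in several variables and product bumps\<close>

lemma C_k_Suc_imp: "C_k (Suc k) f \<Longrightarrow> C_k k f"
proof (induction k arbitrary: f)
  case 0
  then show ?case
    by (auto intro!: continuous_at_imp_continuous_on differentiable_imp_continuous_within)
qed auto

lemma partial_deriv_eqI: "(f has_derivative f') (at x) \<Longrightarrow> partial_deriv b f x = f' b"
  unfolding partial_deriv_def using frechet_derivative_at by metis

lemma C_k_SucI:
  assumes "\<And>x. (f has_derivative D x) (at x)" "\<And>b. b \<in> Basis \<Longrightarrow> C_k k (\<lambda>x. D x b)"
  shows "C_k (Suc k) f"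
proof -
  have "partial_deriv b f = (\<lambda>x. D x b)" for b
    by (rule ext) (rule partial_deriv_eqI[OF assms(1)])
  moreover have "f differentiable at x" for x using assms(1) by (rule differentiableI)
  ultimately show ?thesis using assms(2) by simp
qed

lemma C_k_const: "C_k k (\<lambda>_. c)"
proof (induction k arbitrary: c)
  case (Suc k)
  show ?case by (rule C_k_SucI[OF has_derivative_const]) (rule Suc)
qed auto

lemma C_k_Suc_has_derivative:
  assumes "C_k (Suc k) f"
  shows "(f has_derivative frechet_derivative f (at x)) (at x)" "b \<in> Basis \<Longrightarrow> C_k k (\<lambda>x. frechet_derivative f (at x) b)"
  using assms by (auto simp: frechet_derivative_works[symmetric] partial_deriv_def[abs_def])

lemma C_k_add: "C_k k f \<Longrightarrow> C_k k g \<Longrightarrow> C_k k (\<lambda>x. f x + g x)"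
proof (induction k arbitrary: f g)
  case 0
  then show ?case by (auto intro: continuous_on_add)
next
  case (Suc k)
  note f = C_k_Suc_has_derivative[OF Suc.prems(1)] and g = C_k_Suc_has_derivative[OF Suc.prems(2)]
  show ?case
    by (rule C_k_SucI[OF has_derivative_add[OF f(1) g(1)]]) (intro Suc.IH f(2) g(2))
qed

lemma C_k_mult: "C_k k f \<Longrightarrow> C_k k g \<Longrightarrow> C_k k (\<lambda>x. f x * g x)"
proof (induction k arbitrary: f g)
  case 0
  then show ?case by (auto intro: continuous_on_mult)
next
  case (Suc k)
  note f = C_k_Suc_has_derivative[OF Suc.prems(1)] and g = C_k_Suc_has_derivative[OF Suc.prems(2)]
  show ?case
    by (rule C_k_SucI[OF has_derivative_mult[OF f(1) g(1)]])
      (intro C_k_add Suc.IH f(2) g(2) C_k_Suc_imp[OF Suc.prems(1)] C_k_Suc_imp[OF Suc.prems(2)])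
qed

lemma C_k_compose_inner: "Ck1 k g \<Longrightarrow> C_k k (\<lambda>x. g (x \<bullet> i))"
proof (induction k arbitrary: g)
  case 0
  then show ?case by (auto intro!: continuous_on_compose2[of UNIV g] continuous_intros)
next
  case (Suc k)
  obtain g' where g': "\<forall>x. (g has_real_derivative g' x) (at x)" "Ck1 k g'"
    by (rule Ck1_SucE[OF Suc.prems])
  have D: "((\<lambda>x. g (x \<bullet> i)) has_derivative (\<lambda>h. g' (x \<bullet> i) * (h \<bullet> i))) (at x)" for x
  proof -
    have "(g has_derivative (\<lambda>h. g' (x \<bullet> i) * h)) (at (x \<bullet> i))"
      using g'(1) by (simp add: has_field_derivative_def)
    moreover have "((\<lambda>x. x \<bullet> i) has_derivative (\<lambda>h. h \<bullet> i)) (at x)" by (auto intro!: derivative_eq_intros)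
    ultimately show ?thesis
      using has_derivative_compose[of "\<lambda>x. x \<bullet> i" "\<lambda>h. h \<bullet> i" x UNIV g "\<lambda>h. g' (x \<bullet> i) * h"] by simp
  qed
  show ?case
    by (rule C_k_SucI[OF D]) (intro C_k_mult C_k_const Suc.IH[OF g'(2)])
qed

lemma C_k_prod: "finite B \<Longrightarrow> (\<And>i. i \<in> B \<Longrightarrow> C_k k (f i)) \<Longrightarrow> C_k k (\<lambda>x. \<Prod>i\<in>B. f i x)"
  by (induction B rule: finite_induct) (simp_all add: C_k_const C_k_mult)

lemma C_k_prod_inner:
  "finite B \<Longrightarrow> (\<And>i. i \<in> B \<Longrightarrow> smooth1 (g i)) \<Longrightarrow> C_k k (\<lambda>x. \<Prod>i\<in>B. g i (x \<bullet> i))"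
  by (rule C_k_prod) (simp_all add: C_k_compose_inner smooth1_def)

text \<open>A product over the coordinates: boxes generate the Borel sets, so approximating their
  indicators is enough, and along a coordinate direction the product reduces to a function of one
  variable.\<close>

definition bump :: "'a::euclidean_space \<Rightarrow> 'a \<Rightarrow> nat \<Rightarrow> 'a \<Rightarrow> real" where
  "bump a b m x = (\<Prod>i\<in>Basis. bump1 (a \<bullet> i) (b \<bullet> i) m (x \<bullet> i))"

lemma C_k_bump: "C_k k (bump a b m)"
  unfolding bump_def[abs_def] by (rule C_k_prod_inner) (simp_all add: smooth1_bump1)

lemma bump_abs_le: "\<bar>bump a b m x\<bar> \<le> 1"
  unfolding bump_def abs_prod by (rule prod_le_1) (simp add: bump1_abs_le)

lemma bump_outside:
  assumes "box a b \<noteq> {}" "x \<notin> box a b" shows "bump a b m x = 0"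
proof -
  have lt: "a \<bullet> i < b \<bullet> i" if "i \<in> Basis" for i using assms(1) that by (auto simp: box_ne_empty)
  obtain i where i: "i \<in> Basis" "x \<bullet> i \<notin> {a \<bullet> i<..<b \<bullet> i}" using assms(2) by (auto simp: mem_box)
  then have "bump1 (a \<bullet> i) (b \<bullet> i) m (x \<bullet> i) = 0" using lt by (intro bump1_outside) auto
  then show ?thesis unfolding bump_def using i(1) by (intro prod_zero) auto
qed

lemma bump_tendsto:
  assumes "box a b \<noteq> {}"
  shows "(\<lambda>m. bump a b m x) \<longlonglongrightarrow> indicator (box a b) x"
proof -
  have lt: "a \<bullet> i < b \<bullet> i" if "i \<in> Basis" for i using assms(1) that by (auto simp: box_ne_empty)
  have "(\<lambda>m. bump a b m x) \<longlonglongrightarrow> (\<Prod>i\<in>Basis. indicator {a \<bullet> i<..<b \<bullet> i} (x \<bullet> i))"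
    unfolding bump_def using lt by (intro tendsto_prod bump1_tendsto) auto
  also have "(\<Prod>i\<in>Basis. indicator {a \<bullet> i<..<b \<bullet> i} (x \<bullet> i)) = (indicator (box a b) x :: real)"
    by (simp add: indicator_def mem_box prod.If_cases del: greaterThanLessThan_iff)
      (auto simp: mem_box)
  finally show ?thesis .
qed

lemma C_k_continuous: "C_k k f \<Longrightarrow> continuous_on UNIV f"
  by (induction k) (auto dest: C_k_Suc_imp simp del: C_k.simps(2))

lemma fun_support_subset: "(\<And>x. f x \<noteq> 0 \<Longrightarrow> x \<in> S) \<Longrightarrow> closed S \<Longrightarrow> fun_support f \<subseteq> S"
  unfolding fun_support_def by (intro closure_minimal) auto

lemma fun_support_bump:
  assumes "box a b \<noteq> {}" shows "fun_support (bump a b m) \<subseteq> cbox a b"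
  using bump_outside[OF assms] box_subset_cbox[of a b] by (intro fun_support_subset) auto

lemma compact_fun_support: "fun_support f \<subseteq> S \<Longrightarrow> compact S \<Longrightarrow> compact (fun_support f)"
  unfolding fun_support_def using compact_Int_closed[of S "closure {x. f x \<noteq> 0}"]
  by (simp add: Int_absorb1)

lemma bump_C1_c: "box a b \<noteq> {} \<Longrightarrow> bump a b m \<in> C1_c"
  unfolding C1_c_def using C_k_bump fun_support_bump compact_fun_support[OF _ compact_cbox] by blast

section \<open>Weak derivatives and translations\<close>

lemma box_Pi_system: "Int_stable (range (\<lambda>(a, b). box a b :: 'a::euclidean_space set))"
  by (auto simp: Int_stable_def box_Int_box)

lemma enn2real_eqD: "enn2real s = enn2real t \<Longrightarrow> s \<noteq> \<infinity> \<Longrightarrow> t \<noteq> \<infinity> \<Longrightarrow> s = t"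
  by (cases s; cases t) auto

text \<open>Positive and negative parts of \<open>g\<close> define finite measures agreeing on boxes.\<close>

lemma AE_zero_if_box_integrals_zero:
  fixes g :: "'a::euclidean_space \<Rightarrow> real"
  assumes g: "integrable lborel g" and z: "\<And>a b. (LINT x:box a b|lborel. g x) = 0"
  shows "AE x in lborel. g x = 0"
proof -
  have [measurable]: "g \<in> borel_measurable borel" using g by auto
  let ?P = "density lborel (\<lambda>x. ennreal (g x))" and ?N = "density lborel (\<lambda>x. ennreal (- g x))"
  have eq: "emeasure ?P A = emeasure ?N A" if A: "A \<in> range (\<lambda>(a, b). box a b)" for A
  proof -
    obtain a b where ab: "A = box a b" using A by auto
    have i: "integrable lborel (\<lambda>x. indicator A x * g x)"
      using integrable_mult_indicator[OF _ g, of A] ab by simp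
    have "(\<integral>\<^sup>+x. ennreal (indicator A x * g x) \<partial>lborel) = (\<integral>\<^sup>+x. ennreal (- (indicator A x * g x)) \<partial>lborel)"
    proof -
      have "(LINT x|lborel. indicator A x * g x) = 0" using z[of a b] ab by (simp add: set_lebesgue_integral_def)
      then have "enn2real (\<integral>\<^sup>+x. ennreal (indicator A x * g x) \<partial>lborel) = enn2real (\<integral>\<^sup>+x. ennreal (- (indicator A x * g x)) \<partial>lborel)"
        unfolding real_lebesgue_integral_def[OF i] by simp
      moreover have "(\<integral>\<^sup>+x. ennreal (indicator A x * g x) \<partial>lborel) \<noteq> \<infinity>" "(\<integral>\<^sup>+x. ennreal (- (indicator A x * g x)) \<partial>lborel) \<noteq> \<infinity>"
        using i by (auto simp: real_integrable_def)
      ultimately show ?thesis by (rule enn2real_eqD)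
    qed
    moreover have "ennreal (indicator A x * g x) = ennreal (g x) * indicator A x"
      "ennreal (- (indicator A x * g x)) = ennreal (- g x) * indicator A x" for x
      by (auto simp: indicator_def)
    ultimately show ?thesis using ab by (simp add: emeasure_density)
  qed
  have "?P = ?N"
  proof (rule measure_eqI_generator_eq[OF box_Pi_system, where \<Omega>=UNIV and A="\<lambda>n. box (- (real n *\<^sub>R One)) (real n *\<^sub>R One)"])
    show "sets ?P = sigma_sets UNIV (range (\<lambda>(a, b). box a b))" "sets ?N = sigma_sets UNIV (range (\<lambda>(a, b). box a b))"
      by (simp_all add: borel_eq_box)
    fix i :: nat
    have "emeasure ?P (box (- (real i *\<^sub>R One)) (real i *\<^sub>R One)) \<le> (\<integral>\<^sup>+x. ennreal (g x) \<partial>lborel)"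
      by (subst emeasure_density) (auto intro!: nn_integral_mono simp: indicator_def)
    also have "\<dots> < \<infinity>" using g by (auto simp: real_integrable_def less_top)
    finally show "emeasure ?P (box (- (real i *\<^sub>R One)) (real i *\<^sub>R One)) \<noteq> \<infinity>" by simp
  qed (use eq in \<open>auto simp: UN_box_eq_UNIV\<close>)
  then have "AE x in lborel. ennreal (g x) = ennreal (- g x)"
    by (intro sigma_finite_measure.density_unique[OF sigma_finite_lborel]) auto
  then show ?thesis
  proof eventually_elim
    case (elim x)
    then show ?case by (smt (verit) ennreal_eq_0_iff ennreal_neg)
  qed
qed

text \<open>Dominated convergence replaces the bumps by indicators of boxes. Only boxes with closure
  in \<open>cbox l r\<close> are tested, because their bumps are legitimate test functions as soon
  as \<open>cbox l r\<close> lies in the domain.\<close>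

lemma AE_zero_on_box_if_bump_integrals_zero:
  fixes g :: "'a::euclidean_space \<Rightarrow> real"
  assumes g: "set_integrable lborel (box l r) g"
    and z: "\<And>a b m. box a b \<noteq> {} \<Longrightarrow> cbox a b \<subseteq> cbox l r \<Longrightarrow> (LINT x:box l r|lborel. g x * bump a b m x) = 0"
  shows "AE x in lborel. x \<in> box l r \<longrightarrow> g x = 0"
proof -
  let ?g = "\<lambda>x. indicator (box l r) x * g x"
  have i: "integrable lborel ?g" using g by (simp add: set_integrable_def)
  have [measurable]: "?g \<in> borel_measurable borel" using i by auto
  have bm [measurable]: "bump a b m \<in> borel_measurable borel" for a b :: 'a and m
    by (rule borel_measurable_continuous_onI[OF C_k_continuous[OF C_k_bump]])
  have "AE x in lborel. ?g x = 0"
  proof (rule AE_zero_if_box_integrals_zero[OF i])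
    fix a b :: 'a
    obtain c d where cd: "box a b \<inter> box l r = box c d" using box_Int_box[of a b l r] by auto
    have "(LINT x:box a b|lborel. ?g x) = (LINT x|lborel. ?g x * indicator (box c d) x)"
      unfolding set_lebesgue_integral_def cd[symmetric]
      by (rule Bochner_Integration.integral_cong) (auto simp: indicator_def)
    also have "\<dots> = 0"
    proof (cases "box c d = {}")
      case False
      have "box c d \<subseteq> cbox l r" using cd box_subset_cbox[of l r] by blast
      then have sub: "cbox c d \<subseteq> cbox l r"
        using closure_minimal[OF _ closed_cbox, of "box c d" l r] closure_box[OF False] by simp
      have "(\<lambda>m. LINT x|lborel. ?g x * bump c d m x) \<longlonglongrightarrow> (LINT x|lborel. ?g x * indicator (box c d) x)"
      proof (rule integral_dominated_convergence[where w="\<lambda>x. \<bar>?g x\<bar>"])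
        show "integrable lborel (\<lambda>x. \<bar>?g x\<bar>)" using i by (rule integrable_abs)
        show "AE x in lborel. (\<lambda>m. ?g x * bump c d m x) \<longlonglongrightarrow> ?g x * indicator (box c d) x"
          by (intro AE_I2 tendsto_mult tendsto_const bump_tendsto False)
        show "AE x in lborel. norm (?g x * bump c d m x) \<le> \<bar>?g x\<bar>" for m
          using bump_abs_le[of c d m] by (intro AE_I2) (simp add: abs_mult mult_left_le)
      qed measurable
      moreover have "(LINT x|lborel. ?g x * bump c d m x) = 0" for m
        using z[OF False sub, of m] by (simp add: set_lebesgue_integral_def mult.assoc)
      ultimately show ?thesis by (simp add: LIMSEQ_const_iff)
    qed simp
    finally show "(LINT x:box a b|lborel. ?g x) = 0" .
  qed
  then show ?thesis
  proof eventually_elim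
    case (elim x)
    then show ?case by (cases "x \<in> box l r") auto
  qed
qed

text \<open>By Lindelof countably many boxes suffice, so the exceptional null sets can be
  united.\<close>

lemma AE_open_if_AE_boxes:
  fixes U :: "'a::euclidean_space set"
  assumes "open U" and "\<And>l r. cbox l r \<subseteq> U \<Longrightarrow> AE x in lborel. x \<in> box l r \<longrightarrow> P x"
  shows "AE x in lborel. x \<in> U \<longrightarrow> P x"
proof -
  define F where "F = {X. \<exists>a b. X = box a b \<and> cbox a b \<subseteq> U}"
  obtain E where E: "E \<subseteq> F" "countable E" "\<Union>E = \<Union>F"
    by (rule Lindelof[of F]) (auto simp: F_def)
  have "x \<in> \<Union>F" if x: "x \<in> U" for x
  proof -
    obtain a b where "cbox a b \<subseteq> U" "x \<in> box a b"
      by (rule open_contains_cbox[OF assms(1) x]) auto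
    then show ?thesis unfolding F_def by blast
  qed
  then have U: "U \<subseteq> \<Union>E" using E(3) by auto
  have "AE x in lborel. \<forall>X\<in>E. x \<in> X \<longrightarrow> P x"
    unfolding AE_ball_countable[OF E(2)] using E(1) assms(2) unfolding F_def by blast
  then show ?thesis
  proof eventually_elim
    case (elim x)
    then show ?case using U by blast
  qed
qed

section \<open>Translations and averages along a segment\<close>

lemma lborel_shift: "distr lborel borel (\<lambda>x. x + c) = (lborel :: 'a::euclidean_space measure)"
proof -
  have "(\<lambda>x. x + c) = (+) c" by (simp add: fun_eq_iff add.commute)
  then show ?thesis using lborel_distr_plus[of c] by simp
qed

lemma nn_integral_lborel_shift:
  assumes "f \<in> borel_measurable borel"
  shows "(\<integral>\<^sup>+x. f (x + c) \<partial>lborel) = (\<integral>\<^sup>+x. f x \<partial>(lborel :: 'a::euclidean_space measure))"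
  using nn_integral_distr[of "\<lambda>x. x + c" lborel borel f] assms by (simp add: lborel_shift)

lemma integral_lborel_shift:
  fixes f :: "'a::euclidean_space \<Rightarrow> real"
  assumes "f \<in> borel_measurable borel"
  shows "(LINT x|lborel. f (x + c)) = (LINT x|lborel. f x)"
  using integral_distr[of "\<lambda>x. x + c" lborel borel f] assms by (simp add: lborel_shift)

lemma integrable_lborel_shift:
  fixes f :: "'a::euclidean_space \<Rightarrow> real"
  assumes "integrable lborel f"
  shows "integrable lborel (\<lambda>x. f (x + c))"
  using integrable_distr[of "\<lambda>x. x + c" lborel borel f] assms by (simp add: lborel_shift)

lemma AE_lborel_shift:
  assumes "AE x in lborel. P (x :: 'a::euclidean_space)"
  shows "AE x in lborel. P (x + c)"
proof -
  obtain N where N: "N \<in> sets borel" "emeasure lborel N = 0" "{x. \<not> P x} \<subseteq> N"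
    using assms unfolding eventually_ae_filter by (auto simp: null_sets_def)
  have m: "(\<lambda>x. x + c) -` N \<inter> space borel \<in> sets borel" by (rule measurable_sets[OF _ N(1)]) measurable
  have "emeasure lborel ((\<lambda>x. x + c) -` N \<inter> space borel) = emeasure lborel N"
    using emeasure_distr[of "\<lambda>x. x + c" lborel borel N] N(1) by (simp add: lborel_shift)
  then have "(\<lambda>x. x + c) -` N \<in> null_sets lborel" using m N by auto
  then show ?thesis by (rule AE_I') (use N(3) in auto)
qed

lemma integrable_mult_bounded:
  fixes f g :: "'a \<Rightarrow> real"
  assumes "integrable M f" "g \<in> borel_measurable M" "\<And>x. \<bar>g x\<bar> \<le> C"
  shows "integrable M (\<lambda>x. f x * g x)"
proof (rule Bochner_Integration.integrable_bound)
  show "integrable M (\<lambda>x. f x * C)" using assms(1) by (rule integrable_mult_left)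
  show "(\<lambda>x. f x * g x) \<in> borel_measurable M" using assms(1,2) by measurable
  have "0 \<le> C" using assms(3) abs_ge_zero order_trans by blast
  then show "AE x in M. norm (f x * g x) \<le> norm (f x * C)"
    using assms(3) by (intro AE_I2) (simp add: abs_mult mult_left_mono)
qed

lemma Lp_loc_1_integrable:
  assumes f: "f \<in> Lp_loc lborel \<Omega> 1" and K: "compact K" "K \<subseteq> \<Omega>"
  shows "integrable lborel (\<lambda>x. indicator K x * f (x :: 'a::euclidean_space))"
proof -
  have m: "(\<lambda>x. indicator \<Omega> x *\<^sub>R f x) \<in> borel_measurable lborel"
    using f by (simp add: Lp_loc_def set_borel_measurable_def)
  have [measurable]: "K \<in> sets borel" using K(1) by (intro borel_compact)
  have "(\<lambda>x. indicator K x * (indicator \<Omega> x *\<^sub>R f x)) \<in> borel_measurable lborel"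
    using m by measurable
  also have "(\<lambda>x. indicator K x * (indicator \<Omega> x *\<^sub>R f x)) = (\<lambda>x. indicator K x * f x)"
    using K(2) by (auto simp: indicator_def fun_eq_iff)
  finally have m1: "(\<lambda>x. indicator K x * f x) \<in> borel_measurable lborel" .
  have "(\<integral>\<^sup>+x\<in>K. ennreal (\<bar>f x\<bar> powr 1) \<partial>lborel) < \<infinity>" using f K by (simp add: Lp_loc_def)
  also have "(\<integral>\<^sup>+x\<in>K. ennreal (\<bar>f x\<bar> powr 1) \<partial>lborel) = (\<integral>\<^sup>+x. ennreal (norm (indicator K x * f x)) \<partial>lborel)"
    by (intro nn_integral_cong) (simp add: indicator_def)
  finally show ?thesis using m1 by (intro integrableI_bounded)
qed

text \<open>Every translate has the same L^1 norm, so the double integral is the length of the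
  interval times that norm.\<close>

lemma integrable_translates:
  fixes v :: "'a::euclidean_space \<Rightarrow> real"
  assumes v: "integrable lborel v"
  shows "integrable (lborel \<Otimes>\<^sub>M lborel) (\<lambda>(t, x). indicator {0..\<tau>} t * v (x + t *\<^sub>R e))"
proof -
  have [measurable]: "v \<in> borel_measurable borel" using v by auto
  show ?thesis
  proof (rule lborel_pair.Fubini_integrable)
    have "(\<lambda>t. LINT x|lborel. norm (indicator {0..\<tau>} t * v (x + t *\<^sub>R e))) =
        (\<lambda>t. indicator {0..\<tau>} t * (LINT x|lborel. \<bar>v x\<bar>))"
    proof
      fix t
      have "(LINT x|lborel. \<bar>v (x + t *\<^sub>R e)\<bar>) = (LINT x|lborel. \<bar>v x\<bar>)"
        by (rule integral_lborel_shift[of "\<lambda>x. \<bar>v x\<bar>"]) measurable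
      then show "(LINT x|lborel. norm (indicator {0..\<tau>} t * v (x + t *\<^sub>R e))) = indicator {0..\<tau>} t * (LINT x|lborel. \<bar>v x\<bar>)"
        by (simp add: abs_mult)
    qed
    moreover have "integrable lborel (indicat_real {0..\<tau>})" by (rule integrable_real_indicator) (auto simp: emeasure_lborel_Icc_eq)
    ultimately show "integrable lborel (\<lambda>t. LINT x|lborel. norm (case (t, x) of (t, x) \<Rightarrow> indicator {0..\<tau>} t * v (x + t *\<^sub>R e)))"
      by simp
    show "AE t in lborel. integrable lborel (\<lambda>x. case (t, x) of (t, x) \<Rightarrow> indicator {0..\<tau>} t * v (x + t *\<^sub>R e))"
      by (intro AE_I2) (simp add: integrable_lborel_shift[OF v])
  qed measurable
qed

text \<open>Fubini and translation invariance move the averaging from \<open>v\<close> to the test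
  function, with reversed direction.\<close>

lemma integral_translates_adjoint:
  fixes v \<phi> :: "'a::euclidean_space \<Rightarrow> real"
  assumes v: "integrable lborel v" and [measurable]: "\<phi> \<in> borel_measurable borel" and b: "\<And>x. \<bar>\<phi> x\<bar> \<le> C"
  shows "(LINT x|lborel. (LINT t|lborel. indicator {0..\<tau>} t * v (x + t *\<^sub>R e)) * \<phi> x) =
    (LINT x|lborel. v x * (LINT t|lborel. indicator {0..\<tau>} t * \<phi> (x - t *\<^sub>R e)))"
proof -
  have [measurable]: "v \<in> borel_measurable borel" using v by auto
  have I: "integrable (lborel \<Otimes>\<^sub>M lborel) (\<lambda>(t, x). indicator {0..\<tau>} t * v (x + t *\<^sub>R e) * \<phi> x)"
    using integrable_mult_bounded[OF integrable_translates[OF v, of \<tau> e], of "\<lambda>z. \<phi> (snd z)" C] b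
    by (simp add: case_prod_beta')
  have I2: "integrable (lborel \<Otimes>\<^sub>M lborel) (\<lambda>(t, x). indicator {0..\<tau>} t * (v x * \<phi> (x - t *\<^sub>R e)))"
  proof -
    \<comment> \<open>Direction 0 in place of \<open>e\<close>: integrability on the product space
      before the translate of \<phi> is multiplied in as a bounded factor.\<close>
    have "integrable (lborel \<Otimes>\<^sub>M lborel) (\<lambda>(t, x). indicator {0..\<tau>} t * v (x + t *\<^sub>R 0))"
      by (rule integrable_translates[OF v])
    from integrable_mult_bounded[OF this, of "\<lambda>z. \<phi> (snd z - fst z *\<^sub>R e)" C] b
    show ?thesis by (simp add: case_prod_beta' mult.assoc)
  qed
  have sh: "(LINT x|lborel. v (x + c) * \<phi> x) = (LINT x|lborel. v x * \<phi> (x - c))" for c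
    using integral_lborel_shift[of "\<lambda>x. v x * \<phi> (x - c)" c] by simp
  have "(LINT x|lborel. (LINT t|lborel. indicator {0..\<tau>} t * v (x + t *\<^sub>R e)) * \<phi> x) = (LINT x|lborel. LINT t|lborel. indicator {0..\<tau>} t * v (x + t *\<^sub>R e) * \<phi> x)"
    by simp
  also have "\<dots> = (LINT t|lborel. LINT x|lborel. indicator {0..\<tau>} t * v (x + t *\<^sub>R e) * \<phi> x)"
    by (rule lborel_pair.Fubini_integral[OF I])
  also have "\<dots> = (LINT t|lborel. LINT x|lborel. indicator {0..\<tau>} t * (v x * \<phi> (x - t *\<^sub>R e)))"
    using sh by (simp add: mult.assoc)
  also have "\<dots> = (LINT x|lborel. LINT t|lborel. indicator {0..\<tau>} t * (v x * \<phi> (x - t *\<^sub>R e)))"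
    by (rule lborel_pair.Fubini_integral[OF I2, symmetric])
  also have "\<dots> = (LINT x|lborel. v x * (LINT t|lborel. indicator {0..\<tau>} t * \<phi> (x - t *\<^sub>R e)))"
  proof (rule Bochner_Integration.integral_cong)
    fix x
    have "(LINT t|lborel. indicator {0..\<tau>} t * (v x * \<phi> (x - t *\<^sub>R e))) = (LINT t|lborel. v x * (indicator {0..\<tau>} t * \<phi> (x - t *\<^sub>R e)))"
      by (simp add: mult.left_commute)
    then show "(LINT t|lborel. indicator {0..\<tau>} t * (v x * \<phi> (x - t *\<^sub>R e))) = v x * (LINT t|lborel. indicator {0..\<tau>} t * \<phi> (x - t *\<^sub>R e))"
      by simp
  qed simp
  finally show ?thesis .
qed

text \<open>A bump is a factor \<open>P\<close> independent of the \<open>e\<close>-coordinate times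
  a function of that coordinate with antiderivative \<open>H\<close>. Integrating over the segment
  gives \<open>P\<close> times an increment of \<open>H\<close>; this is smooth, and its
  \<open>e\<close>-derivative is the difference of the bump and its translate.\<close>

lemma bump_line_integral:
  fixes a b e :: "'a::euclidean_space"
  assumes e: "e \<in> Basis" and \<tau>: "0 \<le> \<tau>"
  shows "\<exists>\<Psi>. (\<forall>k. C_k k \<Psi>) \<and>
    (\<forall>x. (LINT t|lborel. indicator {0..\<tau>} t * bump a b m (x - t *\<^sub>R e)) = \<Psi> x) \<and>
    (\<forall>x. partial_deriv e \<Psi> x = bump a b m x - bump a b m (x - \<tau> *\<^sub>R e))"
proof -
  let ?\<beta> = "\<lambda>i. bump1 (a \<bullet> i) (b \<bullet> i) m"
  obtain H where H: "smooth1 H" "\<forall>x. (H has_real_derivative ?\<beta> e x) (at x)"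
    using smooth1_has_antiderivative[OF smooth1_bump1[of "a \<bullet> e" "b \<bullet> e" m]] by auto
  have H': "smooth1 (\<lambda>s. H s - H (s - \<tau>))"
    using smooth1_diff[OF H(1) smooth1_affine[OF H(1), of 1 "- \<tau>"]] by simp
  define P where "P x = (\<Prod>i\<in>Basis-{e}. ?\<beta> i (x \<bullet> i))" for x
  define \<Psi> where "\<Psi> x = P x * (H (x \<bullet> e) - H (x \<bullet> e - \<tau>))" for x
  have be: "bump a b m x = P x * ?\<beta> e (x \<bullet> e)" for x
    unfolding bump_def P_def using e by (subst prod.remove[of _ e]) (auto simp: mult.commute)
  have ee: "e \<bullet> e = 1" using e by (simp add: inner_Basis)
  have Pshift: "P (x + t *\<^sub>R e) = P x" for x t
    unfolding P_def using e by (intro prod.cong) (auto simp: inner_add_left inner_Basis)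
  have CP: "C_k k P" for k unfolding P_def[abs_def]
    by (rule C_k_prod_inner) (simp_all add: smooth1_bump1)
  have C\<Psi>: "C_k k \<Psi>" for k unfolding \<Psi>_def[abs_def]
    using H' by (intro C_k_mult CP C_k_compose_inner[where g="\<lambda>s. H s - H (s - \<tau>)"]) (simp add: smooth1_def)
  have int: "(LINT t|lborel. indicator {0..\<tau>} t * bump a b m (x - t *\<^sub>R e)) = \<Psi> x" for x
  proof -
    have "bump a b m (x - t *\<^sub>R e) = P x * ?\<beta> e (x \<bullet> e - t)" for t
      using Pshift[of x "- t"] by (simp add: be inner_diff_left ee)
    then have "(LINT t|lborel. indicator {0..\<tau>} t * bump a b m (x - t *\<^sub>R e)) =
        (LINT t|lborel. P x * (?\<beta> e (x \<bullet> e - t) * indicator {0..\<tau>} t))"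
      by (intro Bochner_Integration.integral_cong) simp_all
    also have "\<dots> = P x * (LINT t|lborel. ?\<beta> e (x \<bullet> e - t) * indicator {0..\<tau>} t)"
      by (rule Bochner_Integration.integral_mult_right_zero)
    also have "(LINT t|lborel. ?\<beta> e (x \<bullet> e - t) * indicator {0..\<tau>} t) = - H (x \<bullet> e - \<tau>) - (- H (x \<bullet> e - 0))"
    proof (rule integral_FTC_Icc_real[OF \<tau>])
      fix t
      have "((\<lambda>t. x \<bullet> e - t) has_real_derivative - 1) (at t)" by (auto intro!: derivative_eq_intros)
      from DERIV_minus[OF DERIV_chain2[OF H(2)[rule_format] this]]
      show "((\<lambda>t. - H (x \<bullet> e - t)) has_real_derivative ?\<beta> e (x \<bullet> e - t)) (at t)" by simp
      have "continuous_on UNIV (\<lambda>t. ?\<beta> e (x \<bullet> e - t))"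
        by (rule continuous_on_compose2[OF smooth1_continuous[OF smooth1_bump1]]) (auto intro: continuous_intros)
      then show "isCont (\<lambda>t. ?\<beta> e (x \<bullet> e - t)) t" by (simp add: continuous_on_eq_continuous_at)
    qed
    finally show ?thesis by (simp add: \<Psi>_def)
  qed
  have pd: "partial_deriv e \<Psi> x = bump a b m x - bump a b m (x - \<tau> *\<^sub>R e)" for x
  proof -
    have dl: "(\<Psi> has_derivative frechet_derivative \<Psi> (at x)) (at x)"
      using C_k_Suc_has_derivative(1)[of 0 \<Psi> x] C\<Psi>[of "Suc 0"] by blast
    have "((\<lambda>s. x + s *\<^sub>R e) has_derivative (\<lambda>s. s *\<^sub>R e)) (at 0)" by (auto intro!: derivative_eq_intros)
    from has_derivative_compose[OF this, of \<Psi> "frechet_derivative \<Psi> (at x)"] dl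
    have "((\<lambda>s. \<Psi> (x + s *\<^sub>R e)) has_derivative (\<lambda>s. frechet_derivative \<Psi> (at x) (s *\<^sub>R e))) (at 0)" by simp
    moreover have "linear (frechet_derivative \<Psi> (at x))" using dl by (rule has_derivative_linear)
    then have "(\<lambda>s. frechet_derivative \<Psi> (at x) (s *\<^sub>R e)) = (*) (partial_deriv e \<Psi> x)"
      by (simp add: fun_eq_iff partial_deriv_def linear_cmul)
    ultimately have 1: "((\<lambda>s. \<Psi> (x + s *\<^sub>R e)) has_real_derivative partial_deriv e \<Psi> x) (at 0)"
      by (simp add: has_field_derivative_def)
    have "\<Psi> (x + s *\<^sub>R e) = P x * (H (x \<bullet> e + s) - H (x \<bullet> e - \<tau> + s))" for s
      by (simp add: \<Psi>_def Pshift inner_add_left ee algebra_simps)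
    moreover have "((\<lambda>s. P x * (H (x \<bullet> e + s) - H (x \<bullet> e - \<tau> + s))) has_real_derivative
        P x * (?\<beta> e (x \<bullet> e) - ?\<beta> e (x \<bullet> e - \<tau>))) (at 0)"
    proof -
      have "((\<lambda>s. H (c + s)) has_real_derivative ?\<beta> e c * 1) (at 0)" for c
        using H(2) by (intro DERIV_chain2[of H _ "\<lambda>s. c + s"]) (auto intro!: derivative_eq_intros)
      from DERIV_cmult[OF DERIV_diff[OF this[of "x \<bullet> e"] this[of "x \<bullet> e - \<tau>"]], of "P x"]
      show ?thesis by simp
    qed
    ultimately have "partial_deriv e \<Psi> x = P x * (?\<beta> e (x \<bullet> e) - ?\<beta> e (x \<bullet> e - \<tau>))"
      using DERIV_unique[OF 1] by simp
    moreover have "bump a b m (x - \<tau> *\<^sub>R e) = P x * ?\<beta> e (x \<bullet> e - \<tau>)"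
      using Pshift[of x "- \<tau>"] by (simp add: be inner_diff_left ee)
    ultimately show ?thesis by (simp add: be right_diff_distrib)
  qed
  show ?thesis using C\<Psi> int pd by (intro exI[of _ \<Psi>] conjI allI)
qed

text \<open>The complement is the sum of the closed complement of \<Omega> and the compact reflected
  segment, hence closed.\<close>

lemma open_segment_inside:
  fixes \<Omega> :: "'a::euclidean_space set"
  assumes "open \<Omega>"
  shows "open {x. \<forall>t\<in>{0..\<tau>}. x + t *\<^sub>R e \<in> \<Omega>}"
proof -
  let ?C = "(\<lambda>t. - (t *\<^sub>R e)) ` {0..\<tau>}"
  have "compact ?C" by (intro compact_continuous_image continuous_intros) auto
  then have "closed (\<Union>x\<in>- \<Omega>. \<Union>y\<in>?C. {x + y})"
    using assms by (intro closed_compact_sums) auto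
  moreover have "(\<Union>x\<in>- \<Omega>. \<Union>y\<in>?C. {x + y}) = - {x. \<forall>t\<in>{0..\<tau>}. x + t *\<^sub>R e \<in> \<Omega>}"
  proof safe
    fix x t assume "\<forall>s\<in>{0..\<tau>}. x + - (t *\<^sub>R e) + s *\<^sub>R e \<in> \<Omega>" "t \<in> {0..\<tau>}" "x \<notin> \<Omega>"
    then show False by force
  next
    fix x t assume "x \<notin> (\<Union>x\<in>- \<Omega>. \<Union>y\<in>?C. {x + y})" "t \<in> {0..\<tau>}"
    then show "x + t *\<^sub>R e \<in> \<Omega>" by (force dest: bspec[of _ _ "x + t *\<^sub>R e"])
  qed
  ultimately show ?thesis by (simp add: open_closed)
qed

lemma bump_measurable [measurable]: "bump a b m \<in> borel_measurable borel"
  by (rule borel_measurable_continuous_onI[OF C_k_continuous[OF C_k_bump]])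

text \<open>Testing the weak derivative with \<open>\<Psi> x = \<integral>\<^sub>0\<^sup>\<tau> \<phi> (x - t e) dt\<close>, where \<open>\<phi>\<close> is a bump,
  turns into testing the claim with \<open>\<phi>\<close>.\<close>

lemma weak_partial_increment:
  fixes \<Omega> :: "'a::euclidean_space set"
  assumes \<Omega>: "open \<Omega>" and e: "e \<in> Basis" and wp: "is_weak_partial \<Omega> e u v" and \<tau>: "0 \<le> \<tau>"
  shows "AE x in lborel. (\<forall>t\<in>{0..\<tau>}. x + t *\<^sub>R e \<in> \<Omega>) \<longrightarrow>
    u (x + \<tau> *\<^sub>R e) - u x = (LINT t|lborel. indicator {0..\<tau>} t * v (x + t *\<^sub>R e))"
proof -
  let ?V = "{x. \<forall>t\<in>{0..\<tau>}. x + t *\<^sub>R e \<in> \<Omega>}"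
  let ?P = "\<lambda>x. u (x + \<tau> *\<^sub>R e) - u x = (LINT t|lborel. indicator {0..\<tau>} t * v (x + t *\<^sub>R e))"
  have "AE x in lborel. x \<in> ?V \<longrightarrow> ?P x"
  proof (rule AE_open_if_AE_boxes[OF open_segment_inside[OF \<Omega>]])
    fix l r assume lr: "cbox l r \<subseteq> ?V"
    \<comment> \<open>The region swept out by the box along the segment is compact in \<Omega>.
      Cutting \<open>u\<close> and \<open>v\<close> off there makes them integrable on the whole
      space without changing the identity on the box.\<close>
    define K where "K = (\<Union>x\<in>cbox l r. \<Union>y\<in>(\<lambda>t. t *\<^sub>R e) ` {0..\<tau>}. {x + y})"
    have K: "compact K" unfolding K_def
      by (intro compact_sums' compact_cbox compact_continuous_image continuous_intros) auto
    have KI: "x + t *\<^sub>R e \<in> K" if "x \<in> cbox l r" "t \<in> {0..\<tau>}" for x t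
      unfolding K_def using that by (intro UN_I[of x] UN_I[of "t *\<^sub>R e"]) auto
    have KI0: "x \<in> K" if "x \<in> cbox l r" for x using KI[OF that, of 0] \<tau> by simp
    have K\<Omega>: "K \<subseteq> \<Omega>" using lr by (auto simp: K_def)
    define u1 where "u1 x = indicator K x * u x" for x
    define v1 where "v1 x = indicator K x * v x" for x
    have u1: "integrable lborel u1" unfolding u1_def[abs_def]
      using wp K K\<Omega> by (intro Lp_loc_1_integrable) (auto simp: is_weak_partial_def)
    have v1: "integrable lborel v1" unfolding v1_def[abs_def]
      using wp K K\<Omega> by (intro Lp_loc_1_integrable) (auto simp: is_weak_partial_def)
    have [measurable]: "u1 \<in> borel_measurable borel" "v1 \<in> borel_measurable borel" using u1 v1 by auto
    let ?W = "\<lambda>x. LINT t|lborel. indicator {0..\<tau>} t * v1 (x + t *\<^sub>R e)"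
    define g where "g x = u1 (x + \<tau> *\<^sub>R e) - u1 x - ?W x" for x
    have W: "integrable lborel ?W"
      using lborel_pair.integrable_snd[OF integrable_translates[OF v1]] by simp
    have g: "integrable lborel g" unfolding g_def[abs_def]
      by (intro Bochner_Integration.integrable_diff integrable_lborel_shift u1 W)
    have "AE x in lborel. x \<in> box l r \<longrightarrow> g x = 0"
    proof (rule AE_zero_on_box_if_bump_integrals_zero)
      show "set_integrable lborel (box l r) g" unfolding set_integrable_def
        by (rule integrable_mult_indicator[OF _ g]) simp
      fix a b m assume ab: "box a b \<noteq> {}" "cbox a b \<subseteq> cbox l r"
      let ?\<phi> = "bump a b m"
      obtain \<Psi> where \<Psi>': "\<forall>k. C_k k \<Psi>"
        "\<forall>x. (LINT t|lborel. indicator {0..\<tau>} t * ?\<phi> (x - t *\<^sub>R e)) = \<Psi> x"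
        "\<forall>x. partial_deriv e \<Psi> x = ?\<phi> x - ?\<phi> (x - \<tau> *\<^sub>R e)"
        using bump_line_integral[OF e \<tau>, of a b m] by (elim exE conjE) (rule that)
      note \<Psi> = \<Psi>'[rule_format]
      have out: "?\<phi> x = 0" if "x \<notin> cbox l r" for x
        using bump_outside[OF ab(1)] ab(2) box_subset_cbox[of a b] that by blast
      have outK: "?\<phi> (x - t *\<^sub>R e) = 0" if "x \<notin> K" "t \<in> {0..\<tau>}" for x t
        using KI[of "x - t *\<^sub>R e" t] that out by auto
      have \<Psi>K: "\<Psi> x = 0" if "x \<notin> K" for x
      proof -
        have "indicator {0..\<tau>} t * ?\<phi> (x - t *\<^sub>R e) = 0" for t
          by (cases "t \<in> {0..\<tau>}") (simp_all add: outK[OF that])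
        then show ?thesis using \<Psi>(2)[of x] by (simp only: lebesgue_integral_const mult_zero_right) simp
      qed
      \<comment> \<open>\<open>\<Psi>\<close> averages translates of a bump supported in the box, so
        it lives in \<open>K\<close> and qualifies as a test function.\<close>
      have supp: "fun_support \<Psi> \<subseteq> K" using \<Psi>K compact_imp_closed[OF K] by (intro fun_support_subset) auto
      have test: "\<Psi> \<in> test_functions \<Omega>" unfolding test_functions_def
        using \<Psi>(1) supp compact_fun_support[OF supp K] K\<Omega> by auto
      have wk: "(LINT x:\<Omega>|lborel. u x * partial_deriv e \<Psi> x) = - (LINT x:\<Omega>|lborel. v x * \<Psi> x)"
        using wp test by (auto simp: is_weak_partial_def)
      have "(LINT x:\<Omega>|lborel. u x * partial_deriv e \<Psi> x) = (LINT x|lborel. u1 x * (?\<phi> x - ?\<phi> (x - \<tau> *\<^sub>R e)))"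
        unfolding set_lebesgue_integral_def
      proof (rule Bochner_Integration.integral_cong)
        fix x
        have "x \<notin> K \<Longrightarrow> ?\<phi> x - ?\<phi> (x - \<tau> *\<^sub>R e) = 0" using outK[of x 0] outK[of x \<tau>] \<tau> by simp
        then show "indicator \<Omega> x *\<^sub>R (u x * partial_deriv e \<Psi> x) = u1 x * (?\<phi> x - ?\<phi> (x - \<tau> *\<^sub>R e))"
          using K\<Omega> by (cases "x \<in> K") (auto simp: \<Psi>(3) u1_def)
      qed simp
      moreover have "(LINT x:\<Omega>|lborel. v x * \<Psi> x) = (LINT x|lborel. v1 x * \<Psi> x)"
        unfolding set_lebesgue_integral_def using K\<Omega> \<Psi>K
        by (intro Bochner_Integration.integral_cong) (auto simp: v1_def indicator_def)
      \<comment> \<open>The weak derivative tested with \<open>\<Psi>\<close>, rewritten for the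
        cut-off functions. Together with \<open>Weq\<close> below it makes \<open>g\<close>
        orthogonal to the bump.\<close>
      ultimately have key: "(LINT x|lborel. u1 x * (?\<phi> x - ?\<phi> (x - \<tau> *\<^sub>R e))) = - (LINT x|lborel. v1 x * \<Psi> x)"
        using wk by simp
      have i\<phi>: "integrable lborel (\<lambda>x. f x * ?\<phi> (x - c))" if "integrable lborel f" for f :: "'a \<Rightarrow> real" and c
        using that bump_abs_le[of a b m] by (intro integrable_mult_bounded[where C=1]) auto
      have i\<phi>0: "integrable lborel (\<lambda>x. f x * ?\<phi> x)" if "integrable lborel f" for f :: "'a \<Rightarrow> real"
        using i\<phi>[OF that, of 0] by simp
      have sh: "(LINT x|lborel. f (x + c) * ?\<phi> x) = (LINT x|lborel. f x * ?\<phi> (x - c))" if [measurable]: "f \<in> borel_measurable borel"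
        for f :: "'a \<Rightarrow> real" and c
        using integral_lborel_shift[of "\<lambda>x. f x * ?\<phi> (x - c)" c] by simp
      have Weq: "(LINT x|lborel. ?W x * ?\<phi> x) = (LINT x|lborel. v1 x * \<Psi> x)"
        using integral_translates_adjoint[OF v1, of ?\<phi> 1 \<tau> e] bump_abs_le[of a b m] by (simp add: \<Psi>(2))
      have "(LINT x:box l r|lborel. g x * ?\<phi> x) = (LINT x|lborel. u1 (x + \<tau> *\<^sub>R e) * ?\<phi> x - u1 x * ?\<phi> x - ?W x * ?\<phi> x)"
        unfolding set_lebesgue_integral_def
      proof (rule Bochner_Integration.integral_cong)
        fix x
        have "box a b \<subseteq> box l r" using interior_mono[OF ab(2)] by simp
        then have "x \<notin> box l r \<Longrightarrow> ?\<phi> x = 0" using bump_outside[OF ab(1), of x m] by blast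
        then show "indicator (box l r) x *\<^sub>R (g x * ?\<phi> x) = u1 (x + \<tau> *\<^sub>R e) * ?\<phi> x - u1 x * ?\<phi> x - ?W x * ?\<phi> x"
          by (cases "x \<in> box l r") (simp_all add: g_def left_diff_distrib)
      qed simp
      also have "\<dots> = (LINT x|lborel. u1 (x + \<tau> *\<^sub>R e) * ?\<phi> x) - (LINT x|lborel. u1 x * ?\<phi> x) - (LINT x|lborel. ?W x * ?\<phi> x)"
        by (simp only: Bochner_Integration.integral_diff Bochner_Integration.integrable_diff
          i\<phi>0[OF integrable_lborel_shift[OF u1]] i\<phi>0[OF u1] i\<phi>0[OF W])
      also have "\<dots> = - (LINT x|lborel. u1 x * (?\<phi> x - ?\<phi> (x - \<tau> *\<^sub>R e))) - (LINT x|lborel. v1 x * \<Psi> x)"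
        unfolding Weq by (simp add: sh right_diff_distrib Bochner_Integration.integral_diff[OF i\<phi>0[OF u1] i\<phi>[OF u1]])
      also have "\<dots> = 0" using key by simp
      finally show "(LINT x:box l r|lborel. g x * ?\<phi> x) = 0" .
    qed
    then show "AE x in lborel. x \<in> box l r \<longrightarrow> ?P x"
    proof eventually_elim
      case (elim x)
      show ?case
      proof
        assume x: "x \<in> box l r"
        then have xc: "x \<in> cbox l r" using box_subset_cbox by blast
        have "u1 (x + \<tau> *\<^sub>R e) = u (x + \<tau> *\<^sub>R e)" "u1 x = u x" using KI[OF xc, of \<tau>] KI0[OF xc] \<tau> by (simp_all add: u1_def)
        moreover have "indicator {0..\<tau>} t * v1 (x + t *\<^sub>R e) = indicator {0..\<tau>} t * v (x + t *\<^sub>R e)" for t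
          using KI[OF xc, of t] by (simp add: v1_def indicator_def)
        then have "?W x = (LINT t|lborel. indicator {0..\<tau>} t * v (x + t *\<^sub>R e))" by (simp only:)
        ultimately show "?P x" using elim x by (simp add: g_def)
      qed
    qed
  qed
  then show ?thesis by simp
qed

section \<open>Hardy's inequality and the fractional seminorm\<close>

lemma epowr_ennreal: "0 \<le> r \<Longrightarrow> epowr (ennreal r) a = ennreal (r powr a)"
  by (simp add: epowr_def)

lemma epowr_top: "epowr top a = top"
  by (simp add: epowr_def)

lemma epowr_0 [simp]: "epowr 0 a = 0"
  by (simp add: epowr_def)

lemma epowr_mono: "s \<le> t \<Longrightarrow> 0 \<le> a \<Longrightarrow> epowr s a \<le> epowr t a"
  by (cases s; cases t) (auto simp: epowr_ennreal epowr_top top_unique intro!: ennreal_leI powr_mono2)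

lemma epowr_measurable [measurable]: "(\<lambda>t. epowr t a) \<in> borel_measurable borel"
  unfolding epowr_def by measurable

lemma epowr_mult: "0 < c \<Longrightarrow> epowr (ennreal c * t) a = ennreal (c powr a) * epowr t a"
  by (cases t) (auto simp: epowr_ennreal epowr_top ennreal_mult_top powr_mult simp flip: ennreal_mult)

lemma epowr_epowr: "a \<noteq> 0 \<Longrightarrow> epowr (epowr t (1 / a)) a = t"
  by (cases t) (auto simp: epowr_ennreal epowr_top powr_powr)

lemma epowr_add_le:
  assumes "0 < p" shows "epowr (s + t) p \<le> ennreal (2 powr p) * (epowr s p + epowr t p)"
proof -
  have "s + t \<le> ennreal 2 * max s t"
    using add_mono[of s "max s t" t "max s t"] by (simp add: mult_2)
  then have "epowr (s + t) p \<le> epowr (ennreal 2 * max s t) p" using assms by (intro epowr_mono) auto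
  also have "\<dots> = ennreal (2 powr p) * epowr (max s t) p" by (rule epowr_mult) simp
  also have "epowr (max s t) p \<le> epowr s p + epowr t p" by (auto simp: max_def)
  finally show ?thesis by (simp add: mult_left_mono)
qed

lemma epowr_add3_le:
  assumes "0 < p" shows "epowr (s + t + u) p \<le> ennreal (3 powr p) * (epowr s p + epowr t p + epowr u p)"
proof -
  let ?m = "max s (max t u)"
  have "s + t + u \<le> ?m + ?m + ?m" by (intro add_mono) (auto simp: le_max_iff_disj)
  also have "\<dots> = (1 + 1 + 1) * ?m" by (simp only: distrib_right mult_1_left)
  also have "(1 + 1 + 1 :: ennreal) = ennreal 3" by simp
  finally have "epowr (s + t + u) p \<le> epowr (ennreal 3 * ?m) p" using assms by (intro epowr_mono) auto
  also have "\<dots> = ennreal (3 powr p) * epowr ?m p" by (rule epowr_mult) simp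
  also have "epowr ?m p \<le> epowr s p + epowr t p + epowr u p"
    by (auto simp: max_def add_increasing add_increasing2)
  finally show ?thesis by (simp add: mult_left_mono)
qed

text \<open>The graph of s^p lies above its tangent at y; obtained from Young's inequality with
  exponents p and p / (p - 1). It linearises the p-th power before integration.\<close>

lemma powr_tangent_le:
  fixes p s y :: real
  assumes p: "1 < p" and s: "0 \<le> s" and y: "0 < y"
  shows "p * y powr (p - 1) * s \<le> s powr p + (p - 1) * y powr p"
proof -
  define q where "q = p / (p - 1)"
  have q: "q > 1" "1 / p + 1 / q = 1" "(p - 1) * q = p" "p / q = p - 1" using p by (auto simp: q_def field_simps)
  have "s * y powr (p - 1) \<le> s powr p / p + (y powr (p - 1)) powr q / q"
    using p q s by (intro Youngs_inequality) auto
  also have "(y powr (p - 1)) powr q = y powr p" using q(3) by (simp add: powr_powr)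
  finally have "p * (s * y powr (p - 1)) \<le> p * (s powr p / p + y powr p / q)"
    using p by (intro mult_left_mono) auto
  also have "\<dots> = s powr p + (p / q) * y powr p" using p by (simp add: algebra_simps)
  finally show ?thesis using q(4) by (simp add: mult_ac)
qed

text \<open>Jensen's inequality for extended values: the tangent inequality is integrated first and
  the tangent point chosen afterwards.\<close>

lemma nn_integral_powr_le:
  fixes f :: "'a \<Rightarrow> ennreal"
  assumes p: "1 < p" and f [measurable]: "f \<in> borel_measurable M" and m: "emeasure M (space M) \<le> ennreal m" "0 < m"
  shows "epowr (\<integral>\<^sup>+x. f x \<partial>M) p \<le> ennreal (m powr (p - 1)) * (\<integral>\<^sup>+x. epowr (f x) p \<partial>M)"
proof (cases "(\<integral>\<^sup>+x. epowr (f x) p \<partial>M) = \<infinity>")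
  case True
  then show ?thesis using m(2) by (simp add: ennreal_mult_top)
next
  case False
  let ?I = "\<integral>\<^sup>+x. f x \<partial>M" and ?J = "\<integral>\<^sup>+x. epowr (f x) p \<partial>M"
  have tan: "ennreal (p * y powr (p - 1)) * ?I \<le> ?J + ennreal ((p - 1) * y powr p * m)" if y: "0 < y" for y
  proof -
    have pt: "ennreal (p * y powr (p - 1)) * f x \<le> epowr (f x) p + ennreal ((p - 1) * y powr p)" for x
    proof (cases "f x")
      case (real r)
      then show ?thesis using powr_tangent_le[OF p real(1) y] p
        by (simp add: epowr_ennreal flip: ennreal_mult ennreal_plus)
    qed (simp add: epowr_top)
    have "ennreal (p * y powr (p - 1)) * ?I = (\<integral>\<^sup>+x. ennreal (p * y powr (p - 1)) * f x \<partial>M)"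
      by (rule nn_integral_cmult[symmetric]) measurable
    also have "\<dots> \<le> (\<integral>\<^sup>+x. epowr (f x) p + ennreal ((p - 1) * y powr p) \<partial>M)"
      by (rule nn_integral_mono) (rule pt)
    also have "\<dots> = ?J + ennreal ((p - 1) * y powr p) * emeasure M (space M)"
      by (subst nn_integral_add) auto
    also have "\<dots> \<le> ?J + ennreal ((p - 1) * y powr p) * ennreal m"
      by (intro add_left_mono mult_left_mono m) auto
    finally show ?thesis using p m(2) by (simp add: ennreal_mult)
  qed
  obtain j where j: "?J = ennreal j" "0 \<le> j" using False by (cases ?J) auto
  \<comment> \<open>The tangent at 1 already bounds the integral of \<open>f\<close> by that of its
    p-th power.\<close>
  have "?I \<noteq> \<infinity>"
  proof
    assume "?I = \<infinity>"
    then have "top \<le> ennreal j + ennreal ((p - 1) * m)"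
      using tan[of 1] p by (simp add: j ennreal_mult_top)
    then show False by (simp add: top_unique)
  qed
  then obtain i where i: "?I = ennreal i" "0 \<le> i" by (cases ?I) auto
  show ?thesis
  proof (cases "i = 0")
    case True
    then show ?thesis using i by simp
  next
    case False
    then have i0: "0 < i" using i by simp
    \<comment> \<open>The optimal tangent point: the mean value relative to the bound
      \<open>m\<close>.\<close>
    define y where "y = i / m"
    have y: "0 < y" "y * m = i" using i0 m by (auto simp: y_def)
    have "ennreal (p * y powr (p - 1) * i) \<le> ennreal (j + (p - 1) * y powr p * m)"
      using tan[OF y(1)] p m(2) i(2) j(2) by (simp add: i j ennreal_mult ennreal_plus)
    then have "p * y powr (p - 1) * i \<le> j + (p - 1) * y powr p * m"
      using p m(2) j(2) by (subst (asm) ennreal_le_iff) auto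
    moreover have "y powr p * m = y powr (p - 1) * i"
      using y powr_add[of y "p - 1" 1] by simp
    ultimately have "p * (y powr (p - 1) * i) \<le> j + (p - 1) * (y powr (p - 1) * i)"
      by (simp only: mult.assoc)
    then have "y powr (p - 1) * i \<le> j" by (simp only: left_diff_distrib)
    then have "m powr (p - 1) * (y powr (p - 1) * i) \<le> m powr (p - 1) * j" by (intro mult_left_mono) auto
    moreover have "m powr (p - 1) * (y powr (p - 1) * i) = i powr p"
    proof -
      have "m powr (p - 1) * y powr (p - 1) = i powr (p - 1)"
        using y m by (metis powr_mult mult.commute less_imp_le)
      then show ?thesis using i0 powr_add[of i "p - 1" 1] by (simp add: mult.assoc[symmetric])
    qed
    ultimately show ?thesis using i j by (simp add: epowr_ennreal flip: ennreal_mult)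
  qed
qed

lemma nn_integral_powr_le_weight:
  fixes f w :: "'a \<Rightarrow> ennreal"
  assumes p: "1 < p" and [measurable]: "f \<in> borel_measurable M" "w \<in> borel_measurable M"
    and m: "(\<integral>\<^sup>+x. w x \<partial>M) \<le> ennreal m" "0 < m"
  shows "epowr (\<integral>\<^sup>+x. w x * f x \<partial>M) p \<le> ennreal (m powr (p - 1)) * (\<integral>\<^sup>+x. w x * epowr (f x) p \<partial>M)"
proof -
  have "emeasure (density M w) (space (density M w)) = (\<integral>\<^sup>+x. w x \<partial>M)"
    by (subst emeasure_density) (auto intro!: nn_integral_cong)
  then have "epowr (\<integral>\<^sup>+x. f x \<partial>density M w) p \<le> ennreal (m powr (p - 1)) * (\<integral>\<^sup>+x. epowr (f x) p \<partial>density M w)"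
    using m by (intro nn_integral_powr_le[OF p]) auto
  then show ?thesis by (simp add: nn_integral_density)
qed

lemma nn_integral_powr_le_set:
  fixes f :: "'a \<Rightarrow> ennreal"
  assumes p: "1 < p" and [measurable]: "f \<in> borel_measurable M" "A \<in> sets M"
    and m: "emeasure M A \<le> ennreal m" "0 < m"
  shows "epowr (\<integral>\<^sup>+x\<in>A. f x \<partial>M) p \<le> ennreal (m powr (p - 1)) * (\<integral>\<^sup>+x\<in>A. epowr (f x) p \<partial>M)"
  using nn_integral_powr_le_weight[OF p, of f M "indicator A" m] m by (simp add: mult.commute)

section \<open>Power weights, Hardy's inequality and polar coordinates\<close>

lemma nn_integral_powr_from_0:
  assumes "0 < \<kappa>" "0 \<le> r"
  shows "(\<integral>\<^sup>+s\<in>{0<..<r}. ennreal (s powr (\<kappa> - 1)) \<partial>lborel) = ennreal (r powr \<kappa> / \<kappa>)"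
proof -
  have "((\<lambda>s. s powr (\<kappa> - 1)) has_integral (r powr (\<kappa> - 1 + 1) / (\<kappa> - 1 + 1))) {0..r}"
    using assms by (intro has_integral_powr_from_0) auto
  then have "(\<integral>\<^sup>+s. ennreal (s powr (\<kappa> - 1)) * indicator {0..r} s \<partial>lborel) = ennreal (r powr \<kappa> / \<kappa>)"
    by (intro nn_integral_has_integral_lebesgue') auto
  also have "(\<integral>\<^sup>+s. ennreal (s powr (\<kappa> - 1)) * indicator {0..r} s \<partial>lborel) = (\<integral>\<^sup>+s\<in>{0<..<r}. ennreal (s powr (\<kappa> - 1)) \<partial>lborel)"
  proof (rule nn_integral_cong_AE)
    show "AE s in lborel. ennreal (s powr (\<kappa> - 1)) * indicator {0..r} s = ennreal (s powr (\<kappa> - 1)) * indicator {0<..<r} s"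
      using AE_lborel_singleton[of "0::real"] AE_lborel_singleton[of r]
    proof eventually_elim
      case (elim s)
      then show ?case by (auto simp: indicator_def)
    qed
  qed
  finally show ?thesis .
qed

lemma nn_integral_powr_tail:
  assumes "0 < \<kappa>" "0 < s"
  shows "(\<integral>\<^sup>+r\<in>{s..}. ennreal (r powr (- 1 - \<kappa>)) \<partial>lborel) = ennreal (s powr (- \<kappa>) / \<kappa>)"
proof -
  have "(\<integral>\<^sup>+r. ennreal (r powr (- 1 - \<kappa>)) * indicator {s..} r \<partial>lborel) = ennreal (0 - (- (s powr (- \<kappa>) / \<kappa>)))"
  proof (rule nn_integral_FTC_atLeast)
    fix r assume "s \<le> r"
    then have r: "0 < r" using assms by simp
    have "((\<lambda>r. - (r powr (- \<kappa>) / \<kappa>)) has_real_derivative - (- \<kappa> * r powr (- \<kappa> - 1) / \<kappa>)) (at r)"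
      using r by (intro DERIV_minus DERIV_cdivide has_real_derivative_powr)
    moreover have "- (- \<kappa> * r powr (- \<kappa> - 1) / \<kappa>) = r powr (- \<kappa> - 1)" using assms(1) by simp
    moreover have "- \<kappa> - 1 = - 1 - \<kappa>" by simp
    ultimately show "((\<lambda>r. - (r powr (- \<kappa>) / \<kappa>)) has_real_derivative r powr (- 1 - \<kappa>)) (at r)" by (simp only:)
  next
    have "((\<lambda>r. - (r powr (- \<kappa>) / \<kappa>)) \<longlongrightarrow> - (0 / \<kappa>)) at_top"
      using assms by (intro tendsto_minus tendsto_divide tendsto_const tendsto_neg_powr filterlim_ident) auto
    then show "((\<lambda>r. - (r powr (- \<kappa>) / \<kappa>)) \<longlongrightarrow> 0) at_top" by simp
  qed auto
  then show ?thesis by simp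
qed

lemma ennreal_mult_rearrange:
  "0 \<le> a \<Longrightarrow> 0 \<le> b \<Longrightarrow> 0 \<le> d \<Longrightarrow> (ennreal a * (ennreal b * t)) * ennreal d = ennreal (a * (b * d)) * t"
  by (simp add: ennreal_mult mult_ac)

text \<open>Jensen with the weight s^(-1/p) on (0, r), followed by Fubini. With \<kappa> = 1 - 1/p
  both s^(\<kappa>-1) near 0 and r^(-1-\<kappa>) at infinity are integrable. The first contributes
  \<kappa>^(-(p-1)), the second 1/\<kappa>, which gives the classical constant (p/(p-1))^p.\<close>

lemma hardy_inequality:
  fixes g :: "real \<Rightarrow> ennreal"
  assumes p: "1 < p" and [measurable]: "g \<in> borel_measurable borel"
  defines "\<kappa> \<equiv> 1 - 1 / p"
  shows "(\<integral>\<^sup>+r\<in>{0<..<L}. ennreal (r powr (- p)) * epowr (\<integral>\<^sup>+s\<in>{0<..<r}. g s \<partial>lborel) p \<partial>lborel)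
    \<le> ennreal (\<kappa> powr (- p)) * (\<integral>\<^sup>+s\<in>{0<..<L}. epowr (g s) p \<partial>lborel)"
proof -
  have \<kappa>: "0 < \<kappa>" "\<kappa> < 1" "\<kappa> * (p - 1) - p = - 1 - \<kappa>" "- 1 / p + 1 = \<kappa>" "\<kappa> - 1 = - 1 / p"
    using p by (auto simp: \<kappa>_def field_simps)
  have inner: "epowr (\<integral>\<^sup>+s\<in>{0<..<r}. g s \<partial>lborel) p
     \<le> ennreal ((r powr \<kappa> / \<kappa>) powr (p - 1)) * (\<integral>\<^sup>+s\<in>{0<..<r}. ennreal (s powr \<kappa>) * epowr (g s) p \<partial>lborel)" if r: "0 < r" for r
  proof -
    \<comment> \<open>On (0, r) the product \<open>?w s * ?f s\<close> is \<open>g s\<close>, while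
      \<open>?w s * epowr (?f s) p\<close> is s^\<kappa> times the p-th power of \<open>g s\<close>;
      the factor s^\<kappa> later cancels against the tail integral over r.\<close>
    let ?w = "\<lambda>s. ennreal (s powr (\<kappa> - 1)) * indicator {0<..<r} s"
    let ?f = "\<lambda>s. ennreal (s powr (1 / p)) * g s"
    have "epowr (\<integral>\<^sup>+s. ?w s * ?f s \<partial>lborel) p \<le> ennreal ((r powr \<kappa> / \<kappa>) powr (p - 1)) * (\<integral>\<^sup>+s. ?w s * epowr (?f s) p \<partial>lborel)"
    proof (rule nn_integral_powr_le_weight[OF p])
      show "(\<integral>\<^sup>+s. ?w s \<partial>lborel) \<le> ennreal (r powr \<kappa> / \<kappa>)"
        using nn_integral_powr_from_0[OF \<kappa>(1), of r] r by (simp only: order_refl less_imp_le)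
      show "0 < r powr \<kappa> / \<kappa>" using r \<kappa>(1) by simp
      show "?w \<in> borel_measurable lborel" by measurable
      show "?f \<in> borel_measurable lborel" by measurable
    qed
    moreover have "?w s * ?f s = g s * indicator {0<..<r} s" for s
    proof (cases "s \<in> {0<..<r}")
      case True
      then have "ennreal (s powr (\<kappa> - 1)) * ennreal (s powr (1 / p)) = 1"
        by (simp add: \<kappa>(5) flip: ennreal_mult powr_add)
      then show ?thesis using True by (simp add: mult.assoc[symmetric])
    qed simp
    moreover have "?w s * epowr (?f s) p = ennreal (s powr \<kappa>) * epowr (g s) p * indicator {0<..<r} s" for s
    proof (cases "s \<in> {0<..<r}")
      case True
      then have s: "0 < s" by simp
      have "epowr (?f s) p = ennreal (s powr 1) * epowr (g s) p"
        using s p by (subst epowr_mult) (simp_all add: powr_powr)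
      moreover have "ennreal (s powr (\<kappa> - 1)) * ennreal (s powr 1) = ennreal (s powr \<kappa>)"
        using powr_add[of s "\<kappa> - 1" 1] by (simp flip: ennreal_mult)
      ultimately show ?thesis using True by (simp add: mult.assoc[symmetric])
    qed simp
    ultimately show ?thesis by simp
  qed
  let ?c = "\<kappa> powr (- (p - 1))"
  let ?F = "\<lambda>r s. ennreal (?c * r powr (- 1 - \<kappa>)) * (ennreal (s powr \<kappa>) * epowr (g s) p * indicator {0<..<r} s) * indicator {0<..<L} r"
  have "(\<integral>\<^sup>+r\<in>{0<..<L}. ennreal (r powr (- p)) * epowr (\<integral>\<^sup>+s\<in>{0<..<r}. g s \<partial>lborel) p \<partial>lborel)
    \<le> (\<integral>\<^sup>+r. (\<integral>\<^sup>+s. ?F r s \<partial>lborel) \<partial>lborel)"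
  proof (rule nn_integral_mono)
    fix r :: real
    show "ennreal (r powr (- p)) * epowr (\<integral>\<^sup>+s\<in>{0<..<r}. g s \<partial>lborel) p * indicator {0<..<L} r \<le> (\<integral>\<^sup>+s. ?F r s \<partial>lborel)"
    proof (cases "r \<in> {0<..<L}")
      case True
      then have r: "0 < r" by simp
      have e: "r powr (- p) * (r powr \<kappa> / \<kappa>) powr (p - 1) = ?c * r powr (- 1 - \<kappa>)"
      proof -
        have "(r powr \<kappa> / \<kappa>) powr (p - 1) = r powr (\<kappa> * (p - 1)) * ?c"
        proof -
          have "(r powr \<kappa> / \<kappa>) powr (p - 1) = r powr (\<kappa> * (p - 1)) / \<kappa> powr (p - 1)"
            using \<kappa>(1) by (simp add: powr_divide powr_powr)
          then show ?thesis by (simp only: powr_minus divide_inverse)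
        qed
        moreover have "r powr (- p) * r powr (\<kappa> * (p - 1)) = r powr (- 1 - \<kappa>)"
          using \<kappa>(3) by (simp flip: powr_add)
        ultimately show ?thesis by (simp add: mult.assoc[symmetric] mult.commute)
      qed
      have "ennreal (r powr (- p)) * epowr (\<integral>\<^sup>+s\<in>{0<..<r}. g s \<partial>lborel) p \<le>
        ennreal (r powr (- p)) * (ennreal ((r powr \<kappa> / \<kappa>) powr (p - 1)) * (\<integral>\<^sup>+s\<in>{0<..<r}. ennreal (s powr \<kappa>) * epowr (g s) p \<partial>lborel))"
        by (intro mult_left_mono inner r) auto
      also have "\<dots> = ennreal (?c * r powr (- 1 - \<kappa>)) * (\<integral>\<^sup>+s\<in>{0<..<r}. ennreal (s powr \<kappa>) * epowr (g s) p \<partial>lborel)"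
        by (simp add: mult.assoc[symmetric] e flip: ennreal_mult)
      also have "\<dots> = (\<integral>\<^sup>+s. ?F r s \<partial>lborel)"
        using True by (simp add: nn_integral_cmult)
      finally show ?thesis using True by simp
    qed simp
  qed
  also have "\<dots> = (\<integral>\<^sup>+s. (\<integral>\<^sup>+r. ?F r s \<partial>lborel) \<partial>lborel)"
  proof (rule lborel_pair.Fubini'[symmetric])
    have "(\<lambda>(r, s). ?F r s) = (\<lambda>z. if 0 < snd z \<and> snd z < fst z \<and> fst z < L then
        ennreal (?c * fst z powr (- 1 - \<kappa>)) * (ennreal (snd z powr \<kappa>) * epowr (g (snd z)) p) else 0)"
      by (auto simp: fun_eq_iff indicator_def)
    then show "(\<lambda>(r, s). ?F r s) \<in> borel_measurable (lborel \<Otimes>\<^sub>M lborel)" by simp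
  qed
  also have "\<dots> \<le> (\<integral>\<^sup>+s. ennreal (\<kappa> powr (- p)) * (epowr (g s) p * indicator {0<..<L} s) \<partial>lborel)"
  proof (rule nn_integral_mono)
    fix s :: real
    show "(\<integral>\<^sup>+r. ?F r s \<partial>lborel) \<le> ennreal (\<kappa> powr (- p)) * (epowr (g s) p * indicator {0<..<L} s)"
    proof (cases "s \<in> {0<..<L}")
      case True
      then have s: "0 < s" by simp
      have "(\<integral>\<^sup>+r. ?F r s \<partial>lborel) \<le> (\<integral>\<^sup>+r. (ennreal ?c * (ennreal (s powr \<kappa>) * epowr (g s) p)) * (ennreal (r powr (- 1 - \<kappa>)) * indicator {s..} r) \<partial>lborel)"
        by (intro nn_integral_mono) (auto simp: indicator_def ennreal_mult mult_ac)
      also have "\<dots> = (ennreal ?c * (ennreal (s powr \<kappa>) * epowr (g s) p)) * ennreal (s powr (- \<kappa>) / \<kappa>)"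
        using s \<kappa> by (subst nn_integral_cmult) (auto simp: nn_integral_powr_tail)
      also have "\<dots> = ennreal (?c * (s powr \<kappa> * (s powr (- \<kappa>) / \<kappa>))) * epowr (g s) p"
        by (rule ennreal_mult_rearrange) (use \<kappa>(1) in auto)
      also have "?c * (s powr \<kappa> * (s powr (- \<kappa>) / \<kappa>)) = \<kappa> powr (- p)"
        using s \<kappa> powr_add[of \<kappa> "- p" 1] by (simp add: powr_minus field_simps)
      finally show ?thesis using True by simp
    next
      case False
      have "?F r s = 0" for r
      proof -
        have "s \<notin> {0<..<r} \<or> r \<notin> {0<..<L}" using False by auto
        then show ?thesis by (elim disjE) (simp_all only: indicator_simps mult_zero_left mult_zero_right not_False_eq_True)
      qed
      then show ?thesis by (simp only: nn_integral_const mult_zero_left zero_le)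
    qed
  qed
  also have "\<dots> = ennreal (\<kappa> powr (- p)) * (\<integral>\<^sup>+s\<in>{0<..<L}. epowr (g s) p \<partial>lborel)"
    by (rule nn_integral_cmult) measurable
  finally show ?thesis .
qed

text \<open>Polar coordinates for radial functions, read off from the volumes of balls: both
  measures agree on all half-lines.\<close>

lemma distr_norm_lborel:
  "distr (lborel :: 'a::euclidean_space measure) borel norm =
    density lborel (\<lambda>r. ennreal (DIM('a) * unit_ball_vol DIM('a) * r powr (real DIM('a) - 1)) * indicator {0<..} r)"
  (is "?D = ?E")
proof -
  let ?n = "real DIM('a)" and ?w = "unit_ball_vol (real DIM('a))"
  have D: "emeasure ?D {..x} = ennreal (if 0 \<le> x then ?w * x powr ?n else 0)" for x
  proof -
    have "norm -` {..x} \<inter> space lborel = cball (0::'a) x" by (auto simp: dist_norm)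
    then have "emeasure ?D {..x} = emeasure lborel (cball (0::'a) x)"
      by (subst emeasure_distr) auto
    then show ?thesis by (cases "0 \<le> x") (simp_all add: emeasure_cball powr_realpow')
  qed
  have E: "emeasure ?E {..x} = ennreal (if 0 \<le> x then ?w * x powr ?n else 0)" for x
  proof -
    have "emeasure ?E {..x} = (\<integral>\<^sup>+r. ennreal (?n * ?w) * (ennreal (r powr (?n - 1)) * indicator {0<..<x} r) \<partial>lborel)"
      using AE_lborel_singleton[of x]
      by (subst emeasure_density) (auto intro!: nn_integral_cong_AE elim!: eventually_mono simp: indicator_def ennreal_mult)
    also have "\<dots> = ennreal (?n * ?w) * (\<integral>\<^sup>+r\<in>{0<..<x}. ennreal (r powr (?n - 1)) \<partial>lborel)"
      by (rule nn_integral_cmult) measurable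
    also have "\<dots> = ennreal (if 0 \<le> x then ?w * x powr ?n else 0)"
      by (cases "0 \<le> x") (auto simp: nn_integral_powr_from_0 simp flip: ennreal_mult)
    finally show ?thesis .
  qed
  show ?thesis
  proof (rule measure_eqI_generator_eq[where E="range atMost" and \<Omega>=UNIV and A="\<lambda>n::nat. {..real n}"])
    show "Int_stable (range (atMost :: real \<Rightarrow> real set))" by (auto simp: Int_stable_def)
    show "sets ?D = sigma_sets UNIV (range atMost)" "sets ?E = sigma_sets UNIV (range atMost)"
      by (simp_all add: borel_eq_atMost)
    show "(\<Union>n. {..real n}) = UNIV" by (auto intro: real_arch_simple)
    fix X :: "real set" assume "X \<in> range atMost"
    then obtain x where X: "X = {..x}" by auto
    show "emeasure ?D X = emeasure ?E X" unfolding X D E ..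
  next
    show "emeasure ?D {..real n} \<noteq> \<infinity>" for n :: nat unfolding D by simp
  qed auto
qed


lemma nn_integral_radial:
  fixes F :: "real \<Rightarrow> ennreal"
  assumes [measurable]: "F \<in> borel_measurable borel"
  shows "(\<integral>\<^sup>+h\<in>ball (0::'a::euclidean_space) L. F (norm h) \<partial>lborel) =
    ennreal (DIM('a) * unit_ball_vol DIM('a)) * (\<integral>\<^sup>+r\<in>{0<..<L}. ennreal (r powr (real DIM('a) - 1)) * F r \<partial>lborel)"
proof -
  let ?n = "real DIM('a)" and ?w = "unit_ball_vol (real DIM('a))"
  have "(\<integral>\<^sup>+h\<in>ball (0::'a) L. F (norm h) \<partial>lborel) = (\<integral>\<^sup>+h. F (norm h) * indicator {..<L} (norm h) \<partial>(lborel :: 'a measure))"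
    by (intro nn_integral_cong) (auto simp: indicator_def)
  also have "\<dots> = (\<integral>\<^sup>+r. F r * indicator {..<L} r \<partial>distr (lborel :: 'a measure) borel norm)"
    by (subst nn_integral_distr) auto
  also have "\<dots> = (\<integral>\<^sup>+r. ennreal (?n * ?w) * (ennreal (r powr (?n - 1)) * F r * indicator {0<..<L} r) \<partial>lborel)"
    unfolding distr_norm_lborel
    by (subst nn_integral_density) (auto intro!: nn_integral_cong simp: indicator_def ennreal_mult mult_ac)
  also have "\<dots> = ennreal (?n * ?w) * (\<integral>\<^sup>+r\<in>{0<..<L}. ennreal (r powr (?n - 1)) * F r \<partial>lborel)"
    by (rule nn_integral_cmult) measurable
  finally show ?thesis .
qed

text \<open>A height \<rho> lies in (r/2, r) exactly for r in (\<rho>, 2\<rho>), an interval of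
  length \<rho> on which 1/r < 1/\<rho>.\<close>

lemma nn_integral_dyadic_shell:
  assumes [measurable]: "\<Gamma> \<in> borel_measurable borel" 
  shows "(\<integral>\<^sup>+r\<in>{0<..<L}. ennreal (1 / r) * (\<integral>\<^sup>+\<rho>\<in>{r/2<..<r}. \<Gamma> \<rho> \<partial>lborel) \<partial>lborel) \<le> (\<integral>\<^sup>+\<rho>\<in>{0<..<L}. \<Gamma> \<rho> \<partial>lborel)"
proof -
  let ?F = "\<lambda>r \<rho>. ennreal (1 / r) * (\<Gamma> \<rho> * indicator {r/2<..<r} \<rho>) * indicator {0<..<L} r"
  have Fm: "(\<lambda>(r, \<rho>). ?F r \<rho>) \<in> borel_measurable (lborel \<Otimes>\<^sub>M lborel)"
  proof -
    have "(\<lambda>(r, \<rho>). ?F r \<rho>) = (\<lambda>z. if fst z / 2 < snd z \<and> snd z < fst z \<and> 0 < fst z \<and> fst z < L then ennreal (1 / fst z) * \<Gamma> (snd z) else 0)"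
      by (auto simp: fun_eq_iff indicator_def)
    then show ?thesis by simp
  qed
  have "(\<integral>\<^sup>+r\<in>{0<..<L}. ennreal (1 / r) * (\<integral>\<^sup>+\<rho>\<in>{r/2<..<r}. \<Gamma> \<rho> \<partial>lborel) \<partial>lborel) = (\<integral>\<^sup>+r. (\<integral>\<^sup>+\<rho>. ?F r \<rho> \<partial>lborel) \<partial>lborel)"
    by (simp add: nn_integral_cmult nn_integral_multc)
  also have "\<dots> = (\<integral>\<^sup>+\<rho>. (\<integral>\<^sup>+r. ?F r \<rho> \<partial>lborel) \<partial>lborel)"
    by (rule lborel_pair.Fubini'[OF Fm, symmetric])
  also have "\<dots> \<le> (\<integral>\<^sup>+\<rho>\<in>{0<..<L}. \<Gamma> \<rho> \<partial>lborel)"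
  proof (rule nn_integral_mono)
    fix \<rho> :: real
    show "(\<integral>\<^sup>+r. ?F r \<rho> \<partial>lborel) \<le> \<Gamma> \<rho> * indicator {0<..<L} \<rho>"
    proof (cases "\<rho> \<in> {0<..<L}")
      case True
      have "(\<integral>\<^sup>+r. ?F r \<rho> \<partial>lborel) \<le> (\<integral>\<^sup>+r. (ennreal (1 / \<rho>) * \<Gamma> \<rho>) * indicator {\<rho>..2 * \<rho>} r \<partial>lborel)"
      proof (rule nn_integral_mono)
        fix r :: real
        show "?F r \<rho> \<le> (ennreal (1 / \<rho>) * \<Gamma> \<rho>) * indicator {\<rho>..2 * \<rho>} r"
        proof (cases "r / 2 < \<rho> \<and> \<rho> < r")
          case r: True
          have "ennreal (1 / r) \<le> ennreal (1 / \<rho>)" using True r by (intro ennreal_leI) (simp add: frac_le)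
          then show ?thesis using r by (simp add: indicator_def mult_right_mono)
        qed (auto simp: indicator_def)
      qed
      also have "\<dots> = ennreal (1 / \<rho>) * \<Gamma> \<rho> * ennreal \<rho>" using True by (simp add: nn_integral_cmult_indicator)
      also have "\<dots> = (ennreal (1 / \<rho>) * ennreal \<rho>) * \<Gamma> \<rho>" by (simp only: mult_ac)
      also have "ennreal (1 / \<rho>) * ennreal \<rho> = 1" using True by (simp flip: ennreal_mult)
      finally show ?thesis using True by simp
    next
      case False
      have "?F r \<rho> = 0" for r
      proof -
        have "\<rho> \<notin> {r/2<..<r} \<or> r \<notin> {0<..<L}" using False by auto
        then show ?thesis by (elim disjE) (simp_all only: indicator_simps mult_zero_left mult_zero_right not_False_eq_True)
      qed
      then show ?thesis by (simp only: nn_integral_const mult_zero_left zero_le)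
    qed
  qed
  finally show ?thesis .
qed

text \<open>\<open>n * unit_ball_vol n\<close> is the area of the unit sphere, from polar
  coordinates; \<open>3 powr p\<close> comes from splitting an increment into three parts.\<close>

definition seminorm_const :: "nat \<Rightarrow> real \<Rightarrow> real" where
  "seminorm_const n p = n * unit_ball_vol n * 3 powr p"

text \<open>For \<open>r = norm h\<close>, compare \<open>f (x + h)\<close> and \<open>f x\<close> with \<open>U\<close> at a height \<open>\<rho>\<close> that is averaged over
  \<open>{r/2<..<r}\<close>: the vertical increments are handled by Hardy's inequality, the horizontal one by the
  hypothesis on difference quotients.\<close>

lemma fixed_translation_estimate:
  fixes f :: "'a::euclidean_space \<Rightarrow> real" and U :: "'a \<times> real \<Rightarrow> real" and g :: "'a \<times> real \<Rightarrow> ennreal"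
  assumes p: "1 < p" and meas [measurable]: "f \<in> borel_measurable borel" "U \<in> borel_measurable borel" "g \<in> borel_measurable borel"
    and vert: "AE z in lborel. snd z \<in> {0<..<L} \<longrightarrow>
      ennreal \<bar>U z - f (fst z)\<bar> \<le> (\<integral>\<^sup>+s\<in>{0<..<snd z}. g (fst z, s) \<partial>lborel)"
    and r: "0 < r" "r < L"
  shows "(\<integral>\<^sup>+x. ennreal (\<bar>f (x + h) - f x\<bar> powr p) \<partial>lborel) \<le> ennreal (3 powr p) *
    (2 * (\<integral>\<^sup>+x. epowr (\<integral>\<^sup>+s\<in>{0<..<r}. g (x, s) \<partial>lborel) p \<partial>lborel) +
     ennreal (2 / r) * (\<integral>\<^sup>+\<rho>\<in>{r/2<..<r}. (\<integral>\<^sup>+x. ennreal (\<bar>U (x + h, \<rho>) - U (x, \<rho>)\<bar> powr p) \<partial>lborel) \<partial>lborel))"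
proof -
  define A where "A x = (\<integral>\<^sup>+s\<in>{0<..<r}. g (x, s) \<partial>lborel)" for x
  have gp [measurable]: "g \<in> borel_measurable (lborel \<Otimes>\<^sub>M lborel)" by (simp add: lborel_prod)
  have Up [measurable]: "U \<in> borel_measurable (borel \<Otimes>\<^sub>M borel)" by (simp add: borel_prod)
  have Am [measurable]: "A \<in> borel_measurable borel"
  proof -
    have "(\<lambda>x. \<integral>\<^sup>+s. g (x, s) * indicator {0<..<r} s \<partial>lborel) \<in> borel_measurable lborel"
      by (rule lborel.borel_measurable_nn_integral) measurable
    then show ?thesis by (simp add: A_def[abs_def])
  qed
  let ?I = "{r/2<..<r}"
  let ?D = "\<lambda>x. ennreal (\<bar>f (x + h) - f x\<bar> powr p)"
  let ?E = "\<lambda>x \<rho>. ennreal (\<bar>U (x + h, \<rho>) - U (x, \<rho>)\<bar> powr p)"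
  let ?S = "\<lambda>x \<rho>. ennreal (3 powr p) * (epowr (A (x + h)) p + epowr (A x) p + ?E x \<rho>)"
  \<comment> \<open>The vertical comparison at x + h: the exceptional null set is
    translated.\<close>
  have v2: "AE z in lborel. snd (z + (h, 0)) \<in> {0<..<L} \<longrightarrow>
      ennreal \<bar>U (z + (h, 0)) - f (fst (z + (h, 0)))\<bar> \<le> (\<integral>\<^sup>+s\<in>{0<..<snd (z + (h, 0))}. g (fst (z + (h, 0)), s) \<partial>lborel)"
    by (rule AE_lborel_shift[OF vert])
  have AE: "AE z in lborel. ?D (fst z) * indicator ?I (snd z) \<le> ?S (fst z) (snd z) * indicator ?I (snd z)"
    using vert v2
  proof eventually_elim
    case (elim z)
    obtain x \<rho> where z: "z = (x, \<rho>)" by (cases z)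
    show ?case
    proof (cases "\<rho> \<in> ?I")
      case True
      then have \<rho>: "\<rho> \<in> {0<..<L}" "\<rho> < r" using r by auto
      have mono: "(\<integral>\<^sup>+s\<in>{0<..<\<rho>}. g (y, s) \<partial>lborel) \<le> A y" for y
        unfolding A_def using \<rho> by (intro nn_integral_mono) (auto simp: indicator_def)
      have 1: "ennreal \<bar>U (x, \<rho>) - f x\<bar> \<le> A x" using elim(1) \<rho> mono[of x] by (auto simp: z)
      have 2: "ennreal \<bar>U (x + h, \<rho>) - f (x + h)\<bar> \<le> A (x + h)" using elim(2) \<rho> mono[of "x + h"] by (auto simp: z)
      have "\<bar>f (x + h) - f x\<bar> \<le> \<bar>U (x + h, \<rho>) - f (x + h)\<bar> + \<bar>U (x, \<rho>) - f x\<bar> + \<bar>U (x + h, \<rho>) - U (x, \<rho>)\<bar>" by linarith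
      then have "ennreal \<bar>f (x + h) - f x\<bar> \<le> ennreal \<bar>U (x + h, \<rho>) - f (x + h)\<bar> + ennreal \<bar>U (x, \<rho>) - f x\<bar> + ennreal \<bar>U (x + h, \<rho>) - U (x, \<rho>)\<bar>"
        by (simp add: ennreal_leI flip: ennreal_plus)
      also have "\<dots> \<le> A (x + h) + A x + ennreal \<bar>U (x + h, \<rho>) - U (x, \<rho>)\<bar>" using 1 2 by (intro add_mono) auto
      finally have "epowr (ennreal \<bar>f (x + h) - f x\<bar>) p \<le> epowr (A (x + h) + A x + ennreal \<bar>U (x + h, \<rho>) - U (x, \<rho>)\<bar>) p"
        using p by (intro epowr_mono) auto
      also have "\<dots> \<le> ennreal (3 powr p) * (epowr (A (x + h)) p + epowr (A x) p + epowr (ennreal \<bar>U (x + h, \<rho>) - U (x, \<rho>)\<bar>) p)"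
        using p by (intro epowr_add3_le) auto
      finally show ?thesis using True by (simp add: z epowr_ennreal)
    qed (simp add: z)
  qed
  have AE': "AE z in lborel \<Otimes>\<^sub>M lborel. ?D (fst z) * indicator ?I (snd z) \<le> ?S (fst z) (snd z) * indicator ?I (snd z)"
    using AE by (simp only: lborel_prod)
  have shift: "(\<integral>\<^sup>+x. epowr (A (x + h)) p \<partial>lborel) = (\<integral>\<^sup>+x. epowr (A x) p \<partial>lborel)"
    by (rule nn_integral_lborel_shift[of "\<lambda>x. epowr (A x) p"]) measurable
  let ?B = "\<integral>\<^sup>+x. epowr (A x) p \<partial>lborel" and ?C = "\<integral>\<^sup>+\<rho>\<in>?I. (\<integral>\<^sup>+x. ?E x \<rho> \<partial>lborel) \<partial>lborel"
  have eI: "emeasure lborel ?I = ennreal (r / 2)" using r by simp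
  have Em [measurable]: "(\<lambda>(\<rho>, x). ?E x \<rho>) \<in> borel_measurable (lborel \<Otimes>\<^sub>M lborel)" by measurable
  \<comment> \<open>The factor r / 2 is the length of \<open>?I\<close> and lets the integral over
    \<rho> in; it is divided out again at the end.\<close>
  have "ennreal (r / 2) * (\<integral>\<^sup>+x. ?D x \<partial>lborel) = (\<integral>\<^sup>+x. ?D x \<partial>lborel) * ennreal (r / 2)"
    by (rule mult.commute)
  also have "\<dots> = (\<integral>\<^sup>+x. ?D x * ennreal (r / 2) \<partial>lborel)"
    by (rule nn_integral_multc[symmetric]) measurable
  also have "\<dots> = (\<integral>\<^sup>+x. (\<integral>\<^sup>+\<rho>. ?D x * indicator ?I \<rho> \<partial>lborel) \<partial>lborel)"
    using r by (simp add: nn_integral_cmult_indicator)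
  also have "\<dots> = (\<integral>\<^sup>+z. ?D (fst z) * indicator ?I (snd z) \<partial>(lborel \<Otimes>\<^sub>M lborel))"
    by (subst lborel.nn_integral_fst[symmetric]) (auto simp: case_prod_beta')
  also have "\<dots> \<le> (\<integral>\<^sup>+z. ?S (fst z) (snd z) * indicator ?I (snd z) \<partial>(lborel \<Otimes>\<^sub>M lborel))"
    by (rule nn_integral_mono_AE[OF AE'])
  also have "\<dots> = (\<integral>\<^sup>+\<rho>. (\<integral>\<^sup>+x. ?S x \<rho> * indicator ?I \<rho> \<partial>lborel) \<partial>lborel)"
    by (subst lborel_pair.nn_integral_snd[symmetric]) (auto simp: case_prod_beta')
  also have "\<dots> = (\<integral>\<^sup>+\<rho>. ennreal (3 powr p) * ((?B + ?B) * indicator ?I \<rho> + (\<integral>\<^sup>+x. ?E x \<rho> \<partial>lborel) * indicator ?I \<rho>) \<partial>lborel)"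
  proof (rule nn_integral_cong)
    fix \<rho> :: real
    have "(\<integral>\<^sup>+x. ?S x \<rho> * indicator ?I \<rho> \<partial>lborel) = (\<integral>\<^sup>+x. ?S x \<rho> \<partial>lborel) * indicator ?I \<rho>"
      by (rule nn_integral_multc) measurable
    also have "(\<integral>\<^sup>+x. ?S x \<rho> \<partial>lborel) = ennreal (3 powr p) * (\<integral>\<^sup>+x. epowr (A (x + h)) p + epowr (A x) p + ?E x \<rho> \<partial>lborel)"
      by (rule nn_integral_cmult) measurable
    also have "(\<integral>\<^sup>+x. epowr (A (x + h)) p + epowr (A x) p + ?E x \<rho> \<partial>lborel) = (?B + ?B) + (\<integral>\<^sup>+x. ?E x \<rho> \<partial>lborel)"
      by (simp add: nn_integral_add shift)
    finally show "(\<integral>\<^sup>+x. ?S x \<rho> * indicator ?I \<rho> \<partial>lborel) = ennreal (3 powr p) * ((?B + ?B) * indicator ?I \<rho> + (\<integral>\<^sup>+x. ?E x \<rho> \<partial>lborel) * indicator ?I \<rho>)"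
      by (simp add: distrib_right mult.assoc)
  qed
  also have "\<dots> = ennreal (3 powr p) * ((?B + ?B) * ennreal (r / 2) + ?C)"
  proof -
    have [measurable]: "(\<lambda>\<rho>. \<integral>\<^sup>+x. ?E x \<rho> \<partial>lborel) \<in> borel_measurable lborel"
      using lborel.borel_measurable_nn_integral[OF Em] by simp
    show ?thesis using r by (simp add: nn_integral_cmult nn_integral_add nn_integral_cmult_indicator)
  qed
  finally have "ennreal (2 / r) * (ennreal (r / 2) * (\<integral>\<^sup>+x. ?D x \<partial>lborel)) \<le> ennreal (2 / r) * (ennreal (3 powr p) * ((?B + ?B) * ennreal (r / 2) + ?C))"
    by (rule mult_left_mono) simp
  moreover have c: "ennreal (2 / r) * ennreal (r / 2) = 1" using r by (simp flip: ennreal_mult)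
  have "ennreal (2 / r) * (ennreal (r / 2) * (\<integral>\<^sup>+x. ?D x \<partial>lborel)) = (\<integral>\<^sup>+x. ?D x \<partial>lborel)"
    by (simp only: mult.assoc[symmetric] c mult_1_left)
  moreover have "ennreal (2 / r) * (ennreal (3 powr p) * ((?B + ?B) * ennreal (r / 2) + ?C)) =
     ennreal (3 powr p) * ((?B + ?B) * (ennreal (2 / r) * ennreal (r / 2)) + ennreal (2 / r) * ?C)"
    by (simp only: distrib_left mult_ac)
  ultimately show ?thesis by (simp only: c mult_1_right mult_2 A_def)
qed

text \<open>In polar coordinates the kernel leaves r^(n-1) r^(-(p+n-1)) = r^(-p). For the vertical
  part this is precisely the weight in Hardy's inequality; for the horizontal part it cancels r^p
  and leaves the 1/r of \<open>nn_integral_dyadic_shell\<close>. \<open>U\<close>, \<open>g\<close>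
  and \<open>\<Gamma>\<close> are kept abstract so that one estimate serves both boundary
  hyperplanes.\<close>

lemma fractional_seminorm_estimate:
  fixes f :: "'a::euclidean_space \<Rightarrow> real" and U :: "'a \<times> real \<Rightarrow> real" and g :: "'a \<times> real \<Rightarrow> ennreal"
  assumes p: "1 < p" and meas [measurable]: "f \<in> borel_measurable borel" "U \<in> borel_measurable borel" "g \<in> borel_measurable borel"
      "\<Gamma> \<in> borel_measurable borel"
    and vert: "AE z in lborel. snd z \<in> {0<..<L} \<longrightarrow>
      ennreal \<bar>U z - f (fst z)\<bar> \<le> (\<integral>\<^sup>+s\<in>{0<..<snd z}. g (fst z, s) \<partial>lborel)"
    and hor: "\<And>h r. 0 < r \<Longrightarrow> r < L \<Longrightarrow>
      (\<integral>\<^sup>+\<rho>\<in>{r/2<..<r}. (\<integral>\<^sup>+x. ennreal (\<bar>U (x + h, \<rho>) - U (x, \<rho>)\<bar> powr p) \<partial>lborel) \<partial>lborel)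
      \<le> ennreal (norm h powr p) * (\<integral>\<^sup>+\<rho>\<in>{r/2<..<r}. \<Gamma> \<rho> \<partial>lborel)"
  shows "(\<integral>\<^sup>+x. (\<integral>\<^sup>+h\<in>ball 0 L. ennreal (\<bar>f (x + h) - f x\<bar> powr p / norm h powr (p + real (DIM('a) + 1) - 2)) \<partial>lborel) \<partial>lborel)
    \<le> ennreal (2 * seminorm_const DIM('a) p) *
      (ennreal ((1 - 1 / p) powr (- p)) * (\<integral>\<^sup>+x. (\<integral>\<^sup>+s\<in>{0<..<L}. epowr (g (x, s)) p \<partial>lborel) \<partial>lborel) + (\<integral>\<^sup>+\<rho>\<in>{0<..<L}. \<Gamma> \<rho> \<partial>lborel))"
    (is "?X \<le> ennreal _ * ?Y")
proof -
  let ?n = "real DIM('a)" and ?cn = "DIM('a) * unit_ball_vol (real DIM('a))"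
  let ?A = "\<lambda>r x. \<integral>\<^sup>+s\<in>{0<..<r}. g (x, s) \<partial>lborel"
  let ?B = "\<lambda>r. \<integral>\<^sup>+x. epowr (?A r x) p \<partial>lborel"
  let ?G = "\<lambda>r. \<integral>\<^sup>+\<rho>\<in>{r/2<..<r}. \<Gamma> \<rho> \<partial>lborel"
  have gp [measurable]: "g \<in> borel_measurable (borel \<Otimes>\<^sub>M borel)" by (simp add: borel_prod)
  define \<Phi> where "\<Phi> r = ennreal (1 / r powr (p + ?n - 1)) * (ennreal (3 powr p) * (2 * ?B r + ennreal (2 / r) * (ennreal (r powr p) * ?G r)))" for r
  \<comment> \<open>Joint measurability in (r, x): the moving domain of integration is encoded as a
    Borel condition on the variables.\<close>
  have Apair [measurable]: "(\<lambda>(r, x). ?A r x) \<in> borel_measurable (lborel \<Otimes>\<^sub>M lborel)"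
  proof -
    have "(\<lambda>(w, s). g (snd w, s) * (if 0 < s \<and> s < fst w then 1 else 0)) \<in> borel_measurable ((lborel \<Otimes>\<^sub>M lborel) \<Otimes>\<^sub>M lborel)"
      by measurable
    from lborel.borel_measurable_nn_integral[OF this]
    have "(\<lambda>w. \<integral>\<^sup>+s. g (snd w, s) * (if 0 < s \<and> s < fst w then 1 else 0) \<partial>lborel) \<in> borel_measurable (lborel \<Otimes>\<^sub>M lborel)" by simp
    moreover have "(\<integral>\<^sup>+s. g (snd w, s) * (if 0 < s \<and> s < fst w then 1 else 0) \<partial>lborel) = ?A (fst w) (snd w)" for w
      by (rule nn_integral_cong) (auto simp: indicator_def)
    ultimately show ?thesis by (simp add: case_prod_beta')
  qed
  have Bm [measurable]: "?B \<in> borel_measurable lborel"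
    by (rule lborel.borel_measurable_nn_integral) measurable
  have Gm [measurable]: "?G \<in> borel_measurable lborel"
  proof -
    have "(\<lambda>(r, \<rho>). \<Gamma> \<rho> * (if r / 2 < \<rho> \<and> \<rho> < r then 1 else 0)) \<in> borel_measurable (lborel \<Otimes>\<^sub>M lborel)" by measurable
    from lborel.borel_measurable_nn_integral[OF this]
    have "(\<lambda>r. \<integral>\<^sup>+\<rho>. \<Gamma> \<rho> * (if r / 2 < \<rho> \<and> \<rho> < r then 1 else 0) \<partial>lborel) \<in> borel_measurable lborel" by simp
    moreover have "(\<integral>\<^sup>+\<rho>. \<Gamma> \<rho> * (if r / 2 < \<rho> \<and> \<rho> < r then 1 else 0) \<partial>lborel) = ?G r" for r
      by (rule nn_integral_cong) (auto simp: indicator_def)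
    ultimately show ?thesis by (simp only:)
  qed
  have \<Phi>m [measurable]: "\<Phi> \<in> borel_measurable borel" unfolding \<Phi>_def[abs_def] using Bm Gm by simp
  have step: "(\<integral>\<^sup>+x. ennreal (\<bar>f (x + h) - f x\<bar> powr p / norm h powr (p + real (DIM('a) + 1) - 2)) \<partial>lborel) * indicator (ball 0 L) h
      \<le> \<Phi> (norm h) * indicator (ball 0 L) h" for h
  proof (cases "h \<in> ball 0 L \<and> h \<noteq> 0")
    case True
    then have r: "0 < norm h" "norm h < L" by auto
    have ex: "p + real (DIM('a) + 1) - 2 = p + ?n - 1" by simp
    have "(\<integral>\<^sup>+x. ennreal (\<bar>f (x + h) - f x\<bar> powr p / norm h powr (p + real (DIM('a) + 1) - 2)) \<partial>lborel) =
        (\<integral>\<^sup>+x. ennreal (1 / norm h powr (p + ?n - 1)) * ennreal (\<bar>f (x + h) - f x\<bar> powr p) \<partial>lborel)"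
      unfolding ex by (intro nn_integral_cong) (simp flip: ennreal_mult)
    also have "\<dots> = ennreal (1 / norm h powr (p + ?n - 1)) * (\<integral>\<^sup>+x. ennreal (\<bar>f (x + h) - f x\<bar> powr p) \<partial>lborel)"
      by (rule nn_integral_cmult) measurable
    also have "(\<integral>\<^sup>+x. ennreal (\<bar>f (x + h) - f x\<bar> powr p) \<partial>lborel) \<le> ennreal (3 powr p) * (2 * ?B (norm h) +
      ennreal (2 / norm h) * (\<integral>\<^sup>+\<rho>\<in>{norm h/2<..<norm h}. (\<integral>\<^sup>+x. ennreal (\<bar>U (x + h, \<rho>) - U (x, \<rho>)\<bar> powr p) \<partial>lborel) \<partial>lborel))"
      by (rule fixed_translation_estimate[OF p meas(1-3) vert r])
    also have "\<dots> \<le> ennreal (3 powr p) * (2 * ?B (norm h) + ennreal (2 / norm h) * (ennreal (norm h powr p) * ?G (norm h)))"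
      by (intro mult_left_mono add_left_mono hor r) auto
    finally show ?thesis using True by (simp add: \<Phi>_def mult_left_mono)
  next
    case False
    then show ?thesis by (cases "h = 0") auto
  qed
  have "(\<integral>\<^sup>+x. (\<integral>\<^sup>+h\<in>ball 0 L. ennreal (\<bar>f (x + h) - f x\<bar> powr p / norm h powr (p + real (DIM('a) + 1) - 2)) \<partial>lborel) \<partial>lborel) =
    (\<integral>\<^sup>+h. (\<integral>\<^sup>+x. ennreal (\<bar>f (x + h) - f x\<bar> powr p / norm h powr (p + real (DIM('a) + 1) - 2)) * indicator (ball 0 L) h \<partial>lborel) \<partial>lborel)"
  proof (rule lborel_pair.Fubini'[symmetric])
    have [measurable]: "ball (0::'a) L \<in> sets borel" by simp
    show "(\<lambda>(x, h). ennreal (\<bar>f (x + h) - f x\<bar> powr p / norm h powr (p + real (DIM('a) + 1) - 2)) * indicator (ball 0 L) h) \<in> borel_measurable (lborel \<Otimes>\<^sub>M lborel)"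
      by measurable
  qed
  also have "\<dots> = (\<integral>\<^sup>+h. (\<integral>\<^sup>+x. ennreal (\<bar>f (x + h) - f x\<bar> powr p / norm h powr (p + real (DIM('a) + 1) - 2)) \<partial>lborel) * indicator (ball 0 L) h \<partial>lborel)"
    by (intro nn_integral_cong nn_integral_multc) measurable
  also have "\<dots> \<le> (\<integral>\<^sup>+h\<in>ball (0::'a) L. \<Phi> (norm h) \<partial>lborel)"
    by (rule nn_integral_mono) (rule step)
  also have "\<dots> = ennreal ?cn * (\<integral>\<^sup>+r\<in>{0<..<L}. ennreal (r powr (?n - 1)) * \<Phi> r \<partial>lborel)"
    by (rule nn_integral_radial) measurable
  also have "(\<integral>\<^sup>+r\<in>{0<..<L}. ennreal (r powr (?n - 1)) * \<Phi> r \<partial>lborel) =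
    (\<integral>\<^sup>+r. ennreal (3 powr p * 2) * ((ennreal (r powr (- p)) * ?B r) * indicator {0<..<L} r + (ennreal (1 / r) * ?G r) * indicator {0<..<L} r) \<partial>lborel)"
  proof (rule nn_integral_cong)
    fix r :: real
    show "ennreal (r powr (?n - 1)) * \<Phi> r * indicator {0<..<L} r =
      ennreal (3 powr p * 2) * ((ennreal (r powr (- p)) * ?B r) * indicator {0<..<L} r + (ennreal (1 / r) * ?G r) * indicator {0<..<L} r)"
    proof (cases "r \<in> {0<..<L}")
      case True
      then have r: "0 < r" by simp
      have 1: "r powr (?n - 1) * (1 / r powr (p + ?n - 1)) = r powr (- p)"
        using r by (simp add: divide_inverse flip: powr_minus powr_add)
      have 2: "r powr (- p) * (2 / r * r powr p) = 2 * (1 / r)"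
        using r by (simp add: powr_minus field_simps)
      have alg: "a1 * (a2 * (c3 * (2 * b + a4 * (a5 * g')))) = c3 * ((a1 * a2) * 2 * b + (a1 * a2) * (a4 * a5) * g')" for a1 a2 a4 a5 c3 b g' :: ennreal
        by (simp add: distrib_left mult_ac)
      have "ennreal (r powr (?n - 1)) * \<Phi> r = ennreal (3 powr p) * (ennreal (r powr (- p)) * 2 * ?B r + ennreal (2 * (1 / r)) * ?G r)"
      proof -
        have "ennreal (r powr (?n - 1) * (1 / r powr (p + ?n - 1))) = ennreal (r powr (?n - 1)) * ennreal (1 / r powr (p + ?n - 1))"
          by (rule ennreal_mult) auto
        then have e1: "ennreal (r powr (?n - 1)) * ennreal (1 / r powr (p + ?n - 1)) = ennreal (r powr (- p))"
          by (simp only: 1)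
        have "ennreal (r powr (- p) * (2 / r * r powr p)) = ennreal (r powr (- p)) * (ennreal (2 / r) * ennreal (r powr p))"
          using r by (simp only: ennreal_mult powr_ge_zero mult_nonneg_nonneg divide_nonneg_nonneg less_imp_le zero_le_numeral)
        then have e2: "ennreal (r powr (- p)) * (ennreal (2 / r) * ennreal (r powr p)) = ennreal (2 * (1 / r))"
          by (simp only: 2)
        show ?thesis unfolding \<Phi>_def alg e1 e2 ..
      qed
      also have "\<dots> = ennreal (3 powr p * 2) * (ennreal (r powr (- p)) * ?B r + ennreal (1 / r) * ?G r)"
      proof -
        have "ennreal (3 powr p * 2) = ennreal (3 powr p) * 2" by (simp add: ennreal_mult)
        moreover have "ennreal (2 * (1 / r)) = 2 * ennreal (1 / r)" using r by (subst ennreal_mult) auto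
        ultimately show ?thesis by (simp only: distrib_left mult_ac)
      qed
      finally show ?thesis using True by simp
    qed simp
  qed
  also have "\<dots> = ennreal (3 powr p * 2) * ((\<integral>\<^sup>+r\<in>{0<..<L}. ennreal (r powr (- p)) * ?B r \<partial>lborel) + (\<integral>\<^sup>+r\<in>{0<..<L}. ennreal (1 / r) * ?G r \<partial>lborel))"
    using Bm Gm by (simp add: nn_integral_cmult nn_integral_add)
  also have "\<dots> \<le> ennreal (3 powr p * 2) * (ennreal ((1 - 1 / p) powr (- p)) * (\<integral>\<^sup>+x. (\<integral>\<^sup>+s\<in>{0<..<L}. epowr (g (x, s)) p \<partial>lborel) \<partial>lborel) + (\<integral>\<^sup>+\<rho>\<in>{0<..<L}. \<Gamma> \<rho> \<partial>lborel))"
  proof (intro mult_left_mono add_mono nn_integral_dyadic_shell meas)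
    have "(\<integral>\<^sup>+r\<in>{0<..<L}. ennreal (r powr (- p)) * ?B r \<partial>lborel) =
      (\<integral>\<^sup>+r. (\<integral>\<^sup>+x. ennreal (r powr (- p)) * epowr (?A r x) p * indicator {0<..<L} r \<partial>lborel) \<partial>lborel)"
      by (simp add: nn_integral_cmult nn_integral_multc)
    also have "\<dots> = (\<integral>\<^sup>+x. (\<integral>\<^sup>+r\<in>{0<..<L}. ennreal (r powr (- p)) * epowr (?A r x) p \<partial>lborel) \<partial>lborel)"
    proof (rule lborel_pair.Fubini'[symmetric])
      have [measurable]: "(\<lambda>w. ?A (fst w) (snd w)) \<in> borel_measurable (lborel \<Otimes>\<^sub>M lborel)"
        using Apair by (simp only: case_prod_beta')
      show "(\<lambda>(r, x). ennreal (r powr (- p)) * epowr (?A r x) p * indicator {0<..<L} r) \<in> borel_measurable (lborel \<Otimes>\<^sub>M lborel)"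
        unfolding case_prod_beta' by measurable
    qed
    also have "\<dots> \<le> (\<integral>\<^sup>+x. ennreal ((1 - 1 / p) powr (- p)) * (\<integral>\<^sup>+s\<in>{0<..<L}. epowr (g (x, s)) p \<partial>lborel) \<partial>lborel)"
      by (intro nn_integral_mono hardy_inequality[OF p]) measurable
    also have "\<dots> = ennreal ((1 - 1 / p) powr (- p)) * (\<integral>\<^sup>+x. (\<integral>\<^sup>+s\<in>{0<..<L}. epowr (g (x, s)) p \<partial>lborel) \<partial>lborel)"
      by (rule nn_integral_cmult) measurable
    finally show "(\<integral>\<^sup>+r\<in>{0<..<L}. ennreal (r powr (- p)) * ?B r \<partial>lborel) \<le>
      ennreal ((1 - 1 / p) powr (- p)) * (\<integral>\<^sup>+x. (\<integral>\<^sup>+s\<in>{0<..<L}. epowr (g (x, s)) p \<partial>lborel) \<partial>lborel)" .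
  qed auto
  finally have final: "?X \<le> ennreal ?cn * (ennreal (3 powr p * 2) * ?Y)"
    by (simp only: mult_left_mono zero_le)
  have "ennreal ?cn * ennreal (3 powr p * 2) = ennreal (?cn * (3 powr p * 2))"
    by (rule ennreal_mult[symmetric]) auto
  also have "?cn * (3 powr p * 2) = 2 * seminorm_const DIM('a) p"
    by (simp only: seminorm_const_def mult_ac)
  finally show ?thesis using final by (simp only: mult.assoc[symmetric])
qed

section \<open>Sobolev functions on a strip\<close>

text \<open>The fundamental lemma of the calculus of variations, tested with bumps on closed boxes
  inside \<Omega>.\<close>

lemma is_weak_partial_unique:
  fixes \<Omega> :: "'a::euclidean_space set"
  assumes \<Omega>: "open \<Omega>" and v: "is_weak_partial \<Omega> b u v" and v': "is_weak_partial \<Omega> b u v'"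
  shows "AE x in lborel. x \<in> \<Omega> \<longrightarrow> v x = v' x"
proof (rule AE_open_if_AE_boxes[OF \<Omega>])
  fix l r assume lr: "cbox l r \<subseteq> \<Omega>"
  have i: "integrable lborel (\<lambda>x. indicator (cbox l r) x * f x)" if "f \<in> Lp_loc lborel \<Omega> 1" for f
    by (rule Lp_loc_1_integrable[OF that compact_cbox lr])
  have iv: "integrable lborel (\<lambda>x. indicator (cbox l r) x * v x)" "integrable lborel (\<lambda>x. indicator (cbox l r) x * v' x)"
    using v v' by (auto simp: is_weak_partial_def intro!: i)
  have ib: "set_integrable lborel (box l r) (\<lambda>x. v x - v' x)"
  proof -
    have "integrable lborel (\<lambda>x. indicator (box l r) x *\<^sub>R (indicator (cbox l r) x * v x - indicator (cbox l r) x * v' x))"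
      by (intro integrable_mult_indicator Bochner_Integration.integrable_diff iv) simp
    moreover have "indicator (box l r) x *\<^sub>R (indicator (cbox l r) x * v x - indicator (cbox l r) x * v' x) =
        indicator (box l r) x *\<^sub>R (v x - v' x)" for x
      using box_subset_cbox[of l r] by (auto simp: indicator_def)
    ultimately show ?thesis unfolding set_integrable_def by (simp only:)
  qed
  have "AE x in lborel. x \<in> box l r \<longrightarrow> v x - v' x = 0"
  proof (rule AE_zero_on_box_if_bump_integrals_zero[OF ib])
    fix a c m assume ac: "box a c \<noteq> {}" "cbox a c \<subseteq> cbox l r"
    let ?\<phi> = "bump a c m"
    have out: "?\<phi> x = 0" if "x \<notin> box l r" for x
      using bump_outside[OF ac(1), of x m] interior_mono[OF ac(2)] that by auto
    have test: "?\<phi> \<in> test_functions \<Omega>" unfolding test_functions_def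
      using C_k_bump fun_support_bump[OF ac(1)] compact_fun_support[OF fun_support_bump[OF ac(1)] compact_cbox] ac(2) lr by blast
    have eq: "(LINT x:\<Omega>|lborel. f x * ?\<phi> x) = (LINT x|lborel. indicator (cbox l r) x * f x * ?\<phi> x)" for f
      unfolding set_lebesgue_integral_def
      using out box_subset_cbox[of l r] lr by (intro Bochner_Integration.integral_cong) (auto simp: indicator_def)
    have "(LINT x:\<Omega>|lborel. v x * ?\<phi> x) = (LINT x:\<Omega>|lborel. v' x * ?\<phi> x)"
      using v v' test unfolding is_weak_partial_def by (metis neg_equal_iff_equal)
    then have z: "(LINT x|lborel. indicator (cbox l r) x * v x * ?\<phi> x) - (LINT x|lborel. indicator (cbox l r) x * v' x * ?\<phi> x) = 0"
      unfolding eq by simp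
    have "(LINT x:box l r|lborel. (v x - v' x) * ?\<phi> x) = (LINT x|lborel. indicator (cbox l r) x * v x * ?\<phi> x - indicator (cbox l r) x * v' x * ?\<phi> x)"
      unfolding set_lebesgue_integral_def
    proof (rule Bochner_Integration.integral_cong)
      fix x show "indicator (box l r) x *\<^sub>R ((v x - v' x) * ?\<phi> x) = indicator (cbox l r) x * v x * ?\<phi> x - indicator (cbox l r) x * v' x * ?\<phi> x"
        using out[of x] box_subset_cbox[of l r] by (cases "x \<in> box l r") (auto simp: left_diff_distrib)
    qed simp
    also have "\<dots> = 0"
      unfolding z[symmetric]
      by (intro Bochner_Integration.integral_diff integrable_mult_bounded[where C=1] iv) (auto simp: bump_abs_le)
    finally show "(LINT x:box l r|lborel. (v x - v' x) * ?\<phi> x) = 0" .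
  qed
  then show "AE x in lborel. x \<in> box l r \<longrightarrow> v x = v' x" by eventually_elim simp
qed

lemma Lp_on_cong_AE:
  assumes f: "f \<in> Lp_on lborel \<Omega> p" and g: "set_borel_measurable lborel \<Omega> g" and fg: "AE x in lborel. x \<in> \<Omega> \<longrightarrow> f x = g x"
  shows "g \<in> Lp_on lborel \<Omega> p"
proof -
  have "(\<integral>\<^sup>+x\<in>\<Omega>. ennreal (\<bar>g x\<bar> powr p) \<partial>lborel) = (\<integral>\<^sup>+x\<in>\<Omega>. ennreal (\<bar>f x\<bar> powr p) \<partial>lborel)"
  proof (rule nn_integral_cong_AE)
    show "AE x in lborel. ennreal (\<bar>g x\<bar> powr p) * indicator \<Omega> x = ennreal (\<bar>f x\<bar> powr p) * indicator \<Omega> x"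
      using fg
    proof eventually_elim
      case (elim x)
      then show ?case by (cases "x \<in> \<Omega>") auto
    qed
  qed
  then show ?thesis using f g by (simp add: Lp_on_def)
qed

text \<open>\<open>weak_partial\<close> picks some weak derivative without regard to its
  integrability; uniqueness almost everywhere transfers the L^p bound from the derivative that
  exists by assumption.\<close>

lemma weak_partial_properties:
  fixes \<Omega> :: "'a::euclidean_space set"
  assumes \<Omega>: "open \<Omega>" and u: "u \<in> hom_sobolev \<Omega> p" and b: "b \<in> Basis"
  shows "is_weak_partial \<Omega> b u (weak_partial \<Omega> b u)" "weak_partial \<Omega> b u \<in> Lp_on lborel \<Omega> p"
proof -
  obtain v where v: "is_weak_partial \<Omega> b u v" "v \<in> Lp_on lborel \<Omega> p"
    using u b unfolding hom_sobolev_def by auto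
  show w: "is_weak_partial \<Omega> b u (weak_partial \<Omega> b u)"
    unfolding weak_partial_def by (rule someI[of "is_weak_partial \<Omega> b u" v, OF v(1)])
  then have "set_borel_measurable lborel \<Omega> (weak_partial \<Omega> b u)"
    by (simp add: is_weak_partial_def Lp_loc_def)
  then show "weak_partial \<Omega> b u \<in> Lp_on lborel \<Omega> p"
    by (rule Lp_on_cong_AE[OF v(2) _ is_weak_partial_unique[OF \<Omega> v(1) w]])
qed

lemma open_strip: "open (strip bm bp :: ('a::euclidean_space \<times> real) set)"
proof -
  have "(strip bm bp :: ('a \<times> real) set) = UNIV \<times> {bm<..<bp}" by (auto simp: strip_def)
  then show ?thesis by (simp add: open_Times)
qed

lemma strip_iff: "(x, t) \<in> strip bm bp \<longleftrightarrow> bm < t \<and> t < bp"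
  by (simp add: strip_def)

lemma AE_fst_lborel:
  assumes "AE x in lborel. P (x :: 'a::euclidean_space)"
  shows "AE z in lborel. P (fst (z :: 'a \<times> real))"
proof -
  obtain N where N: "N \<in> null_sets lborel" "{x. \<not> P x} \<subseteq> N"
    using assms unfolding eventually_ae_filter by auto
  have "emeasure (lborel \<Otimes>\<^sub>M lborel) (N \<times> (UNIV :: real set)) = emeasure lborel N * emeasure lborel (UNIV :: real set)"
    using N by (intro lborel.emeasure_pair_measure_Times) auto
  also have "\<dots> = 0" using N by auto
  finally have "N \<times> (UNIV :: real set) \<in> null_sets (lborel \<Otimes>\<^sub>M lborel)"
    using N by (intro null_setsI) auto
  then have "N \<times> (UNIV :: real set) \<in> null_sets lborel" by (simp only: lborel_prod)
  then show ?thesis by (rule AE_I') (use N in auto)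
qed

text \<open>In the non-integrable case the Bochner integral is 0 by convention, so the bound holds
  for every function.\<close>

lemma abs_integral_le_nn_integral:
  fixes f :: "'a \<Rightarrow> real"
  shows "ennreal \<bar>LINT x|M. f x\<bar> \<le> (\<integral>\<^sup>+x. ennreal \<bar>f x\<bar> \<partial>M)"
proof (cases "integrable M f")
  case True
  have "\<bar>LINT x|M. f x\<bar> \<le> (LINT x|M. \<bar>f x\<bar>)" by (rule integral_abs_bound)
  then have "ennreal \<bar>LINT x|M. f x\<bar> \<le> ennreal (LINT x|M. \<bar>f x\<bar>)" by (rule ennreal_leI)
  also have "\<dots> = (\<integral>\<^sup>+x. ennreal \<bar>f x\<bar> \<partial>M)"
    using True by (intro nn_integral_eq_integral[symmetric]) auto
  finally show ?thesis .
qed (simp add: not_integrable_integral_eq)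

lemma powr_add_le:
  fixes a b :: real
  assumes "0 < p" shows "ennreal (\<bar>a + b\<bar> powr p) \<le> ennreal (2 powr p) * (ennreal (\<bar>a\<bar> powr p) + ennreal (\<bar>b\<bar> powr p))"
proof -
  have "ennreal (\<bar>a + b\<bar> powr p) \<le> epowr (ennreal \<bar>a\<bar> + ennreal \<bar>b\<bar>) p"
    using assms abs_triangle_ineq[of a b]
    by (simp add: epowr_ennreal powr_mono2 flip: ennreal_plus)
  also have "\<dots> \<le> ennreal (2 powr p) * (epowr (ennreal \<bar>a\<bar>) p + epowr (ennreal \<bar>b\<bar>) p)"
    by (rule epowr_add_le[OF assms])
  finally show ?thesis by (simp add: epowr_ennreal)
qed

lemma borel_measurable_fst_borel [measurable (raw)]:
  "f \<in> borel_measurable M \<Longrightarrow> (\<lambda>x. fst (f x :: 'a::euclidean_space \<times> real)) \<in> borel_measurable M"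
  by (rule measurable_compose[of f M borel fst], assumption) (intro borel_measurable_continuous_onI continuous_on_fst continuous_on_id)

lemma borel_measurable_snd_borel [measurable (raw)]:
  "f \<in> borel_measurable M \<Longrightarrow> (\<lambda>x. snd (f x :: 'a::euclidean_space \<times> real)) \<in> borel_measurable M"
  by (rule measurable_compose[of f M borel snd], assumption) (intro borel_measurable_continuous_onI continuous_on_snd continuous_on_id)

locale strip_sobolev =
  fixes p bm bp :: real and u :: "'a::euclidean_space \<times> real \<Rightarrow> real"
  assumes p: "1 < p" and bm_bp: "bm < bp" and u: "u \<in> hom_sobolev (strip bm bp) p"
begin

abbreviation S :: "('a \<times> real) set" where "S \<equiv> strip bm bp"

text \<open>Membership in the Sobolev space makes \<open>u\<close> measurable on the strip only; the
  extension by 0 is Borel on the whole space and can be translated freely.\<close>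

definition u0 :: "'a \<times> real \<Rightarrow> real" where "u0 z = indicator S z * u z"

definition D :: "'a \<times> real \<Rightarrow> 'a \<times> real \<Rightarrow> real" where "D b z = indicator S z * weak_partial S b u z"

lemma S_borel [measurable]: "S \<in> sets borel"
  using open_strip by (rule borel_open)

lemma u0_measurable [measurable]: "u0 \<in> borel_measurable borel"
  using u by (simp add: u0_def[abs_def] hom_sobolev_def Lp_loc_def set_borel_measurable_def)

lemma wp: "b \<in> Basis \<Longrightarrow> is_weak_partial S b u (weak_partial S b u)"
  by (rule weak_partial_properties(1)[OF open_strip u])

lemma D_measurable [measurable]: "b \<in> Basis \<Longrightarrow> D b \<in> borel_measurable borel"
  using weak_partial_properties(2)[OF open_strip u, of b]
  by (simp add: D_def[abs_def] Lp_on_def set_borel_measurable_def)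

lemma D_Lp_eq: "(\<integral>\<^sup>+z. ennreal (\<bar>D b z\<bar> powr p) \<partial>lborel) = (\<integral>\<^sup>+z\<in>S. ennreal (\<bar>weak_partial S b u z\<bar> powr p) \<partial>lborel)"
  using p by (intro nn_integral_cong) (auto simp: D_def indicator_def)

lemma D_Lp: "b \<in> Basis \<Longrightarrow> (\<integral>\<^sup>+z. ennreal (\<bar>D b z\<bar> powr p) \<partial>lborel) < \<infinity>"
  using weak_partial_properties(2)[OF open_strip u, of b] unfolding D_Lp_eq by (simp add: Lp_on_def)

lemma increment:
  assumes e: "e \<in> Basis" and \<tau>: "0 \<le> \<tau>"
  shows "AE z in lborel. z \<in> S \<longrightarrow> z + \<tau> *\<^sub>R e \<in> S \<longrightarrow>
    u0 (z + \<tau> *\<^sub>R e) - u0 z = (LINT t|lborel. indicator {0..\<tau>} t * D e (z + t *\<^sub>R e))"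
  using weak_partial_increment[OF open_strip e wp[OF e] \<tau>]
proof eventually_elim
  case (elim z)
  show ?case
  proof (intro impI)
    assume z: "z \<in> S" "z + \<tau> *\<^sub>R e \<in> S"
    \<comment> \<open>The height is monotone along the segment, so it stays between the heights of
      the end points.\<close>
    have in_S: "z + t *\<^sub>R e \<in> S" if "t \<in> {0..\<tau>}" for t
    proof (cases "0 \<le> snd e")
      case True
      then have "0 \<le> t * snd e" "t * snd e \<le> \<tau> * snd e" using that by (auto intro: mult_right_mono)
      then show ?thesis using z by (auto simp: strip_def)
    next
      case False
      then have "t * snd e \<le> 0" "\<tau> * snd e \<le> t * snd e" using that by (auto intro: mult_nonneg_nonpos mult_right_mono_neg)
      then show ?thesis using z by (auto simp: strip_def)
    qed
    have "indicator {0..\<tau>} t * weak_partial S e u (z + t *\<^sub>R e) = indicator {0..\<tau>} t * D e (z + t *\<^sub>R e)" for t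
      using in_S[of t] by (cases "t \<in> {0..\<tau>}") (auto simp: D_def)
    then have "(LINT t|lborel. indicator {0..\<tau>} t * weak_partial S e u (z + t *\<^sub>R e)) = (LINT t|lborel. indicator {0..\<tau>} t * D e (z + t *\<^sub>R e))"
      by (simp only:)
    then show "u0 (z + \<tau> *\<^sub>R e) - u0 z = (LINT t|lborel. indicator {0..\<tau>} t * D e (z + t *\<^sub>R e))"
      using elim in_S z by (simp add: u0_def)
  qed
qed

text \<open>The p-th power of an L^p norm over the layer of points with height in \<open>J\<close>.
  Layers are invariant under horizontal translations, which allows a translation to be performed in
  several moves.\<close>

definition dq :: "real set \<Rightarrow> 'a \<Rightarrow> ennreal" where
  "dq J h = (\<integral>\<^sup>+z. ennreal (\<bar>u0 (z + (h, 0)) - u0 z\<bar> powr p) * indicator J (snd z) \<partial>lborel)"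

definition dL :: "real set \<Rightarrow> 'a \<Rightarrow> ennreal" where
  "dL J b = (\<integral>\<^sup>+z. ennreal (\<bar>D (b, 0) z\<bar> powr p) * indicator J (snd z) \<partial>lborel)"

text \<open>The second move starts at points translated by \<open>h\<close>, which are in the same
  layer; invariance of the measure brings it back to \<open>dq J k\<close>.\<close>

lemma dq_add:
  assumes [measurable]: "J \<in> sets borel"
  shows "dq J (h + k) \<le> ennreal (2 powr p) * (dq J h + dq J k)"
proof -
  have "dq J (h + k) \<le> (\<integral>\<^sup>+z. ennreal (2 powr p) * (ennreal (\<bar>u0 (z + (h, 0) + (k, 0)) - u0 (z + (h, 0))\<bar> powr p) * indicator J (snd (z + (h, 0))) +
      ennreal (\<bar>u0 (z + (h, 0)) - u0 z\<bar> powr p) * indicator J (snd z)) \<partial>lborel)"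
    unfolding dq_def
  proof (rule nn_integral_mono)
    fix z :: "'a \<times> real"
    have E: "z + (h + k, 0) = z + (h, 0) + (k, 0)" by (cases z) (simp add: algebra_simps)
    have "ennreal (\<bar>u0 (z + (h + k, 0)) - u0 z\<bar> powr p) \<le> ennreal (2 powr p) *
        (ennreal (\<bar>u0 (z + (h, 0) + (k, 0)) - u0 (z + (h, 0))\<bar> powr p) + ennreal (\<bar>u0 (z + (h, 0)) - u0 z\<bar> powr p))"
      using powr_add_le[of p "u0 (z + (h, 0) + (k, 0)) - u0 (z + (h, 0))" "u0 (z + (h, 0)) - u0 z"] p unfolding E by (simp only: diff_add_cancel add_diff_eq)
    then show "ennreal (\<bar>u0 (z + (h + k, 0)) - u0 z\<bar> powr p) * indicator J (snd z) \<le>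
      ennreal (2 powr p) * (ennreal (\<bar>u0 (z + (h, 0) + (k, 0)) - u0 (z + (h, 0))\<bar> powr p) * indicator J (snd (z + (h, 0))) +
      ennreal (\<bar>u0 (z + (h, 0)) - u0 z\<bar> powr p) * indicator J (snd z))"
      by (cases "snd z \<in> J") simp_all
  qed
  also have "\<dots> = ennreal (2 powr p) * ((\<integral>\<^sup>+z. ennreal (\<bar>u0 (z + (h, 0) + (k, 0)) - u0 (z + (h, 0))\<bar> powr p) * indicator J (snd (z + (h, 0))) \<partial>lborel) + dq J h)"
    unfolding dq_def by (simp add: nn_integral_cmult nn_integral_add)
  also have "(\<integral>\<^sup>+z. ennreal (\<bar>u0 (z + (h, 0) + (k, 0)) - u0 (z + (h, 0))\<bar> powr p) * indicator J (snd (z + (h, 0))) \<partial>lborel) = dq J k"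
    unfolding dq_def
    by (rule nn_integral_lborel_shift[of "\<lambda>z. ennreal (\<bar>u0 (z + (k, 0)) - u0 z\<bar> powr p) * indicator J (snd z)"]) measurable
  finally show ?thesis by (simp add: add.commute)
qed

text \<open>Translating the variable of integration exchanges the two points of the
  difference.\<close>

lemma dq_minus:
  assumes [measurable]: "J \<in> sets borel"
  shows "dq J (- h) = dq J h"
proof -
  have "dq J h = (\<integral>\<^sup>+z. ennreal (\<bar>u0 (z + (-h, 0) + (h, 0)) - u0 (z + (-h, 0))\<bar> powr p) * indicator J (snd (z + (-h, 0))) \<partial>lborel)"
    unfolding dq_def
    by (rule nn_integral_lborel_shift[of "\<lambda>z. ennreal (\<bar>u0 (z + (h, 0)) - u0 z\<bar> powr p) * indicator J (snd z)", symmetric]) measurable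
  also have "\<dots> = dq J (- h)"
    unfolding dq_def by (intro nn_integral_cong) (simp add: abs_minus_commute add.assoc zero_prod_def[symmetric])
  finally show ?thesis by simp
qed

text \<open>The increment is the integral of the derivative over a segment of length \<tau>. Jensen
  gives \<tau>^(p-1), and integrating out the position on the segment gives one more factor
  \<tau>.\<close>

lemma dq_direction_nonneg:
  assumes [measurable]: "J \<in> sets borel" and J: "J \<subseteq> {bm<..<bp}" and b: "b \<in> Basis" and \<tau>: "0 < \<tau>"
  shows "dq J (\<tau> *\<^sub>R b) \<le> ennreal (\<tau> powr p) * dL J b"
proof -
  let ?e = "(b, 0) :: 'a \<times> real"
  have e: "?e \<in> Basis" using b by (simp add: Basis_prod_def)
  note [measurable] = D_measurable[OF e]
  let ?F = "\<lambda>z t. ennreal (\<tau> powr (p - 1)) * (ennreal (\<bar>D ?e (z + t *\<^sub>R ?e)\<bar> powr p) * indicator {0..\<tau>} t * indicator J (snd z))"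
  have "dq J (\<tau> *\<^sub>R b) \<le> (\<integral>\<^sup>+z. (\<integral>\<^sup>+t. ?F z t \<partial>lborel) \<partial>lborel)"
    unfolding dq_def
  proof (rule nn_integral_mono_AE)
    show "AE z in lborel. ennreal (\<bar>u0 (z + (\<tau> *\<^sub>R b, 0)) - u0 z\<bar> powr p) * indicator J (snd z) \<le> (\<integral>\<^sup>+t. ?F z t \<partial>lborel)"
      using increment[OF e less_imp_le[OF \<tau>]]
    proof eventually_elim
      case (elim z)
      show ?case
      proof (cases "snd z \<in> J")
        case True
        then have "z \<in> S" "z + \<tau> *\<^sub>R ?e \<in> S" using J by (auto simp: strip_def)
        then have eq: "u0 (z + (\<tau> *\<^sub>R b, 0)) - u0 z = (LINT t|lborel. indicator {0..\<tau>} t * D ?e (z + t *\<^sub>R ?e))"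
          using elim by simp
        have "ennreal \<bar>u0 (z + (\<tau> *\<^sub>R b, 0)) - u0 z\<bar> \<le> (\<integral>\<^sup>+t\<in>{0..\<tau>}. ennreal \<bar>D ?e (z + t *\<^sub>R ?e)\<bar> \<partial>lborel)"
          unfolding eq by (rule order_trans[OF abs_integral_le_nn_integral]) (auto intro!: nn_integral_mono simp: indicator_def)
        then have "epowr (ennreal \<bar>u0 (z + (\<tau> *\<^sub>R b, 0)) - u0 z\<bar>) p \<le> epowr (\<integral>\<^sup>+t\<in>{0..\<tau>}. ennreal \<bar>D ?e (z + t *\<^sub>R ?e)\<bar> \<partial>lborel) p"
          using p by (intro epowr_mono) auto
        also have "\<dots> \<le> ennreal (\<tau> powr (p - 1)) * (\<integral>\<^sup>+t\<in>{0..\<tau>}. epowr (ennreal \<bar>D ?e (z + t *\<^sub>R ?e)\<bar>) p \<partial>lborel)"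
          using \<tau> by (intro nn_integral_powr_le_set[OF p]) auto
        also have "\<dots> = (\<integral>\<^sup>+t. ?F z t \<partial>lborel)"
          using True by (simp add: epowr_ennreal nn_integral_cmult)
        finally show ?thesis using True by (simp add: epowr_ennreal)
      qed simp
    qed
  qed
  also have "\<dots> = (\<integral>\<^sup>+t. (\<integral>\<^sup>+z. ?F z t \<partial>lborel) \<partial>lborel)"
    by (rule lborel_pair.Fubini'[symmetric]) (unfold case_prod_beta', measurable)
  also have "\<dots> = (\<integral>\<^sup>+t. (ennreal (\<tau> powr (p - 1)) * dL J b) * indicator {0..\<tau>} t \<partial>lborel)"
  proof (rule nn_integral_cong)
    fix t :: real
    have "(\<integral>\<^sup>+z. ?F z t \<partial>lborel) = (\<integral>\<^sup>+z. ennreal (\<tau> powr (p - 1)) * (ennreal (\<bar>D ?e (z + t *\<^sub>R ?e)\<bar> powr p) * indicator J (snd (z + t *\<^sub>R ?e))) * indicator {0..\<tau>} t \<partial>lborel)"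
    proof (rule nn_integral_cong)
      fix z :: "'a \<times> real"
      have "snd (z + t *\<^sub>R ?e) = snd z" by simp
      then show "?F z t = ennreal (\<tau> powr (p - 1)) * (ennreal (\<bar>D ?e (z + t *\<^sub>R ?e)\<bar> powr p) * indicator J (snd (z + t *\<^sub>R ?e))) * indicator {0..\<tau>} t"
        by (simp only: mult_ac)
    qed
    also have "\<dots> = (\<integral>\<^sup>+z. ennreal (\<tau> powr (p - 1)) * (ennreal (\<bar>D ?e z\<bar> powr p) * indicator J (snd z)) * indicator {0..\<tau>} t \<partial>lborel)"
      by (rule nn_integral_lborel_shift[of "\<lambda>z. ennreal (\<tau> powr (p - 1)) * (ennreal (\<bar>D ?e z\<bar> powr p) * indicator J (snd z)) * indicator {0..\<tau>} t"]) measurable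
    also have "\<dots> = (ennreal (\<tau> powr (p - 1)) * dL J b) * indicator {0..\<tau>} t"
      unfolding dL_def by (subst nn_integral_multc, measurable, subst nn_integral_cmult, measurable)
    finally show "(\<integral>\<^sup>+z. ?F z t \<partial>lborel) = (ennreal (\<tau> powr (p - 1)) * dL J b) * indicator {0..\<tau>} t" .
  qed
  also have "\<dots> = ennreal (\<tau> powr (p - 1)) * dL J b * ennreal \<tau>"
    using \<tau> by (simp add: nn_integral_cmult_indicator)
  also have "\<dots> = (ennreal (\<tau> powr (p - 1)) * ennreal \<tau>) * dL J b" by (simp only: mult_ac)
  also have "ennreal (\<tau> powr (p - 1)) * ennreal \<tau> = ennreal (\<tau> powr p)"
    using \<tau> powr_add[of \<tau> "p - 1" 1] by (simp flip: ennreal_mult)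
  finally show ?thesis .
qed

lemma dq_direction:
  assumes J: "J \<in> sets borel" "J \<subseteq> {bm<..<bp}" and b: "b \<in> Basis"
  shows "dq J (\<tau> *\<^sub>R b) \<le> ennreal (\<bar>\<tau>\<bar> powr p) * dL J b"
proof -
  consider "\<tau> > 0" | "\<tau> = 0" | "\<tau> < 0" by linarith
  then show ?thesis
  proof cases
    case 1 then show ?thesis using dq_direction_nonneg[OF J b 1] by simp
  next
    case 2
    have "dq J 0 = 0" unfolding dq_def by (simp add: zero_prod_def[symmetric])
    then show ?thesis using 2 by simp
  next
    case 3
    then show ?thesis using dq_direction_nonneg[OF J b, of "- \<tau>"] dq_minus[OF J(1), of "\<tau> *\<^sub>R b"] by simp
  qed
qed

text \<open>The translation is performed coordinate by coordinate; every use of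
  \<open>dq_add\<close> costs a factor 2^p, whence (2^p)^n.\<close>

lemma dq_le:
  assumes J: "J \<in> sets borel" "J \<subseteq> {bm<..<bp}"
  shows "dq J h \<le> ennreal (norm h powr p) * (ennreal ((2 powr p) ^ DIM('a)) * (\<Sum>b\<in>Basis. dL J b))"
proof -
  have "dq J (\<Sum>b\<in>B. (h \<bullet> b) *\<^sub>R b) \<le> ennreal (norm h powr p) * (ennreal ((2 powr p) ^ card B) * (\<Sum>b\<in>B. dL J b))"
    if "finite B" "B \<subseteq> Basis" for B
    using that
  proof (induction B)
    case empty
    have "dq J 0 = 0" unfolding dq_def by (simp add: zero_prod_def[symmetric])
    then show ?case by simp
  next
    case (insert b B)
    let ?q = "ennreal (2 powr p)" and ?h = "ennreal (norm h powr p)" and ?Q = "ennreal ((2 powr p) ^ card B)"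
    have Q1: "1 \<le> ?Q" using p by (simp add: ge_one_powr_ge_zero)
    have bb: "\<bar>h \<bullet> b\<bar> \<le> norm h" using insert.prems Basis_le_norm by auto
    have IH: "dq J (\<Sum>b\<in>B. (h \<bullet> b) *\<^sub>R b) \<le> ?h * (?Q * (\<Sum>b\<in>B. dL J b))"
      using insert by auto
    have "dq J (\<Sum>b\<in>insert b B. (h \<bullet> b) *\<^sub>R b) = dq J ((h \<bullet> b) *\<^sub>R b + (\<Sum>b\<in>B. (h \<bullet> b) *\<^sub>R b))"
      using insert.hyps by simp
    also have "\<dots> \<le> ?q * (dq J ((h \<bullet> b) *\<^sub>R b) + dq J (\<Sum>b\<in>B. (h \<bullet> b) *\<^sub>R b))"
      by (rule dq_add[OF J(1)])
    also have "\<dots> \<le> ?q * (?h * (?Q * dL J b) + ?h * (?Q * (\<Sum>b\<in>B. dL J b)))"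
    proof (intro mult_left_mono add_mono IH)
      have "dq J ((h \<bullet> b) *\<^sub>R b) \<le> ennreal (\<bar>h \<bullet> b\<bar> powr p) * dL J b"
        using insert.prems by (intro dq_direction J) auto
      also have "\<dots> \<le> ?h * dL J b"
        using bb p by (intro mult_right_mono ennreal_leI powr_mono2) auto
      also have "\<dots> \<le> ?h * (?Q * dL J b)"
        using mult_right_mono[OF Q1, of "dL J b"] by (intro mult_left_mono) auto
      finally show "dq J ((h \<bullet> b) *\<^sub>R b) \<le> ?h * (?Q * dL J b)" .
    qed auto
    also have "\<dots> = ?h * ((?q * ?Q) * (\<Sum>b\<in>insert b B. dL J b))"
      using insert.hyps by (simp add: distrib_left mult_ac)
    also have "?q * ?Q = ennreal ((2 powr p) ^ card (insert b B))"
      using insert.hyps by (simp flip: ennreal_mult)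
    finally show ?case .
  qed
  from this[OF finite_Basis order_refl] show ?thesis by (simp add: euclidean_representation)
qed

end

section \<open>Boundary values\<close>

lemma integrable_mult_indicator':
  fixes f :: "'a \<Rightarrow> real"
  assumes "integrable M f" "A \<in> sets M" shows "integrable M (\<lambda>x. f x * indicator A x)"
  using integrable_mult_indicator[OF assms(2,1)] by (simp add: mult.commute)

lemma AE_exists_in_interval:
  assumes "AE s in lborel. R (s :: real)" "a < b"
  shows "\<exists>s\<in>{a<..<b}. R s"
proof (rule ccontr)
  assume c: "\<not> ?thesis"
  obtain N where N: "N \<in> null_sets lborel" "{s. \<not> R s} \<subseteq> N"
    using assms(1) unfolding eventually_ae_filter by auto
  have "{a<..<b} \<subseteq> N" using c N(2) by auto
  then have "emeasure lborel {a<..<b} \<le> emeasure lborel N" using N(1) by (intro emeasure_mono) auto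
  then show False using N(1) assms(2) by auto
qed

lemma AE_pair_lines:
  assumes "AE z in lborel. P (z :: 'a::euclidean_space \<times> real)"
  shows "AE x in lborel. AE t in lborel. P (x, t)"
proof (rule lborel_pair.AE_pair)
  show "AE z in lborel \<Otimes>\<^sub>M lborel. P z" using assms by (simp only: lborel_prod)
qed

text \<open>The converse of slicing requires the set of good points to be Borel, hence the
  measurability arguments in its applications.\<close>

lemma AE_lines_pair:
  assumes "AE x in lborel. AE t in lborel. P (x :: 'a::euclidean_space, t :: real)" and "{z. P z} \<in> sets borel"
  shows "AE z in lborel. P z"
proof -
  have "{z. P z} \<in> sets (lborel \<Otimes>\<^sub>M lborel)" using assms(2) by (simp only: lborel_prod sets_lborel)
  then have "AE z in lborel \<Otimes>\<^sub>M lborel. P z"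
    using lborel_pair.AE_pair_measure[of P] assms(1) by (simp add: space_pair_measure)
  then show ?thesis by (simp only: lborel_prod)
qed

context strip_sobolev
begin

abbreviation I :: "real set" where "I \<equiv> {bm<..<bp}"

abbreviation w :: "'a \<times> real \<Rightarrow> real" where "w \<equiv> D (0, 1)"

lemma vertical_Basis: "(0, 1) \<in> (Basis :: ('a \<times> real) set)"
  by (simp add: Basis_prod_def)

lemma w_measurable [measurable]: "w \<in> borel_measurable borel"
  by (rule D_measurable[OF vertical_Basis])

lemma w_outside: "t \<notin> I \<Longrightarrow> w (x, t) = 0"
  by (simp add: D_def strip_iff)

definition W :: "'a \<times> real \<Rightarrow> real" where
  "W z = (LINT r|lborel. w (fst z, r) * indicator {bm<..<snd z} r)"

lemma W_measurable [measurable]: "W \<in> borel_measurable borel"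
proof -
  have "(\<lambda>(z, r). w (fst z, r) * (if bm < r \<and> r < snd z then 1 else 0)) \<in> borel_measurable (borel \<Otimes>\<^sub>M lborel)"
    by measurable
  then have "(\<lambda>z. LINT r|lborel. w (fst z, r) * (if bm < r \<and> r < snd z then 1 else 0)) \<in> borel_measurable borel"
    by (rule lborel.borel_measurable_lebesgue_integral)
  moreover have "(if bm < r \<and> r < t then 1 else 0 :: real) = indicator {bm<..<t} r" for r t
    by (simp add: indicator_def)
  ultimately show ?thesis by (simp only: W_def[abs_def])
qed

lemma power_line_integral:
  "(\<integral>\<^sup>+x. (\<integral>\<^sup>+r. ennreal (\<bar>w (x, r)\<bar> powr p) \<partial>lborel) \<partial>lborel) = (\<integral>\<^sup>+z. ennreal (\<bar>w z\<bar> powr p) \<partial>lborel)"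
  using lborel.nn_integral_fst[of "\<lambda>z. ennreal (\<bar>w z\<bar> powr p)" "lborel :: 'a measure"]
  by (simp add: lborel_prod)

lemma line_abs_integral_le:
  "epowr (\<integral>\<^sup>+r. ennreal \<bar>w (x, r)\<bar> \<partial>lborel) p \<le> ennreal ((bp - bm) powr (p - 1)) * (\<integral>\<^sup>+r. ennreal (\<bar>w (x, r)\<bar> powr p) \<partial>lborel)"
proof -
  have "epowr (\<integral>\<^sup>+r\<in>I. ennreal \<bar>w (x, r)\<bar> \<partial>lborel) p \<le> ennreal ((bp - bm) powr (p - 1)) * (\<integral>\<^sup>+r\<in>I. epowr (ennreal \<bar>w (x, r)\<bar>) p \<partial>lborel)"
    using bm_bp by (intro nn_integral_powr_le_set[OF p]) auto
  also have "(\<integral>\<^sup>+r\<in>I. epowr (ennreal \<bar>w (x, r)\<bar>) p \<partial>lborel) = (\<integral>\<^sup>+r. ennreal (\<bar>w (x, r)\<bar> powr p) \<partial>lborel)"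
    using p w_outside by (intro nn_integral_cong) (auto simp: epowr_ennreal indicator_def)
  also have "(\<integral>\<^sup>+r\<in>I. ennreal \<bar>w (x, r)\<bar> \<partial>lborel) = (\<integral>\<^sup>+r. ennreal \<bar>w (x, r)\<bar> \<partial>lborel)"
    using w_outside by (intro nn_integral_cong) (auto simp: indicator_def)
  finally show ?thesis .
qed

text \<open>By Fubini the p-th power is integrable on almost every vertical line, and on a segment
  of finite length this implies integrability.\<close>

lemma AE_w_integrable: "AE x in lborel. integrable lborel (\<lambda>r. w (x, r))"
proof -
  have "AE x in lborel. (\<integral>\<^sup>+r. ennreal (\<bar>w (x, r)\<bar> powr p) \<partial>lborel) \<noteq> \<infinity>"
  proof (rule nn_integral_PInf_AE)
    show "(\<lambda>x. \<integral>\<^sup>+r. ennreal (\<bar>w (x, r)\<bar> powr p) \<partial>lborel) \<in> borel_measurable lborel"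
      by (rule lborel.borel_measurable_nn_integral) measurable
    show "(\<integral>\<^sup>+x. (\<integral>\<^sup>+r. ennreal (\<bar>w (x, r)\<bar> powr p) \<partial>lborel) \<partial>lborel) \<noteq> \<infinity>"
      unfolding power_line_integral using D_Lp[OF vertical_Basis] by simp
  qed
  then show ?thesis
  proof eventually_elim
    case (elim x)
    have "epowr (\<integral>\<^sup>+r. ennreal \<bar>w (x, r)\<bar> \<partial>lborel) p < \<infinity>"
      using line_abs_integral_le[of x] elim by (auto simp: ennreal_mult_less_top less_top intro: le_less_trans)
    then have "(\<integral>\<^sup>+r. ennreal \<bar>w (x, r)\<bar> \<partial>lborel) < \<infinity>"
      by (auto simp: epowr_def less_top split: if_splits)
    then show ?case by (intro integrableI_bounded) auto
  qed
qed

lemma W_diff: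
  assumes i: "integrable lborel (\<lambda>r. w (x, r))" and st: "bm < s" "s \<le> t"
  shows "W (x, t) - W (x, s) = (LINT r|lborel. w (x, r) * indicator {s..t} r)"
proof -
  have "W (x, t) - W (x, s) = (LINT r|lborel. w (x, r) * indicator {bm<..<t} r - w (x, r) * indicator {bm<..<s} r)"
    unfolding W_def fst_conv snd_conv
    by (rule Bochner_Integration.integral_diff[symmetric]; rule integrable_mult_indicator'[OF i]) auto
  also have "\<dots> = (LINT r|lborel. w (x, r) * indicator {s..t} r)"
  proof (rule integral_cong_AE)
    show "AE r in lborel. w (x, r) * indicator {bm<..<t} r - w (x, r) * indicator {bm<..<s} r = w (x, r) * indicator {s..t} r"
      using AE_lborel_singleton[of t]
    proof eventually_elim
      case (elim r)
      then show ?case using st by (auto simp: indicator_def)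
    qed
  qed measurable
  finally show ?thesis .
qed

definition U :: "'a \<times> real \<Rightarrow> real" where "U z = u0 z - W z"

lemma U_measurable [measurable]: "U \<in> borel_measurable borel"
  unfolding U_def[abs_def] by measurable

text \<open>\<open>u0\<close> and \<open>W\<close> have the same vertical increments, both being
  integrals of \<open>w\<close> over the segment.\<close>

lemma U_increment:
  assumes \<tau>: "0 \<le> \<tau>"
  shows "AE z in lborel. z \<in> S \<longrightarrow> z + \<tau> *\<^sub>R (0, 1) \<in> S \<longrightarrow> U (z + \<tau> *\<^sub>R (0, 1)) = U z"
  using increment[OF vertical_Basis \<tau>] AE_fst_lborel[OF AE_w_integrable]
proof eventually_elim
  case (elim z)
  obtain x s where z: "z = (x, s)" by (cases z)
  show ?case
  proof (intro impI)
    assume S: "z \<in> S" "z + \<tau> *\<^sub>R (0, 1) \<in> S"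
    have "u0 (x, s + \<tau>) - u0 (x, s) = (LINT t|lborel. indicator {0..\<tau>} t * w (x, s + t))"
      using elim(1) S by (simp add: z)
    also have "\<dots> = (LINT t|lborel. w (x, t + s) * indicator {s..s + \<tau>} (t + s))"
      by (intro Bochner_Integration.integral_cong) (auto simp: indicator_def add.commute)
    also have "\<dots> = (LINT r|lborel. w (x, r) * indicator {s..s + \<tau>} r)"
      by (rule integral_lborel_shift[of "\<lambda>r. w (x, r) * indicator {s..s + \<tau>} r"]) measurable
    also have "\<dots> = W (x, s + \<tau>) - W (x, s)"
      using elim(2) S \<tau> by (intro W_diff[symmetric]) (auto simp: z strip_iff)
    finally show "U (z + \<tau> *\<^sub>R (0, 1)) = U z" by (simp add: U_def z)
  qed
qed

text \<open>For each step \<tau> the invariance fails on a null set that depends on \<tau>. Fubini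
  exchanges the quantifiers: on almost every line almost all pairs of heights have equal values, and
  one good height provides the constant.\<close>

lemma U_constant_on_lines:
  "AE x in lborel. \<exists>c. AE t in lborel. t \<in> I \<longrightarrow> U (x, t) = c"
proof -
  let ?P = "\<lambda>(\<tau> :: real) (z :: 'a \<times> real). 0 \<le> \<tau> \<longrightarrow> snd z \<in> I \<longrightarrow> snd z + \<tau> \<in> I \<longrightarrow> U (fst z, snd z + \<tau>) = U z"
  have 1: "AE \<tau> in lborel. AE z in lborel. ?P \<tau> z"
  proof (rule AE_I2)
    fix \<tau> :: real
    show "AE z in lborel. ?P \<tau> z"
    proof (cases "0 \<le> \<tau>")
      case True
      from U_increment[OF True] show ?thesis
      proof eventually_elim
        case (elim z)
        then show ?case by (cases z) (auto simp: strip_iff)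
      qed
    qed simp
  qed
  have meas: "{y \<in> space (lborel \<Otimes>\<^sub>M lborel). ?P (fst y) (snd y)} \<in> sets (lborel \<Otimes>\<^sub>M lborel)"
    by measurable
  have "AE z in lborel. AE \<tau> in lborel. ?P \<tau> z"
    by (rule iffD1[OF lborel_pair.AE_commute[of ?P, OF meas] 1])
  from AE_pair_lines[OF this] show ?thesis
  proof eventually_elim
    case (elim x)
    have a: "AE s in lborel. AE t in lborel. s \<in> I \<and> t \<in> I \<and> s \<le> t \<longrightarrow> U (x, t) = U (x, s)"
      using elim
    proof eventually_elim
      case (elim s)
      \<comment> \<open>Substitutes t = s + \<tau> for the step.\<close>
      from AE_lborel_shift[OF elim, of "- s"] show ?case
        by eventually_elim auto
    qed
    have m: "{y \<in> space (lborel \<Otimes>\<^sub>M lborel). fst y \<in> I \<and> snd y \<in> I \<and> fst y \<le> snd y \<longrightarrow> U (x, snd y) = U (x, fst y)} \<in> sets (lborel \<Otimes>\<^sub>M lborel)"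
      by measurable
    \<comment> \<open>Exchanging the two heights removes the restriction s \<le> t.\<close>
    have b: "AE t in lborel. AE s in lborel. s \<in> I \<and> t \<in> I \<and> s \<le> t \<longrightarrow> U (x, t) = U (x, s)"
      by (rule iffD1[OF lborel_pair.AE_commute[of "\<lambda>s t. s \<in> I \<and> t \<in> I \<and> s \<le> t \<longrightarrow> U (x, t) = U (x, s)", OF m] a])
    have "AE s in lborel. AE t in lborel. s \<in> I \<longrightarrow> t \<in> I \<longrightarrow> U (x, t) = U (x, s)"
      using a b
    proof eventually_elim
      case (elim s)
      from elim show ?case
      proof eventually_elim
        case (elim t)
        then show ?case by (cases "s \<le> t") auto
      qed
    qed
    then obtain s where "s \<in> I" "AE t in lborel. s \<in> I \<longrightarrow> t \<in> I \<longrightarrow> U (x, t) = U (x, s)"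
      using AE_exists_in_interval[OF _ bm_bp, of "\<lambda>s. AE t in lborel. s \<in> I \<longrightarrow> t \<in> I \<longrightarrow> U (x, t) = U (x, s)"] by auto
    then show ?case by (intro exI[of _ "U (x, s)"]) auto
  qed
qed

text \<open>\<open>U\<close> is a.e. constant on vertical segments, so the mean below is its value there.\<close>

definition Tm :: "'a \<Rightarrow> real" where
  "Tm x = (LINT t|lborel. U (x, t) * indicator I t) / (bp - bm)"

definition Tp :: "'a \<Rightarrow> real" where
  "Tp x = Tm x + W (x, bp)"

lemma Tm_measurable [measurable]: "Tm \<in> borel_measurable borel"
proof -
  have "(\<lambda>(x, t). U (x, t) * indicator I t) \<in> borel_measurable (borel \<Otimes>\<^sub>M lborel)"
    by measurable
  from lborel.borel_measurable_lebesgue_integral[OF this] show ?thesis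
    unfolding Tm_def[abs_def] by simp
qed

lemma Tp_measurable [measurable]: "Tp \<in> borel_measurable borel"
  unfolding Tp_def[abs_def] by measurable

lemma constant_eq_Tm:
  assumes "AE t in lborel. t \<in> I \<longrightarrow> U (x, t) = c"
  shows "Tm x = c"
proof -
  have "(LINT t|lborel. U (x, t) * indicator I t) = (LINT t|lborel. c * indicator I t)"
  proof (rule integral_cong_AE)
    show "AE t in lborel. U (x, t) * indicator I t = c * indicator I t"
      using assms by eventually_elim (auto simp: indicator_def)
  qed measurable
  also have "\<dots> = c * (bp - bm)" using bm_bp by simp
  finally show ?thesis using bm_bp by (simp add: Tm_def)
qed

lemma AE_representation:
  "AE x in lborel. integrable lborel (\<lambda>r. w (x, r)) \<and> (AE t in lborel. t \<in> I \<longrightarrow> u0 (x, t) = Tm x + W (x, t))"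
  using U_constant_on_lines AE_w_integrable
proof eventually_elim
  case (elim x)
  then obtain c where c: "AE t in lborel. t \<in> I \<longrightarrow> U (x, t) = c" by auto
  from c have "AE t in lborel. t \<in> I \<longrightarrow> u0 (x, t) = Tm x + W (x, t)"
    unfolding constant_eq_Tm[OF c] by eventually_elim (auto simp: U_def)
  then show ?case using elim by simp
qed

lemma W_top: "W (x, bp) = (LINT r|lborel. w (x, r))"
  unfolding W_def using w_outside by (intro Bochner_Integration.integral_cong) (auto simp: indicator_def)

lemma Tp_minus_representation:
  assumes i: "integrable lborel (\<lambda>r. w (x, r))" and t: "t \<in> I"
  shows "Tp x - (Tm x + W (x, t)) = (LINT r|lborel. w (x, r) * indicator {t..bp} r)"
  using W_diff[OF i, of t bp] t by (simp add: Tp_def)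

lemma jump_estimate:
  "(\<integral>\<^sup>+x. ennreal (\<bar>Tp x - Tm x\<bar> powr p) \<partial>lborel) \<le> ennreal ((bp - bm) powr (p - 1)) * (\<integral>\<^sup>+z. ennreal (\<bar>w z\<bar> powr p) \<partial>lborel)"
proof -
  have "(\<integral>\<^sup>+x. ennreal (\<bar>Tp x - Tm x\<bar> powr p) \<partial>lborel) \<le>
    (\<integral>\<^sup>+x. ennreal ((bp - bm) powr (p - 1)) * (\<integral>\<^sup>+r. ennreal (\<bar>w (x, r)\<bar> powr p) \<partial>lborel) \<partial>lborel)"
  proof (rule nn_integral_mono)
    fix x
    have "ennreal (\<bar>Tp x - Tm x\<bar> powr p) = epowr (ennreal \<bar>W (x, bp)\<bar>) p" by (simp add: Tp_def epowr_ennreal)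
    also have "\<dots> \<le> epowr (\<integral>\<^sup>+r. ennreal \<bar>w (x, r)\<bar> \<partial>lborel) p"
      using p unfolding W_top by (intro epowr_mono abs_integral_le_nn_integral) auto
    also have "\<dots> \<le> ennreal ((bp - bm) powr (p - 1)) * (\<integral>\<^sup>+r. ennreal (\<bar>w (x, r)\<bar> powr p) \<partial>lborel)"
      by (rule line_abs_integral_le)
    finally show "ennreal (\<bar>Tp x - Tm x\<bar> powr p) \<le> ennreal ((bp - bm) powr (p - 1)) * (\<integral>\<^sup>+r. ennreal (\<bar>w (x, r)\<bar> powr p) \<partial>lborel)" .
  qed
  also have "\<dots> = ennreal ((bp - bm) powr (p - 1)) * (\<integral>\<^sup>+x. (\<integral>\<^sup>+r. ennreal (\<bar>w (x, r)\<bar> powr p) \<partial>lborel) \<partial>lborel)"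
    by (rule nn_integral_cmult) (rule lborel.borel_measurable_nn_integral, measurable)
  finally show ?thesis by (simp only: power_line_integral)
qed

end

section \<open>Seminorm of the boundary values\<close>

text \<open>Serves to measure heights as distances from a boundary hyperplane: \<sigma> = 1 upwards
  from \<open>bm\<close>, \<sigma> = -1 downwards from \<open>bp\<close>. One argument then covers
  both boundary values.\<close>

lemma nn_integral_reflect:
  fixes F :: "real \<Rightarrow> ennreal"
  assumes [measurable]: "F \<in> borel_measurable borel" "A \<in> sets borel" and \<sigma>: "\<sigma> = 1 \<or> \<sigma> = -1"
  shows "(\<integral>\<^sup>+\<rho>\<in>A. F (\<beta> + \<sigma> * \<rho>) \<partial>lborel) = (\<integral>\<^sup>+t. F t * indicator {t. \<sigma> * (t - \<beta>) \<in> A} t \<partial>lborel)"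
proof -
  have [measurable]: "{t. \<sigma> * (t - \<beta>) \<in> A} \<in> sets borel"
  proof -
    have "(\<lambda>t. \<sigma> * (t - \<beta>)) -` A \<inter> space borel \<in> sets borel" by (rule measurable_sets[OF _ assms(2)]) measurable
    then show ?thesis by (simp add: vimage_def)
  qed
  have "(\<integral>\<^sup>+t. F t * indicator {t. \<sigma> * (t - \<beta>) \<in> A} t \<partial>lborel) =
      ennreal \<bar>\<sigma>\<bar> * (\<integral>\<^sup>+\<rho>. F (\<beta> + \<sigma> * \<rho>) * indicator {t. \<sigma> * (t - \<beta>) \<in> A} (\<beta> + \<sigma> * \<rho>) \<partial>lborel)"
    using \<sigma> by (intro nn_integral_real_affine) auto
  also have "\<dots> = (\<integral>\<^sup>+\<rho>\<in>A. F (\<beta> + \<sigma> * \<rho>) \<partial>lborel)"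
    using \<sigma> by (auto simp: indicator_def intro!: nn_integral_cong)
  finally show ?thesis by simp
qed

lemma AE_reflect:
  assumes "AE t in lborel. P (t :: real)" and \<sigma>: "\<sigma> = 1 \<or> \<sigma> = -1"
  shows "AE \<rho> in lborel. P (\<beta> + \<sigma> * \<rho>)"
proof -
  obtain N where N: "N \<in> sets borel" "emeasure lborel N = 0" "{x. \<not> P x} \<subseteq> N"
    using assms(1) unfolding eventually_ae_filter by (auto simp: null_sets_def)
  have [measurable]: "(\<lambda>\<rho>. \<beta> + \<sigma> * \<rho>) -` N \<in> sets borel"
    using measurable_sets[of "\<lambda>\<rho>. \<beta> + \<sigma> * \<rho>" borel borel N] N(1) by simp
  have "emeasure lborel ((\<lambda>\<rho>. \<beta> + \<sigma> * \<rho>) -` N) = (\<integral>\<^sup>+\<rho>. indicator ((\<lambda>\<rho>. \<beta> + \<sigma> * \<rho>) -` N) \<rho> \<partial>lborel)"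
    by (rule nn_integral_indicator[symmetric]) simp
  also have "\<dots> = (\<integral>\<^sup>+\<rho>\<in>UNIV. indicator N (\<beta> + \<sigma> * \<rho>) \<partial>lborel)"
    by (intro nn_integral_cong) (simp add: indicator_def)
  also have "\<dots> = (\<integral>\<^sup>+t. indicator N t * indicator {t. \<sigma> * (t - \<beta>) \<in> UNIV} t \<partial>lborel)"
    using N(1) \<sigma> by (intro nn_integral_reflect) auto
  also have "\<dots> = 0" using N by simp
  finally have "(\<lambda>\<rho>. \<beta> + \<sigma> * \<rho>) -` N \<in> null_sets lborel" by (intro null_setsI) auto
  then show ?thesis by (rule AE_I') (use N(3) in auto)
qed

lemma AE_exists_in_ball:
  assumes "AE x in lborel. R (x :: 'a::euclidean_space)" "0 < r"
  shows "\<exists>x\<in>ball y r. R x"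
proof (rule ccontr)
  assume c: "\<not> ?thesis"
  obtain N where N: "N \<in> null_sets lborel" "{s. \<not> R s} \<subseteq> N"
    using assms(1) unfolding eventually_ae_filter by auto
  have "ball y r \<subseteq> N" using c N(2) by auto
  then have "emeasure lborel (ball y r) \<le> emeasure lborel N" using N(1) by (intro emeasure_mono) auto
  then have "emeasure lborel (ball y r) = 0" using N(1) by auto
  then show False using assms(2) unit_ball_vol_pos[of "real DIM('a)"] by (simp add: emeasure_ball)
qed

text \<open>For almost every centre x the inner integral is finite; since |h|^q \<le> L^q it bounds
  f - f(x) in L^p on the ball of radius L around x. Such centres are dense, so finitely many of
  these balls cover the compact set.\<close>

lemma locally_Lp_if_finite_seminorm:
  fixes f :: "'a::euclidean_space \<Rightarrow> real"
  assumes p: "1 < p" and L: "0 < L" and q: "0 < q" and [measurable]: "f \<in> borel_measurable borel"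
    and fin: "(\<integral>\<^sup>+x. (\<integral>\<^sup>+h\<in>ball 0 L. ennreal (\<bar>f (x + h) - f x\<bar> powr p / norm h powr q) \<partial>lborel) \<partial>lborel) < \<infinity>"
    and K: "compact K"
  shows "(\<integral>\<^sup>+x\<in>K. ennreal (\<bar>f x\<bar> powr p) \<partial>lborel) < \<infinity>"
proof -
  let ?X = "\<lambda>x. \<integral>\<^sup>+h\<in>ball 0 L. ennreal (\<bar>f (x + h) - f x\<bar> powr p / norm h powr q) \<partial>lborel"
  have [measurable]: "ball y L \<in> sets borel" for y :: 'a by simp
  have "AE x in lborel. ?X x \<noteq> \<infinity>"
  proof (rule nn_integral_PInf_AE)
    show "?X \<in> borel_measurable lborel" by (rule lborel.borel_measurable_nn_integral) measurable
  qed (use fin in auto)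
  then have ex: "\<exists>x\<in>ball y L. ?X x \<noteq> \<infinity>" for y by (rule AE_exists_in_ball[OF _ L])
  have cov: "K \<subseteq> (\<Union>x\<in>{x. ?X x \<noteq> \<infinity>}. ball x L)"
  proof -
    have "y \<in> (\<Union>x\<in>{x. ?X x \<noteq> \<infinity>}. ball x L)" for y
    proof -
      obtain x where "x \<in> ball y L" "?X x \<noteq> \<infinity>" using ex[of y] by blast
      then show ?thesis by (intro UN_I[of x]) (simp_all add: dist_commute)
    qed
    then show ?thesis by blast
  qed
  have near: "(\<integral>\<^sup>+y\<in>ball x L. ennreal (\<bar>f y\<bar> powr p) \<partial>lborel) < \<infinity>" if x: "?X x \<noteq> \<infinity>" for x
  proof -
    have "(\<integral>\<^sup>+y\<in>ball x L. ennreal (\<bar>f y\<bar> powr p) \<partial>lborel) = (\<integral>\<^sup>+h. ennreal (\<bar>f (h + x)\<bar> powr p) * indicator (ball x L) (h + x) \<partial>lborel)"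
      by (rule nn_integral_lborel_shift[symmetric]) measurable
    also have "\<dots> \<le> (\<integral>\<^sup>+h. ennreal (2 powr p) * (ennreal (L powr q) * (ennreal (\<bar>f (x + h) - f x\<bar> powr p / norm h powr q) * indicator (ball 0 L) h)
        + ennreal (\<bar>f x\<bar> powr p) * indicator (ball 0 L) h) \<partial>lborel)"
    proof (rule nn_integral_mono)
      fix h
      show "ennreal (\<bar>f (h + x)\<bar> powr p) * indicator (ball x L) (h + x) \<le> ennreal (2 powr p) * (ennreal (L powr q) *
        (ennreal (\<bar>f (x + h) - f x\<bar> powr p / norm h powr q) * indicator (ball 0 L) h) + ennreal (\<bar>f x\<bar> powr p) * indicator (ball 0 L) h)"
      proof (cases "h \<in> ball 0 L")
        case True
        have "ennreal (\<bar>f (x + h) - f x\<bar> powr p) \<le> ennreal (L powr q) * ennreal (\<bar>f (x + h) - f x\<bar> powr p / norm h powr q)"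
        proof (cases "h = 0")
          case False
          then have "norm h powr q \<le> L powr q" "0 < norm h powr q" using True q by (auto intro: powr_mono2)
          then have "1 \<le> L powr q / norm h powr q" by simp
          then have "\<bar>f (x + h) - f x\<bar> powr p * 1 \<le> \<bar>f (x + h) - f x\<bar> powr p * (L powr q / norm h powr q)" by (intro mult_left_mono) auto
          then have "ennreal (\<bar>f (x + h) - f x\<bar> powr p) \<le> ennreal (L powr q * (\<bar>f (x + h) - f x\<bar> powr p / norm h powr q))"
            by (intro ennreal_leI) (simp add: mult.commute)
          also have "\<dots> = ennreal (L powr q) * ennreal (\<bar>f (x + h) - f x\<bar> powr p / norm h powr q)"
            by (rule ennreal_mult) auto
          finally show ?thesis .
        qed simp
        then have "ennreal (\<bar>(f (x + h) - f x) + f x\<bar> powr p) \<le> ennreal (2 powr p) * (ennreal (L powr q) * ennreal (\<bar>f (x + h) - f x\<bar> powr p / norm h powr q) + ennreal (\<bar>f x\<bar> powr p))"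
          using p by (intro order_trans[OF powr_add_le] mult_left_mono add_mono) auto
        moreover have "h + x \<in> ball x L" using True by (simp add: dist_norm)
        ultimately show ?thesis using True by (simp add: add.commute)
      next
        case False
        then have "h + x \<notin> ball x L" by (simp add: dist_norm)
        then show ?thesis by simp
      qed
    qed
    also have "\<dots> = ennreal (2 powr p) * (ennreal (L powr q) * ?X x + ennreal (\<bar>f x\<bar> powr p) * emeasure lborel (ball (0::'a) L))"
      by (simp add: nn_integral_cmult nn_integral_add)
    also have "\<dots> < \<infinity>"
      using x emeasure_lborel_ball_finite[of "0::'a" L] by (auto simp: ennreal_mult_less_top less_top)
    finally show ?thesis .
  qed
  obtain C where C: "C \<subseteq> {x. ?X x \<noteq> \<infinity>}" "finite C" "K \<subseteq> (\<Union>x\<in>C. ball x L)"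
    by (rule compactE_image[OF K _ cov]) auto
  have "(\<integral>\<^sup>+y\<in>K. ennreal (\<bar>f y\<bar> powr p) \<partial>lborel) \<le> (\<integral>\<^sup>+y. (\<Sum>x\<in>C. ennreal (\<bar>f y\<bar> powr p) * indicator (ball x L) y) \<partial>lborel)"
  proof (rule nn_integral_mono)
    fix y
    show "ennreal (\<bar>f y\<bar> powr p) * indicator K y \<le> (\<Sum>x\<in>C. ennreal (\<bar>f y\<bar> powr p) * indicator (ball x L) y)"
    proof (cases "y \<in> K")
      case True
      then obtain x where x: "x \<in> C" "y \<in> ball x L" using C(3) by auto
      then have "ennreal (\<bar>f y\<bar> powr p) * indicator K y = ennreal (\<bar>f y\<bar> powr p) * indicator (ball x L) y" using True by simp
      also have "\<dots> \<le> (\<Sum>x\<in>C. ennreal (\<bar>f y\<bar> powr p) * indicator (ball x L) y)"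
        using C(2) x(1) by (intro member_le_sum) auto
      finally show ?thesis .
    qed simp
  qed
  also have "\<dots> = (\<Sum>x\<in>C. \<integral>\<^sup>+y\<in>ball x L. ennreal (\<bar>f y\<bar> powr p) \<partial>lborel)"
    by (rule nn_integral_sum) measurable
  also have "\<dots> < \<infinity>" using C(1,2) near by (auto simp: less_top[symmetric] ennreal_sum_eq_top)
  finally show ?thesis .
qed

lemma weak_grad_inner: "b \<in> Basis \<Longrightarrow> weak_grad \<Omega> u z \<bullet> b = weak_partial \<Omega> b u z"
  unfolding weak_grad_def by (simp add: inner_sum_left_Basis)

text \<open>The first summand is the constant in Hardy's inequality. The second one is lost in bounding a horizontal
  translation by \<open>n\<close> successive translations along the coordinate axes.\<close>

definition trace_const :: "nat \<Rightarrow> real \<Rightarrow> real" where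
  "trace_const n p = 2 * seminorm_const n p * ((1 - 1 / p) powr (- p) + (2 powr p) ^ n * n)"

context strip_sobolev
begin

definition G :: ennreal where
  "G = (\<integral>\<^sup>+z\<in>S. ennreal (norm (weak_grad S u z) powr p) \<partial>lborel)"

lemma D_le_grad:
  assumes "b \<in> Basis" shows "ennreal (\<bar>D b z\<bar> powr p) \<le> ennreal (norm (weak_grad S u z) powr p) * indicator S z"
proof (cases "z \<in> S")
  case True
  then have "\<bar>D b z\<bar> \<le> norm (weak_grad S u z)"
    using Basis_le_norm[OF assms, of "weak_grad S u z"] by (simp add: D_def weak_grad_inner[OF assms])
  then show ?thesis using True p by (auto intro!: ennreal_leI powr_mono2)
qed (use p in \<open>simp add: D_def\<close>)

lemma D_Lp_le_G: "b \<in> Basis \<Longrightarrow> (\<integral>\<^sup>+z. ennreal (\<bar>D b z\<bar> powr p) \<partial>lborel) \<le> G"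
  unfolding G_def by (intro nn_integral_mono D_le_grad)

lemma G_finite: "G < \<infinity>"
proof -
  let ?N = "real DIM('a \<times> real)"
  have "G \<le> (\<integral>\<^sup>+z. ennreal (?N powr p) * (\<Sum>b\<in>Basis. ennreal (\<bar>D b z\<bar> powr p)) \<partial>lborel)"
    unfolding G_def
  proof (rule nn_integral_mono)
    fix z :: "'a \<times> real"
    show "ennreal (norm (weak_grad S u z) powr p) * indicator S z \<le> ennreal (?N powr p) * (\<Sum>b\<in>Basis. ennreal (\<bar>D b z\<bar> powr p))"
    proof (cases "z \<in> S")
      case True
      \<comment> \<open>The largest partial derivative at \<open>z\<close> bounds the norm up to the
        factor N, and its own summand pays for it.\<close>
      define m where "m = Max ((\<lambda>b. \<bar>D b z\<bar>) ` Basis)"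
      have "m \<in> (\<lambda>b. \<bar>D b z\<bar>) ` Basis" unfolding m_def by (rule Max_in) auto
      then obtain b where b: "b \<in> Basis" "m = \<bar>D b z\<bar>" by auto
      have le: "\<bar>D c z\<bar> \<le> m" if "c \<in> Basis" for c unfolding m_def using that by (intro Max_ge) auto
      have "norm (weak_grad S u z) \<le> (\<Sum>c\<in>Basis. \<bar>weak_grad S u z \<bullet> c\<bar>)" by (rule norm_le_l1)
      also have "\<dots> \<le> (\<Sum>c\<in>(Basis :: ('a \<times> real) set). m)"
        using le True by (intro sum_mono) (simp add: weak_grad_inner D_def)
      also have "\<dots> = ?N * m" by simp
      finally have "norm (weak_grad S u z) powr p \<le> (?N * m) powr p" using p by (intro powr_mono2) auto
      also have "\<dots> = ?N powr p * m powr p" using b by (simp add: powr_mult)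
      finally have "ennreal (norm (weak_grad S u z) powr p) \<le> ennreal (?N powr p) * ennreal (\<bar>D b z\<bar> powr p)"
        using b by (simp add: ennreal_leI flip: ennreal_mult)
      also have "\<dots> \<le> ennreal (?N powr p) * (\<Sum>b\<in>Basis. ennreal (\<bar>D b z\<bar> powr p))"
        using b by (intro mult_left_mono member_le_sum) auto
      finally show ?thesis using True by simp
    qed simp
  qed
  also have "\<dots> = ennreal (?N powr p) * (\<Sum>b\<in>Basis. \<integral>\<^sup>+z. ennreal (\<bar>D b z\<bar> powr p) \<partial>lborel)"
    by (subst nn_integral_cmult, simp, subst nn_integral_sum, simp, simp)
  also have "\<dots> < \<infinity>"
  proof -
    have "(\<integral>\<^sup>+z. ennreal (\<bar>D b z\<bar> powr p) \<partial>lborel) < top" if "b \<in> Basis" for b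
      using D_Lp[OF that] by simp
    then have "(\<Sum>b\<in>(Basis :: ('a \<times> real) set). \<integral>\<^sup>+z. ennreal (\<bar>D b z\<bar> powr p) \<partial>lborel) < top"
      unfolding ennreal_sum_less_top[OF finite_Basis] by (rule ballI)
    then show ?thesis by (simp add: ennreal_mult_less_top)
  qed
  finally show ?thesis .
qed

text \<open>In both cases \<open>u0\<close> at distance \<rho> from the hyperplane differs from the
  boundary value by an integral of \<open>w\<close> over the segment in between.\<close>

lemma boundary_vertical_estimate:
  assumes cases: "(\<sigma>, \<beta>, f) = (1, bm, Tm) \<or> (\<sigma>, \<beta>, f) = (-1, bp, Tp)"
  shows "AE z in lborel. snd z \<in> {0<..<bp - bm} \<longrightarrow>
    ennreal \<bar>u0 (fst z, \<beta> + \<sigma> * snd z) - f (fst z)\<bar> \<le> (\<integral>\<^sup>+s\<in>{0<..<snd z}. ennreal \<bar>w (fst z, \<beta> + \<sigma> * s)\<bar> \<partial>lborel)"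
proof (rule AE_lines_pair)
  have \<sigma>: "\<sigma> = 1 \<or> \<sigma> = -1" using cases by auto
  show "AE x in lborel. AE t in lborel. snd (x, t) \<in> {0<..<bp - bm} \<longrightarrow>
    ennreal \<bar>u0 (fst (x, t), \<beta> + \<sigma> * snd (x, t)) - f (fst (x, t))\<bar> \<le> (\<integral>\<^sup>+s\<in>{0<..<snd (x, t)}. ennreal \<bar>w (fst (x, t), \<beta> + \<sigma> * s)\<bar> \<partial>lborel)"
    using AE_representation
  proof eventually_elim
    case (elim x)
    then have i: "integrable lborel (\<lambda>r. w (x, r))" and ae: "AE t in lborel. t \<in> I \<longrightarrow> u0 (x, t) = Tm x + W (x, t)" by auto
    have [measurable]: "(\<lambda>r. ennreal \<bar>w (x, r)\<bar>) \<in> borel_measurable borel" by measurable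
    from AE_reflect[OF ae \<sigma>, of \<beta>] show ?case
    proof eventually_elim
      case (elim \<rho>)
      show ?case
      proof
        assume "snd (x, \<rho>) \<in> {0<..<bp - bm}"
        then have \<rho>: "0 < \<rho>" "\<rho> < bp - bm" by auto
        \<comment> \<open>The closed interval dominates both the open one of the lower case and the
          closed one of the upper case; its end points are removed afterwards.\<close>
        have "ennreal \<bar>u0 (x, \<beta> + \<sigma> * \<rho>) - f x\<bar> \<le> (\<integral>\<^sup>+t. ennreal \<bar>w (x, t)\<bar> * indicator {t. \<sigma> * (t - \<beta>) \<in> {0..\<rho>}} t \<partial>lborel)"
          using cases
        proof
          assume c: "(\<sigma>, \<beta>, f) = (1, bm, Tm)"
          then have "u0 (x, \<beta> + \<sigma> * \<rho>) - f x = (LINT r|lborel. w (x, r) * indicator {bm<..<bm + \<rho>} r)"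
            using elim \<rho> by (simp add: W_def)
          then show ?thesis using c
            by (simp only: prod.inject) (rule order_trans[OF abs_integral_le_nn_integral], auto intro!: nn_integral_mono simp: indicator_def)
        next
          assume c: "(\<sigma>, \<beta>, f) = (-1, bp, Tp)"
          have "Tp x - (Tm x + W (x, bp - \<rho>)) = (LINT r|lborel. w (x, r) * indicator {bp - \<rho>..bp} r)"
            using \<rho> by (intro Tp_minus_representation[OF i]) auto
          then have "\<bar>u0 (x, \<beta> + \<sigma> * \<rho>) - f x\<bar> = \<bar>LINT r|lborel. w (x, r) * indicator {bp - \<rho>..bp} r\<bar>"
            using elim \<rho> c by (simp add: abs_minus_commute)
          then show ?thesis using c
            by (simp only: prod.inject) (rule order_trans[OF abs_integral_le_nn_integral], auto intro!: nn_integral_mono simp: indicator_def)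
        qed
        also have "\<dots> = (\<integral>\<^sup>+s\<in>{0..\<rho>}. ennreal \<bar>w (x, \<beta> + \<sigma> * s)\<bar> \<partial>lborel)"
          using \<sigma> by (intro nn_integral_reflect[symmetric]) auto
        also have "\<dots> = (\<integral>\<^sup>+s\<in>{0<..<\<rho>}. ennreal \<bar>w (x, \<beta> + \<sigma> * s)\<bar> \<partial>lborel)"
        proof (rule nn_integral_cong_AE)
          show "AE s in lborel. ennreal \<bar>w (x, \<beta> + \<sigma> * s)\<bar> * indicator {0..\<rho>} s = ennreal \<bar>w (x, \<beta> + \<sigma> * s)\<bar> * indicator {0<..<\<rho>} s"
            using AE_lborel_singleton[of "0::real"] AE_lborel_singleton[of \<rho>]
          proof eventually_elim
            case (elim s)
            then show ?case by (auto simp: indicator_def)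
          qed
        qed
        finally show "ennreal \<bar>u0 (fst (x, \<rho>), \<beta> + \<sigma> * snd (x, \<rho>)) - f (fst (x, \<rho>))\<bar> \<le>
          (\<integral>\<^sup>+s\<in>{0<..<snd (x, \<rho>)}. ennreal \<bar>w (fst (x, \<rho>), \<beta> + \<sigma> * s)\<bar> \<partial>lborel)" by simp
      qed
    qed
  qed
  have [measurable]: "f \<in> borel_measurable borel" using cases by auto
  have Am: "(\<lambda>z :: 'a \<times> real. \<integral>\<^sup>+s\<in>{0<..<snd z}. ennreal \<bar>w (fst z, \<beta> + \<sigma> * s)\<bar> \<partial>lborel) \<in> borel_measurable borel"
  proof -
    have "(\<lambda>(z :: 'a \<times> real, s). ennreal \<bar>w (fst z, \<beta> + \<sigma> * s)\<bar> * (if 0 < s \<and> s < snd z then 1 else 0)) \<in> borel_measurable (borel \<Otimes>\<^sub>M lborel)"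
      by measurable
    from lborel.borel_measurable_nn_integral[OF this]
    have "(\<lambda>z :: 'a \<times> real. \<integral>\<^sup>+s. ennreal \<bar>w (fst z, \<beta> + \<sigma> * s)\<bar> * (if 0 < s \<and> s < snd z then 1 else 0) \<partial>lborel) \<in> borel_measurable borel" by simp
    moreover have "(if 0 < s \<and> s < t then 1 else 0 :: ennreal) = indicator {0<..<t} s" for s t :: real by (simp add: indicator_def)
    ultimately show ?thesis by (simp only:)
  qed
  show "{z :: 'a \<times> real. snd z \<in> {0<..<bp - bm} \<longrightarrow> ennreal \<bar>u0 (fst z, \<beta> + \<sigma> * snd z) - f (fst z)\<bar> \<le>
    (\<integral>\<^sup>+s\<in>{0<..<snd z}. ennreal \<bar>w (fst z, \<beta> + \<sigma> * s)\<bar> \<partial>lborel)} \<in> sets borel"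
  proof -
    define F where "F z = ennreal \<bar>u0 (fst z, \<beta> + \<sigma> * snd z) - f (fst z)\<bar>" for z :: "'a \<times> real"
    define H where "H z = (\<integral>\<^sup>+s\<in>{0<..<snd z}. ennreal \<bar>w (fst z, \<beta> + \<sigma> * s)\<bar> \<partial>lborel)" for z :: "'a \<times> real"
    have Fm: "F \<in> borel_measurable borel" unfolding F_def[abs_def] by measurable
    have Hm: "H \<in> borel_measurable borel" unfolding H_def[abs_def] by (rule Am)
    have "{z \<in> space borel. F z \<le> H z} \<in> sets borel" using Fm Hm by (rule borel_measurable_le)
    moreover have "(UNIV :: 'a set) \<times> {0<..<bp - bm} \<in> sets borel" by (intro borel_open open_Times) auto
    ultimately have "- ((UNIV :: 'a set) \<times> {0<..<bp - bm}) \<union> {z \<in> space borel. F z \<le> H z} \<in> sets borel"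
      by (intro sets.Un borel_comp)
    also have "- ((UNIV :: 'a set) \<times> {0<..<bp - bm}) \<union> {z \<in> space borel. F z \<le> H z} = {z. snd z \<in> {0<..<bp - bm} \<longrightarrow> F z \<le> H z}"
      by auto
    finally show ?thesis unfolding F_def H_def .
  qed
qed

lemma nn_integral_layers:
  assumes [measurable]: "F \<in> borel_measurable borel" "J \<in> sets borel"
  shows "(\<integral>\<^sup>+z. F z * indicator J (snd (z :: 'a \<times> real)) \<partial>lborel) = (\<integral>\<^sup>+t. (\<integral>\<^sup>+x. F (x, t) \<partial>lborel) * indicator J t \<partial>lborel)"
proof -
  have [measurable]: "F \<in> borel_measurable (borel \<Otimes>\<^sub>M borel)" using assms(1) by (simp only: borel_prod)
  have "(\<integral>\<^sup>+z. F z * indicator J (snd z) \<partial>(lborel \<Otimes>\<^sub>M lborel)) = (\<integral>\<^sup>+t. (\<integral>\<^sup>+x. F (x, t) * indicator J t \<partial>lborel) \<partial>lborel)"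
    by (subst lborel_pair.nn_integral_snd[symmetric]) (auto simp: case_prod_beta')
  also have "\<dots> = (\<integral>\<^sup>+t. (\<integral>\<^sup>+x. F (x, t) \<partial>lborel) * indicator J t \<partial>lborel)"
    by (intro nn_integral_cong nn_integral_multc) measurable
  finally show ?thesis by (simp only: lborel_prod)
qed

text \<open>In the abstract estimate \<open>g\<close> becomes the absolute value of the vertical
  derivative, and \<open>\<Gamma>\<close> at height \<rho> the horizontal energy of that layer with
  the constant of \<open>dq_le\<close>. The energies of both are bounded by multiples of
  \<open>G\<close>.\<close>

lemma boundary_seminorm_estimate:
  fixes \<sigma> \<beta> :: real
  assumes cases: "(\<sigma>, \<beta>, f) = (1, bm, Tm) \<or> (\<sigma>, \<beta>, f) = (-1, bp, Tp)"
  shows "(\<integral>\<^sup>+x. (\<integral>\<^sup>+h\<in>ball 0 (bp - bm). ennreal (\<bar>f (x + h) - f x\<bar> powr p / norm h powr (p + real (DIM('a) + 1) - 2)) \<partial>lborel) \<partial>lborel)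
    \<le> ennreal (trace_const DIM('a) p) * G"
proof -
  have \<sigma>: "\<sigma> = 1 \<or> \<sigma> = -1" using cases by auto
  have fm [measurable]: "f \<in> borel_measurable borel" using cases by auto
  let ?L = "bp - bm"
  let ?C = "ennreal ((2 powr p) ^ DIM('a))"
  let ?V = "\<lambda>z. u0 (fst z, \<beta> + \<sigma> * snd z)"
  let ?g = "\<lambda>z. ennreal \<bar>w (fst z, \<beta> + \<sigma> * snd z)\<bar>"
  define d where "d b t = (\<integral>\<^sup>+x. ennreal (\<bar>D (b, 0) (x, t)\<bar> powr p) \<partial>lborel)" for b t
  define \<Gamma> where "\<Gamma> \<rho> = ?C * (\<Sum>b\<in>Basis. d b (\<beta> + \<sigma> * \<rho>))" for \<rho>
  have Db [measurable]: "D (b, 0) \<in> borel_measurable borel" if "b \<in> Basis" for b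
    using that by (intro D_measurable) (simp add: Basis_prod_def)
  have d_meas: "d b \<in> borel_measurable borel" if b: "b \<in> Basis" for b
  proof -
    note [measurable] = Db[OF b]
    have "(\<lambda>(t, x). ennreal (\<bar>D (b, 0) (x, t)\<bar> powr p)) \<in> borel_measurable (borel \<Otimes>\<^sub>M lborel)" by measurable
    from lborel.borel_measurable_nn_integral[OF this] show ?thesis by (simp add: d_def[abs_def])
  qed
  have dm: "(\<lambda>\<rho>. d b (\<beta> + \<sigma> * \<rho>)) \<in> borel_measurable borel" if b: "b \<in> Basis" for b
    by (rule measurable_compose[OF _ d_meas[OF b]]) measurable
  have dmA: "(\<lambda>\<rho>. d b (\<beta> + \<sigma> * \<rho>) * indicator A \<rho>) \<in> borel_measurable borel" if b: "b \<in> Basis" and [measurable]: "A \<in> sets borel" for b A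
    using dm[OF b] by measurable
  have G_meas [measurable]: "\<Gamma> \<in> borel_measurable borel"
    unfolding \<Gamma>_def[abs_def]
    by (intro borel_measurable_times_ennreal borel_measurable_const borel_measurable_sum dm)
  \<comment> \<open>By reflection and Fubini, integrating \<open>\<Gamma>\<close> over a range of
    heights gives the horizontal energy of the corresponding layer.\<close>
  have dL_eq: "(\<integral>\<^sup>+\<rho>\<in>A. \<Gamma> \<rho> \<partial>lborel) = ?C * (\<Sum>b\<in>Basis. dL {t. \<sigma> * (t - \<beta>) \<in> A} b)" if [measurable]: "A \<in> sets borel" for A
  proof -
    have [measurable]: "{t. \<sigma> * (t - \<beta>) \<in> A} \<in> sets borel"
      using measurable_sets[of "\<lambda>t. \<sigma> * (t - \<beta>)" borel borel A] that by (simp add: vimage_def)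
    have 1: "(\<integral>\<^sup>+\<rho>\<in>A. d b (\<beta> + \<sigma> * \<rho>) \<partial>lborel) = dL {t. \<sigma> * (t - \<beta>) \<in> A} b" if b: "b \<in> Basis" for b
    proof -
      note [measurable] = Db[OF b] d_meas[OF b]
      have "(\<integral>\<^sup>+\<rho>\<in>A. d b (\<beta> + \<sigma> * \<rho>) \<partial>lborel) = (\<integral>\<^sup>+t. d b t * indicator {t. \<sigma> * (t - \<beta>) \<in> A} t \<partial>lborel)"
        by (intro nn_integral_reflect \<sigma>) measurable
      also have "\<dots> = dL {t. \<sigma> * (t - \<beta>) \<in> A} b"
        unfolding dL_def d_def by (subst nn_integral_layers) auto
      finally show ?thesis .
    qed
    have "(\<integral>\<^sup>+\<rho>\<in>A. \<Gamma> \<rho> \<partial>lborel) = (\<integral>\<^sup>+\<rho>. ?C * (\<Sum>b\<in>Basis. d b (\<beta> + \<sigma> * \<rho>) * indicator A \<rho>) \<partial>lborel)"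
      by (simp add: \<Gamma>_def sum_distrib_right mult.assoc)
    also have "\<dots> = ?C * (\<integral>\<^sup>+\<rho>. (\<Sum>b\<in>Basis. d b (\<beta> + \<sigma> * \<rho>) * indicator A \<rho>) \<partial>lborel)"
      by (intro nn_integral_cmult borel_measurable_sum) (simp add: dmA that)
    also have "(\<integral>\<^sup>+\<rho>. (\<Sum>b\<in>Basis. d b (\<beta> + \<sigma> * \<rho>) * indicator A \<rho>) \<partial>lborel) = (\<Sum>b\<in>Basis. \<integral>\<^sup>+\<rho>\<in>A. d b (\<beta> + \<sigma> * \<rho>) \<partial>lborel)"
      by (intro nn_integral_sum) (simp add: dmA that)
    finally show ?thesis by (simp add: 1)
  qed
  have "(\<integral>\<^sup>+x. (\<integral>\<^sup>+h\<in>ball 0 ?L. ennreal (\<bar>f (x + h) - f x\<bar> powr p / norm h powr (p + real (DIM('a) + 1) - 2)) \<partial>lborel) \<partial>lborel)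
    \<le> ennreal (2 * seminorm_const DIM('a) p) *
      (ennreal ((1 - 1 / p) powr (- p)) * (\<integral>\<^sup>+x. (\<integral>\<^sup>+s\<in>{0<..<?L}. epowr (?g (x, s)) p \<partial>lborel) \<partial>lborel) + (\<integral>\<^sup>+\<rho>\<in>{0<..<?L}. \<Gamma> \<rho> \<partial>lborel))"
  proof (rule fractional_seminorm_estimate[OF p fm, where U="?V"])
    show "?V \<in> borel_measurable borel" "?g \<in> borel_measurable borel" by measurable
    show "AE z in lborel. snd z \<in> {0<..<?L} \<longrightarrow> ennreal \<bar>?V z - f (fst z)\<bar> \<le> (\<integral>\<^sup>+s\<in>{0<..<snd z}. ?g (fst z, s) \<partial>lborel)"
      using boundary_vertical_estimate[OF cases] by simp
    fix h :: 'a and r :: real assume r: "0 < r" "r < ?L"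
    let ?A = "{r/2<..<r}"
    let ?J = "{t. \<sigma> * (t - \<beta>) \<in> ?A}"
    have J [measurable]: "?J \<in> sets borel"
      using measurable_sets[of "\<lambda>t. \<sigma> * (t - \<beta>)" borel borel ?A] by (simp add: vimage_def)
    \<comment> \<open>Heights between r/2 and r remain inside the strip because r < bp - bm; this is
      what the radius in the seminorm is for.\<close>
    have JI: "?J \<subseteq> I" using cases r by auto
    have [measurable]: "(\<lambda>t. \<integral>\<^sup>+x. ennreal (\<bar>u0 (x + h, t) - u0 (x, t)\<bar> powr p) \<partial>lborel) \<in> borel_measurable borel"
    proof -
      have "(\<lambda>(t, x). ennreal (\<bar>u0 (x + h, t) - u0 (x, t)\<bar> powr p)) \<in> borel_measurable (borel \<Otimes>\<^sub>M lborel)" by measurable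
      from lborel.borel_measurable_nn_integral[OF this] show ?thesis by simp
    qed
    have "(\<integral>\<^sup>+\<rho>\<in>?A. (\<integral>\<^sup>+x. ennreal (\<bar>u0 (x + h, \<beta> + \<sigma> * \<rho>) - u0 (x, \<beta> + \<sigma> * \<rho>)\<bar> powr p) \<partial>lborel) \<partial>lborel) =
        (\<integral>\<^sup>+t. (\<integral>\<^sup>+x. ennreal (\<bar>u0 (x + h, t) - u0 (x, t)\<bar> powr p) \<partial>lborel) * indicator ?J t \<partial>lborel)"
      by (rule nn_integral_reflect[OF _ _ \<sigma>]) measurable
    also have "\<dots> = dq ?J h"
      unfolding dq_def using nn_integral_layers[of "\<lambda>z. ennreal (\<bar>u0 (z + (h, 0)) - u0 z\<bar> powr p)" ?J] by simp
    also have "\<dots> \<le> ennreal (norm h powr p) * (?C * (\<Sum>b\<in>Basis. dL ?J b))"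
      by (rule dq_le[OF J JI])
    also have "\<dots> = ennreal (norm h powr p) * (\<integral>\<^sup>+\<rho>\<in>?A. \<Gamma> \<rho> \<partial>lborel)"
      by (subst dL_eq) auto
    finally show "(\<integral>\<^sup>+\<rho>\<in>?A. (\<integral>\<^sup>+x. ennreal (\<bar>?V (x + h, \<rho>) - ?V (x, \<rho>)\<bar> powr p) \<partial>lborel) \<partial>lborel) \<le> ennreal (norm h powr p) * (\<integral>\<^sup>+\<rho>\<in>?A. \<Gamma> \<rho> \<partial>lborel)"
      by simp
  qed (rule G_meas)
  also have "\<dots> \<le> ennreal (2 * seminorm_const DIM('a) p) * (ennreal ((1 - 1 / p) powr (- p)) * G + ?C * (real DIM('a) * G))"
  proof (intro mult_left_mono add_mono)
    have "(\<integral>\<^sup>+s\<in>{0<..<?L}. epowr (?g (x, s)) p \<partial>lborel) \<le> (\<integral>\<^sup>+t. ennreal (\<bar>w (x, t)\<bar> powr p) \<partial>lborel)" for x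
    proof -
      have "(\<integral>\<^sup>+s\<in>{0<..<?L}. epowr (?g (x, s)) p \<partial>lborel) = (\<integral>\<^sup>+t. ennreal (\<bar>w (x, t)\<bar> powr p) * indicator {t. \<sigma> * (t - \<beta>) \<in> {0<..<?L}} t \<partial>lborel)"
        using nn_integral_reflect[of "\<lambda>t. ennreal (\<bar>w (x, t)\<bar> powr p)" "{0<..<?L}" \<sigma> \<beta>] \<sigma> by (simp add: epowr_ennreal)
      also have "\<dots> \<le> (\<integral>\<^sup>+t. ennreal (\<bar>w (x, t)\<bar> powr p) \<partial>lborel)"
        by (intro nn_integral_mono) (simp add: indicator_def)
      finally show ?thesis .
    qed
    then have "(\<integral>\<^sup>+x. (\<integral>\<^sup>+s\<in>{0<..<?L}. epowr (?g (x, s)) p \<partial>lborel) \<partial>lborel) \<le> (\<integral>\<^sup>+x. (\<integral>\<^sup>+t. ennreal (\<bar>w (x, t)\<bar> powr p) \<partial>lborel) \<partial>lborel)"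
      by (rule nn_integral_mono)
    also have "\<dots> \<le> G" unfolding power_line_integral by (rule D_Lp_le_G[OF vertical_Basis])
    finally show "(\<integral>\<^sup>+x. (\<integral>\<^sup>+s\<in>{0<..<?L}. epowr (?g (x, s)) p \<partial>lborel) \<partial>lborel) \<le> G" .
    have "dL A b \<le> G" if "b \<in> Basis" for A b
    proof -
      have "dL A b \<le> (\<integral>\<^sup>+z. ennreal (\<bar>D (b, 0) z\<bar> powr p) \<partial>lborel)"
        unfolding dL_def by (intro nn_integral_mono) (simp add: indicator_def)
      also have "\<dots> \<le> G" using that by (intro D_Lp_le_G) (simp add: Basis_prod_def)
      finally show ?thesis .
    qed
    then have "(\<Sum>b\<in>(Basis :: 'a set). dL A b) \<le> (\<Sum>b\<in>(Basis :: 'a set). G)" for A by (intro sum_mono) auto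
    then have "(\<Sum>b\<in>(Basis :: 'a set). dL A b) \<le> real DIM('a) * G" for A by (simp add: ennreal_of_nat_eq_real_of_nat)
    then show "(\<integral>\<^sup>+\<rho>\<in>{0<..<?L}. \<Gamma> \<rho> \<partial>lborel) \<le> ?C * (real DIM('a) * G)"
      by (subst dL_eq) (auto intro: mult_left_mono)
  qed auto
  also have "\<dots> = ennreal (trace_const DIM('a) p) * G"
  proof -
    have "ennreal ((1 - 1 / p) powr (- p)) * G + ?C * (real DIM('a) * G) = ennreal ((1 - 1 / p) powr (- p) + (2 powr p) ^ DIM('a) * DIM('a)) * G"
      by (simp add: ennreal_plus ennreal_mult distrib_right mult.assoc)
    moreover have "ennreal (2 * seminorm_const DIM('a) p) * ennreal ((1 - 1 / p) powr (- p) + (2 powr p) ^ DIM('a) * DIM('a)) = ennreal (trace_const DIM('a) p)"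
      unfolding trace_const_def by (rule ennreal_mult[symmetric]) (auto simp: seminorm_const_def)
    ultimately show ?thesis by (simp add: mult.assoc[symmetric])
  qed
  finally show ?thesis .
qed

lemma frac_seminorm_estimate:
  "epowr (frac_seminorm p (bp - bm) Tm) p \<le> ennreal (trace_const DIM('a) p) * G"
  "epowr (frac_seminorm p (bp - bm) Tp) p \<le> ennreal (trace_const DIM('a) p) * G"
  unfolding frac_seminorm_def
  using p boundary_seminorm_estimate[of 1 bm Tm] boundary_seminorm_estimate[of "-1" bp Tp]
  by (simp_all add: epowr_epowr)

lemma boundary_Lp_loc:
  assumes "compact K"
  shows "(\<integral>\<^sup>+x\<in>K. ennreal (\<bar>Tm x\<bar> powr p) \<partial>lborel) < \<infinity>" "(\<integral>\<^sup>+x\<in>K. ennreal (\<bar>Tp x\<bar> powr p) \<partial>lborel) < \<infinity>"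
proof -
  have fin: "ennreal (trace_const DIM('a) p) * G < \<infinity>" using G_finite by (simp add: ennreal_mult_less_top)
  have q: "0 < p + real (DIM('a) + 1) - 2" using p DIM_positive[where 'a='a] by simp
  show "(\<integral>\<^sup>+x\<in>K. ennreal (\<bar>Tm x\<bar> powr p) \<partial>lborel) < \<infinity>"
    using le_less_trans[OF boundary_seminorm_estimate[of 1 bm Tm] fin] bm_bp
    by (intro locally_Lp_if_finite_seminorm[OF p _ q _ _ assms, of "bp - bm"]) auto
  show "(\<integral>\<^sup>+x\<in>K. ennreal (\<bar>Tp x\<bar> powr p) \<partial>lborel) < \<infinity>"
    using le_less_trans[OF boundary_seminorm_estimate[of "-1" bp Tp] fin] bm_bp
    by (intro locally_Lp_if_finite_seminorm[OF p _ q _ _ assms, of "bp - bm"]) auto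
qed

end

section \<open>Integration by parts\<close>

text \<open>On a set of finite measure, by |f| \<le> 1 + |f|^p.\<close>

lemma integrable_if_Lp:
  fixes f :: "'a \<Rightarrow> real"
  assumes p: "1 \<le> p" and [measurable]: "f \<in> borel_measurable M" "A \<in> sets M"
    and A: "emeasure M A < \<infinity>" and f: "(\<integral>\<^sup>+x\<in>A. ennreal (\<bar>f x\<bar> powr p) \<partial>M) < \<infinity>"
  shows "integrable M (\<lambda>x. f x * indicator A x)"
proof (rule integrableI_bounded)
  have "(\<integral>\<^sup>+x. ennreal (norm (f x * indicator A x)) \<partial>M) \<le> (\<integral>\<^sup>+x. indicator A x + ennreal (\<bar>f x\<bar> powr p) * indicator A x \<partial>M)"
  proof (rule nn_integral_mono)
    fix x
    have "\<bar>f x\<bar> \<le> 1 + \<bar>f x\<bar> powr p"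
    proof (cases "\<bar>f x\<bar> \<le> 1")
      case False
      then have "\<bar>f x\<bar> powr 1 \<le> \<bar>f x\<bar> powr p" using p by (intro powr_mono) auto
      then show ?thesis by simp
    qed (simp add: add_increasing2)
    then have "ennreal \<bar>f x\<bar> \<le> 1 + ennreal (\<bar>f x\<bar> powr p)"
      using ennreal_leI[of "\<bar>f x\<bar>" "1 + \<bar>f x\<bar> powr p"] by (simp add: ennreal_plus)
    then show "ennreal (norm (f x * indicator A x)) \<le> indicator A x + ennreal (\<bar>f x\<bar> powr p) * indicator A x"
      by (simp add: indicator_def)
  qed
  also have "\<dots> = emeasure M A + (\<integral>\<^sup>+x\<in>A. ennreal (\<bar>f x\<bar> powr p) \<partial>M)"
    by (subst nn_integral_add) auto
  also have "\<dots> < \<infinity>" using A f by simp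
  finally show "(\<integral>\<^sup>+x. ennreal (norm (f x * indicator A x)) \<partial>M) < \<infinity>" .
qed measurable

lemma integrable_product:
  fixes f :: "'a::euclidean_space \<Rightarrow> real" and g :: "'b::euclidean_space \<Rightarrow> real"
  assumes f: "integrable lborel f" and g: "integrable lborel g"
  shows "integrable (lborel \<Otimes>\<^sub>M lborel) (\<lambda>(s, t). f s * g t)"
proof (rule lborel_pair.Fubini_integrable)
  have [measurable]: "f \<in> borel_measurable borel" "g \<in> borel_measurable borel" using f g by auto
  show "(\<lambda>(s, t). f s * g t) \<in> borel_measurable (lborel \<Otimes>\<^sub>M lborel)" by measurable
  have "integrable lborel (\<lambda>s. \<bar>f s\<bar> * (LINT t|lborel. \<bar>g t\<bar>))" using f by (intro integrable_mult_left integrable_abs)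
  then show "integrable lborel (\<lambda>s. LINT t|lborel. norm (case (s, t) of (s, t) \<Rightarrow> f s * g t))"
    by (simp add: abs_mult)
  show "AE s in lborel. integrable lborel (\<lambda>t. case (s, t) of (s, t) \<Rightarrow> f s * g t)"
    using g by (intro AE_I2) simp
qed

text \<open>The first factor is an antiderivative only in the integral sense, so Fubini over the
  triangle a < r < t < b takes the place of a product rule; the inner integral of \<open>g'\<close>
  is g(b) - g(r).\<close>

lemma integration_by_parts_line:
  fixes w g g' :: "real \<Rightarrow> real"
  assumes w: "integrable lborel w" "\<And>r. r \<notin> {a<..<b} \<Longrightarrow> w r = 0" and ab: "a < b"
    and g: "\<And>t. (g has_real_derivative g' t) (at t)" "continuous_on UNIV g'" "\<And>t. \<bar>g t\<bar> \<le> M" "\<And>t. \<bar>g' t\<bar> \<le> M"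
  shows "integrable lborel (\<lambda>t. (LINT r|lborel. w r * indicator {a<..<t} r) * (g' t * indicator {a<..<b} t))"
    "(LINT t|lborel. (LINT r|lborel. w r * indicator {a<..<t} r) * (g' t * indicator {a<..<b} t)) =
      g b * (LINT r|lborel. w r) - (LINT r|lborel. w r * g r)"
proof -
  have [measurable]: "w \<in> borel_measurable borel" using w by auto
  have [measurable]: "g' \<in> borel_measurable borel" by (rule borel_measurable_continuous_onI[OF g(2)])
  have gm [measurable]: "g \<in> borel_measurable borel"
    by (rule borel_measurable_continuous_onI[OF has_real_derivative_imp_continuous_on_UNIV[OF g(1)]])
  define H where "H t r = w r * indicator {a<..<t} r * (g' t * indicator {a<..<b} t)" for t r
  \<comment> \<open>The integrand is \<open>w\<close> times the indicator of the interval, an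
    integrable product, times a factor bounded by \<open>M\<close>.\<close>
  have H: "integrable (lborel \<Otimes>\<^sub>M lborel) (\<lambda>(t, r). H t r)"
  proof -
    have "integrable lborel (indicat_real {a<..<b})" by (rule integrable_real_indicator) (use ab in auto)
    from integrable_product[OF this w(1)]
    have "integrable (lborel \<Otimes>\<^sub>M lborel) (\<lambda>z. (case z of (t, r) \<Rightarrow> indicator {a<..<b} t * w r) * ((if a < snd z \<and> snd z < fst z then 1 else 0) * g' (fst z)))"
    proof (rule integrable_mult_bounded)
      show "(\<lambda>z :: real \<times> real. (if a < snd z \<and> snd z < fst z then 1 else 0) * g' (fst z)) \<in> borel_measurable (lborel \<Otimes>\<^sub>M lborel)" by measurable
      show "\<bar>(if a < snd z \<and> snd z < fst z then 1 else 0) * g' (fst z)\<bar> \<le> M" for z :: "real \<times> real"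
        using g(4)[of "fst z"] by (auto intro: order_trans[OF abs_ge_zero])
    qed
    moreover have "(\<lambda>z. (case z of (t, r) \<Rightarrow> indicator {a<..<b} t * w r) * ((if a < snd z \<and> snd z < fst z then 1 else 0) * g' (fst z))) = (\<lambda>(t, r). H t r)"
      by (auto simp: fun_eq_iff H_def indicator_def)
    ultimately show ?thesis by simp
  qed
  have inner: "(LINT r|lborel. H t r) = (LINT r|lborel. w r * indicator {a<..<t} r) * (g' t * indicator {a<..<b} t)" for t
    unfolding H_def by (rule Bochner_Integration.integral_mult_left_zero)
  show "integrable lborel (\<lambda>t. (LINT r|lborel. w r * indicator {a<..<t} r) * (g' t * indicator {a<..<b} t))"
    using lborel_pair.integrable_fst[OF H] by (simp only: inner)
  have "(LINT t|lborel. (LINT r|lborel. w r * indicator {a<..<t} r) * (g' t * indicator {a<..<b} t)) = (LINT r|lborel. LINT t|lborel. H t r)"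
    using lborel_pair.Fubini_integral[OF H] by (simp only: inner)
  also have "\<dots> = (LINT r|lborel. w r * (g b - g r))"
  proof (rule Bochner_Integration.integral_cong)
    fix r
    show "(LINT t|lborel. H t r) = w r * (g b - g r)"
    proof (cases "r \<in> {a<..<b}")
      case True
      have "(LINT t|lborel. H t r) = (LINT t|lborel. w r * (g' t * indicator {r..b} t))"
      proof (rule integral_cong_AE)
        show "AE t in lborel. H t r = w r * (g' t * indicator {r..b} t)"
          using AE_lborel_singleton[of r] AE_lborel_singleton[of b]
        proof eventually_elim
          case (elim t)
          then show ?case using True by (auto simp: H_def indicator_def)
        qed
        show "(\<lambda>t. H t r) \<in> borel_measurable lborel"
        proof -
          have "(\<lambda>t. w r * (if a < r \<and> r < t then 1 else 0) * (g' t * indicator {a<..<b} t)) \<in> borel_measurable lborel" by measurable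
          moreover have "(if a < r \<and> r < t then 1 else 0 :: real) = indicator {a<..<t} r" for t by (simp add: indicator_def)
          ultimately show ?thesis unfolding H_def by (simp only:)
        qed
      qed measurable
      also have "\<dots> = w r * (LINT t|lborel. g' t * indicator {r..b} t)"
        by (rule Bochner_Integration.integral_mult_right_zero)
      also have "(LINT t|lborel. g' t * indicator {r..b} t) = g b - g r"
        using True g(2) by (intro integral_FTC_Icc_real g(1)) (auto simp: continuous_on_eq_continuous_at)
      finally show ?thesis .
    next
      case False
      then show ?thesis using w(2)[OF False] by (simp add: H_def)
    qed
  qed simp
  also have "\<dots> = (LINT r|lborel. w r * g b - w r * g r)" by (simp only: right_diff_distrib)
  also have "\<dots> = (LINT r|lborel. w r * g b) - (LINT r|lborel. w r * g r)"
    using w(1) g(3) by (intro Bochner_Integration.integral_diff integrable_mult_bounded[where C=M]) auto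
  finally show "(LINT t|lborel. (LINT r|lborel. w r * indicator {a<..<t} r) * (g' t * indicator {a<..<b} t)) =
      g b * (LINT r|lborel. w r) - (LINT r|lborel. w r * g r)"
    by (simp add: mult.commute)
qed

section \<open>Compactly supported test functions of class C^1\<close>

lemma C1_has_directional_derivative:
  fixes \<psi> :: "'a::euclidean_space \<Rightarrow> real"
  assumes "C_k 1 \<psi>"
  shows "((\<lambda>s. \<psi> (z + s *\<^sub>R e)) has_real_derivative partial_deriv e \<psi> (z + s *\<^sub>R e)) (at s)"
proof -
  let ?F = "frechet_derivative \<psi> (at (z + s *\<^sub>R e))"
  have d: "(\<psi> has_derivative ?F) (at (z + s *\<^sub>R e))"
    using assms by (intro C_k_Suc_has_derivative(1)[of 0]) simp
  have "((\<lambda>s. z + s *\<^sub>R e) has_derivative (\<lambda>s. s *\<^sub>R e)) (at s)" by (auto intro!: derivative_eq_intros)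
  from has_derivative_compose[OF this, of \<psi> ?F] d
  have "((\<lambda>s. \<psi> (z + s *\<^sub>R e)) has_derivative (\<lambda>s. ?F (s *\<^sub>R e))) (at s)" by simp
  moreover have "linear ?F" using d by (rule has_derivative_linear)
  then have "(\<lambda>s. ?F (s *\<^sub>R e)) = (*) (partial_deriv e \<psi> (z + s *\<^sub>R e))"
    by (simp add: fun_eq_iff partial_deriv_def linear_cmul)
  ultimately show ?thesis by (simp add: has_field_derivative_def)
qed

lemma outside_support: "z \<notin> fun_support \<psi> \<Longrightarrow> \<psi> z = 0"
  using closure_subset[of "{x. \<psi> x \<noteq> 0}"] by (auto simp: fun_support_def)

lemma partial_deriv_outside_support:
  assumes "z \<notin> fun_support \<psi>" shows "partial_deriv e \<psi> z = 0"
proof -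
  have "(\<psi> has_derivative (\<lambda>_. 0)) (at z)"
  proof (rule has_derivative_transform_within_open[of "\<lambda>_. 0" _ _ _ "- fun_support \<psi>"])
    show "open (- fun_support \<psi>)" by (simp add: fun_support_def open_closed)
  qed (use assms outside_support[of _ \<psi>] in auto)
  then show ?thesis by (rule partial_deriv_eqI)
qed

lemma C1_c_bounds:
  fixes \<psi> :: "'a::euclidean_space \<Rightarrow> real"
  assumes \<psi>: "\<psi> \<in> C1_c" and e: "e \<in> Basis"
  obtains R M where "0 \<le> R" "0 \<le> M" "\<forall>z. \<bar>\<psi> z\<bar> \<le> M" "\<forall>z. \<bar>partial_deriv e \<psi> z\<bar> \<le> M"
    "\<forall>z. R < norm z \<longrightarrow> \<psi> z = 0 \<and> partial_deriv e \<psi> z = 0"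
    "continuous_on UNIV \<psi>" "continuous_on UNIV (partial_deriv e \<psi>)"
proof -
  have C: "C_k 1 \<psi>" and K: "compact (fun_support \<psi>)" using \<psi> by (auto simp: C1_c_def)
  have c1: "continuous_on UNIV \<psi>" using C by (rule C_k_continuous)
  have c2: "continuous_on UNIV (partial_deriv e \<psi>)" using C e by simp
  have out1: "\<psi> z = 0" if "z \<notin> fun_support \<psi>" for z
    by (rule outside_support[OF that])
  have out2: "partial_deriv e \<psi> z = 0" if "z \<notin> fun_support \<psi>" for z
    by (rule partial_deriv_outside_support[OF that])
  have bdd: "\<exists>M. \<forall>z. \<bar>f z\<bar> \<le> M" if f: "continuous_on UNIV f" "\<And>z. z \<notin> fun_support \<psi> \<Longrightarrow> f z = 0" for f :: "'a \<Rightarrow> real"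
  proof -
    have "bounded (f ` fun_support \<psi>)"
      by (intro compact_imp_bounded compact_continuous_image K continuous_on_subset[OF f(1)]) simp
    then obtain M where M: "\<forall>z\<in>fun_support \<psi>. \<bar>f z\<bar> \<le> M" by (auto simp: bounded_iff)
    have "\<bar>f z\<bar> \<le> max M 0" for z using M f(2)[of z] by (cases "z \<in> fun_support \<psi>") (auto simp: le_max_iff_disj)
    then show ?thesis by blast
  qed
  obtain M1 where M1: "\<forall>z. \<bar>\<psi> z\<bar> \<le> M1" using bdd[OF c1 out1] by auto
  obtain M2 where M2: "\<forall>z. \<bar>partial_deriv e \<psi> z\<bar> \<le> M2" using bdd[OF c2 out2] by auto
  obtain R where R: "\<forall>z\<in>fun_support \<psi>. norm z \<le> R" using compact_imp_bounded[OF K] by (auto simp: bounded_iff)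
  show ?thesis
  proof (rule that[of "max R 0" "max (max M1 M2) 0"])
    show "\<forall>z. \<bar>\<psi> z\<bar> \<le> max (max M1 M2) 0" "\<forall>z. \<bar>partial_deriv e \<psi> z\<bar> \<le> max (max M1 M2) 0"
      using M1 M2 by (auto simp: le_max_iff_disj)
    show "\<forall>z. max R 0 < norm z \<longrightarrow> \<psi> z = 0 \<and> partial_deriv e \<psi> z = 0"
      using R out1 out2 by (metis le_max_iff_disj not_le)
  qed (use c1 c2 in auto)
qed

context strip_sobolev
begin

text \<open>Cylinders instead of balls: the strip already bounds the heights, so only the horizontal
  variable has to be cut off.\<close>

abbreviation cyl :: "real \<Rightarrow> ('a \<times> real) set" where "cyl R \<equiv> cball 0 R \<times> UNIV"

lemma cyl_borel [measurable]: "cyl R \<in> sets borel"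
  by (intro borel_closed closed_Times) auto

lemma D_locally_integrable:
  assumes b: "b \<in> Basis"
  shows "integrable lborel (\<lambda>z. D b z * indicator (cyl R) z)"
proof -
  let ?A = "cball 0 R \<times> I :: ('a \<times> real) set"
  note [measurable] = D_measurable[OF b]
  have [measurable]: "?A \<in> sets borel"
  proof -
    have "?A = cyl R \<inter> S" by (auto simp: strip_def)
    then show ?thesis by simp
  qed
  have "integrable lborel (\<lambda>z. D b z * indicator ?A z)"
  proof (rule integrable_if_Lp[where p=p])
    have "bounded I" by (rule bounded_subset[OF compact_imp_bounded[OF compact_Icc[of bm bp]]]) auto
    then have "bounded ?A" by (intro bounded_Times bounded_cball)
    then show "emeasure lborel ?A < \<infinity>" by (rule emeasure_bounded_finite)
    have "(\<integral>\<^sup>+z\<in>?A. ennreal (\<bar>D b z\<bar> powr p) \<partial>lborel) \<le> (\<integral>\<^sup>+z. ennreal (\<bar>D b z\<bar> powr p) \<partial>lborel)"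
      by (intro nn_integral_mono) (simp add: indicator_def)
    then show "(\<integral>\<^sup>+z\<in>?A. ennreal (\<bar>D b z\<bar> powr p) \<partial>lborel) < \<infinity>" using D_Lp[OF b] by (rule le_less_trans)
  qed (use p in auto)
  moreover have "D b z * indicator ?A z = D b z * indicator (cyl R) z" for z
    by (cases z) (auto simp: indicator_def D_def strip_iff)
  ultimately show ?thesis by (simp only:)
qed

lemma boundary_locally_integrable:
  "integrable lborel (\<lambda>x. Tm x * indicator (cball 0 R) x)" "integrable lborel (\<lambda>x. Tp x * indicator (cball 0 R) x)"
  using p boundary_Lp_loc[OF compact_cball, of 0 R] emeasure_lborel_cball_finite[of "0::'a" R]
  by (auto intro!: integrable_if_Lp[where p=p])

lemma AE_representation_pair: "AE z in lborel. z \<in> S \<longrightarrow> u0 z = Tm (fst z) + W z"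
proof (rule AE_lines_pair)
  show "AE x in lborel. AE t in lborel. (x, t) \<in> S \<longrightarrow> u0 (x, t) = Tm (fst (x, t)) + W (x, t)"
    using AE_representation
  proof eventually_elim
    case (elim x)
    from elim[THEN conjunct2] show ?case by eventually_elim (auto simp: strip_iff)
  qed
  have "{z \<in> space borel. u0 z = Tm (fst z) + W z} \<in> sets borel" by measurable
  then have "- S \<union> {z \<in> space borel. u0 z = Tm (fst z) + W z} \<in> sets borel" by (intro sets.Un borel_comp S_borel)
  also have "- S \<union> {z \<in> space borel. u0 z = Tm (fst z) + W z} = {z. z \<in> S \<longrightarrow> u0 z = Tm (fst z) + W z}" by auto
  finally show "{z. z \<in> S \<longrightarrow> u0 z = Tm (fst z) + W z} \<in> sets borel" .
qed

lemma integrable_strip_product: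
  assumes f: "integrable lborel (f :: 'a \<Rightarrow> real)"
  shows "integrable lborel (\<lambda>z. f (fst z) * indicator I (snd z))"
proof -
  have "integrable lborel (indicat_real I)" by (rule integrable_real_indicator) (use bm_bp in auto)
  from integrable_product[OF f this] show ?thesis by (simp add: lborel_prod case_prod_beta')
qed

text \<open>Local integrability in the open strip says nothing about the boundary. Up to the
  boundary it follows from u0 = Tm + W, with |W| at most the integral of |w| over the line.\<close>

lemma u0_locally_integrable: "integrable lborel (\<lambda>z. u0 z * indicator (cyl R) z)"
proof -
  let ?N = "\<lambda>x. LINT r|lborel. \<bar>w (x, r) * indicator (cyl R) (x, r)\<bar>"
  have "integrable (lborel \<Otimes>\<^sub>M lborel) (\<lambda>z. \<bar>w z * indicator (cyl R) z\<bar>)"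
    using D_locally_integrable[OF vertical_Basis, of R] by (simp add: lborel_prod)
  from lborel_pair.integrable_fst'[OF this] have N: "integrable lborel ?N" by simp
  have "integrable lborel (\<lambda>z. Tm (fst z) * indicator (cball 0 R) (fst z) * indicator I (snd z) + ?N (fst z) * indicator I (snd z))"
    by (intro Bochner_Integration.integrable_add integrable_strip_product boundary_locally_integrable N
        integrable_strip_product[of "\<lambda>x. Tm x * indicator (cball 0 R) x"])
  then have "integrable lborel (\<lambda>z. \<bar>Tm (fst z) * indicator (cball 0 R) (fst z) * indicator I (snd z)\<bar> + ?N (fst z) * indicator I (snd z))"
    by (intro Bochner_Integration.integrable_add integrable_abs integrable_strip_product N
        integrable_strip_product[of "\<lambda>x. Tm x * indicator (cball 0 R) x"] boundary_locally_integrable)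
  then show ?thesis
  proof (rule Bochner_Integration.integrable_bound)
    show "AE z in lborel. norm (u0 z * indicator (cyl R) z) \<le> norm (\<bar>Tm (fst z) * indicator (cball 0 R) (fst z) * indicator I (snd z)\<bar> + ?N (fst z) * indicator I (snd z))"
      using AE_representation_pair AE_fst_lborel[OF AE_w_integrable]
    proof eventually_elim
      case (elim z)
      obtain x t where z: "z = (x, t)" by (cases z)
      have N0: "0 \<le> ?N x" by (rule Bochner_Integration.integral_nonneg) simp
      show ?case
      proof (cases "z \<in> S \<and> x \<in> cball 0 R")
        case True
        then have t: "t \<in> I" by (simp add: z strip_iff)
        have i: "integrable lborel (\<lambda>r. w (x, r))" using elim(2) by (simp add: z)
        have "\<bar>W (x, t)\<bar> \<le> (LINT r|lborel. \<bar>w (x, r) * indicator {bm<..<t} r\<bar>)"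
          unfolding W_def fst_conv snd_conv by (rule integral_abs_bound)
        also have "\<dots> \<le> ?N x"
          using True i by (intro integral_mono integrable_abs integrable_mult_indicator') (auto simp: indicator_def z)
        finally have "\<bar>W (x, t)\<bar> \<le> ?N x" .
        then show ?thesis using True t elim N0 by (simp add: z)
      next
        case False
        then show ?thesis using N0 by (auto simp: z u0_def indicator_def)
      qed
    qed
  qed measurable
qed

lemma locally_integrable_mult:
  fixes f \<phi> :: "'a \<times> real \<Rightarrow> real"
  assumes f: "integrable lborel (\<lambda>z. f z * indicator (cyl R) z)" and \<phi>: "\<phi> \<in> borel_measurable borel" "\<And>z. \<bar>\<phi> z\<bar> \<le> M"
    "\<And>z. R < norm (fst z) \<Longrightarrow> \<phi> z = 0"
  shows "integrable lborel (\<lambda>z. f z * \<phi> z)"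
proof -
  have "integrable lborel (\<lambda>z. f z * indicator (cyl R) z * \<phi> z)"
    using \<phi>(1,2) by (intro integrable_mult_bounded[OF f]) auto
  moreover have "f z * indicator (cyl R) z * \<phi> z = f z * \<phi> z" for z
    using \<phi>(3)[of z] by (cases "norm (fst z) \<le> R") (auto simp: indicator_def mem_Times_iff)
  ultimately show ?thesis by (simp only:)
qed

end

lemma C1_directional_Lipschitz:
  fixes \<psi> :: "'a::euclidean_space \<Rightarrow> real"
  assumes "C_k 1 \<psi>" and M: "\<And>z. \<bar>partial_deriv e \<psi> z\<bar> \<le> M"
  shows "\<bar>\<psi> (z + s *\<^sub>R e) - \<psi> z\<bar> \<le> M * \<bar>s\<bar>"
proof -
  have "norm (\<psi> (z + s *\<^sub>R e) - \<psi> (z + 0 *\<^sub>R e)) \<le> M * norm (s - 0)"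
    using C1_has_directional_derivative[OF assms(1)] M
    by (intro field_differentiable_bound[where S=UNIV and f="\<lambda>s. \<psi> (z + s *\<^sub>R e)" and f'="\<lambda>s. partial_deriv e \<psi> (z + s *\<^sub>R e)"]) auto
  then show ?thesis by simp
qed

context strip_sobolev
begin

lemma integral_lines:
  assumes "integrable lborel (f :: 'a \<times> real \<Rightarrow> real)"
  shows "(LINT z|lborel. f z) = (LINT x|lborel. LINT t|lborel. f (x, t))" "integrable lborel (\<lambda>x. LINT t|lborel. f (x, t))"
  using lborel_pair.integral_fst'[of f] lborel_pair.integrable_fst'[of f] assms by (simp_all add: lborel_prod)

text \<open>On almost every vertical line u0 = Tm + W. The constant part is treated by the
  fundamental theorem of calculus and \<open>W\<close> by \<open>integration_by_parts_line\<close>;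
  the result is integrated over all lines.\<close>

lemma integration_by_parts_vertical:
  assumes \<psi>: "\<psi> \<in> C1_c"
  shows "integrable lborel (\<lambda>z. u0 z * partial_deriv (0, 1) \<psi> z)" "integrable lborel (\<lambda>z. w z * \<psi> z)"
    "integrable lborel (\<lambda>x. Tp x * \<psi> (x, bp))" "integrable lborel (\<lambda>x. Tm x * \<psi> (x, bm))"
    "(LINT z|lborel. u0 z * partial_deriv (0, 1) \<psi> z) + (LINT z|lborel. w z * \<psi> z) =
      (LINT x|lborel. Tp x * \<psi> (x, bp)) - (LINT x|lborel. Tm x * \<psi> (x, bm))"
proof -
  have C: "C_k 1 \<psi>" using \<psi> by (simp add: C1_c_def)
  obtain R M where RM: "0 \<le> R" "0 \<le> M" "\<forall>z. \<bar>\<psi> z\<bar> \<le> M" "\<forall>z. \<bar>partial_deriv (0, 1) \<psi> z\<bar> \<le> M"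
    "\<forall>z. R < norm z \<longrightarrow> \<psi> z = 0 \<and> partial_deriv (0, 1) \<psi> z = 0"
    "continuous_on UNIV \<psi>" "continuous_on UNIV (partial_deriv (0, 1) \<psi>)"
    by (rule C1_c_bounds[OF \<psi> vertical_Basis])
  have out: "\<psi> z = 0" "partial_deriv (0, 1) \<psi> z = 0" if "R < norm (fst z)" for z
    using RM(5)[rule_format, of z] that norm_fst_le[of "fst z" "snd z"] by auto
  have [measurable]: "\<psi> \<in> borel_measurable borel" "partial_deriv (0, 1) \<psi> \<in> borel_measurable borel"
    using RM(6,7) by (auto intro: borel_measurable_continuous_onI)
  show i1: "integrable lborel (\<lambda>z. u0 z * partial_deriv (0, 1) \<psi> z)"
    using RM(4) out by (intro locally_integrable_mult[OF u0_locally_integrable]) auto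
  show i2: "integrable lborel (\<lambda>z. w z * \<psi> z)"
    using RM(3) out by (intro locally_integrable_mult[OF D_locally_integrable[OF vertical_Basis]]) auto
  have bd: "integrable lborel (\<lambda>x. f x * \<psi> (x, c))" if f: "integrable lborel (\<lambda>x. f x * indicator (cball 0 R) x)" for f and c :: real
  proof -
    have "integrable lborel (\<lambda>x. f x * indicator (cball 0 R) x * \<psi> (x, c))"
      using RM(3) by (intro integrable_mult_bounded[OF f]) auto
    moreover have "f x * indicator (cball 0 R) x * \<psi> (x, c) = f x * \<psi> (x, c)" for x
      using out(1)[of "(x, c)"] by (cases "norm x \<le> R") (auto simp: indicator_def)
    ultimately show ?thesis by (simp only:)
  qed
  show i3: "integrable lborel (\<lambda>x. Tp x * \<psi> (x, bp))" by (rule bd[OF boundary_locally_integrable(2)])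
  show i4: "integrable lborel (\<lambda>x. Tm x * \<psi> (x, bm))" by (rule bd[OF boundary_locally_integrable(1)])
  have line: "AE x in lborel. (LINT t|lborel. u0 (x, t) * partial_deriv (0, 1) \<psi> (x, t)) + (LINT t|lborel. w (x, t) * \<psi> (x, t)) =
    Tp x * \<psi> (x, bp) - Tm x * \<psi> (x, bm)"
    using AE_representation
  proof eventually_elim
    case (elim x)
    then have wi: "integrable lborel (\<lambda>r. w (x, r))" and rep: "AE t in lborel. t \<in> I \<longrightarrow> u0 (x, t) = Tm x + W (x, t)" by auto
    define g where "g t = \<psi> (x, t)" for t
    define g' where "g' t = partial_deriv (0, 1) \<psi> (x, t)" for t
    have gd: "(g has_real_derivative g' t) (at t)" for t
      using C1_has_directional_derivative[OF C, of "(x, 0)" "(0, 1)" t] by (simp add: g_def[abs_def] g'_def)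
    have gc: "continuous_on UNIV g'" unfolding g'_def[abs_def]
      by (rule continuous_on_compose2[OF RM(7)]) (auto intro: continuous_intros)
    have gM: "\<bar>g t\<bar> \<le> M" "\<bar>g' t\<bar> \<le> M" for t using RM(3,4) by (auto simp: g_def g'_def)
    have [measurable]: "g' \<in> borel_measurable borel" by (rule borel_measurable_continuous_onI[OF gc])
    have [measurable]: "(\<lambda>t. W (x, t)) \<in> borel_measurable borel" "(\<lambda>t. u0 (x, t)) \<in> borel_measurable borel" by measurable
    note parts = integration_by_parts_line[OF wi w_outside bm_bp gd gc gM]
    have Wi: "integrable lborel (\<lambda>t. W (x, t) * (g' t * indicator I t))" using parts(1) by (simp add: W_def)
    have gi: "integrable lborel (\<lambda>t. g' t * indicator I t)"
    proof -
      have "integrable lborel (indicat_real I)" by (rule integrable_real_indicator) (use bm_bp in auto)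
      from integrable_mult_bounded[OF this, of g' M] show ?thesis using gM(2) by (simp add: mult.commute)
    qed
    have FTC: "(LINT t|lborel. g' t * indicator I t) = g bp - g bm"
    proof -
      have "(LINT t|lborel. g' t * indicator I t) = (LINT t|lborel. g' t * indicator {bm..bp} t)"
      proof (rule integral_cong_AE)
        show "AE t in lborel. g' t * indicator I t = g' t * indicator {bm..bp} t"
          using AE_lborel_singleton[of bm] AE_lborel_singleton[of bp]
          by eventually_elim (auto simp: indicator_def)
      qed measurable
      also have "\<dots> = g bp - g bm"
        using bm_bp gc by (intro integral_FTC_Icc_real gd) (auto simp: continuous_on_eq_continuous_at)
      finally show ?thesis .
    qed
    have "(LINT t|lborel. u0 (x, t) * g' t) = (LINT t|lborel. Tm x * (g' t * indicator I t) + W (x, t) * (g' t * indicator I t))"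
    proof (rule integral_cong_AE)
      show "AE t in lborel. u0 (x, t) * g' t = Tm x * (g' t * indicator I t) + W (x, t) * (g' t * indicator I t)"
        using rep
      proof eventually_elim
        case (elim t)
        then show ?case by (cases "t \<in> I") (auto simp: distrib_right u0_def strip_iff)
      qed
    qed measurable
    \<comment> \<open>As \<open>Tp\<close> is \<open>Tm\<close> plus the integral of
      \<open>w\<close>, the boundary terms collect to Tp g(bp) - Tm g(bm).\<close>
    also have "\<dots> = Tm x * (g bp - g bm) + (g bp * (LINT r|lborel. w (x, r)) - (LINT r|lborel. w (x, r) * g r))"
      using gi Wi parts(2) by (simp add: FTC W_def)
    finally show ?case
      by (simp add: g_def g'_def Tp_def W_top algebra_simps)
  qed
  have "(LINT z|lborel. u0 z * partial_deriv (0, 1) \<psi> z) + (LINT z|lborel. w z * \<psi> z) =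
      (LINT x|lborel. (LINT t|lborel. u0 (x, t) * partial_deriv (0, 1) \<psi> (x, t)) + (LINT t|lborel. w (x, t) * \<psi> (x, t)))"
    unfolding integral_lines(1)[OF i1] integral_lines(1)[OF i2]
    by (rule Bochner_Integration.integral_add[OF integral_lines(2)[OF i1] integral_lines(2)[OF i2], symmetric])
  also have "\<dots> = (LINT x|lborel. Tp x * \<psi> (x, bp) - Tm x * \<psi> (x, bm))"
    using integral_lines(2)[OF i1] integral_lines(2)[OF i2] i3 i4 by (intro integral_cong_AE line) auto
  also have "\<dots> = (LINT x|lborel. Tp x * \<psi> (x, bp)) - (LINT x|lborel. Tm x * \<psi> (x, bm))"
    by (rule Bochner_Integration.integral_diff[OF i3 i4])
  finally show "(LINT z|lborel. u0 z * partial_deriv (0, 1) \<psi> z) + (LINT z|lborel. w z * \<psi> z) =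
      (LINT x|lborel. Tp x * \<psi> (x, bp)) - (LINT x|lborel. Tm x * \<psi> (x, bm))" .
qed

text \<open>A horizontal segment lies entirely inside or entirely outside the strip, and outside
  everything is 0.\<close>

lemma increment_horizontal:
  assumes e: "e \<in> Basis" "snd e = 0" and \<tau>: "0 \<le> \<tau>"
  shows "AE z in lborel. u0 (z + \<tau> *\<^sub>R e) - u0 z = (LINT t|lborel. indicator {0..\<tau>} t * D e (z + t *\<^sub>R e))"
proof -
  from increment[OF e(1) \<tau>] show ?thesis
  proof eventually_elim
    case (elim z)
    have iff: "z + t *\<^sub>R e \<in> S \<longleftrightarrow> z \<in> S" for t using e(2) by (simp add: strip_def)
    show ?case
    proof (cases "z \<in> S")
      case False
      then have "u0 (z + \<tau> *\<^sub>R e) = 0" "u0 z = 0" "D e (z + t *\<^sub>R e) = 0" for t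
        using iff by (simp_all only: u0_def D_def) (simp_all add: indicator_def)
      then show ?thesis by simp
    qed (use elim iff in blast)
  qed
qed

text \<open>The test function need not vanish near the boundary of the strip and is only \<open>C\<^sup>1\<close>, so the weak
  derivative is not applied to it. Instead the identity is the limit, for \<open>\<tau> \<rightarrow> 0\<close>, of the one obtained by
  integrating \<open>increment_horizontal\<close> against \<open>\<psi>\<close>.\<close>

lemma integration_by_parts_horizontal:
  assumes \<psi>: "\<psi> \<in> C1_c" and e: "e \<in> Basis" "snd e = 0"
  shows "integrable lborel (\<lambda>z. u0 z * partial_deriv e \<psi> z)" "integrable lborel (\<lambda>z. D e z * \<psi> z)"
    "(LINT z|lborel. u0 z * partial_deriv e \<psi> z) = - (LINT z|lborel. D e z * \<psi> z)"
proof -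
  have ne: "norm e = 1" using e by simp
  then have nfe: "norm (fst e) \<le> 1" using norm_fst_le[of "fst e" "snd e"] by simp
  have C: "C_k 1 \<psi>" using \<psi> by (simp add: C1_c_def)
  obtain R M where RM: "0 \<le> R" "0 \<le> M" "\<forall>z. \<bar>\<psi> z\<bar> \<le> M" "\<forall>z. \<bar>partial_deriv e \<psi> z\<bar> \<le> M"
    "\<forall>z. R < norm z \<longrightarrow> \<psi> z = 0 \<and> partial_deriv e \<psi> z = 0"
    "continuous_on UNIV \<psi>" "continuous_on UNIV (partial_deriv e \<psi>)"
    by (rule C1_c_bounds[OF \<psi> e(1)])
  note [measurable] = D_measurable[OF e(1)]
  have out: "\<psi> z = 0" "partial_deriv e \<psi> z = 0" if "R < norm (fst z)" for z
    using RM(5)[rule_format, of z] that norm_fst_le[of "fst z" "snd z"] by auto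
  have outs: "\<psi> (z - t *\<^sub>R e) = 0" if "R + 1 < norm (fst z)" "t \<in> {0..\<tau>}" "\<tau> \<le> 1" for z t \<tau>
  proof (rule out(1))
    have "norm (fst z) \<le> norm (fst z - t *\<^sub>R fst e) + norm (t *\<^sub>R fst e)"
      using norm_triangle_ineq[of "fst z - t *\<^sub>R fst e" "t *\<^sub>R fst e"] by simp
    moreover have "norm (t *\<^sub>R fst e) \<le> 1" using that nfe mult_mono[of "\<bar>t\<bar>" 1 "norm (fst e)" 1] by simp
    ultimately show "R < norm (fst (z - t *\<^sub>R e))" using that(1) by simp
  qed
  have [measurable]: "\<psi> \<in> borel_measurable borel" "partial_deriv e \<psi> \<in> borel_measurable borel"
    using RM(6,7) by (auto intro: borel_measurable_continuous_onI)
  have lip: "\<bar>\<psi> (z - t *\<^sub>R e) - \<psi> z\<bar> \<le> M * \<bar>t\<bar>" for z t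
    using C1_directional_Lipschitz[OF C, of e M z "- t"] RM(4)[rule_format] by simp
  show i1: "integrable lborel (\<lambda>z. u0 z * partial_deriv e \<psi> z)"
    using RM(4) out by (intro locally_integrable_mult[OF u0_locally_integrable]) auto
  show i2: "integrable lborel (\<lambda>z. D e z * \<psi> z)"
    using RM(3) out by (intro locally_integrable_mult[OF D_locally_integrable[OF e(1)]]) auto
  \<comment> \<open>Radius R + 1 leaves room for translations of length up to 1.\<close>
  define D1 where "D1 z = D e z * indicator (cyl (R + 1)) z" for z
  have D1: "integrable lborel D1" unfolding D1_def[abs_def] by (rule D_locally_integrable[OF e(1)])
  define u1 where "u1 z = u0 z * indicator (cyl (R + 1)) z" for z
  have u1: "integrable lborel u1" unfolding u1_def[abs_def] by (rule u0_locally_integrable)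
  have [measurable]: "D1 \<in> borel_measurable borel" "u1 \<in> borel_measurable borel" using D1 u1 by auto
  have in_cyl: "z + t *\<^sub>R e \<in> cyl (R + 1)" if "\<psi> z \<noteq> 0" "t \<in> {0..\<tau>}" "\<tau> \<le> 1" for z t \<tau>
  proof (rule ccontr)
    assume "z + t *\<^sub>R e \<notin> cyl (R + 1)"
    then have "R + 1 < norm (fst (z + t *\<^sub>R e))" by (simp only: mem_Times_iff) simp
    from outs[OF this that(2,3)] that(1) show False by simp
  qed
  \<comment> \<open>The average of translates of \<psi> produced by
    \<open>integral_translates_adjoint\<close>; divided by \<tau> it tends to \<psi> with error at
    most M \<tau>.\<close>
  define A where "A \<tau> z = (LINT t|lborel. indicator {0..\<tau>} t * \<psi> (z - t *\<^sub>R e))" for \<tau> z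
  have A_close: "\<bar>A \<tau> z - \<tau> * \<psi> z\<bar> \<le> M * \<tau> * \<tau>" if \<tau>: "0 \<le> \<tau>" for \<tau> z
  proof -
    have ii: "integrable lborel (\<lambda>t. indicat_real {0..\<tau>} t)" by (rule integrable_real_indicator) (auto simp: emeasure_lborel_Icc_eq)
    have i3: "integrable lborel (\<lambda>t. indicator {0..\<tau>} t * \<psi> (z - t *\<^sub>R e))"
      by (rule integrable_mult_bounded[OF ii _ RM(3)[rule_format]]) measurable
    have "A \<tau> z - \<tau> * \<psi> z = (LINT t|lborel. indicator {0..\<tau>} t * \<psi> (z - t *\<^sub>R e)) - (LINT t|lborel. indicator {0..\<tau>} t * \<psi> z)"
      using \<tau> by (simp add: A_def)
    also have "\<dots> = (LINT t|lborel. indicator {0..\<tau>} t * \<psi> (z - t *\<^sub>R e) - indicator {0..\<tau>} t * \<psi> z)"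
      using i3 ii by (intro Bochner_Integration.integral_diff[symmetric] integrable_mult_left) auto
    finally have "\<bar>A \<tau> z - \<tau> * \<psi> z\<bar> \<le> (LINT t|lborel. \<bar>indicator {0..\<tau>} t * \<psi> (z - t *\<^sub>R e) - indicator {0..\<tau>} t * \<psi> z\<bar>)"
      by (simp add: integral_abs_bound)
    also have "\<dots> \<le> (LINT t|lborel. indicator {0..\<tau>} t * (M * \<tau>))"
    proof (rule integral_mono)
      show "integrable lborel (\<lambda>t. \<bar>indicator {0..\<tau>} t * \<psi> (z - t *\<^sub>R e) - indicator {0..\<tau>} t * \<psi> z\<bar>)"
        using i3 ii by (intro integrable_abs Bochner_Integration.integrable_diff integrable_mult_left)
      show "integrable lborel (\<lambda>t. indicator {0..\<tau>} t * (M * \<tau>))" using ii by (rule integrable_mult_left)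
      fix t
      show "\<bar>indicator {0..\<tau>} t * \<psi> (z - t *\<^sub>R e) - indicator {0..\<tau>} t * \<psi> z\<bar> \<le> indicator {0..\<tau>} t * (M * \<tau>)"
      proof (cases "t \<in> {0..\<tau>}")
        case True
        then have "M * \<bar>t\<bar> \<le> M * \<tau>" using RM(2) by (intro mult_left_mono) auto
        then show ?thesis using True lip[of z t] by simp
      qed simp
    qed
    also have "\<dots> = M * \<tau> * \<tau>" using \<tau> by simp
    finally show ?thesis .
  qed
  have A_bound: "\<bar>A \<tau> z\<bar> \<le> \<tau> * M" if \<tau>: "0 \<le> \<tau>" for \<tau> z
  proof -
    have ii: "integrable lborel (\<lambda>t. indicat_real {0..\<tau>} t)" by (rule integrable_real_indicator) (auto simp: emeasure_lborel_Icc_eq)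
    have "\<bar>A \<tau> z\<bar> \<le> (LINT t|lborel. \<bar>indicator {0..\<tau>} t * \<psi> (z - t *\<^sub>R e)\<bar>)" unfolding A_def by (rule integral_abs_bound)
    also have "\<dots> \<le> (LINT t|lborel. indicator {0..\<tau>} t * M)"
    proof (rule integral_mono)
      show "integrable lborel (\<lambda>t. \<bar>indicator {0..\<tau>} t * \<psi> (z - t *\<^sub>R e)\<bar>)"
        by (rule integrable_abs, rule integrable_mult_bounded[OF ii _ RM(3)[rule_format]]) measurable
      show "integrable lborel (\<lambda>t. indicator {0..\<tau>} t * M)" using ii by (rule integrable_mult_left)
      show "\<bar>indicator {0..\<tau>} t * \<psi> (z - t *\<^sub>R e)\<bar> \<le> indicator {0..\<tau>} t * M" for t
        using RM(3)[rule_format, of "z - t *\<^sub>R e"] by (simp add: indicator_def)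
    qed
    also have "\<dots> = \<tau> * M" using \<tau> by simp
    finally show ?thesis .
  qed
  have A_out: "A \<tau> z = 0" if "R + 1 < norm (fst z)" "\<tau> \<le> 1" for \<tau> z
  proof -
    have "indicator {0..\<tau>} t * \<psi> (z - t *\<^sub>R e) = 0" for t
      using outs[OF that(1) _ that(2), of t] by (cases "t \<in> {0..\<tau>}") simp_all
    then show ?thesis unfolding A_def by (simp only:) simp
  qed
  have A_meas [measurable]: "A \<tau> \<in> borel_measurable borel" for \<tau>
  proof -
    have "(\<lambda>(z, t). indicator {0..\<tau>} t * \<psi> (z - t *\<^sub>R e)) \<in> borel_measurable (borel \<Otimes>\<^sub>M lborel)" by measurable
    from lborel.borel_measurable_lebesgue_integral[OF this] show ?thesis by (simp add: A_def[abs_def])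
  qed
  \<comment> \<open>Integration by parts at step \<tau>: the translation is moved from
    \<open>u1\<close> to \<psi>, and the averaging from \<open>D1\<close> to \<psi>.\<close>
  have key: "(LINT z|lborel. u1 z * (\<psi> (z - \<tau> *\<^sub>R e) - \<psi> z)) = (LINT z|lborel. D1 z * A \<tau> z)" if \<tau>: "0 \<le> \<tau>" "\<tau> \<le> 1" for \<tau>
  proof -
    have i\<psi>: "integrable lborel (\<lambda>z. f z * \<psi> (z - c))" if "integrable lborel f" for f :: "'a \<times> real \<Rightarrow> real" and c
      by (rule integrable_mult_bounded[OF that _ RM(3)[rule_format]]) measurable
    have i\<psi>0: "integrable lborel (\<lambda>z. f z * \<psi> z)" if "integrable lborel f" for f :: "'a \<times> real \<Rightarrow> real"
      using i\<psi>[OF that, of 0] by simp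
    have "(LINT z|lborel. u1 z * (\<psi> (z - \<tau> *\<^sub>R e) - \<psi> z)) = (LINT z|lborel. u1 z * \<psi> (z - \<tau> *\<^sub>R e)) - (LINT z|lborel. u1 z * \<psi> z)"
      by (simp add: right_diff_distrib Bochner_Integration.integral_diff[OF i\<psi>[OF u1] i\<psi>0[OF u1]])
    also have "(LINT z|lborel. u1 z * \<psi> (z - \<tau> *\<^sub>R e)) = (LINT z|lborel. u1 (z + \<tau> *\<^sub>R e) * \<psi> z)"
      using integral_lborel_shift[of "\<lambda>z. u1 z * \<psi> (z - \<tau> *\<^sub>R e)" "\<tau> *\<^sub>R e"] by simp
    also have "\<dots> - (LINT z|lborel. u1 z * \<psi> z) = (LINT z|lborel. u1 (z + \<tau> *\<^sub>R e) * \<psi> z - u1 z * \<psi> z)"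
      by (rule Bochner_Integration.integral_diff[OF i\<psi>0[OF integrable_lborel_shift[OF u1]] i\<psi>0[OF u1], symmetric])
    also have "\<dots> = (LINT z|lborel. (LINT t|lborel. indicator {0..\<tau>} t * D1 (z + t *\<^sub>R e)) * \<psi> z)"
    proof (rule integral_cong_AE)
      show "AE z in lborel. u1 (z + \<tau> *\<^sub>R e) * \<psi> z - u1 z * \<psi> z = (LINT t|lborel. indicator {0..\<tau>} t * D1 (z + t *\<^sub>R e)) * \<psi> z"
        using increment_horizontal[OF e \<tau>(1)]
      proof eventually_elim
        case (elim z)
        show ?case
        proof (cases "\<psi> z = 0")
          case False
          have "indicator {0..\<tau>} t * D1 (z + t *\<^sub>R e) = indicator {0..\<tau>} t * D e (z + t *\<^sub>R e)" for t
            using in_cyl[OF False _ \<tau>(2), of t] by (cases "t \<in> {0..\<tau>}") (simp_all add: D1_def)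
          then have "(LINT t|lborel. indicator {0..\<tau>} t * D1 (z + t *\<^sub>R e)) = (LINT t|lborel. indicator {0..\<tau>} t * D e (z + t *\<^sub>R e))" by (simp only:)
          moreover have "u1 (z + \<tau> *\<^sub>R e) = u0 (z + \<tau> *\<^sub>R e)" "u1 z = u0 z"
            using in_cyl[OF False _ \<tau>(2), of \<tau>] in_cyl[OF False _ \<tau>(2), of 0] \<tau>(1) by (simp_all add: u1_def)
          ultimately show ?thesis using elim by (simp add: left_diff_distrib[symmetric])
        qed simp
      qed
      have "(\<lambda>(z, t). indicator {0..\<tau>} t * D1 (z + t *\<^sub>R e)) \<in> borel_measurable (borel \<Otimes>\<^sub>M lborel)" by measurable
      from lborel.borel_measurable_lebesgue_integral[OF this]
      show "(\<lambda>z. (LINT t|lborel. indicator {0..\<tau>} t * D1 (z + t *\<^sub>R e)) * \<psi> z) \<in> borel_measurable lborel" by simp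
    qed measurable
    also have "\<dots> = (LINT z|lborel. D1 z * A \<tau> z)"
      unfolding A_def by (rule integral_translates_adjoint[OF D1, where C=M]) (use RM(3) in auto)
    finally show ?thesis .
  qed
  define \<tau> where "\<tau> m = 1 / real (Suc m)" for m
  have \<tau>: "0 < \<tau> m" "\<tau> m \<le> 1" for m by (auto simp: \<tau>_def)
  have \<tau>0: "\<tau> \<longlonglongrightarrow> 0" unfolding \<tau>_def[abs_def] using LIMSEQ_inverse_real_of_nat by (simp add: inverse_eq_divide)
  \<comment> \<open>Dominated by M |u1|, through the Lipschitz bound on \<psi> in direction
    \<open>e\<close>.\<close>
  have lim1: "(\<lambda>m. LINT z|lborel. u1 z * ((\<psi> (z - \<tau> m *\<^sub>R e) - \<psi> z) / \<tau> m)) \<longlonglongrightarrow> (LINT z|lborel. u1 z * (- partial_deriv e \<psi> z))"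
  proof (rule integral_dominated_convergence[where w="\<lambda>z. \<bar>u1 z\<bar> * M"])
    show "integrable lborel (\<lambda>z. \<bar>u1 z\<bar> * M)" using u1 by (intro integrable_mult_left integrable_abs)
    show "AE z in lborel. (\<lambda>m. u1 z * ((\<psi> (z - \<tau> m *\<^sub>R e) - \<psi> z) / \<tau> m)) \<longlonglongrightarrow> u1 z * (- partial_deriv e \<psi> z)"
    proof (intro AE_I2 tendsto_mult tendsto_const)
      fix z
      have "((\<lambda>h. (\<psi> (z + (0 + h) *\<^sub>R e) - \<psi> (z + 0 *\<^sub>R e)) / h) \<longlongrightarrow> partial_deriv e \<psi> (z + 0 *\<^sub>R e)) (at 0)"
        using C1_has_directional_derivative[OF C, of z e 0] unfolding DERIV_def .
      \<comment> \<open>The difference quotient of \<psi> is taken along negative increments, hence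
        the sign in the limit.\<close>
      moreover have "filterlim (\<lambda>m. - \<tau> m) (at 0) sequentially"
        using tendsto_minus[OF \<tau>0] \<tau>(1) by (simp add: filterlim_at less_imp_neq[symmetric])
      ultimately have "(\<lambda>m. (\<psi> (z + (0 + - \<tau> m) *\<^sub>R e) - \<psi> (z + 0 *\<^sub>R e)) / (- \<tau> m)) \<longlonglongrightarrow> partial_deriv e \<psi> (z + 0 *\<^sub>R e)"
        by (rule filterlim_compose)
      from tendsto_minus[OF this] show "(\<lambda>m. (\<psi> (z - \<tau> m *\<^sub>R e) - \<psi> z) / \<tau> m) \<longlonglongrightarrow> - partial_deriv e \<psi> z"
        by (simp add: zero_prod_def[symmetric])
    qed
    show "AE z in lborel. norm (u1 z * ((\<psi> (z - \<tau> m *\<^sub>R e) - \<psi> z) / \<tau> m)) \<le> \<bar>u1 z\<bar> * M" for m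
    proof (rule AE_I2)
      fix z
      have "\<bar>(\<psi> (z - \<tau> m *\<^sub>R e) - \<psi> z) / \<tau> m\<bar> \<le> M"
        using lip[of z "\<tau> m"] \<tau>(1)[of m] by (simp add: pos_divide_le_eq)
      then show "norm (u1 z * ((\<psi> (z - \<tau> m *\<^sub>R e) - \<psi> z) / \<tau> m)) \<le> \<bar>u1 z\<bar> * M"
        by (simp only: real_norm_def abs_mult) (intro mult_left_mono, auto)
    qed
  qed measurable
  have lim2: "(\<lambda>m. LINT z|lborel. D1 z * (A (\<tau> m) z / \<tau> m)) \<longlonglongrightarrow> (LINT z|lborel. D1 z * \<psi> z)"
  proof (rule integral_dominated_convergence[where w="\<lambda>z. \<bar>D1 z\<bar> * M"])
    show "integrable lborel (\<lambda>z. \<bar>D1 z\<bar> * M)" using D1 by (intro integrable_mult_left integrable_abs)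
    show "AE z in lborel. (\<lambda>m. D1 z * (A (\<tau> m) z / \<tau> m)) \<longlonglongrightarrow> D1 z * \<psi> z"
    proof (intro AE_I2 tendsto_mult tendsto_const)
      fix z
      have "(\<lambda>m. A (\<tau> m) z / \<tau> m - \<psi> z) \<longlonglongrightarrow> 0"
      proof (rule Lim_null_comparison)
        show "\<forall>\<^sub>F m in sequentially. norm (A (\<tau> m) z / \<tau> m - \<psi> z) \<le> M * \<tau> m"
        proof (intro always_eventually allI)
          fix m
          have "A (\<tau> m) z / \<tau> m - \<psi> z = (A (\<tau> m) z - \<tau> m * \<psi> z) / \<tau> m" using \<tau>(1)[of m] by (simp add: diff_divide_distrib)
          then show "norm (A (\<tau> m) z / \<tau> m - \<psi> z) \<le> M * \<tau> m"
            using A_close[of "\<tau> m" z] \<tau>(1)[of m] by (simp add: pos_divide_le_eq)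
        qed
        show "(\<lambda>m. M * \<tau> m) \<longlonglongrightarrow> 0" using tendsto_mult_right_zero[OF \<tau>0] .
      qed
      then show "(\<lambda>m. A (\<tau> m) z / \<tau> m) \<longlonglongrightarrow> \<psi> z" by (rule LIM_zero_cancel)
    qed
    show "AE z in lborel. norm (D1 z * (A (\<tau> m) z / \<tau> m)) \<le> \<bar>D1 z\<bar> * M" for m
    proof (rule AE_I2)
      fix z
      have "\<bar>A (\<tau> m) z / \<tau> m\<bar> \<le> M"
        using A_bound[of "\<tau> m" z] \<tau>(1)[of m] by (simp add: pos_divide_le_eq mult.commute)
      then show "norm (D1 z * (A (\<tau> m) z / \<tau> m)) \<le> \<bar>D1 z\<bar> * M"
        by (simp only: real_norm_def abs_mult) (intro mult_left_mono, auto)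
    qed
  qed measurable
  have "(LINT z|lborel. u1 z * ((\<psi> (z - \<tau> m *\<^sub>R e) - \<psi> z) / \<tau> m)) = (LINT z|lborel. D1 z * (A (\<tau> m) z / \<tau> m))" for m
    using key[of "\<tau> m"] \<tau>[of m] by (simp add: times_divide_eq_right[symmetric] del: times_divide_eq_right) simp
  then have eq: "(LINT z|lborel. u1 z * (- partial_deriv e \<psi> z)) = (LINT z|lborel. D1 z * \<psi> z)"
    using lim1 lim2 by (simp only: LIMSEQ_unique)
  have e1: "u1 z * (- partial_deriv e \<psi> z) = - (u0 z * partial_deriv e \<psi> z)" for z
    using out(2)[of z] by (cases "norm (fst z) \<le> R + 1") (auto simp: u1_def indicator_def mem_Times_iff)
  have e2: "D1 z * \<psi> z = D e z * \<psi> z" for z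
    using out(1)[of z] by (cases "norm (fst z) \<le> R + 1") (auto simp: D1_def indicator_def mem_Times_iff)
  show "(LINT z|lborel. u0 z * partial_deriv e \<psi> z) = - (LINT z|lborel. D e z * \<psi> z)"
    using eq unfolding e1 e2 by simp
qed

end

section \<open>Normals, linearity and continuous functions\<close>

lemma closure_strip: "bm < bp \<Longrightarrow> closure (strip bm bp :: ('a::euclidean_space \<times> real) set) = UNIV \<times> {bm..bp}"
proof -
  assume "bm < bp"
  moreover have "(strip bm bp :: ('a \<times> real) set) = UNIV \<times> {bm<..<bp}" by (auto simp: strip_def)
  ultimately show ?thesis by (simp add: closure_Times)
qed

lemma frontier_strip:
  assumes "bm < bp"
  shows "frontier (strip bm bp :: ('a::euclidean_space \<times> real) set) = UNIV \<times> {bm} \<union> UNIV \<times> {bp}"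
proof -
  have "frontier (strip bm bp :: ('a \<times> real) set) = UNIV \<times> {bm..bp} - strip bm bp"
    unfolding frontier_def closure_strip[OF assms] interior_open[OF open_strip] ..
  also have "\<dots> = UNIV \<times> {bm} \<union> UNIV \<times> {bp}" using assms by (auto simp: strip_def)
  finally show ?thesis .
qed

text \<open>The defining function in \<open>is_outward_normal\<close> is minimal along the boundary, so its gradient there is vertical;
  this makes the normal unique.\<close>

lemma outward_normal_flat:
  fixes S :: "('a::euclidean_space \<times> real) set"
  assumes x: "x \<in> frontier S" "snd x = \<beta>" and V: "open V" "x \<in> V" "S \<inter> V = {y\<in>V. \<sigma> * (snd y - \<beta>) < 0}"
    and \<sigma>: "\<sigma> = 1 \<or> \<sigma> = -1"
  shows "outward_normal S x = (0, \<sigma>)"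
  unfolding outward_normal_def
proof (rule the_equality)
  show "is_outward_normal S x (0, \<sigma>)"
    unfolding is_outward_normal_def
  proof (intro conjI exI)
    show "\<forall>y\<in>V. ((\<lambda>y. \<sigma> * (snd y - \<beta>)) has_derivative (\<lambda>h. (0, \<sigma>) \<bullet> h)) (at y)"
      by (auto intro!: derivative_eq_intros simp: inner_prod_def)
    show "continuous_on V (\<lambda>_. (0 :: 'a, \<sigma>))" by (rule continuous_on_const)
    show "(0 :: 'a, \<sigma>) \<noteq> 0" using \<sigma> by (auto simp: zero_prod_def)
    show "(0 :: 'a, \<sigma>) = (0, \<sigma>) /\<^sub>R norm (0 :: 'a, \<sigma>)" using \<sigma> by (auto simp: norm_prod_def)
  qed (use x V in auto)
next
  fix n assume "is_outward_normal S x n"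
  then obtain U \<phi> g where U: "open U" "x \<in> U" and der: "\<forall>y\<in>U. (\<phi> has_derivative (\<lambda>h. g y \<bullet> h)) (at y)"
    and SU: "S \<inter> U = {y\<in>U. \<phi> y < 0}" and g0: "g x \<noteq> 0" and n: "n = g x /\<^sub>R norm (g x)"
    unfolding is_outward_normal_def by (elim conjE exE) (rule that)
  obtain r where r: "0 < r" "ball x r \<subseteq> U \<inter> V"
    using open_Int[OF U(1) V(1)] U(2) V(2) unfolding open_contains_ball by blast
  have iff: "\<phi> y < 0 \<longleftrightarrow> \<sigma> * (snd y - \<beta>) < 0" if "y \<in> ball x r" for y
  proof -
    have y: "y \<in> U" "y \<in> V" using that r(2) by auto
    have "y \<in> S \<longleftrightarrow> \<phi> y < 0" using SU y(1) by blast
    moreover have "y \<in> S \<longleftrightarrow> \<sigma> * (snd y - \<beta>) < 0" using V(3) y(2) by blast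
    ultimately show ?thesis by simp
  qed
  \<comment> \<open>The summand 1 keeps the denominator positive for d = 0.\<close>
  have near: "x + s *\<^sub>R d \<in> ball x r" if "\<bar>s\<bar> < r / (norm d + 1)" for s d
  proof -
    have "\<bar>s\<bar> * norm d \<le> \<bar>s\<bar> * (norm d + 1)" by (intro mult_left_mono) auto
    also have "\<dots> < r" using that by (simp add: pos_less_divide_eq add_nonneg_pos)
    finally show ?thesis by (simp add: dist_norm)
  qed
  have dd: "((\<lambda>s. \<phi> (x + s *\<^sub>R d)) has_real_derivative g x \<bullet> d) (at 0)" for d
  proof -
    have "((\<lambda>s. x + s *\<^sub>R d) has_derivative (\<lambda>s. s *\<^sub>R d)) (at 0)" by (auto intro!: derivative_eq_intros)
    moreover have "(\<phi> has_derivative (\<lambda>h. g x \<bullet> h)) (at (x + 0 *\<^sub>R d))" using der U(2) by simp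
    ultimately have "((\<lambda>s. \<phi> (x + s *\<^sub>R d)) has_derivative (\<lambda>s. g x \<bullet> (s *\<^sub>R d))) (at 0)"
      by (rule has_derivative_compose)
    moreover have "(\<lambda>s. g x \<bullet> (s *\<^sub>R d)) = (*) (g x \<bullet> d)" by (simp add: fun_eq_iff)
    ultimately show ?thesis by (simp add: has_field_derivative_def)
  qed
  define dn :: "'a \<times> real" where "dn = (0, - \<sigma>)"
  define \<rho> where "\<rho> = r / (norm dn + 1)"
  have \<rho>: "0 < \<rho>" using r(1) by (simp add: \<rho>_def add_nonneg_pos)
  have neg: "\<phi> (x + s *\<^sub>R dn) < 0" if "0 < s" "s < \<rho>" for s
  proof -
    have "\<sigma> * (snd (x + s *\<^sub>R dn) - \<beta>) = - s" using \<sigma> x(2) by (auto simp: dn_def)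
    then show ?thesis using iff[OF near[of s dn]] that by (simp add: \<rho>_def)
  qed
  \<comment> \<open>The point itself is not in the domain, whereas the beginning of the inward ray
    is; by continuity \<phi> vanishes at x.\<close>
  have "0 \<le> \<phi> x" using iff[of x] r(1) x(2) by simp
  moreover have "\<phi> x \<le> 0"
  proof -
    have "isCont (\<lambda>s. \<phi> (x + s *\<^sub>R dn)) 0" by (rule DERIV_isCont[OF dd])
    then have "((\<lambda>s. \<phi> (x + s *\<^sub>R dn)) \<longlongrightarrow> \<phi> (x + 0 *\<^sub>R dn)) (at_right 0)"
      unfolding isCont_def by (rule tendsto_within_subset) simp
    moreover have "\<forall>\<^sub>F s in at_right 0. \<phi> (x + s *\<^sub>R dn) \<le> 0"
      unfolding eventually_at_right_field using \<rho> neg by (intro exI[of _ \<rho>]) (auto intro: less_imp_le)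
    ultimately have "\<phi> (x + 0 *\<^sub>R dn) \<le> 0" by (rule tendsto_upperbound) simp
    then show ?thesis by simp
  qed
  ultimately have \<phi>x: "\<phi> x = 0" by simp
  have tang: "g x \<bullet> (k, 0) = 0" for k
  proof (rule DERIV_local_min[OF dd])
    show "0 < r / (norm (k, 0::real) + 1)" using r(1) by (simp add: add_nonneg_pos)
    show "\<forall>s. \<bar>0 - s\<bar> < r / (norm (k, 0::real) + 1) \<longrightarrow> \<phi> (x + 0 *\<^sub>R (k, 0)) \<le> \<phi> (x + s *\<^sub>R (k, 0))"
    proof (intro allI impI)
      fix s assume "\<bar>0 - s\<bar> < r / (norm (k, 0::real) + 1)"
      then have "x + s *\<^sub>R (k, 0) \<in> ball x r" by (intro near) simp
      from iff[OF this] have "\<not> \<phi> (x + s *\<^sub>R (k, 0)) < 0" using x(2) by simp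
      then show "\<phi> (x + 0 *\<^sub>R (k, 0)) \<le> \<phi> (x + s *\<^sub>R (k, 0))" using \<phi>x by (simp add: zero_prod_def[symmetric])
    qed
  qed
  have f0: "fst (g x) = 0" using tang[of "fst (g x)"] by (simp add: inner_prod_def)
  define c where "c = snd (g x)"
  have gx: "g x = (0, c)" using f0 by (simp add: c_def prod_eq_iff)
  have c0: "c \<noteq> 0" using g0 gx by (auto simp: zero_prod_def)
  \<comment> \<open>A positive derivative in the inward direction would make \<phi> positive there;
    this fixes the sign of the vertical gradient.\<close>
  have "\<not> 0 < g x \<bullet> dn"
  proof
    assume "0 < g x \<bullet> dn"
    then obtain \<delta> where \<delta>: "0 < \<delta>" "\<forall>h>0. h < \<delta> \<longrightarrow> \<phi> (x + 0 *\<^sub>R dn) < \<phi> (x + (0 + h) *\<^sub>R dn)"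
      using DERIV_pos_inc_right[OF dd] by blast
    define h where "h = min \<delta> \<rho> / 2"
    have h: "0 < h" "h < \<delta>" "h < \<rho>" using \<delta>(1) \<rho> by (auto simp: h_def)
    have "\<phi> x < \<phi> (x + h *\<^sub>R dn)" using \<delta>(2)[rule_format, OF h(1,2)] by simp
    then show False using neg[OF h(1,3)] \<phi>x by simp
  qed
  then have "0 \<le> \<sigma> * c" by (simp add: gx dn_def inner_prod_def not_less mult.commute)
  then show "n = (0, \<sigma>)" using \<sigma> c0 unfolding n gx by (auto simp: norm_prod_def)
qed

lemma outward_normal_strip:
  assumes "bm < bp"
  shows "outward_normal (strip bm bp) (x :: 'a::euclidean_space, bp) = (0, 1)"
    "outward_normal (strip bm bp) (x, bm) = (0, -1)"
proof -
  have o: "open (UNIV \<times> A :: ('a \<times> real) set)" if "open A" for A using that by (intro open_Times) auto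
  have f: "(x, bp) \<in> frontier (strip bm bp)" "(x, bm) \<in> frontier (strip bm bp)"
    by (simp_all add: frontier_strip[OF assms])
  \<comment> \<open>In the half-space above \<open>bm\<close>, or below \<open>bp\<close> in the
    second case, a single inequality describes the strip.\<close>
  show "outward_normal (strip bm bp) (x, bp) = (0, 1)"
    by (rule outward_normal_flat[where V="UNIV \<times> {bm<..}" and \<beta>=bp])
      (use assms in \<open>auto simp: f strip_iff intro!: o\<close>)
  show "outward_normal (strip bm bp) (x, bm) = (0, -1)"
    by (rule outward_normal_flat[where V="UNIV \<times> {..<bp}" and \<beta>=bm])
      (use assms in \<open>auto simp: f strip_iff intro!: o\<close>)
qed

section \<open>Linear combinations of Sobolev functions and of their boundary values\<close>

lemma locally_integrable_test:
  fixes f \<phi> :: "'a::euclidean_space \<Rightarrow> real"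
  assumes f: "f \<in> Lp_loc lborel \<Omega> 1" and K: "compact K" "K \<subseteq> \<Omega>" and \<phi>: "\<phi> \<in> borel_measurable borel" "\<And>x. \<bar>\<phi> x\<bar> \<le> M" "\<And>x. x \<notin> K \<Longrightarrow> \<phi> x = 0"
  shows "set_integrable lborel \<Omega> (\<lambda>x. f x * \<phi> x)"
proof -
  have "integrable lborel (\<lambda>x. indicator K x * f x * \<phi> x)"
    using \<phi>(1,2) by (intro integrable_mult_bounded[OF Lp_loc_1_integrable[OF f K]]) auto
  moreover have "indicator K x * f x * \<phi> x = indicator \<Omega> x *\<^sub>R (f x * \<phi> x)" for x
    using \<phi>(3)[of x] K(2) by (cases "x \<in> K") auto
  ultimately show ?thesis unfolding set_integrable_def by (simp only:)
qed

lemma test_function_integrable: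
  fixes f :: "'a::euclidean_space \<Rightarrow> real"
  assumes f: "f \<in> Lp_loc lborel \<Omega> 1" and \<phi>: "\<phi> \<in> test_functions \<Omega>" and b: "b \<in> Basis"
  shows "set_integrable lborel \<Omega> (\<lambda>x. f x * \<phi> x)" "set_integrable lborel \<Omega> (\<lambda>x. f x * partial_deriv b \<phi> x)"
    "\<phi> \<in> borel_measurable borel" "partial_deriv b \<phi> \<in> borel_measurable borel"
proof -
  have K: "compact (fun_support \<phi>)" "fun_support \<phi> \<subseteq> \<Omega>" and C: "\<phi> \<in> C1_c"
    using \<phi> unfolding test_functions_def C1_c_def by blast+
  obtain R M where RM: "0 \<le> R" "0 \<le> M" "\<forall>z. \<bar>\<phi> z\<bar> \<le> M" "\<forall>z. \<bar>partial_deriv b \<phi> z\<bar> \<le> M"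
    "\<forall>z. R < norm z \<longrightarrow> \<phi> z = 0 \<and> partial_deriv b \<phi> z = 0"
    "continuous_on UNIV \<phi>" "continuous_on UNIV (partial_deriv b \<phi>)"
    by (rule C1_c_bounds[OF C b])
  show m: "\<phi> \<in> borel_measurable borel" "partial_deriv b \<phi> \<in> borel_measurable borel"
    using RM(6,7) by (auto intro: borel_measurable_continuous_onI)
  show "set_integrable lborel \<Omega> (\<lambda>x. f x * \<phi> x)"
    using RM(3) by (intro locally_integrable_test[OF f K m(1)]) (auto intro: outside_support)
  show "set_integrable lborel \<Omega> (\<lambda>x. f x * partial_deriv b \<phi> x)"
    using RM(4) by (intro locally_integrable_test[OF f K m(2)]) (auto intro: partial_deriv_outside_support)
qed

lemma set_borel_measurable_combination:
  fixes u v :: "'a \<Rightarrow> real"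
  assumes "set_borel_measurable M A u" "set_borel_measurable M A v"
  shows "set_borel_measurable M A (\<lambda>x. \<alpha> * u x + \<beta> * v x)"
proof -
  have "(\<lambda>x. \<alpha> * (indicator A x *\<^sub>R u x) + \<beta> * (indicator A x *\<^sub>R v x)) \<in> borel_measurable M"
    using assms unfolding set_borel_measurable_def by measurable
  moreover have "\<alpha> * (indicator A x *\<^sub>R u x) + \<beta> * (indicator A x *\<^sub>R v x) = indicator A x *\<^sub>R (\<alpha> * u x + \<beta> * v x)" for x
    by (simp add: algebra_simps)
  ultimately show ?thesis unfolding set_borel_measurable_def by (simp only:)
qed

lemma Lp_loc_1_combination:
  fixes u v :: "'a::euclidean_space \<Rightarrow> real"
  assumes u: "u \<in> Lp_loc lborel \<Omega> 1" and v: "v \<in> Lp_loc lborel \<Omega> 1"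
  shows "(\<lambda>x. \<alpha> * u x + \<beta> * v x) \<in> Lp_loc lborel \<Omega> 1"
  unfolding Lp_loc_def mem_Collect_eq
proof (intro conjI allI impI)
  show "set_borel_measurable lborel \<Omega> (\<lambda>x. \<alpha> * u x + \<beta> * v x)"
    using u v by (intro set_borel_measurable_combination) (auto simp: Lp_loc_def)
  fix K assume K: "compact K \<and> K \<subseteq> \<Omega>"
  have "integrable lborel (\<lambda>x. \<alpha> * (indicator K x * u x) + \<beta> * (indicator K x * v x))"
    using K by (intro Bochner_Integration.integrable_add integrable_mult_right Lp_loc_1_integrable[OF u] Lp_loc_1_integrable[OF v]) auto
  then have "(\<integral>\<^sup>+x. ennreal (norm (\<alpha> * (indicator K x * u x) + \<beta> * (indicator K x * v x))) \<partial>lborel) < \<infinity>"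
    by (simp only: integrable_iff_bounded)
  also have "(\<integral>\<^sup>+x. ennreal (norm (\<alpha> * (indicator K x * u x) + \<beta> * (indicator K x * v x))) \<partial>lborel) = (\<integral>\<^sup>+x\<in>K. ennreal (\<bar>\<alpha> * u x + \<beta> * v x\<bar> powr 1) \<partial>lborel)"
    by (intro nn_integral_cong) (simp add: indicator_def)
  finally show "(\<integral>\<^sup>+x\<in>K. ennreal (\<bar>\<alpha> * u x + \<beta> * v x\<bar> powr 1) \<partial>lborel) < \<infinity>" .
qed

lemma is_weak_partial_combination:
  fixes u v :: "'a::euclidean_space \<Rightarrow> real"
  assumes b: "b \<in> Basis" and u: "is_weak_partial \<Omega> b u u'" and v: "is_weak_partial \<Omega> b v v'"
  shows "is_weak_partial \<Omega> b (\<lambda>x. \<alpha> * u x + \<beta> * v x) (\<lambda>x. \<alpha> * u' x + \<beta> * v' x)"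
  unfolding is_weak_partial_def
proof (intro conjI ballI)
  have loc: "u \<in> Lp_loc lborel \<Omega> 1" "u' \<in> Lp_loc lborel \<Omega> 1" "v \<in> Lp_loc lborel \<Omega> 1" "v' \<in> Lp_loc lborel \<Omega> 1"
    using u v by (auto simp: is_weak_partial_def)
  then show "(\<lambda>x. \<alpha> * u x + \<beta> * v x) \<in> Lp_loc lborel \<Omega> 1" "(\<lambda>x. \<alpha> * u' x + \<beta> * v' x) \<in> Lp_loc lborel \<Omega> 1"
    by (auto intro: Lp_loc_1_combination)
  fix \<phi> assume \<phi>: "\<phi> \<in> test_functions \<Omega>"
  have lin: "(LINT x:\<Omega>|lborel. (\<alpha> * f x + \<beta> * g x) * h x) = \<alpha> * (LINT x:\<Omega>|lborel. f x * h x) + \<beta> * (LINT x:\<Omega>|lborel. g x * h x)"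
    if "set_integrable lborel \<Omega> (\<lambda>x. f x * h x)" "set_integrable lborel \<Omega> (\<lambda>x. g x * h x)" for f g h
  proof -
    have "(LINT x:\<Omega>|lborel. (\<alpha> * f x + \<beta> * g x) * h x) = (LINT x:\<Omega>|lborel. \<alpha> * (f x * h x) + \<beta> * (g x * h x))"
      by (simp add: distrib_right mult.assoc)
    also have "\<dots> = (LINT x:\<Omega>|lborel. \<alpha> * (f x * h x)) + (LINT x:\<Omega>|lborel. \<beta> * (g x * h x))"
      using that by (intro set_integral_add set_integrable_mult_right)
    finally show ?thesis by simp
  qed
  have "(LINT x:\<Omega>|lborel. u x * partial_deriv b \<phi> x) = - (LINT x:\<Omega>|lborel. u' x * \<phi> x)"
    "(LINT x:\<Omega>|lborel. v x * partial_deriv b \<phi> x) = - (LINT x:\<Omega>|lborel. v' x * \<phi> x)"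
    using u v \<phi> by (auto simp: is_weak_partial_def)
  then show "(LINT x:\<Omega>|lborel. (\<alpha> * u x + \<beta> * v x) * partial_deriv b \<phi> x) = - (LINT x:\<Omega>|lborel. (\<alpha> * u' x + \<beta> * v' x) * \<phi> x)"
    using loc \<phi> b by (simp add: lin test_function_integrable)
qed

lemma is_weak_partial_cong_AE:
  fixes f g :: "'a::euclidean_space \<Rightarrow> real"
  assumes b: "b \<in> Basis" and g: "is_weak_partial \<Omega> b g v" and f: "f \<in> Lp_loc lborel \<Omega> 1" and fg: "AE x in lborel. x \<in> \<Omega> \<longrightarrow> f x = g x"
  shows "is_weak_partial \<Omega> b f v"
  unfolding is_weak_partial_def
proof (intro conjI ballI)
  show "f \<in> Lp_loc lborel \<Omega> 1" by (rule f)
  show "v \<in> Lp_loc lborel \<Omega> 1" using g by (simp add: is_weak_partial_def)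
  have gl: "g \<in> Lp_loc lborel \<Omega> 1" using g by (simp add: is_weak_partial_def)
  fix \<phi> assume \<phi>: "\<phi> \<in> test_functions \<Omega>"
  have "(LINT x:\<Omega>|lborel. f x * partial_deriv b \<phi> x) = (LINT x:\<Omega>|lborel. g x * partial_deriv b \<phi> x)"
    unfolding set_lebesgue_integral_def
  proof (rule integral_cong_AE)
    show "(\<lambda>x. indicator \<Omega> x *\<^sub>R (f x * partial_deriv b \<phi> x)) \<in> borel_measurable lborel"
      "(\<lambda>x. indicator \<Omega> x *\<^sub>R (g x * partial_deriv b \<phi> x)) \<in> borel_measurable lborel"
      using test_function_integrable(2)[OF f \<phi> b] test_function_integrable(2)[OF gl \<phi> b]
      unfolding set_integrable_def by (simp_all only: borel_measurable_integrable)
    show "AE x in lborel. indicator \<Omega> x *\<^sub>R (f x * partial_deriv b \<phi> x) = indicator \<Omega> x *\<^sub>R (g x * partial_deriv b \<phi> x)"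
      using fg
    proof eventually_elim
      case (elim x)
      then show ?case by (cases "x \<in> \<Omega>") auto
    qed
  qed
  then show "(LINT x:\<Omega>|lborel. f x * partial_deriv b \<phi> x) = - (LINT x:\<Omega>|lborel. v x * \<phi> x)"
    using g \<phi> by (simp add: is_weak_partial_def)
qed

lemma Lp_on_combination:
  fixes u v :: "'a::euclidean_space \<Rightarrow> real"
  assumes p: "0 < p" and \<Omega>: "\<Omega> \<in> sets borel" and u: "u \<in> Lp_on lborel \<Omega> p" and v: "v \<in> Lp_on lborel \<Omega> p"
  shows "(\<lambda>x. \<alpha> * u x + \<beta> * v x) \<in> Lp_on lborel \<Omega> p"
  unfolding Lp_on_def mem_Collect_eq
proof
  show "set_borel_measurable lborel \<Omega> (\<lambda>x. \<alpha> * u x + \<beta> * v x)"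
    using u v by (intro set_borel_measurable_combination) (auto simp: Lp_on_def)
  define u0 where "u0 x = indicator \<Omega> x * u x" for x
  define v0 where "v0 x = indicator \<Omega> x * v x" for x
  have [measurable]: "u0 \<in> borel_measurable borel" "v0 \<in> borel_measurable borel"
    using u v by (auto simp: Lp_on_def set_borel_measurable_def u0_def[abs_def] v0_def[abs_def])
  have fin: "(\<integral>\<^sup>+x. ennreal (\<bar>u0 x\<bar> powr p) \<partial>lborel) < \<infinity>" "(\<integral>\<^sup>+x. ennreal (\<bar>v0 x\<bar> powr p) \<partial>lborel) < \<infinity>"
  proof -
    have "ennreal (\<bar>indicator \<Omega> x * f x\<bar> powr p) = ennreal (\<bar>f x\<bar> powr p) * indicator \<Omega> x" for f :: "'a \<Rightarrow> real" and x
      using p by (simp add: indicator_def)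
    then show "(\<integral>\<^sup>+x. ennreal (\<bar>u0 x\<bar> powr p) \<partial>lborel) < \<infinity>" "(\<integral>\<^sup>+x. ennreal (\<bar>v0 x\<bar> powr p) \<partial>lborel) < \<infinity>"
      using u v by (simp_all only: u0_def v0_def Lp_on_def mem_Collect_eq)
  qed
  have "(\<integral>\<^sup>+x\<in>\<Omega>. ennreal (\<bar>\<alpha> * u x + \<beta> * v x\<bar> powr p) \<partial>lborel) \<le>
    (\<integral>\<^sup>+x. ennreal (2 powr p) * (ennreal (\<bar>\<alpha>\<bar> powr p) * ennreal (\<bar>u0 x\<bar> powr p) + ennreal (\<bar>\<beta>\<bar> powr p) * ennreal (\<bar>v0 x\<bar> powr p)) \<partial>lborel)"
  proof (rule nn_integral_mono)
    fix x
    show "ennreal (\<bar>\<alpha> * u x + \<beta> * v x\<bar> powr p) * indicator \<Omega> x \<le>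
      ennreal (2 powr p) * (ennreal (\<bar>\<alpha>\<bar> powr p) * ennreal (\<bar>u0 x\<bar> powr p) + ennreal (\<bar>\<beta>\<bar> powr p) * ennreal (\<bar>v0 x\<bar> powr p))"
      using powr_add_le[OF p, of "\<alpha> * u x" "\<beta> * v x"]
      by (cases "x \<in> \<Omega>") (simp_all add: u0_def v0_def abs_mult powr_mult ennreal_mult)
  qed
  also have "\<dots> = ennreal (2 powr p) * (ennreal (\<bar>\<alpha>\<bar> powr p) * (\<integral>\<^sup>+x. ennreal (\<bar>u0 x\<bar> powr p) \<partial>lborel) + ennreal (\<bar>\<beta>\<bar> powr p) * (\<integral>\<^sup>+x. ennreal (\<bar>v0 x\<bar> powr p) \<partial>lborel))"
    by (simp add: nn_integral_cmult nn_integral_add)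
  also have "\<dots> < \<infinity>" using fin by (simp add: ennreal_mult_less_top)
  finally show "(\<integral>\<^sup>+x\<in>\<Omega>. ennreal (\<bar>\<alpha> * u x + \<beta> * v x\<bar> powr p) \<partial>lborel) < \<infinity>" .
qed

lemma hom_sobolev_combination:
  fixes u v :: "'a::euclidean_space \<Rightarrow> real"
  assumes p: "0 < p" and \<Omega>: "open \<Omega>" and u: "u \<in> hom_sobolev \<Omega> p" and v: "v \<in> hom_sobolev \<Omega> p"
  shows "(\<lambda>x. \<alpha> * u x + \<beta> * v x) \<in> hom_sobolev \<Omega> p"
  unfolding hom_sobolev_def mem_Collect_eq
proof (intro conjI ballI)
  show "(\<lambda>x. \<alpha> * u x + \<beta> * v x) \<in> Lp_loc lborel \<Omega> 1"
    using u v by (intro Lp_loc_1_combination) (auto simp: hom_sobolev_def)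
  fix b :: 'a assume b: "b \<in> Basis"
  note wu = weak_partial_properties[OF \<Omega> u b] and wv = weak_partial_properties[OF \<Omega> v b]
  show "\<exists>f. is_weak_partial \<Omega> b (\<lambda>x. \<alpha> * u x + \<beta> * v x) f \<and> f \<in> Lp_on lborel \<Omega> p"
    by (intro exI[of _ "\<lambda>x. \<alpha> * weak_partial \<Omega> b u x + \<beta> * weak_partial \<Omega> b v x"] conjI is_weak_partial_combination[OF b wu(1) wv(1)] Lp_on_combination[OF p borel_open[OF \<Omega>] wu(2) wv(2)])
qed

text \<open>Stated for \<open>f\<close> a.e. equal to the combination, so that it yields linearity
  as well as independence of the representative (\<alpha> = 1, \<beta> = 0). The chosen weak
  derivatives combine linearly almost everywhere by uniqueness, hence so do the functions
  \<open>W\<close> and the constants \<open>Tm\<close> on almost every line.\<close>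

lemma boundary_values_combination:
  fixes u v f :: "'a::euclidean_space \<times> real \<Rightarrow> real"
  assumes p: "1 < p" and bm_bp: "bm < bp" and u: "u \<in> hom_sobolev (strip bm bp) p" and v: "v \<in> hom_sobolev (strip bm bp) p"
    and f: "f \<in> hom_sobolev (strip bm bp) p" and eq: "AE z in lborel. z \<in> strip bm bp \<longrightarrow> f z = \<alpha> * u z + \<beta> * v z"
  shows "AE x in lborel. strip_sobolev.Tm bm bp f x = \<alpha> * strip_sobolev.Tm bm bp u x + \<beta> * strip_sobolev.Tm bm bp v x \<and>
    strip_sobolev.Tp bm bp f x = \<alpha> * strip_sobolev.Tp bm bp u x + \<beta> * strip_sobolev.Tp bm bp v x"
proof -
  interpret u: strip_sobolev p bm bp u using p bm_bp u by unfold_locales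
  interpret v: strip_sobolev p bm bp v using p bm_bp v by unfold_locales
  interpret f: strip_sobolev p bm bp f using p bm_bp f by unfold_locales
  let ?S = "strip bm bp :: ('a \<times> real) set"
  let ?e = "(0, 1) :: 'a \<times> real"
  note e = u.vertical_Basis
  have "is_weak_partial ?S ?e f (\<lambda>z. \<alpha> * weak_partial ?S ?e u z + \<beta> * weak_partial ?S ?e v z)"
  proof (rule is_weak_partial_cong_AE[OF e _ _ eq])
    show "is_weak_partial ?S ?e (\<lambda>z. \<alpha> * u z + \<beta> * v z) (\<lambda>z. \<alpha> * weak_partial ?S ?e u z + \<beta> * weak_partial ?S ?e v z)"
      by (rule is_weak_partial_combination[OF e u.wp[OF e] v.wp[OF e]])
    show "f \<in> Lp_loc lborel ?S 1" using f by (simp add: hom_sobolev_def)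
  qed
  from is_weak_partial_unique[OF open_strip f.wp[OF e] this]
  have w: "AE z in lborel. f.w z = \<alpha> * u.w z + \<beta> * v.w z"
    by eventually_elim (auto simp: f.D_def u.D_def v.D_def indicator_def)
  have u0: "AE z in lborel. f.u0 z = \<alpha> * u.u0 z + \<beta> * v.u0 z"
    using eq by eventually_elim (auto simp: f.u0_def u.u0_def v.u0_def indicator_def)
  show ?thesis
    using AE_pair_lines[OF w] AE_pair_lines[OF u0] u.AE_representation v.AE_representation
  proof eventually_elim
    case (elim x)
    have iu: "integrable lborel (\<lambda>r. u.w (x, r))" and iv: "integrable lborel (\<lambda>r. v.w (x, r))" using elim by auto
    have [measurable]: "(\<lambda>r. f.w (x, r)) \<in> borel_measurable borel" "(\<lambda>r. u.w (x, r)) \<in> borel_measurable borel" "(\<lambda>r. v.w (x, r)) \<in> borel_measurable borel"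
      by measurable
    have W: "f.W (x, t) = \<alpha> * u.W (x, t) + \<beta> * v.W (x, t)" for t
    proof -
      have "f.W (x, t) = (LINT r|lborel. \<alpha> * (u.w (x, r) * indicator {bm<..<t} r) + \<beta> * (v.w (x, r) * indicator {bm<..<t} r))"
        unfolding f.W_def fst_conv snd_conv
      proof (rule integral_cong_AE)
        show "AE r in lborel. f.w (x, r) * indicator {bm<..<t} r = \<alpha> * (u.w (x, r) * indicator {bm<..<t} r) + \<beta> * (v.w (x, r) * indicator {bm<..<t} r)"
          using elim(1) by eventually_elim (simp add: algebra_simps)
      qed measurable
      also have "\<dots> = \<alpha> * u.W (x, t) + \<beta> * v.W (x, t)"
        using integrable_mult_indicator'[OF iu, of "{bm<..<t}"] integrable_mult_indicator'[OF iv, of "{bm<..<t}"]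
        by (simp add: u.W_def v.W_def)
      finally show ?thesis .
    qed
    have "AE t in lborel. t \<in> {bm<..<bp} \<longrightarrow> f.U (x, t) = \<alpha> * u.Tm x + \<beta> * v.Tm x"
      using elim(2) elim(3)[THEN conjunct2] elim(4)[THEN conjunct2]
    proof eventually_elim
      case (elim t)
      then show ?case by (auto simp: f.U_def W algebra_simps)
    qed
    then have "f.Tm x = \<alpha> * u.Tm x + \<beta> * v.Tm x" by (rule f.constant_eq_Tm)
    then show ?case by (simp add: f.Tp_def u.Tp_def v.Tp_def W algebra_simps)
  qed
qed

context strip_sobolev
begin

text \<open>The representation holds only at almost every height, so good heights converging to the
  boundary are selected. Along them \<open>u\<close> converges by continuity and the integrals of
  \<open>w\<close> by dominated convergence.\<close>

lemma boundary_values_continuous: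
  assumes cont: "continuous_on (closure S) u"
  shows "AE x in lborel. Tm x = u (x, bm) \<and> Tp x = u (x, bp)"
  using AE_representation
proof eventually_elim
  case (elim x)
  then have i: "integrable lborel (\<lambda>r. w (x, r))" and rep: "AE t in lborel. t \<in> I \<longrightarrow> u0 (x, t) = Tm x + W (x, t)" by auto
  have lim_u: "(\<lambda>k. u (x, t k)) \<longlonglongrightarrow> u (x, c)" if "t \<longlonglongrightarrow> c" "\<And>k. t k \<in> I" "c \<in> {bm..bp}" for t and c :: real
  proof (rule continuous_on_tendsto_compose[OF cont])
    show "(\<lambda>k. (x, t k)) \<longlonglongrightarrow> (x, c)" by (intro tendsto_Pair tendsto_const that)
    show "(x, c) \<in> closure S" "\<forall>\<^sub>F k in sequentially. (x, t k) \<in> closure S"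
      using that(2,3) by (auto simp: closure_strip[OF bm_bp] intro!: always_eventually less_imp_le)
  qed
  have rep_u: "u (x, t) = Tm x + W (x, t)" if "t \<in> I" "t \<in> I \<longrightarrow> u0 (x, t) = Tm x + W (x, t)" for t
    using that by (simp add: u0_def strip_iff)
  \<comment> \<open>At most the width of the strip, so that the intervals in which heights are
    selected lie inside it.\<close>
  define \<delta> where "\<delta> k = (bp - bm) / real (Suc k)" for k
  have \<delta>: "0 < \<delta> k" "\<delta> k \<le> bp - bm" for k
    using bm_bp by (auto simp: \<delta>_def divide_le_eq mult_le_cancel_left1)
  have \<delta>0: "\<delta> \<longlonglongrightarrow> 0"
    using tendsto_mult_right_zero[OF LIMSEQ_inverse_real_of_nat, of "bp - bm"] by (simp add: \<delta>_def[abs_def] divide_inverse)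
  have "\<exists>t\<in>{bm<..<bm + \<delta> k}. t \<in> I \<longrightarrow> u0 (x, t) = Tm x + W (x, t)" for k
    using \<delta>(1)[of k] by (intro AE_exists_in_interval[OF rep]) simp
  then obtain s where s: "\<And>k. bm < s k" "\<And>k. s k < bm + \<delta> k" "\<And>k. s k \<in> I \<longrightarrow> u0 (x, s k) = Tm x + W (x, s k)"
    by (metis greaterThanLessThan_iff)
  have "\<exists>t\<in>{bp - \<delta> k<..<bp}. t \<in> I \<longrightarrow> u0 (x, t) = Tm x + W (x, t)" for k
    using \<delta>(1)[of k] by (intro AE_exists_in_interval[OF rep]) simp
  then obtain t where t: "\<And>k. bp - \<delta> k < t k" "\<And>k. t k < bp" "\<And>k. t k \<in> I \<longrightarrow> u0 (x, t k) = Tm x + W (x, t k)"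
    by (metis greaterThanLessThan_iff)
  have sI: "s k \<in> I" for k using s(1,2)[of k] \<delta>(2)[of k] by simp
  have tI: "t k \<in> I" for k using t(1,2)[of k] \<delta>(2)[of k] by simp
  have s0: "s \<longlonglongrightarrow> bm"
  proof (rule tendsto_sandwich[of "\<lambda>_. bm" _ _ "\<lambda>k. bm + \<delta> k"])
    show "(\<lambda>k. bm + \<delta> k) \<longlonglongrightarrow> bm" using tendsto_add[OF tendsto_const \<delta>0, of bm] by simp
  qed (use s in \<open>auto intro!: always_eventually less_imp_le\<close>)
  have t0: "t \<longlonglongrightarrow> bp"
  proof (rule tendsto_sandwich[of "\<lambda>k. bp - \<delta> k" _ _ "\<lambda>_. bp"])
    show "(\<lambda>k. bp - \<delta> k) \<longlonglongrightarrow> bp" using tendsto_diff[OF tendsto_const \<delta>0, of bp] by simp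
  qed (use t in \<open>auto intro!: always_eventually less_imp_le\<close>)
  \<comment> \<open>Every point of the open interval, outside of which \<open>w\<close> is 0,
    eventually leaves the domain of integration.\<close>
  have vanish: "(\<lambda>k. LINT r|lborel. w (x, r) * indicator (A k) r) \<longlonglongrightarrow> 0"
    if A: "\<And>k. A k \<in> sets borel" and ev: "\<And>r. r \<in> I \<Longrightarrow> \<forall>\<^sub>F k in sequentially. r \<notin> A k" for A :: "nat \<Rightarrow> real set"
  proof -
    have "(\<lambda>k. LINT r|lborel. w (x, r) * indicator (A k) r) \<longlonglongrightarrow> (LINT r|(lborel::real measure). (0::real))"
    proof (rule integral_dominated_convergence[where w="\<lambda>r. \<bar>w (x, r)\<bar>"])
      show "integrable lborel (\<lambda>r. \<bar>w (x, r)\<bar>)" using i by (rule integrable_abs)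
      show "AE r in lborel. (\<lambda>k. w (x, r) * indicator (A k) r) \<longlonglongrightarrow> 0"
      proof (rule AE_I2)
        fix r
        show "(\<lambda>k. w (x, r) * indicator (A k) r) \<longlonglongrightarrow> 0"
        proof (cases "r \<in> I")
          case True
          from ev[OF True] have "\<forall>\<^sub>F k in sequentially. w (x, r) * indicator (A k) r = 0" by eventually_elim simp
          then show ?thesis by (rule tendsto_eventually)
        qed (use w_outside in simp)
      qed
      show "AE r in lborel. norm (w (x, r) * indicator (A k) r) \<le> \<bar>w (x, r)\<bar>" for k
        by (intro AE_I2) (simp add: indicator_def)
      show "(\<lambda>r. w (x, r) * indicator (A k) r) \<in> borel_measurable lborel" for k
        using A[of k] by measurable
    qed measurable
    then show ?thesis by simp
  qed
  have "(\<lambda>k. Tm x + W (x, s k)) \<longlonglongrightarrow> Tm x + 0"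
  proof (intro tendsto_add tendsto_const)
    show "(\<lambda>k. W (x, s k)) \<longlonglongrightarrow> 0"
      unfolding W_def fst_conv snd_conv
    proof (rule vanish)
      fix r assume "r \<in> I"
      then have "\<forall>\<^sub>F k in sequentially. s k < r" using order_tendstoD(2)[OF s0] by simp
      then show "\<forall>\<^sub>F k in sequentially. r \<notin> {bm<..<s k}" by eventually_elim simp
    qed simp
  qed
  moreover have "(\<lambda>k. Tm x + W (x, s k)) \<longlonglongrightarrow> u (x, bm)"
    using lim_u[OF s0 sI] bm_bp rep_u[OF sI s(3)] by simp
  ultimately have 1: "Tm x = u (x, bm)" by (simp add: LIMSEQ_unique)
  have "(\<lambda>k. Tp x - (LINT r|lborel. w (x, r) * indicator {t k..bp} r)) \<longlonglongrightarrow> Tp x - 0"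
  proof (intro tendsto_diff tendsto_const vanish)
    fix r assume "r \<in> I"
    then have "\<forall>\<^sub>F k in sequentially. r < t k" using order_tendstoD(1)[OF t0] by simp
    then show "\<forall>\<^sub>F k in sequentially. r \<notin> {t k..bp}" by eventually_elim simp
  qed simp
  moreover have "Tp x - (LINT r|lborel. w (x, r) * indicator {t k..bp} r) = u (x, t k)" for k
    using Tp_minus_representation[OF i tI[of k]] rep_u[OF tI t(3), of k] by simp
  ultimately have "(\<lambda>k. u (x, t k)) \<longlonglongrightarrow> Tp x" by simp
  moreover have "(\<lambda>k. u (x, t k)) \<longlonglongrightarrow> u (x, bp)" using lim_u[OF t0 tI] bm_bp by simp
  ultimately have 2: "Tp x = u (x, bp)" by (rule LIMSEQ_unique)
  show ?case using 1 2 by simp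
qed

end

section \<open>The trace operator\<close>

lemma bdry_eq_strip:
  fixes f g :: "'a::euclidean_space \<times> real \<Rightarrow> real"
  assumes "bm < bp"
  shows "bdry_eq (strip bm bp) f g \<longleftrightarrow> (AE x in lborel. f (x, bm) = g (x, bm)) \<and> (AE x in lborel. f (x, bp) = g (x, bp))"
proof -
  have "bdry_eq (strip bm bp) f g \<longleftrightarrow> (AE z in surf. (z \<in> UNIV \<times> {bm} \<longrightarrow> f z = g z) \<and> (z \<in> UNIV \<times> {bp} \<longrightarrow> f z = g z))"
    unfolding bdry_eq_def surface_measure_eq frontier_strip[OF assms] by (intro AE_cong) blast
  also have "\<dots> \<longleftrightarrow> (AE z in surf. z \<in> UNIV \<times> {bm} \<longrightarrow> f z = g z) \<and> (AE z in surf. z \<in> UNIV \<times> {bp} \<longrightarrow> f z = g z)"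
    by (rule AE_conj_iff)
  finally show ?thesis unfolding AE_surf_hyperplane .
qed

lemma hyperplane_surf [measurable]: "(UNIV :: 'a::euclidean_space set) \<times> {b::real} \<in> sets surf"
  using hyperplane_borel by (simp add: sets_hausdorff_measure)

lemma set_integral_frontier_strip:
  fixes f :: "'a::euclidean_space \<times> real \<Rightarrow> real"
  assumes bm_bp: "bm < bp" and f: "set_borel_measurable surf (frontier (strip bm bp)) f"
  shows "set_integrable surf (frontier (strip bm bp)) f \<longleftrightarrow> integrable lborel (\<lambda>x. f (x, bm)) \<and> integrable lborel (\<lambda>x. f (x, bp))"
    "set_integrable surf (frontier (strip bm bp)) f \<Longrightarrow>
      (LINT z:frontier (strip bm bp)|surf. f z) = (LINT x|lborel. f (x, bm)) + (LINT x|lborel. f (x, bp))"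
proof -
  note F = frontier_strip[OF bm_bp, where 'a='a]
  have m: "set_borel_measurable surf (UNIV \<times> {bm}) f" "set_borel_measurable surf (UNIV \<times> {bp}) f"
    using f unfolding F by (auto intro: set_borel_measurable_subset[OF _ hyperplane_surf])
  have iff: "set_integrable surf (frontier (strip bm bp)) f \<longleftrightarrow> set_integrable surf (UNIV \<times> {bm}) f \<and> set_integrable surf (UNIV \<times> {bp}) f"
    unfolding F by (auto intro: set_integrable_Un set_integrable_subset[OF _ hyperplane_surf])
  then show "set_integrable surf (frontier (strip bm bp)) f \<longleftrightarrow> integrable lborel (\<lambda>x. f (x, bm)) \<and> integrable lborel (\<lambda>x. f (x, bp))"
    using set_integral_surf_hyperplane(1)[OF m(1)] set_integral_surf_hyperplane(1)[OF m(2)] by simp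
  assume "set_integrable surf (frontier (strip bm bp)) f"
  then have i: "set_integrable surf (UNIV \<times> {bm}) f" "set_integrable surf (UNIV \<times> {bp}) f" using iff by auto
  have "UNIV \<times> {bm} \<inter> UNIV \<times> {bp} = ({} :: ('a \<times> real) set)" using bm_bp by auto
  from set_integral_Un[OF this i]
  show "(LINT z:frontier (strip bm bp)|surf. f z) = (LINT x|lborel. f (x, bm)) + (LINT x|lborel. f (x, bp))"
    unfolding F set_integral_surf_hyperplane(2)[OF m(1)] set_integral_surf_hyperplane(2)[OF m(2)] .
qed

section \<open>Uniqueness of the boundary values\<close>

lemma mem_box_Pair_real:
  fixes x a b :: "'a::euclidean_space" and t s r :: real
  shows "(x, t) \<in> box (a, s) (b, r) \<longleftrightarrow> x \<in> box a b \<and> s < t \<and> t < r"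
  by (auto simp: box_def Basis_prod_def ball_Un)

text \<open>\<open>Lp_loc\<close> is applied to the disc of radius R in the hyperplane, a compact
  part of the frontier, where the surface integral becomes a Lebesgue integral.\<close>

lemma Lp_loc_frontier_integrable:
  fixes T :: "'a::euclidean_space \<times> real \<Rightarrow> real"
  assumes p: "1 \<le> p" and bm_bp: "bm < bp" and T: "T \<in> Lp_loc surf (frontier (strip bm bp)) p" and \<beta>: "\<beta> = bm \<or> \<beta> = bp"
  shows "integrable lborel (\<lambda>x. T (x, \<beta>) * indicator (cball 0 R) x)"
proof -
  note F = frontier_strip[OF bm_bp, where 'a='a]
  define T0 where "T0 z = indicator (frontier (strip bm bp)) z * T z" for z
  have "T0 \<in> borel_measurable surf" using T by (simp add: Lp_loc_def set_borel_measurable_def T0_def[abs_def])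
  then have [measurable]: "T0 \<in> borel_measurable borel"
    by (simp add: measurable_cong_sets[OF sets_hausdorff_measure refl])
  have T0: "T0 (x, \<beta>) = T (x, \<beta>)" for x using \<beta> by (auto simp: T0_def F)
  have [measurable]: "(\<lambda>x. T (x, \<beta>)) \<in> borel_measurable borel" unfolding T0[symmetric] by measurable
  define K where "K = cball (0::'a) R \<times> {\<beta>}"
  have K: "compact K" "K \<subseteq> frontier (strip bm bp)" using \<beta> unfolding K_def F by (auto intro!: compact_Times)
  have KB [measurable]: "K \<in> sets borel" using K(1) by (rule borel_compact)
  have hm: "(\<lambda>z. ennreal (\<bar>T0 z\<bar> powr p) * indicator K z) \<in> borel_measurable borel" by measurable
  have "(\<integral>\<^sup>+x\<in>cball 0 R. ennreal (\<bar>T (x, \<beta>)\<bar> powr p) \<partial>lborel) = (\<integral>\<^sup>+z\<in>UNIV \<times> {\<beta>}. ennreal (\<bar>T0 z\<bar> powr p) * indicator K z \<partial>surf)"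
    unfolding nn_integral_surf_hyperplane[OF hm] by (intro nn_integral_cong) (simp add: T0 K_def indicator_def)
  also have "\<dots> = (\<integral>\<^sup>+z\<in>K. ennreal (\<bar>T z\<bar> powr p) \<partial>surf)"
    using K(2) by (intro nn_integral_cong) (auto simp: K_def T0_def indicator_def)
  also have "\<dots> < \<infinity>" using T K unfolding Lp_loc_def by blast
  finally show ?thesis using emeasure_bounded_finite[OF bounded_cball] by (intro integrable_if_Lp[OF p]) simp_all
qed

text \<open>The hyperplane at height \<beta> passes through the middle of the boxes, so that the
  bumps restricted to it tend to indicators of boxes in the horizontal space.\<close>

lemma AE_zero_if_test_integrals_zero:
  fixes g :: "'a::euclidean_space \<Rightarrow> real" and \<beta> \<delta> :: real
  assumes g: "\<And>R. integrable lborel (\<lambda>x. g x * indicator (cball 0 R) x)" and \<delta>: "0 < \<delta>"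
    and z: "\<And>a b m. box a b \<noteq> {} \<Longrightarrow> (LINT x|lborel. g x * bump (a, \<beta> - \<delta>) (b, \<beta> + \<delta>) m (x, \<beta>)) = 0"
  shows "AE x in lborel. g x = 0"
proof -
  have bx: "(x, \<beta>) \<in> box (a, \<beta> - \<delta>) (b, \<beta> + \<delta>) \<longleftrightarrow> x \<in> box a b" for x a b :: 'a
    using \<delta> by (simp add: mem_box_Pair_real)
  have box0: "(LINT x:box a b|lborel. g x) = 0" for a b
  proof (cases "box a b = {}")
    case False
    then obtain x0 where "x0 \<in> box a b" by blast
    then have ne: "box (a, \<beta> - \<delta>) (b, \<beta> + \<delta>) \<noteq> {}" using bx[of x0 a b] by blast
    obtain R where "\<forall>x\<in>box a b. norm x \<le> R" using bounded_box[of a b] unfolding bounded_iff by (rule exE)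
    then have R: "box a b \<subseteq> cball 0 R" by auto
    define h where "h x = g x * indicator (cball 0 R) x" for x
    have h: "integrable lborel h" using g[of R] by (simp add: h_def[abs_def])
    have bm [measurable]: "(\<lambda>x. bump (a, \<beta> - \<delta>) (b, \<beta> + \<delta>) m (x, \<beta>)) \<in> borel_measurable borel" for m
      by (intro borel_measurable_continuous_onI continuous_on_compose2[OF C_k_continuous[OF C_k_bump[of 0]]] continuous_intros) auto
    have eq: "g x * bump (a, \<beta> - \<delta>) (b, \<beta> + \<delta>) m (x, \<beta>) = h x * bump (a, \<beta> - \<delta>) (b, \<beta> + \<delta>) m (x, \<beta>)" for m x
    proof (cases "x \<in> box a b")
      case False
      then show ?thesis using bump_outside[OF ne, of "(x, \<beta>)" m] by (simp add: bx)
    qed (use R in \<open>auto simp: h_def\<close>)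
    have "(\<lambda>m. LINT x|lborel. h x * bump (a, \<beta> - \<delta>) (b, \<beta> + \<delta>) m (x, \<beta>)) \<longlonglongrightarrow> (LINT x|lborel. h x * indicator (box a b) x)"
    proof (rule integral_dominated_convergence[where w="\<lambda>x. \<bar>h x\<bar>"])
      show "integrable lborel (\<lambda>x. \<bar>h x\<bar>)" using h by (rule integrable_abs)
      show "(\<lambda>x. h x * indicator (box a b) x) \<in> borel_measurable lborel" using borel_measurable_integrable[OF h] by measurable
      show "(\<lambda>x. h x * bump (a, \<beta> - \<delta>) (b, \<beta> + \<delta>) m (x, \<beta>)) \<in> borel_measurable lborel" for m
        using borel_measurable_integrable[OF h] bm[of m] by (intro borel_measurable_times) simp_all
      show "AE x in lborel. (\<lambda>m. h x * bump (a, \<beta> - \<delta>) (b, \<beta> + \<delta>) m (x, \<beta>)) \<longlonglongrightarrow> h x * indicator (box a b) x"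
      proof (rule AE_I2)
        fix x
        have "indicator (box (a, \<beta> - \<delta>) (b, \<beta> + \<delta>)) (x, \<beta>) = (indicator (box a b) x :: real)"
          by (simp only: indicator_def bx)
        then show "(\<lambda>m. h x * bump (a, \<beta> - \<delta>) (b, \<beta> + \<delta>) m (x, \<beta>)) \<longlonglongrightarrow> h x * indicator (box a b) x"
          using tendsto_mult[OF tendsto_const[of "h x"] bump_tendsto[OF ne, of "(x, \<beta>)"]] by simp
      qed
      show "AE x in lborel. norm (h x * bump (a, \<beta> - \<delta>) (b, \<beta> + \<delta>) m (x, \<beta>)) \<le> \<bar>h x\<bar>" for m
        by (intro AE_I2) (simp add: abs_mult bump_abs_le mult_left_le)
    qed
    moreover have "(LINT x|lborel. h x * bump (a, \<beta> - \<delta>) (b, \<beta> + \<delta>) m (x, \<beta>)) = 0" for m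
      using z[OF False, of m] by (simp only: eq)
    ultimately have "(LINT x|lborel. h x * indicator (box a b) x) = 0"
      by (simp add: LIMSEQ_const_iff)
    moreover have "h x * indicator (box a b) x = indicator (box a b) x *\<^sub>R g x" for x
      using R by (auto simp: h_def indicator_def)
    ultimately show ?thesis unfolding set_lebesgue_integral_def by (simp only:)
  qed (simp add: set_lebesgue_integral_def)
  have "AE x in lborel. x \<in> UNIV \<longrightarrow> g x = 0"
  proof (rule AE_open_if_AE_boxes)
    fix l r :: 'a
    obtain R where "\<forall>x\<in>box l r. norm x \<le> R" using bounded_box[of l r] unfolding bounded_iff by (rule exE)
    then have R: "box l r \<subseteq> cball 0 R" by auto
    have "AE x in lborel. indicator (box l r) x * g x = 0"
    proof (rule AE_zero_if_box_integrals_zero)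
      have "integrable lborel (\<lambda>x. indicator (box l r) x * (g x * indicator (cball 0 R) x))"
        using integrable_mult_indicator[OF _ g[of R], of "box l r"] by simp
      moreover have "indicator (box l r) x * (g x * indicator (cball 0 R) x) = indicator (box l r) x * g x" for x
        using R by (auto simp: indicator_def)
      ultimately show "integrable lborel (\<lambda>x. indicator (box l r) x * g x)" by (simp only:)
      fix a b
      obtain c d where cd: "box a b \<inter> box l r = box c d" using box_Int_box[of a b l r] by auto
      have "indicator (box a b) x *\<^sub>R (indicator (box l r) x * g x) = indicator (box c d) x *\<^sub>R g x" for x
        unfolding cd[symmetric] by (simp add: indicator_inter_arith)
      then show "(LINT x:box a b|lborel. indicator (box l r) x * g x) = 0"
        using box0[of c d] unfolding set_lebesgue_integral_def by (simp only:)
    qed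
    then show "AE x in lborel. x \<in> box l r \<longrightarrow> g x = 0" by eventually_elim (auto simp: indicator_def)
  qed simp
  then show ?thesis by simp
qed

text \<open>The test functions are bumps around one boundary hyperplane whose height is so small that they vanish
  on the other one.\<close>

lemma trace_unique:
  fixes T T' :: "'a::euclidean_space \<times> real \<Rightarrow> real"
  assumes p: "1 \<le> p" and bm_bp: "bm < bp"
    and T: "T \<in> Lp_loc surf (frontier (strip bm bp)) p" and T': "T' \<in> Lp_loc surf (frontier (strip bm bp)) p"
    and i: "\<And>\<psi>. \<psi> \<in> C1_c \<Longrightarrow> set_integrable surf (frontier (strip bm bp)) (\<lambda>z. \<psi> z * T z * (outward_normal (strip bm bp) z \<bullet> (0, 1)))"
    and i': "\<And>\<psi>. \<psi> \<in> C1_c \<Longrightarrow> set_integrable surf (frontier (strip bm bp)) (\<lambda>z. \<psi> z * T' z * (outward_normal (strip bm bp) z \<bullet> (0, 1)))"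
    and eq: "\<And>\<psi>. \<psi> \<in> C1_c \<Longrightarrow> (LINT z:frontier (strip bm bp)|surf. \<psi> z * T' z * (outward_normal (strip bm bp) z \<bullet> (0, 1))) =
      (LINT z:frontier (strip bm bp)|surf. \<psi> z * T z * (outward_normal (strip bm bp) z \<bullet> (0, 1)))"
  shows "bdry_eq (strip bm bp) T' T"
proof -
  note n = outward_normal_strip[OF bm_bp, where 'a='a]
  \<comment> \<open>The vertical component of the normal is 1 at the top and -1 at the bottom, so
    the boundary integral is a difference of two Lebesgue integrals.\<close>
  have parts: "integrable lborel (\<lambda>x. \<psi> (x, bm) * V (x, bm))" "integrable lborel (\<lambda>x. \<psi> (x, bp) * V (x, bp))"
      "(LINT z:frontier (strip bm bp)|surf. \<psi> z * V z * (outward_normal (strip bm bp) z \<bullet> (0, 1))) =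
        (LINT x|lborel. \<psi> (x, bp) * V (x, bp)) - (LINT x|lborel. \<psi> (x, bm) * V (x, bm))"
    if V: "set_integrable surf (frontier (strip bm bp)) (\<lambda>z. \<psi> z * V z * (outward_normal (strip bm bp) z \<bullet> (0, 1)))"
    for \<psi> V :: "'a \<times> real \<Rightarrow> real"
  proof -
    have "set_borel_measurable surf (frontier (strip bm bp)) (\<lambda>z. \<psi> z * V z * (outward_normal (strip bm bp) z \<bullet> (0, 1)))"
      using V unfolding set_integrable_def set_borel_measurable_def by (rule borel_measurable_integrable)
    from set_integral_frontier_strip[OF bm_bp this] V
    show "integrable lborel (\<lambda>x. \<psi> (x, bm) * V (x, bm))" "integrable lborel (\<lambda>x. \<psi> (x, bp) * V (x, bp))"
      "(LINT z:frontier (strip bm bp)|surf. \<psi> z * V z * (outward_normal (strip bm bp) z \<bullet> (0, 1))) =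
        (LINT x|lborel. \<psi> (x, bp) * V (x, bp)) - (LINT x|lborel. \<psi> (x, bm) * V (x, bm))"
      by (simp_all add: n)
  qed
  have "AE x in lborel. T' (x, \<beta>) - T (x, \<beta>) = 0" if \<beta>: "\<beta> = bm \<or> \<beta> = bp" for \<beta>
  \<comment> \<open>With this half-height the other hyperplane just touches the open box, and bumps
    vanish outside the open box.\<close>
  proof (rule AE_zero_if_test_integrals_zero[where \<beta>=\<beta> and \<delta>="bp - bm"])
    have "integrable lborel (\<lambda>x. T' (x, \<beta>) * indicator (cball 0 R) x - T (x, \<beta>) * indicator (cball 0 R) x)" for R
      by (intro Bochner_Integration.integrable_diff Lp_loc_frontier_integrable[OF p bm_bp _ \<beta>] T T')
    then show "integrable lborel (\<lambda>x. (T' (x, \<beta>) - T (x, \<beta>)) * indicator (cball 0 R) x)" for R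
      by (simp only: left_diff_distrib)
    show "0 < bp - bm" using bm_bp by simp
    fix a b :: 'a and m assume "box a b \<noteq> {}"
    then obtain x0 where x0: "x0 \<in> box a b" by blast
    define \<psi> where "\<psi> = bump (a, \<beta> - (bp - bm)) (b, \<beta> + (bp - bm)) m"
    have bx: "(x, t) \<in> box (a, \<beta> - (bp - bm)) (b, \<beta> + (bp - bm)) \<longleftrightarrow> x \<in> box a b \<and> \<beta> - (bp - bm) < t \<and> t < \<beta> + (bp - bm)" for x t
      by (rule mem_box_Pair_real)
    have "(x0, \<beta>) \<in> box (a, \<beta> - (bp - bm)) (b, \<beta> + (bp - bm))" using x0 bm_bp by (simp only: bx) simp
    then have ne: "box (a, \<beta> - (bp - bm)) (b, \<beta> + (bp - bm)) \<noteq> {}" by blast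
    have \<psi>: "\<psi> \<in> C1_c" unfolding \<psi>_def by (rule bump_C1_c[OF ne])
    have v: "\<psi> (x, t) = 0" if "t = bm \<or> t = bp" "t \<noteq> \<beta>" for x t
      unfolding \<psi>_def using that \<beta> by (intro bump_outside[OF ne]) (simp only: bx, auto)
    note P = parts[OF i[OF \<psi>]] and P' = parts[OF i'[OF \<psi>]]
    have "(LINT x|lborel. \<psi> (x, \<beta>) * T' (x, \<beta>)) = (LINT x|lborel. \<psi> (x, \<beta>) * T (x, \<beta>))"
      using \<beta> eq[OF \<psi>] bm_bp unfolding P(3) P'(3) by (auto simp: v)
    moreover have "integrable lborel (\<lambda>x. \<psi> (x, \<beta>) * T' (x, \<beta>))" "integrable lborel (\<lambda>x. \<psi> (x, \<beta>) * T (x, \<beta>))"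
      using \<beta> P P' by auto
    ultimately have "(LINT x|lborel. \<psi> (x, \<beta>) * T' (x, \<beta>) - \<psi> (x, \<beta>) * T (x, \<beta>)) = 0" by simp
    then show "(LINT x|lborel. (T' (x, \<beta>) - T (x, \<beta>)) * bump (a, \<beta> - (bp - bm)) (b, \<beta> + (bp - bm)) m (x, \<beta>)) = 0"
      by (simp add: \<psi>_def algebra_simps)
  qed
  then have "AE x in lborel. T' (x, bm) - T (x, bm) = 0" "AE x in lborel. T' (x, bp) - T (x, bp) = 0" by auto
  then show ?thesis unfolding bdry_eq_strip[OF bm_bp] by simp
qed

text \<open>Only the values on the two hyperplanes matter; assigning \<open>Tm\<close> to every
  other height keeps the function Borel.\<close>

definition strip_trace :: "real \<Rightarrow> real \<Rightarrow> ('a::euclidean_space \<times> real \<Rightarrow> real) \<Rightarrow> 'a \<times> real \<Rightarrow> real" where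
  "strip_trace bm bp u z = (if snd z = bp then strip_sobolev.Tp bm bp u (fst z) else strip_sobolev.Tm bm bp u (fst z))"

lemma strip_trace_bottom: "bm < bp \<Longrightarrow> strip_trace bm bp u (x, bm) = strip_sobolev.Tm bm bp u x"
  and strip_trace_top: "strip_trace bm bp u (x, bp) = strip_sobolev.Tp bm bp u x"
  by (simp_all add: strip_trace_def)

context strip_sobolev
begin

lemmas trace_simps = strip_trace_bottom[OF bm_bp] strip_trace_top

lemma strip_trace_measurable [measurable]: "strip_trace bm bp u \<in> borel_measurable borel"
  unfolding strip_trace_def[abs_def] by measurable

lemma strip_trace_Lp_loc: "strip_trace bm bp u \<in> Lp_loc surf (frontier S) p"
  unfolding Lp_loc_def mem_Collect_eq
proof (intro conjI allI impI)
  note F = frontier_strip[OF bm_bp, where 'a='a]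
  have FB [measurable]: "frontier S \<in> sets borel" by (intro borel_closed) simp
  have "(\<lambda>z. indicator (frontier S) z *\<^sub>R strip_trace bm bp u z) \<in> borel_measurable borel" by measurable
  then show "set_borel_measurable surf (frontier S) (strip_trace bm bp u)"
    unfolding set_borel_measurable_def by (simp add: measurable_cong_sets[OF sets_hausdorff_measure refl])
  fix K :: "('a \<times> real) set" assume K: "compact K \<and> K \<subseteq> frontier S"
  \<comment> \<open>Both boundary values are controlled on the horizontal projection of
    \<open>K\<close>, so it does not matter which part of \<open>K\<close> lies on which
    hyperplane.\<close>
  have K': "compact (fst ` K)" using K by (intro compact_continuous_image continuous_intros) auto
  then have [measurable]: "fst ` K \<in> sets borel" by (rule borel_compact)
  define h where "h z = ennreal (\<bar>strip_trace bm bp u z\<bar> powr p) * indicator (fst ` K) (fst z)" for z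
  have h [measurable]: "h \<in> borel_measurable borel" unfolding h_def[abs_def] by measurable
  have hs: "(\<lambda>z. h z * indicator (UNIV \<times> {b}) z) \<in> borel_measurable surf" for b
    by (simp add: measurable_cong_sets[OF sets_hausdorff_measure refl])
  have "(\<integral>\<^sup>+z\<in>K. ennreal (\<bar>strip_trace bm bp u z\<bar> powr p) \<partial>surf) \<le> (\<integral>\<^sup>+z. h z * indicator (UNIV \<times> {bm}) z + h z * indicator (UNIV \<times> {bp}) z \<partial>surf)"
  proof (rule nn_integral_mono)
    fix z
    show "ennreal (\<bar>strip_trace bm bp u z\<bar> powr p) * indicator K z \<le> h z * indicator (UNIV \<times> {bm}) z + h z * indicator (UNIV \<times> {bp}) z"
    proof (cases "z \<in> K")
      case True
      then have "fst z \<in> fst ` K" "z \<in> UNIV \<times> {bm} \<or> z \<in> UNIV \<times> {bp}" using K F by auto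
      then show ?thesis using True by (auto simp: h_def)
    qed simp
  qed
  also have "\<dots> = (\<integral>\<^sup>+z\<in>UNIV \<times> {bm}. h z \<partial>surf) + (\<integral>\<^sup>+z\<in>UNIV \<times> {bp}. h z \<partial>surf)"
    by (rule nn_integral_add[OF hs hs])
  also have "\<dots> = (\<integral>\<^sup>+x\<in>fst ` K. ennreal (\<bar>Tm x\<bar> powr p) \<partial>lborel) + (\<integral>\<^sup>+x\<in>fst ` K. ennreal (\<bar>Tp x\<bar> powr p) \<partial>lborel)"
    unfolding nn_integral_surf_hyperplane[OF h] by (simp add: h_def trace_simps)
  also have "\<dots> < \<infinity>" using boundary_Lp_loc[OF K'] by simp
  finally show "(\<integral>\<^sup>+z\<in>K. ennreal (\<bar>strip_trace bm bp u z\<bar> powr p) \<partial>surf) < \<infinity>" .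
qed

lemma strip_trace_integration_by_parts:
  assumes \<psi>: "\<psi> \<in> C1_c" and i: "i \<in> Basis"
  shows "set_integrable lborel S (\<lambda>z. u z * partial_deriv i \<psi> z)"
    "set_integrable lborel S (\<lambda>z. \<psi> z * weak_partial S i u z)"
    "set_integrable surf (frontier S) (\<lambda>z. \<psi> z * strip_trace bm bp u z * (outward_normal S z \<bullet> i))"
    "(LINT z:S|lborel. u z * partial_deriv i \<psi> z) = - (LINT z:S|lborel. \<psi> z * weak_partial S i u z)
      + (LINT z:frontier S|surf. \<psi> z * strip_trace bm bp u z * (outward_normal S z \<bullet> i))"
proof -
  note F = frontier_strip[OF bm_bp, where 'a='a]
  note n = outward_normal_strip[OF bm_bp, where 'a='a]
  let ?B = "\<lambda>z. \<psi> z * strip_trace bm bp u z * (outward_normal S z \<bullet> i)"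
  have e1: "indicator S z *\<^sub>R (u z * partial_deriv i \<psi> z) = u0 z * partial_deriv i \<psi> z" for z
    by (simp add: u0_def)
  have e2: "indicator S z *\<^sub>R (\<psi> z * weak_partial S i u z) = D i z * \<psi> z" for z
    by (simp add: D_def)
  obtain R M where "continuous_on UNIV \<psi>" by (rule C1_c_bounds[OF \<psi> i])
  then have [measurable]: "\<psi> \<in> borel_measurable borel" by (rule borel_measurable_continuous_onI)
  have FB [measurable]: "frontier S \<in> sets borel" by (intro borel_closed) simp
  \<comment> \<open>On the frontier the normal is (0, 1) or (0, -1); writing this out exhibits the
    integrand as Borel.\<close>
  have eB: "indicator (frontier S) z *\<^sub>R ?B z =
      indicator (frontier S) z * (\<psi> z * strip_trace bm bp u z * ((if snd z = bp then 1 else -1) * snd i))" for z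
  proof (cases "z \<in> frontier S")
    case True
    then have "z = (fst z, bp) \<or> (z = (fst z, bm) \<and> bm \<noteq> bp)" using bm_bp unfolding F by (auto simp: prod_eq_iff)
    then have "outward_normal S z = (0, if snd z = bp then 1 else -1)"
      using n(1)[of "fst z"] n(2)[of "fst z"] by (metis snd_conv)
    then show ?thesis by (simp add: inner_prod_def)
  qed simp
  have "(\<lambda>z. indicator (frontier S) z * (\<psi> z * strip_trace bm bp u z * ((if snd z = bp then 1 else -1) * snd i))) \<in> borel_measurable borel"
    by measurable
  then have mB: "set_borel_measurable surf (frontier S) ?B"
    unfolding set_borel_measurable_def eB by (simp add: measurable_cong_sets[OF sets_hausdorff_measure refl])
  note B = set_integral_frontier_strip[OF bm_bp mB]
  have nB: "?B (x, bm) = - (Tm x * \<psi> (x, bm)) * snd i" "?B (x, bp) = Tp x * \<psi> (x, bp) * snd i" for x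
    by (simp_all add: n trace_simps inner_prod_def)
  note V = integration_by_parts_vertical[OF \<psi>]
  have iB: "integrable lborel (\<lambda>x. ?B (x, bm))" "integrable lborel (\<lambda>x. ?B (x, bp))"
    unfolding nB using V(3,4) by simp_all
  then show sB: "set_integrable surf (frontier S) ?B" unfolding B(1) by simp
  have LB: "(LINT z:frontier S|surf. ?B z) = ((LINT x|lborel. Tp x * \<psi> (x, bp)) - (LINT x|lborel. Tm x * \<psi> (x, bm))) * snd i"
    unfolding B(2)[OF sB] nB using V(3,4) by (simp add: algebra_simps)
  \<comment> \<open>For a horizontal direction \<open>snd i = 0\<close> removes the boundary
    term.\<close>
  have "i = (0, 1) \<or> snd i = 0" using i by (auto simp: Basis_prod_def)
  then show "set_integrable lborel S (\<lambda>z. u z * partial_deriv i \<psi> z)"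
    "set_integrable lborel S (\<lambda>z. \<psi> z * weak_partial S i u z)"
    "(LINT z:S|lborel. u z * partial_deriv i \<psi> z) = - (LINT z:S|lborel. \<psi> z * weak_partial S i u z) + (LINT z:frontier S|surf. ?B z)"
    using V integration_by_parts_horizontal[OF \<psi> i] unfolding set_integrable_def set_lebesgue_integral_def[of lborel] e1 e2 LB
    by (auto simp: algebra_simps)
qed

lemma strip_trace_bounds:
  "(\<integral>\<^sup>+x. ennreal (\<bar>strip_trace bm bp u (x, bp) - strip_trace bm bp u (x, bm)\<bar> powr p) \<partial>lborel)
    \<le> ennreal ((bp - bm) powr (p - 1)) * (\<integral>\<^sup>+z\<in>S. ennreal (\<bar>weak_partial S (0, 1) u z\<bar> powr p) \<partial>lborel)"
  "b \<in> {bm, bp} \<Longrightarrow> epowr (frac_seminorm p (bp - bm) (\<lambda>x. strip_trace bm bp u (x, b))) p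
    \<le> ennreal (trace_const DIM('a) p) * (\<integral>\<^sup>+z\<in>S. ennreal (norm (weak_grad S u z) powr p) \<partial>lborel)"
  using jump_estimate frac_seminorm_estimate unfolding D_Lp_eq G_def by (auto simp: trace_simps)

lemma strip_trace_continuous:
  assumes "continuous_on (closure S) u"
  shows "bdry_eq S (strip_trace bm bp u) u"
  using boundary_values_continuous[OF assms] unfolding bdry_eq_strip[OF bm_bp] trace_simps by (simp add: AE_conj_iff)

end

section \<open>Linearity, existence and uniqueness of the operator\<close>

lemma strip_sobolevI: "1 < p \<Longrightarrow> bm < bp \<Longrightarrow> u \<in> hom_sobolev (strip bm bp) p \<Longrightarrow> strip_sobolev p bm bp u"
  by unfold_locales

lemma linear_trace_strip_trace:
  assumes p: "1 < p" and bm_bp: "bm < bp"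
  shows "linear_trace p (strip bm bp) (strip_trace bm bp :: ('a::euclidean_space \<times> real \<Rightarrow> real) \<Rightarrow> _)"
  unfolding linear_trace_def surface_measure_eq
proof (intro conjI ballI allI impI)
  fix u :: "'a \<times> real \<Rightarrow> real" assume u: "u \<in> hom_sobolev (strip bm bp) p"
  then show "strip_trace bm bp u \<in> Lp_loc surf (frontier (strip bm bp)) p"
    by (intro strip_sobolev.strip_trace_Lp_loc strip_sobolevI p bm_bp)
  fix v :: "'a \<times> real \<Rightarrow> real" assume v: "v \<in> hom_sobolev (strip bm bp) p"
  note S = strip_trace_bottom[OF bm_bp] strip_trace_top
  show "bdry_eq (strip bm bp) (strip_trace bm bp u) (strip_trace bm bp v)" if eq: "AE x in lborel. x \<in> strip bm bp \<longrightarrow> u x = v x"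
  proof -
    \<comment> \<open>Equality almost everywhere is a combination with coefficients 1 and 0.\<close>
    have "AE z in lborel. z \<in> strip bm bp \<longrightarrow> u z = 1 * v z + 0 * v z" using eq by simp
    from boundary_values_combination[OF p bm_bp v v u this] show ?thesis
      unfolding bdry_eq_strip[OF bm_bp] S by (simp add: AE_conj_iff)
  qed
  fix \<alpha> \<beta>
  have "(\<lambda>x. \<alpha> * u x + \<beta> * v x) \<in> hom_sobolev (strip bm bp) p"
    using p u v by (intro hom_sobolev_combination open_strip) simp_all
  from boundary_values_combination[OF p bm_bp u v this, of \<alpha> \<beta>]
  show "bdry_eq (strip bm bp) (strip_trace bm bp (\<lambda>x. \<alpha> * u x + \<beta> * v x)) (\<lambda>x. \<alpha> * strip_trace bm bp u x + \<beta> * strip_trace bm bp v x)"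
    unfolding bdry_eq_strip[OF bm_bp] S by (simp add: AE_conj_iff)
qed

lemma trace_const_pos:
  assumes "1 < p" "0 < n" shows "0 < trace_const n p"
proof -
  have "0 < (1 - 1 / p) powr (- p)" using assms(1) by simp
  then show ?thesis unfolding trace_const_def seminorm_const_def
    using assms by (intro mult_pos_pos add_pos_nonneg) auto
qed

theorem theorem1p2:
  fixes p :: real
  assumes "1 < p"
  shows "\<exists>c>0. \<forall>bm bp :: real. bm < bp \<longrightarrow>
    (\<exists>Tr :: ((real^'n) \<times> real \<Rightarrow> real) \<Rightarrow> (real^'n) \<times> real \<Rightarrow> real.
       (linear_trace p (strip bm bp) Tr \<and>
        extends_restriction p (strip bm bp) Tr \<and>
        trace_bounds p bm bp c Tr \<and>
        integration_by_parts p (strip bm bp) Tr) \<and>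
       (\<forall>Tr'. linear_trace p (strip bm bp) Tr' \<and>
          extends_restriction p (strip bm bp) Tr' \<and>
          (\<exists>c'>0. trace_bounds p bm bp c' Tr') \<and>
          integration_by_parts p (strip bm bp) Tr' \<longrightarrow>
          (\<forall>u\<in>hom_sobolev (strip bm bp) p. bdry_eq (strip bm bp) (Tr' u) (Tr u))))"
proof (intro exI conjI allI impI ballI)
  \<comment> \<open>Chosen before \<open>bm\<close> and \<open>bp\<close>, hence dependent on N and
    p alone.\<close>
  show "0 < trace_const DIM(real^'n) p" using assms by (intro trace_const_pos) simp_all
  fix bm bp :: real assume bm_bp: "bm < bp"
  let ?S = "strip bm bp :: ((real^'n) \<times> real) set"
  let ?Tr = "strip_trace bm bp :: ((real^'n) \<times> real \<Rightarrow> real) \<Rightarrow> _"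
  note sob = strip_sobolevI[OF assms bm_bp]
  show "linear_trace p ?S ?Tr" by (rule linear_trace_strip_trace[OF assms bm_bp])
  show "extends_restriction p ?S ?Tr"
    unfolding extends_restriction_def by (intro ballI impI strip_sobolev.strip_trace_continuous[OF sob])
  show "trace_bounds p bm bp (trace_const DIM(real^'n) p) ?Tr"
    unfolding trace_bounds_def by (intro ballI conjI strip_sobolev.strip_trace_bounds[OF sob])
  show ibp: "integration_by_parts p ?S ?Tr"
    unfolding integration_by_parts_def surface_measure_eq
    by (intro ballI conjI strip_sobolev.strip_trace_integration_by_parts[OF sob])
  fix Tr' :: "((real^'n) \<times> real \<Rightarrow> real) \<Rightarrow> (real^'n) \<times> real \<Rightarrow> real" and u :: "(real^'n) \<times> real \<Rightarrow> real"
  assume Tr': "linear_trace p ?S Tr' \<and> extends_restriction p ?S Tr' \<and> (\<exists>c'>0. trace_bounds p bm bp c' Tr') \<and> integration_by_parts p ?S Tr'"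
    and u: "u \<in> hom_sobolev ?S p"
  interpret strip_sobolev p bm bp u by (rule sob[OF u])
  have e: "(0, 1) \<in> (Basis :: ((real^'n) \<times> real) set)" by (rule vertical_Basis)
  \<comment> \<open>Both operators satisfy the vertical formula with the same interior integrals, so
    their boundary integrals agree for every test function.\<close>
  have ibp': "set_integrable surf (frontier ?S) (\<lambda>z. \<psi> z * Tr' u z * (outward_normal ?S z \<bullet> (0, 1)))"
    "(LINT z:?S|lborel. u z * partial_deriv (0, 1) \<psi> z) = - (LINT z:?S|lborel. \<psi> z * weak_partial ?S (0, 1) u z)
      + (LINT z:frontier ?S|surf. \<psi> z * Tr' u z * (outward_normal ?S z \<bullet> (0, 1)))"
    if "\<psi> \<in> C1_c" for \<psi>
    using Tr' u that e unfolding integration_by_parts_def surface_measure_eq by blast+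
  show "bdry_eq ?S (Tr' u) (?Tr u)"
  proof (rule trace_unique)
    show "1 \<le> p" "bm < bp" using assms bm_bp by simp_all
    show "?Tr u \<in> Lp_loc surf (frontier ?S) p" by (rule strip_trace_Lp_loc)
    show "Tr' u \<in> Lp_loc surf (frontier ?S) p"
      using Tr' u unfolding linear_trace_def surface_measure_eq by blast
    fix \<psi> :: "(real^'n) \<times> real \<Rightarrow> real" assume \<psi>: "\<psi> \<in> C1_c"
    show "set_integrable surf (frontier ?S) (\<lambda>z. \<psi> z * ?Tr u z * (outward_normal ?S z \<bullet> (0, 1)))"
      by (rule strip_trace_integration_by_parts(3)[OF \<psi> e])
    show "set_integrable surf (frontier ?S) (\<lambda>z. \<psi> z * Tr' u z * (outward_normal ?S z \<bullet> (0, 1)))"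
      by (rule ibp'(1)[OF \<psi>])
    show "(LINT z:frontier ?S|surf. \<psi> z * Tr' u z * (outward_normal ?S z \<bullet> (0, 1))) =
      (LINT z:frontier ?S|surf. \<psi> z * ?Tr u z * (outward_normal ?S z \<bullet> (0, 1)))"
      using ibp'(2)[OF \<psi>] strip_trace_integration_by_parts(4)[OF \<psi> e] by simp
  qed
qed

end
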